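(* Let $1\leq p<\infty$. The system of parabolic polynomials $\{v_{\alpha}\}_{\alpha\in\mathbb{N}_0^n}$ (restricted to $\Sigma_2\cup\Sigma_3$) is complete in $L^{p}(\Sigma_{2}\cup\Sigma_{3})$; that is, the linear span of the restrictions $v_\alpha|_{\Sigma_2\cup\Sigma_3}$ is dense in $L^p(\Sigma_2\cup\Sigma_3)$.
   Context: Setting: $n\geq 3$; $\Omega\subset\mathbb{R}^n$ is a bounded domain with $C^1$ boundary such that $\mathbb{R}^n\setminus\overline{\Omega}$ is connected; $T>0$; $\Omega_T=\Omega\times(0,T)\subset\mathbb{R}^{n+1}$, with points written $(x,t)$, $x\in\mathbb{R}^n$, $t\in\mathbb{R}$. $\Sigma_2=\{(x,0): x\in\Omega\}$ and $\Sigma_3=\partial\Omega\times(0,T)$; $L^p(\Sigma_2\cup\Sigma_3)$ is the space of real-valued functions whose $p$-th power is integrable with respect to the surface measure $d\sigma$ (Lebesgue measure on $\Sigma_2$; the product of surface measure on $\partial\Omega$ and Lebesgue measure in $t$ on $\Sigma_3$). $(a_{hk})$ is a constant real symmetric positive definite $n\times n$ matrix, and $H=\sum_{h,k=1}^n a_{hk}\frac{\partial^2}{\partial x_h\partial x_k}-\frac{\partial}{\partial t}$. For a multiindex $\alpha\in\mathbb{N}_0^n$ the parabolic polynomial $v_\alpha$ (which satisfies $Hv_\alpha=0$) is $$v_{\alpha}(x,t)=D^{\alpha}_{\xi}\Big(\exp\big[\langle x,\xi\rangle+t\sum_{h,k=1}^n a_{hk}\xi_h\xi_k\big]\Big)\Big|_{\xi=0},$$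 i.e. $v_\alpha(x,t)$ is the coefficient of $\xi^\alpha/\alpha!$ in the power series expansion of $\exp[\langle x,\xi\rangle+t\sum_{h,k} a_{hk}\xi_h\xi_k]$ in $\xi\in\mathbb{R}^n$. *)

theory Defs
  imports "HOL-Analysis.Analysis"
begin

section \<open>Hausdorff measure and surface measure\<close>

text \<open>
  The factor \<open>unit_ball_vol d / 2 ^ d\<close> normalises the \<open>d\<close>-dimensional Hausdorff measure so that it is
  the usual \<open>d\<close>-dimensional area on \<open>C\<^sup>1\<close> submanifolds. The empty set needs its own case because
  \<open>0 ^ 0 = 1\<close>. The outer measure is countably additive on Borel sets, so the fallback of
  \<^const>\<open>measure_of\<close> to the zero measure does not occur; see \<open>emeasure_hausdorff_measure\<close> below.
\<close>

definition hausdorff_gauge :: "nat \<Rightarrow> 'a::metric_space set \<Rightarrow> ennreal" where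
  "hausdorff_gauge d U =
     (if U = {} then 0 else ennreal (unit_ball_vol (real d) * (diameter U / 2) ^ d))"

definition hausdorff_covers :: "real \<Rightarrow> 'a::metric_space set \<Rightarrow> (nat \<Rightarrow> 'a set) set" where
  "hausdorff_covers \<delta> A =
     {U. A \<subseteq> (\<Union>i. U i) \<and> (\<forall>i. bounded (U i) \<and> diameter (U i) \<le> \<delta>)}"

definition hausdorff_content :: "nat \<Rightarrow> real \<Rightarrow> 'a::metric_space set \<Rightarrow> ennreal" where
  "hausdorff_content d \<delta> A = (INF U\<in>hausdorff_covers \<delta> A. \<Sum>i. hausdorff_gauge d (U i))"

definition hausdorff_outer :: "nat \<Rightarrow> 'a::metric_space set \<Rightarrow> ennreal" where
  "hausdorff_outer d A = (SUP \<delta>\<in>{0<..}. hausdorff_content d \<delta> A)"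

definition hausdorff_measure :: "nat \<Rightarrow> 'a::metric_space measure" where
  "hausdorff_measure d = measure_of UNIV (sets borel) (hausdorff_outer d)"

lemma hausdorff_content_mono: "A \<subseteq> B \<Longrightarrow> hausdorff_content d \<delta> A \<le> hausdorff_content d \<delta> B"
  unfolding hausdorff_content_def by (rule INF_superset_mono) (auto simp: hausdorff_covers_def)

lemma hausdorff_content_antimono:
  "\<delta> \<le> \<epsilon> \<Longrightarrow> hausdorff_content d \<epsilon> A \<le> hausdorff_content d \<delta> A"
  unfolding hausdorff_content_def
  by (rule INF_superset_mono) (auto simp: hausdorff_covers_def intro: order_trans)

lemma hausdorff_content_le_outer: "\<delta> > 0 \<Longrightarrow> hausdorff_content d \<delta> A \<le> hausdorff_outer d A"
  unfolding hausdorff_outer_def by (rule SUP_upper) auto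

lemma hausdorff_outer_mono: "A \<subseteq> B \<Longrightarrow> hausdorff_outer d A \<le> hausdorff_outer d B"
  unfolding hausdorff_outer_def by (intro SUP_mono') (rule hausdorff_content_mono)

lemma hausdorff_outer_empty [simp]: "hausdorff_outer d {} = 0"
proof -
  have "hausdorff_content d \<delta> ({} :: 'a set) = 0" if "\<delta> > 0" for \<delta>
    unfolding hausdorff_content_def using that
    by (intro antisym INF_lower2[of "\<lambda>_. {}"])
       (auto simp: hausdorff_covers_def hausdorff_gauge_def)
  then show ?thesis by (simp add: hausdorff_outer_def)
qed

lemma hausdorff_content_countably_subadditive:
  fixes A :: "nat \<Rightarrow> 'a::metric_space set"
  shows "hausdorff_content d \<delta> (\<Union>n. A n) \<le> (\<Sum>n. hausdorff_content d \<delta> (A n))"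
proof (rule ennreal_le_epsilon)
  let ?O = "hausdorff_content d \<delta>" and ?f = "hausdorff_gauge d"
  fix e :: real assume e: "0 < e" and "(\<Sum>n. ?O (A n)) < top"
  then have *: "?O (A n) < ?O (A n) + e * (1/2) ^ Suc n" for n
    by (auto simp add: less_top dest!: ennreal_suminf_lessD)
  have "\<exists>B. B \<in> hausdorff_covers \<delta> (A n) \<and> (\<Sum>i. ?f (B i)) \<le> ?O (A n) + e * (1/2) ^ Suc n" for n
  proof -
    obtain B where "B \<in> hausdorff_covers \<delta> (A n)" "(\<Sum>i. ?f (B i)) < ?O (A n) + e * (1/2) ^ Suc n"
      using *[of n, THEN eq_refl[OF hausdorff_content_def[symmetric], THEN le_less_trans]]
      unfolding INF_less_iff by blast
    then show ?thesis by (blast intro: less_imp_le)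
  qed
  then obtain B where B: "\<And>n. B n \<in> hausdorff_covers \<delta> (A n)"
    and Ble: "\<And>n. (\<Sum>i. ?f (B n i)) \<le> ?O (A n) + e * (1/2) ^ Suc n"
    by metis
  define C where "C = case_prod B o prod_decode"
  have "C \<in> hausdorff_covers \<delta> (\<Union>n. A n)"
    unfolding hausdorff_covers_def
  proof (intro CollectI conjI allI)
    show "(\<Union>n. A n) \<subseteq> (\<Union>i. C i)"
    proof
      fix x assume "x \<in> (\<Union>n. A n)"
      then obtain n i where "x \<in> B n i"
        using B unfolding hausdorff_covers_def by blast
      then have "x \<in> C (prod_encode (n, i))" by (simp add: C_def)
      then show "x \<in> (\<Union>i. C i)" by blast
    qed
  qed (use B in \<open>auto simp: hausdorff_covers_def C_def split_def\<close>)
  then have "?O (\<Union>n. A n) \<le> (\<Sum>i. ?f (C i))"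
    unfolding hausdorff_content_def by (rule INF_lower)
  also have "\<dots> = (\<Sum>n. \<Sum>i. ?f (B n i))"
    unfolding C_def comp_def by (intro suminf_ennreal_2dimen) auto
  also have "\<dots> \<le> (\<Sum>n. ?O (A n) + e * (1/2) ^ Suc n)"
    by (intro suminf_le suminf_nonneg allI Ble) auto
  also have "\<dots> = (\<Sum>n. ?O (A n)) + (\<Sum>n. ennreal e * ennreal ((1/2) ^ Suc n))"
    using e by (subst suminf_add[symmetric])
               (auto simp del: ennreal_suminf_cmult simp add: ennreal_mult[symmetric])
  also have "\<dots> = (\<Sum>n. ?O (A n)) + e"
    unfolding ennreal_suminf_cmult
    by (subst suminf_ennreal_eq[OF zero_le_power power_half_series]) auto
  finally show "?O (\<Union>n. A n) \<le> (\<Sum>n. ?O (A n)) + e" .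
qed

lemma hausdorff_outer_countably_subadditive:
  "hausdorff_outer d (\<Union>n. A n) \<le> (\<Sum>n. hausdorff_outer d (A n))"
proof -
  have "hausdorff_content d \<delta> (\<Union>n. A n) \<le> (\<Sum>n. hausdorff_outer d (A n))" if "\<delta> > 0" for \<delta>
    by (rule order_trans[OF hausdorff_content_countably_subadditive suminf_le])
       (auto intro: hausdorff_content_le_outer that)
  then show ?thesis
    unfolding hausdorff_outer_def[of d "\<Union>n. A n"] by (intro SUP_least) auto
qed

lemma hausdorff_outer_measure_space: "outer_measure_space (Pow UNIV) (hausdorff_outer d)"
  by (auto simp: outer_measure_space_def positive_def increasing_def countably_subadditive_def
      intro: hausdorff_outer_mono hausdorff_outer_countably_subadditive)

lemma hausdorff_outer_Un: "hausdorff_outer d (A \<union> B) \<le> hausdorff_outer d A + hausdorff_outer d B"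
proof -
  have "hausdorff_outer d (\<Union>n. binaryset A B n) \<le> (\<Sum>n. hausdorff_outer d (binaryset A B n))"
    by (rule hausdorff_outer_countably_subadditive)
  then show ?thesis
    by (simp add: UN_binaryset_eq suminf_binaryset_eq)
qed

lemma hausdorff_outer_separated:
  assumes "e > 0" and sep: "\<And>x y. x \<in> A \<Longrightarrow> y \<in> B \<Longrightarrow> dist x y \<ge> e"
  shows "hausdorff_outer d A + hausdorff_outer d B \<le> hausdorff_outer d (A \<union> B)"
proof -
  let ?f = "hausdorff_gauge d"
  have small: "hausdorff_content d \<delta> A + hausdorff_content d \<delta> B \<le> hausdorff_content d \<delta> (A \<union> B)"
    if "\<delta> < e" "\<delta> > 0" for \<delta>
    unfolding hausdorff_content_def[of d \<delta> "A \<union> B"]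
  proof (rule INF_greatest)
    fix U assume U: "U \<in> hausdorff_covers \<delta> (A \<union> B)"
    define V where "V S i = (if U i \<inter> S = {} then {} else U i)" for S i
    have V: "V S \<in> hausdorff_covers \<delta> S" if sub: "S \<subseteq> A \<union> B" for S
    proof -
      have "S \<subseteq> (\<Union>i. V S i)"
      proof
        fix x assume "x \<in> S"
        moreover obtain i where "x \<in> U i"
          using U \<open>x \<in> S\<close> sub unfolding hausdorff_covers_def by blast
        ultimately have "x \<in> V S i" by (auto simp: V_def)
        then show "x \<in> (\<Union>i. V S i)" by blast
      qed
      then show ?thesis
        using U \<open>\<delta> > 0\<close> by (auto simp: hausdorff_covers_def V_def)
    qed
    have disj: "V A i = {} \<or> V B i = {}" for i
    proof (rule ccontr)
      assume "\<not> (V A i = {} \<or> V B i = {})"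
      then obtain x y where xy: "x \<in> U i" "x \<in> A" "y \<in> U i" "y \<in> B"
        by (auto simp: V_def split: if_splits)
      then have "dist x y \<le> diameter (U i)"
        using U by (intro diameter_bounded_bound) (auto simp: hausdorff_covers_def)
      also have "\<dots> \<le> \<delta>" using U by (auto simp: hausdorff_covers_def)
      finally show False using sep[OF xy(2,4)] \<open>\<delta> < e\<close> by simp
    qed
    have f_empty: "?f {} = 0" by (simp add: hausdorff_gauge_def)
    have f_V: "?f (V S i) \<le> ?f (U i)" for S i by (simp add: V_def f_empty)
    have "?f (V A i) + ?f (V B i) \<le> ?f (U i)" for i
      using disj[of i] f_V[of A i] f_V[of B i] by (metis add_0 add_0_right f_empty)
    then have le: "(\<Sum>i. ?f (V A i) + ?f (V B i)) \<le> (\<Sum>i. ?f (U i))"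
      by (intro suminf_le) auto
    have "hausdorff_content d \<delta> A \<le> (\<Sum>i. ?f (V A i))" "hausdorff_content d \<delta> B \<le> (\<Sum>i. ?f (V B i))"
      unfolding hausdorff_content_def by (auto intro!: INF_lower V)
    then have "hausdorff_content d \<delta> A + hausdorff_content d \<delta> B
        \<le> (\<Sum>i. ?f (V A i)) + (\<Sum>i. ?f (V B i))"
      by (rule add_mono)
    also have "\<dots> = (\<Sum>i. ?f (V A i) + ?f (V B i))"
      by (rule suminf_add) auto
    finally show "hausdorff_content d \<delta> A + hausdorff_content d \<delta> B \<le> (\<Sum>i. ?f (U i))"
      using le by (rule order_trans)
  qed
  have "hausdorff_content d \<alpha> A + hausdorff_content d \<beta> B \<le> hausdorff_outer d (A \<union> B)"
    if "\<alpha> > 0" "\<beta> > 0" for \<alpha> \<beta>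
  proof -
    define \<delta> where "\<delta> = min (min \<alpha> \<beta>) (e / 2)"
    have \<delta>: "\<delta> > 0" "\<delta> < e" "\<delta> \<le> \<alpha>" "\<delta> \<le> \<beta>" using that \<open>e > 0\<close> by (auto simp: \<delta>_def)
    have "hausdorff_content d \<alpha> A + hausdorff_content d \<beta> B
        \<le> hausdorff_content d \<delta> A + hausdorff_content d \<delta> B"
      by (intro add_mono hausdorff_content_antimono \<delta>)
    also have "\<dots> \<le> hausdorff_content d \<delta> (A \<union> B)" by (rule small) (use \<delta> in auto)
    also have "\<dots> \<le> hausdorff_outer d (A \<union> B)" by (rule hausdorff_content_le_outer) (use \<delta> in auto)
    finally show ?thesis .
  qed
  then have "hausdorff_content d \<alpha> A + hausdorff_outer d B \<le> hausdorff_outer d (A \<union> B)"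
    if "\<alpha> > 0" for \<alpha>
    unfolding hausdorff_outer_def[of d B] using that
    by (subst ennreal_SUP_add_right) (auto intro!: SUP_least)
  then show ?thesis
    unfolding hausdorff_outer_def[of d A]
    by (subst ennreal_SUP_add_left[symmetric]) (auto intro!: SUP_least)
qed

lemma hausdorff_outer_closed:
  fixes C :: "'a::metric_space set"
  assumes "closed C"
  shows "hausdorff_outer d (A \<inter> C) + hausdorff_outer d (A - C) = hausdorff_outer d A"
proof (rule antisym)
  let ?H = "hausdorff_outer d :: 'a set \<Rightarrow> ennreal"
  have "A \<inter> C \<union> (A - C) = A" by blast
  then show "?H A \<le> ?H (A \<inter> C) + ?H (A - C)"
    using hausdorff_outer_Un[of d "A \<inter> C" "A - C"] by simp
  show "?H (A \<inter> C) + ?H (A - C) \<le> ?H A"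
  proof (cases "C = {} \<or> ?H A = top")
    case True then show ?thesis by auto
  next
    case False
    then have ne: "C \<noteq> {}" and fin: "?H A < top" by (auto simp: less_top)
    define r where "r k = 1 / (real k + 1)" for k :: nat
    define B where "B k = {x \<in> A. infdist x C \<ge> r k}" for k
    define R where "R k = B (Suc k) - B k" for k
    have r_less: "i < j \<Longrightarrow> r j < r i" for i j by (simp add: r_def field_simps)
    have r_le: "i \<le> j \<Longrightarrow> r j \<le> r i" for i j by (simp add: r_def field_simps)
    have r_pos: "r k > 0" for k by (simp add: r_def)
    have sepRB: "?H (B i) + ?H (A \<inter> C) \<le> ?H (B i \<union> (A \<inter> C))" for i
    proof (rule hausdorff_outer_separated[OF r_pos[of i]])
      fix x y assume "x \<in> B i" "y \<in> A \<inter> C"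
      then show "r i \<le> dist x y" using infdist_le[of y C x] by (auto simp: B_def)
    qed
    have Bmono: "i \<le> j \<Longrightarrow> B i \<subseteq> B j" for i j using r_le by (force simp: B_def)
    have BA: "B k \<subseteq> A" and RA: "R k \<subseteq> A" for k by (auto simp: B_def R_def)
    have sepR: "?H S + ?H (R k) \<le> ?H (S \<union> R k)" if "S \<subseteq> B j" "j < k" for S j k
    proof (rule hausdorff_outer_separated)
      show "r j - r k > 0" using r_less[OF \<open>j < k\<close>] by simp
      fix x y assume "x \<in> S" "y \<in> R k"
      then have "infdist x C \<ge> r j" "infdist y C < r k"
        using that by (auto simp: B_def R_def)
      then show "r j - r k \<le> dist x y"
        using infdist_triangle[of x C y] by simp
    qed
    have part: "(\<Sum>i<n. ?H (R (2 * i + c))) \<le> ?H (\<Union>i<n. R (2 * i + c))" for n c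
    proof (induction n)
      case (Suc n)
      have "?H (\<Union>i<n. R (2 * i + c)) + ?H (R (2 * n + c)) \<le> ?H (\<Union>i<Suc n. R (2 * i + c))"
      proof (cases n)
        case 0 then show ?thesis by (simp add: lessThan_Suc)
      next
        case (Suc m)
        have "R (2 * i + c) \<subseteq> B (2 * m + c + 1)" if "i < n" for i
          using Bmono[of "Suc (2 * i + c)" "2 * m + c + 1"] that Suc by (auto simp: R_def)
        then have "(\<Union>i<n. R (2 * i + c)) \<subseteq> B (2 * m + c + 1)" by blast
        then have "?H (\<Union>i<n. R (2 * i + c)) + ?H (R (2 * n + c))
            \<le> ?H ((\<Union>i<n. R (2 * i + c)) \<union> R (2 * n + c))"
          by (rule sepR) (use Suc in simp)
        then show ?thesis by (simp add: lessThan_Suc Un_commute)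
      qed
      then show ?case using Suc by (simp add: order_trans[OF add_right_mono])
    qed simp
    have part': "(\<Sum>i<n. ?H (R (2 * i + c))) \<le> ?H A" for n c
      by (rule order_trans[OF part hausdorff_outer_mono]) (use RA in blast)
    have two: "(\<Sum>i<2 * n. ?H (R i)) = (\<Sum>i<n. ?H (R (2 * i + 0))) + (\<Sum>i<n. ?H (R (2 * i + 1)))" for n
      by (induction n) (auto simp: ac_simps)
    have "(\<Sum>i<n. ?H (R i)) \<le> 2 * ?H A" for n
    proof -
      have "(\<Sum>i<n. ?H (R i)) \<le> (\<Sum>i<2 * n. ?H (R i))" by (rule sum_mono2) auto
      also have "\<dots> \<le> ?H A + ?H A" unfolding two by (intro add_mono part')
      finally show ?thesis by (simp add: mult_2)
    qed
    then have "(\<Sum>i. ?H (R i)) \<le> 2 * ?H A" by (intro suminf_le_const) auto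
    also have "\<dots> < top" using fin by (simp add: ennreal_mult_less_top)
    finally have S: "(\<Sum>i. ?H (R i)) < top" .
    let ?S = "\<Sum>i. ?H (R i)" and ?X = "?H (A \<inter> C) + ?H (A - C)"
    have step: "(\<Sum>i<k. ?H (R i)) + ?X \<le> ?S + ?H A" for k
    proof -
      have "A - C \<subseteq> B k \<union> (\<Union>i. R (i + k))"
      proof
        fix x assume x: "x \<in> A - C"
        then have "infdist x C > 0"
          using ne \<open>closed C\<close> infdist_pos_not_in_closed by blast
        then obtain m where "r m < infdist x C"
          unfolding r_def using reals_Archimedean[of "infdist x C"]
          by (auto simp: inverse_eq_divide add.commute)
        then have ex: "x \<in> B m" using x by (auto simp: B_def)
        define l where "l = (LEAST m. x \<in> B m)"
        have l: "x \<in> B l" and lm: "\<And>i. i < l \<Longrightarrow> x \<notin> B i"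
          unfolding l_def using LeastI[of "\<lambda>m. x \<in> B m", OF ex] not_less_Least by auto
        show "x \<in> B k \<union> (\<Union>i. R (i + k))"
        proof (cases "l \<le> k")
          case True then show ?thesis using l Bmono by blast
        next
          case False
          then obtain i where "l = Suc (i + k)"
            by (metis add.commute less_imp_Suc_add not_le_imp_less)
          then have "x \<in> R (i + k)" using l lm by (auto simp: R_def)
          then show ?thesis by blast
        qed
      qed
      then have "?H (A - C) \<le> ?H (B k \<union> (\<Union>i. R (i + k)))" by (rule hausdorff_outer_mono)
      also have "\<dots> \<le> ?H (B k) + ?H (\<Union>i. R (i + k))" by (rule hausdorff_outer_Un)
      also have "\<dots> \<le> ?H (B k) + (\<Sum>i. ?H (R (i + k)))"
        by (intro add_left_mono hausdorff_outer_countably_subadditive)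
      finally have "?X \<le> (?H (B k) + ?H (A \<inter> C)) + (\<Sum>i. ?H (R (i + k)))"
        by (metis add.assoc add.commute add_left_mono)
      also have "?H (B k) + ?H (A \<inter> C) \<le> ?H A"
        by (rule order_trans[OF sepRB hausdorff_outer_mono]) (use BA in blast)
      finally have "?X \<le> ?H A + (\<Sum>i. ?H (R (i + k)))" by (simp add: add_right_mono)
      then have "(\<Sum>i<k. ?H (R i)) + ?X \<le> (\<Sum>i<k. ?H (R i)) + (?H A + (\<Sum>i. ?H (R (i + k))))"
        by (rule add_left_mono)
      also have "\<dots> = ((\<Sum>i. ?H (R (i + k))) + (\<Sum>i<k. ?H (R i))) + ?H A" by (simp add: ac_simps)
      also have "(\<Sum>i. ?H (R (i + k))) + (\<Sum>i<k. ?H (R i)) = ?S"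
        by (subst suminf_offset[of _ k]) (auto simp: add.commute)
      finally show ?thesis .
    qed
    have "?X \<le> ?S + ?H A" using step[of 0] by simp
    then have X: "?X < top"
      by (rule le_less_trans) (use S fin in \<open>simp only: ennreal_add_less_top simp_thms\<close>)
    have "?S + ?X = (SUP k. (\<Sum>i<k. ?H (R i)) + ?X)"
      unfolding suminf_eq_SUP by (rule ennreal_SUP_add_left[symmetric]) (use X in auto)
    also have "\<dots> \<le> ?S + ?H A" by (intro SUP_least step)
    finally show ?thesis using S by (auto simp: ennreal_add_left_cancel_le)
  qed
qed

lemma sets_hausdorff_measure [simp, measurable_cong]: "sets (hausdorff_measure d) = sets borel"
  unfolding hausdorff_measure_def by (metis sets.sets_measure_of_eq space_borel)

lemma space_hausdorff_measure [simp]: "space (hausdorff_measure d) = UNIV"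
  using sets_eq_imp_space_eq[OF sets_hausdorff_measure] by simp

lemma emeasure_hausdorff_measure:
  assumes "A \<in> sets borel"
  shows "emeasure (hausdorff_measure d) A = hausdorff_outer d A"
proof -
  let ?L = "lambda_system UNIV (Pow UNIV) (hausdorff_outer d) :: 'a set set"
  have L: "measure_space UNIV ?L (hausdorff_outer d)"
    by (rule sigma_algebra.caratheodory_lemma[OF sigma_algebra_Pow hausdorff_outer_measure_space])
  then interpret L: sigma_algebra UNIV ?L by (simp add: measure_space_def)
  have "Collect closed \<subseteq> ?L"
  proof
    fix C :: "'a set" assume "C \<in> Collect closed"
    then have "\<forall>A\<in>Pow UNIV. hausdorff_outer d (A \<inter> C) + hausdorff_outer d (A - C) = hausdorff_outer d A"
      by (simp add: hausdorff_outer_closed)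
    then show "C \<in> ?L"
      by (subst algebra.lambda_system_eq[OF algebra_Pow]) simp
  qed
  then have sub: "sets borel \<subseteq> ?L"
    unfolding borel_eq_closed using L.sigma_sets_subset[of "Collect closed"]
    by (simp only: sets_measure_of subset_UNIV Pow_UNIV)
  have "countably_additive ?L (hausdorff_outer d)" using L by (simp add: measure_space_def)
  then have "countably_additive (sets borel) (hausdorff_outer d :: 'a set \<Rightarrow> _)"
    using sub unfolding countably_additive_def by blast
  then show ?thesis
    unfolding hausdorff_measure_def
    by (intro emeasure_measure_of_sigma assms)
       (auto simp: positive_def sets.sigma_algebra_axioms[of borel, simplified])
qed

text \<open>Surface measure on a hypersurface of \<open>\<real>\<^sup>n\<close>: Hausdorff measure of dimension \<open>n - 1\<close>.\<close>

definition surface_measure :: "(real^'n) set \<Rightarrow> (real^'n) measure" where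
  "surface_measure S = restrict_space (hausdorff_measure (CARD('n) - 1)) S"


section \<open>Domains with \<open>C\<^sup>1\<close> boundary\<close>

text \<open>
  Near each boundary point \<open>\<Omega>\<close> is the open side of a graph over the hyperplane orthogonal to some
  unit vector \<open>e\<close>; a function on that hyperplane is encoded as a function \<open>\<gamma>\<close> on the whole space
  that is constant along \<open>e\<close>.
\<close>

definition C1_boundary :: "'a::euclidean_space set \<Rightarrow> bool" where
  "C1_boundary \<Omega> \<longleftrightarrow>
     (\<forall>x0\<in>frontier \<Omega>. \<exists>r>0. \<exists>e \<gamma> g. norm e = 1 \<and>
        (\<forall>x. GDERIV \<gamma> x :> g x) \<and> continuous_on UNIV g \<and>
        (\<forall>x s. \<gamma> (x + s *\<^sub>R e) = \<gamma> x) \<and>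
        \<Omega> \<inter> ball x0 r = {x \<in> ball x0 r. \<gamma> x < x \<bullet> e})"


section \<open>The measure on the parabolic boundary\<close>

text \<open>
  Bottom \<open>\<Omega> \<times> {0}\<close> with Lebesgue measure, lateral surface \<open>\<partial>\<Omega> \<times> (0,T)\<close> with the product of surface
  measure and Lebesgue measure. For open \<open>\<Omega>\<close> the set function is a measure; see
  \<open>emeasure_parabolic_boundary_measure\<close> below.
\<close>

definition parabolic_boundary :: "(real^'n) set \<Rightarrow> real \<Rightarrow> ((real^'n) \<times> real) set" where
  "parabolic_boundary \<Omega> T = \<Omega> \<times> {0} \<union> frontier \<Omega> \<times> {0<..<T}"

definition parabolic_boundary_measure :: "(real^'n) set \<Rightarrow> real \<Rightarrow> ((real^'n) \<times> real) measure" where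
  "parabolic_boundary_measure \<Omega> T =
     measure_of (parabolic_boundary \<Omega> T) (sets (restrict_space borel (parabolic_boundary \<Omega> T)))
       (\<lambda>E. emeasure lborel {x\<in>\<Omega>. (x, 0) \<in> E} +
            emeasure (surface_measure (frontier \<Omega>) \<Otimes>\<^sub>M restrict_space lborel {0<..<T})
              (E \<inter> frontier \<Omega> \<times> {0<..<T}))"

lemma sets_parabolic_boundary_measure [simp, measurable_cong]:
  "sets (parabolic_boundary_measure \<Omega> T) = sets (restrict_space borel (parabolic_boundary \<Omega> T))"
proof -
  have "space (restrict_space borel (parabolic_boundary \<Omega> T)) = parabolic_boundary \<Omega> T"
    by (simp add: space_restrict_space)
  then show ?thesis
    unfolding parabolic_boundary_measure_def
    using sets.sets_measure_of_eq[of "restrict_space borel (parabolic_boundary \<Omega> T)"] by simp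
qed

lemma space_parabolic_boundary_measure [simp]:
  "space (parabolic_boundary_measure \<Omega> T) = parabolic_boundary \<Omega> T"
  using sets_eq_imp_space_eq[OF sets_parabolic_boundary_measure[of \<Omega> T]]
  by (simp add: space_restrict_space)

lemma emeasure_parabolic_boundary_measure:
  fixes \<Omega> :: "(real^'n) set"
  assumes "open \<Omega>" and E: "E \<in> sets (restrict_space borel (parabolic_boundary \<Omega> T))"
  shows "emeasure (parabolic_boundary_measure \<Omega> T) E =
           emeasure lborel {x\<in>\<Omega>. (x, 0) \<in> E} +
           emeasure (surface_measure (frontier \<Omega>) \<Otimes>\<^sub>M restrict_space lborel {0<..<T})
             (E \<inter> frontier \<Omega> \<times> {0<..<T})"
proof -
  let ?P = "parabolic_boundary \<Omega> T" and ?Q = "frontier \<Omega> \<times> {0<..<T}"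
  let ?R = "restrict_space borel ?P"
  let ?N = "surface_measure (frontier \<Omega>) \<Otimes>\<^sub>M restrict_space lborel {0<..<T}"
  have m1: "{x\<in>\<Omega>. (x, 0) \<in> F} \<in> sets lborel" and m2: "F \<inter> ?Q \<in> sets ?N"
    if F: "F \<in> sets ?R" for F
  proof -
    obtain G where G: "G \<in> sets borel" "F = ?P \<inter> G"
      using F by (auto simp: sets_restrict_space)
    have "(\<lambda>x. (x, 0)) \<in> borel_measurable (borel :: (real^'n) measure)"
      by (intro borel_measurable_continuous_onI continuous_intros)
    from measurable_sets[OF this G(1)] have "(\<lambda>x. (x, 0)) -` G \<in> sets borel" by simp
    moreover have "{x\<in>\<Omega>. (x, 0) \<in> F} = \<Omega> \<inter> (\<lambda>x. (x, 0)) -` G"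
      by (auto simp: G parabolic_boundary_def)
    ultimately show "{x\<in>\<Omega>. (x, 0) \<in> F} \<in> sets lborel" using \<open>open \<Omega>\<close> by simp
    have "id \<in> surface_measure (frontier \<Omega>) \<Otimes>\<^sub>M restrict_space lborel {0<..<T} \<rightarrow>\<^sub>M borel \<Otimes>\<^sub>M borel"
      unfolding surface_measure_def
      by (rule measurable_pair)
         (auto simp: comp_def intro!: measurable_compose[OF measurable_fst] measurable_compose[OF measurable_snd]
            measurable_restrict_space1)
    then have "id -` G \<inter> space ?N \<in> sets ?N"
      using G(1) by (intro measurable_sets) (auto simp: borel_prod)
    moreover have "space ?N = ?Q"
      by (auto simp: space_pair_measure surface_measure_def space_restrict_space)
    moreover have "F \<inter> ?Q = G \<inter> ?Q" by (auto simp: G parabolic_boundary_def)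
    ultimately show "F \<inter> ?Q \<in> sets ?N" by simp
  qed
  have sa: "sigma_algebra ?P (sets ?R)"
    using sets.sigma_algebra_axioms[of ?R] by (simp add: space_restrict_space)
  have "countably_additive (sets ?R) (\<lambda>E. emeasure lborel {x\<in>\<Omega>. (x, 0) \<in> E} + emeasure ?N (E \<inter> ?Q))"
  proof (rule countably_additiveI)
    fix A :: "nat \<Rightarrow> _" assume A: "range A \<subseteq> sets ?R" "disjoint_family A"
    have "range (\<lambda>i. {x\<in>\<Omega>. (x, 0) \<in> A i}) \<subseteq> sets lborel" "range (\<lambda>i. A i \<inter> ?Q) \<subseteq> sets ?N"
      using A(1) m1 m2 by blast+
    moreover have "disjoint_family (\<lambda>i. {x\<in>\<Omega>. (x, 0) \<in> A i})" "disjoint_family (\<lambda>i. A i \<inter> ?Q)"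
      using A(2) by (fastforce simp: disjoint_family_on_def)+
    ultimately have "(\<Sum>i. emeasure lborel {x\<in>\<Omega>. (x, 0) \<in> A i}) = emeasure lborel (\<Union>i. {x\<in>\<Omega>. (x, 0) \<in> A i})"
      and "(\<Sum>i. emeasure ?N (A i \<inter> ?Q)) = emeasure ?N (\<Union>i. A i \<inter> ?Q)"
      by (simp_all only: suminf_emeasure)
    moreover have "(\<Union>i. {x\<in>\<Omega>. (x, 0) \<in> A i}) = {x\<in>\<Omega>. (x, 0) \<in> (\<Union>i. A i)}" by blast
    moreover have "(\<Union>i. A i \<inter> ?Q) = (\<Union>i. A i) \<inter> ?Q" by blast
    ultimately show "(\<Sum>i. emeasure lborel {x\<in>\<Omega>. (x, 0) \<in> A i} + emeasure ?N (A i \<inter> ?Q)) =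
        emeasure lborel {x\<in>\<Omega>. (x, 0) \<in> (\<Union>i. A i)} + emeasure ?N ((\<Union>i. A i) \<inter> ?Q)"
      by (subst suminf_add[symmetric]) auto
  qed
  then show ?thesis
    unfolding parabolic_boundary_measure_def
    by (intro emeasure_measure_of_sigma sa E) (auto simp: positive_def)
qed


section \<open>\<open>L\<^sup>p\<close> and completeness of a system\<close>

text \<open>
  \<open>L\<^sup>p\<close> is represented by functions rather than by classes modulo null sets, and a linear combination
  by a finite index set \<open>F\<close> with coefficients \<open>c\<close>.
\<close>

definition Lp_fun :: "'a measure \<Rightarrow> real \<Rightarrow> ('a \<Rightarrow> real) set" where
  "Lp_fun M p = {f \<in> borel_measurable M. integrable M (\<lambda>x. \<bar>f x\<bar> powr p)}"

definition Lp_norm :: "'a measure \<Rightarrow> real \<Rightarrow> ('a \<Rightarrow> real) \<Rightarrow> real" where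
  "Lp_norm M p f = (\<integral>x. \<bar>f x\<bar> powr p \<partial>M) powr (1 / p)"

definition complete_in_Lp :: "'a measure \<Rightarrow> real \<Rightarrow> ('i \<Rightarrow> 'a \<Rightarrow> real) \<Rightarrow> bool" where
  "complete_in_Lp M p v \<longleftrightarrow>
     (\<forall>i. v i \<in> Lp_fun M p) \<and>
     (\<forall>f\<in>Lp_fun M p. \<forall>\<epsilon>>0. \<exists>F c. finite F \<and>
        Lp_norm M p (\<lambda>x. f x - (\<Sum>i\<in>F. c i * v i x)) < \<epsilon>)"


section \<open>Parabolic polynomials\<close>

definition partial_deriv :: "'n \<Rightarrow> (real^'n \<Rightarrow> real) \<Rightarrow> real^'n \<Rightarrow> real" where
  "partial_deriv i f \<xi> = deriv (\<lambda>s. f (\<xi> + s *\<^sub>R axis i 1)) 0"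

text \<open>
  \<open>D\<^sup>\<alpha>\<close> iterates partial derivatives along some list in which each index \<open>i\<close> occurs \<open>\<alpha> i\<close> times;
  for smooth functions the order, and hence the choice of the list, does not matter.
\<close>

lemma multi_index_list_exists:
  fixes \<alpha> :: "'n::finite \<Rightarrow> nat"
  shows "\<exists>ks. \<forall>i. count_list ks i = \<alpha> i"
proof -
  obtain ks where "mset ks = Abs_multiset \<alpha>" using ex_mset by blast
  then have "count_list ks i = \<alpha> i" for i using count_mset[of ks i] by simp
  then show ?thesis by blast
qed

definition multi_deriv :: "('n \<Rightarrow> nat) \<Rightarrow> (real^'n \<Rightarrow> real) \<Rightarrow> real^'n \<Rightarrow> real" where
  "multi_deriv \<alpha> = foldr partial_deriv (SOME ks. \<forall>i. count_list ks i = \<alpha> i)"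

definition parabolic_poly :: "real^'n^'n \<Rightarrow> ('n \<Rightarrow> nat) \<Rightarrow> (real^'n) \<times> real \<Rightarrow> real" where
  "parabolic_poly A \<alpha> = (\<lambda>(x, t).
     multi_deriv \<alpha> (\<lambda>\<xi>. exp (x \<bullet> \<xi> + t * (\<Sum>h\<in>UNIV. \<Sum>k\<in>UNIV. A $ h $ k * \<xi> $ h * \<xi> $ k))) 0)"

end

(*
  The span of the v_alpha consists of the caloric extensions exp (t L) p of polynomials p, where
  H = L - d/dt. It is dense in the continuous functions on the parabolic boundary for the uniform
  norm, which gives density in L^p because the surface measure is finite.

  For y outside the closure S of Omega and the fundamental solution Phi of l - L, the function
  exp (l t) Phi (x - y) is a uniform limit of caloric polynomials on S x [0,T]: for distant y expand
  it in x into homogeneous polynomials, then move y through the connected complement of S (Runge).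
  On the boundary of Omega every continuous g(x) is a limit of combinations of the Phi (x - y):
  g is close to a difference of resolvent potentials, and a large absorption term on compact subsets
  of the complement of S sweeps their densities out of S, with an error that vanishes at the boundary
  because C^1 domains have exterior corkscrews. By Weierstrass in s = exp t, lateral data vanishing
  for t <= 0 are then approximated by sums of the exp (l t) Phi (x - y) with error eps exp (2 t), and
  the maximum principle on t <= 0 shows that these sums are small on the bottom. Subtracting first
  the caloric extension of a polynomial close to the data on the bottom reduces to this case.
*)
theory Submission
  imports Defs
begin

text \<open>Fitting the lateral data alone leaves the bottom uncontrolled. Solutions of the form
  \<open>exp (l t) Phi (x - y)\<close> are used because they exist for all negative times and decay
  there: if they fit the data, extended by zero, on the whole lateral half-cylinder
  \<open>t <= T\<close>, their size on the bottom follows from the past, without initial data. The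
  exponent in \<open>exp (2 t)\<close> must exceed one, since the maximum principle is applied after
  multiplication by \<open>exp (- t)\<close>, which makes it strict, and decay must survive this. It
  is the reason for \<open>l >= 2\<close>.

  The powers of \<open>s\<close> bring in arbitrarily many parameters \<open>l\<close>, so the
  kernels must be dense on the boundary for each fixed \<open>l\<close>; hence the difference of
  potentials with a common parameter. Sweeping replaces the solution of an exterior Dirichlet
  problem by absorption, which needs only a quantitative amount of exterior volume near each
  boundary point. Resolvents act on nonnegative functions with values in \<open>ennreal\<close>,
  where Tonelli's theorem and monotone limits are available without integrability, and differences
  are formed only at the end.\<close>

section \<open>Factorisation of the coefficient matrix\<close>

text \<open>Lagrange's completion of squares: splitting off the pivot \<open>d\<close> leaves the
  Schur complement \<open>a'\<close>, to which the induction hypothesis applies. Forms are taken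
  over an arbitrary index set \<open>I\<close> so that one index can be removed, while the linear
  forms \<open>c i\<close> remain over \<open>UNIV\<close>.\<close>

lemma posdef_sum_of_squares_aux:
  fixes a :: "'n::finite \<Rightarrow> 'n \<Rightarrow> real"
  assumes "finite I" "\<And>h k. a h k = a k h"
    and "\<And>\<xi>. \<exists>i\<in>I. \<xi> i \<noteq> 0 \<Longrightarrow> (\<Sum>h\<in>I. \<Sum>k\<in>I. a h k * \<xi> h * \<xi> k) > 0"
  shows "\<exists>c :: 'n \<Rightarrow> 'n \<Rightarrow> real. \<forall>\<xi>.
    (\<Sum>h\<in>I. \<Sum>k\<in>I. a h k * \<xi> h * \<xi> k) = (\<Sum>i\<in>I. (\<Sum>h\<in>UNIV. c i h * \<xi> h)\<^sup>2)"
  using assms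
proof (induction I arbitrary: a rule: finite_induct)
  case empty
  then show ?case by simp
next
  case (insert k I)
  define d where "d = a k k"
  have d: "d > 0"
  proof -
    have "(\<Sum>h\<in>insert k I. \<Sum>l\<in>insert k I. a h l * of_bool (h = k) * of_bool (l = k)) = d"
    proof -
      have "(\<Sum>h\<in>I. \<Sum>l\<in>insert k I. a h l * of_bool (h = k) * of_bool (l = k)) = 0"
      proof (rule sum.neutral, rule ballI)
        fix h assume "h \<in> I"
        then have "h \<noteq> k" using insert.hyps by auto
        then show "(\<Sum>l\<in>insert k I. a h l * of_bool (h = k) * of_bool (l = k)) = 0" by simp
      qed
      moreover have "(\<Sum>l\<in>I. a k l * of_bool (k = k) * of_bool (l = k)) = 0"
        using insert.hyps by (intro sum.neutral) auto
      ultimately show ?thesis using insert.hyps by (simp add: d_def)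
    qed
    then show ?thesis using insert.prems(2)[of "\<lambda>i. of_bool (i = k)"] by simp
  qed
  have complete_square: "d * z * z + 2 * z * S + (X + S * S / d) = (d * z + S)\<^sup>2 / d + X"
    if "d > 0" for z S X :: real
    using that by (simp add: power2_eq_square field_simps)
  define a' where "a' h l = a h l - a h k * a k l / d" for h l
  have split: "(\<Sum>h\<in>insert k I. \<Sum>l\<in>insert k I. a h l * \<xi> h * \<xi> l)
      = (d * \<xi> k + (\<Sum>h\<in>I. a h k * \<xi> h))\<^sup>2 / d + (\<Sum>h\<in>I. \<Sum>l\<in>I. a' h l * \<xi> h * \<xi> l)" for \<xi>
  proof -
    define S where "S = (\<Sum>h\<in>I. a h k * \<xi> h)"
    have S': "(\<Sum>l\<in>I. a k l * \<xi> k * \<xi> l) = \<xi> k * S"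
      unfolding S_def sum_distrib_left by (intro sum.cong refl) (simp add: insert.prems(1)[of k])
    have S'': "(\<Sum>h\<in>I. a h k * \<xi> h * \<xi> k) = \<xi> k * S"
      unfolding S_def sum_distrib_left by (intro sum.cong refl) simp
    have SS: "(\<Sum>h\<in>I. \<Sum>l\<in>I. (a h k * a k l / d) * \<xi> h * \<xi> l) = S * S / d"
      unfolding S_def sum_product sum_divide_distrib
      by (intro sum.cong refl) (simp add: insert.prems(1)[of k])
    have "(\<Sum>h\<in>insert k I. \<Sum>l\<in>insert k I. a h l * \<xi> h * \<xi> l)
        = d * \<xi> k * \<xi> k + 2 * \<xi> k * S + (\<Sum>h\<in>I. \<Sum>l\<in>I. a h l * \<xi> h * \<xi> l)"
      using insert.hyps by (simp add: sum.distrib S' S'' d_def)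
    also have "(\<Sum>h\<in>I. \<Sum>l\<in>I. a h l * \<xi> h * \<xi> l) = (\<Sum>h\<in>I. \<Sum>l\<in>I. a' h l * \<xi> h * \<xi> l) + S * S / d"
      unfolding SS[symmetric] sum.distrib[symmetric] by (intro sum.cong refl) (simp add: a'_def algebra_simps)
    finally have eq: "(\<Sum>h\<in>insert k I. \<Sum>l\<in>insert k I. a h l * \<xi> h * \<xi> l)
        = d * \<xi> k * \<xi> k + 2 * \<xi> k * S + ((\<Sum>h\<in>I. \<Sum>l\<in>I. a' h l * \<xi> h * \<xi> l) + S * S / d)" .
    show ?thesis
      unfolding eq S_def[symmetric] by (rule complete_square[OF d])
  qed
  have "(\<Sum>h\<in>I. \<Sum>l\<in>I. a' h l * \<xi> h * \<xi> l) > 0" if "\<exists>i\<in>I. \<xi> i \<noteq> 0" for \<xi>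
  proof -
    \<comment> \<open>The value at \<open>k\<close> makes the completed square vanish, so the form
      at \<eta> equals the reduced form at \<xi>.\<close>
    define \<eta> where "\<eta> = \<xi>(k := - (\<Sum>h\<in>I. a h k * \<xi> h) / d)"
    have on_I: "\<eta> i = \<xi> i" if "i \<in> I" for i using that insert.hyps by (auto simp: \<eta>_def)
    have "0 < (\<Sum>h\<in>insert k I. \<Sum>l\<in>insert k I. a h l * \<eta> h * \<eta> l)"
      by (rule insert.prems(2)) (use that on_I in auto)
    also have "\<dots> = (\<Sum>h\<in>I. \<Sum>l\<in>I. a' h l * \<xi> h * \<xi> l)"
      unfolding split using d by (simp add: on_I) (simp add: \<eta>_def)
    finally show ?thesis .
  qed
  moreover have "a' h l = a' l h" for h l
    by (simp add: a'_def insert.prems(1)[of h l] insert.prems(1)[of h k] insert.prems(1)[of k l])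
  ultimately obtain c where
    c: "\<And>\<xi>. (\<Sum>h\<in>I. \<Sum>l\<in>I. a' h l * \<xi> h * \<xi> l) = (\<Sum>i\<in>I. (\<Sum>h\<in>UNIV. c i h * \<xi> h)\<^sup>2)"
    using insert.IH[of a'] by blast
  \<comment> \<open>Coefficients of the completed square divided by \<open>sqrt d\<close>, set to
    zero off \<open>insert k I\<close> so that the sum may run over \<open>UNIV\<close>.\<close>
  define ck where "ck h = (if h = k then d else if h \<in> I then a h k else 0) / sqrt d" for h
  have "(\<Sum>h\<in>UNIV. ck h * \<xi> h) = (d * \<xi> k + (\<Sum>h\<in>I. a h k * \<xi> h)) / sqrt d" for \<xi>
  proof -
    have "(\<Sum>h\<in>UNIV. ck h * \<xi> h) = (\<Sum>h\<in>insert k I. ck h * \<xi> h)"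
      by (rule sum.mono_neutral_right) (auto simp: ck_def)
    also have "\<dots> = ck k * \<xi> k + (\<Sum>h\<in>I. (a h k / sqrt d) * \<xi> h)"
      using insert.hyps by (auto simp: ck_def intro!: sum.cong)
    finally show ?thesis by (simp add: ck_def add_divide_distrib sum_divide_distrib)
  qed
  then have ck: "(\<Sum>h\<in>UNIV. ck h * \<xi> h)\<^sup>2 = (d * \<xi> k + (\<Sum>h\<in>I. a h k * \<xi> h))\<^sup>2 / d" for \<xi>
    using d by (simp add: power_divide)
  have "(\<Sum>h\<in>insert k I. \<Sum>l\<in>insert k I. a h l * \<xi> h * \<xi> l)
      = (\<Sum>i\<in>insert k I. (\<Sum>h\<in>UNIV. (c(k := ck)) i h * \<xi> h)\<^sup>2)" for \<xi>
  proof -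
    have "(\<Sum>i\<in>I. (\<Sum>h\<in>UNIV. (c(k := ck)) i h * \<xi> h)\<^sup>2) = (\<Sum>i\<in>I. (\<Sum>h\<in>UNIV. c i h * \<xi> h)\<^sup>2)"
      using insert.hyps by (intro sum.cong refl) auto
    then show ?thesis
      unfolding split c using insert.hyps ck by simp
  qed
  then show ?case by blast
qed

lemma posdef_sum_of_squares:
  fixes A :: "real^'n^'n"
  assumes "transpose A = A"
    and "\<And>\<xi>. \<xi> \<noteq> 0 \<Longrightarrow> (\<Sum>h\<in>UNIV. \<Sum>k\<in>UNIV. A $ h $ k * \<xi> $ h * \<xi> $ k) > 0"
  shows "\<exists>c::'n \<Rightarrow> real^'n. \<forall>\<xi>.
    (\<Sum>h\<in>UNIV. \<Sum>k\<in>UNIV. A $ h $ k * \<xi> $ h * \<xi> $ k) = (\<Sum>i\<in>UNIV. (c i \<bullet> \<xi>)\<^sup>2)"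
proof -
  have "A $ h $ k = A $ k $ h" for h k
    using assms(1) by (metis transpose_def vec_lambda_beta)
  moreover have "(\<Sum>h\<in>UNIV. \<Sum>k\<in>UNIV. A $ h $ k * \<xi> h * \<xi> k) > 0" if "\<exists>i\<in>UNIV. \<xi> i \<noteq> 0" for \<xi>
    using assms(2)[of "\<chi> i. \<xi> i"] that by (simp add: vec_eq_iff)
  ultimately obtain c :: "'n \<Rightarrow> 'n \<Rightarrow> real" where
    c: "\<And>\<xi>. (\<Sum>h\<in>UNIV. \<Sum>k\<in>UNIV. A $ h $ k * \<xi> h * \<xi> k) = (\<Sum>i\<in>UNIV. (\<Sum>h\<in>UNIV. c i h * \<xi> h)\<^sup>2)"
    using posdef_sum_of_squares_aux[of UNIV "\<lambda>h k. A $ h $ k"] by auto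
  show ?thesis
    by (rule exI[of _ "\<lambda>i. \<chi> h. c i h"]) (simp add: c[of "($) _"] inner_vec_def)
qed

text \<open>
  A factorisation \<open>A = \<Sum>\<^sub>i c\<^sub>i c\<^sub>i\<^sup>T\<close> and the inverse \<open>\<beta>\<close> of the linear map sending the \<open>i\<close>-th unit
  vector to \<open>c\<^sub>i\<close>. Then \<open>H\<close> is the sum of the squared directional derivatives along
  the \<open>c\<^sub>i\<close> minus the time derivative, and the quadratic form of \<open>A\<^sup>-\<^sup>1\<close> is \<open>\<parallel>\<beta> x\<parallel>\<^sup>2\<close>.
\<close>
locale elliptic_frame =
  fixes c :: "'n::finite \<Rightarrow> real^'n" and \<beta> :: "real^'n \<Rightarrow> real^'n"
  assumes linear_\<beta>: "linear \<beta>"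
    and \<beta>_c: "\<beta> (c i) = axis i 1"
    and \<beta>_expand: "x = (\<Sum>i\<in>UNIV. \<beta> x $ i *\<^sub>R c i)"

text \<open>Positivity makes the matrix \<open>C\<close> with rows \<open>c i\<close> injective,
  hence invertible; \<beta> is multiplication by the inverse of its transpose, whose columns are the
  \<open>c i\<close>.\<close>

lemma elliptic_frame_exists:
  fixes c :: "'n::finite \<Rightarrow> real^'n"
  assumes pos: "\<And>\<xi>. \<xi> \<noteq> 0 \<Longrightarrow> (\<Sum>i\<in>UNIV. (c i \<bullet> \<xi>)\<^sup>2) > 0"
  obtains \<beta> where "elliptic_frame c \<beta>"
proof -
  define C where "C = (\<chi> i. c i)"
  have C: "(C *v \<xi>) $ i = c i \<bullet> \<xi>" for \<xi> i
    by (simp add: C_def matrix_vector_mult_def inner_vec_def)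
  have "inj ((*v) C)"
    unfolding linear_injective_0[OF matrix_vector_mul_linear]
  proof (intro allI impI)
    fix \<xi> assume "C *v \<xi> = 0"
    then have "(\<Sum>i\<in>UNIV. (c i \<bullet> \<xi>)\<^sup>2) = 0" by (simp add: C[symmetric])
    then show "\<xi> = 0" using pos[of \<xi>] by force
  qed
  then obtain B' where B': "B' ** C = mat 1"
    using matrix_left_invertible_injective by blast
  define B where "B = transpose B'"
  have B: "transpose C ** B = mat 1"
    unfolding B_def matrix_transpose_mul[symmetric] B' by simp
  then have B: "transpose C ** B = mat 1" "B ** transpose C = mat 1"
    using matrix_left_right_inverse by auto
  have T: "transpose C *v y = (\<Sum>i\<in>UNIV. y $ i *\<^sub>R c i)" for y
    by (simp add: vec_eq_iff C_def matrix_vector_mult_def transpose_def mult.commute)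
  have TB: "transpose C *v (B *v x) = x" "B *v (transpose C *v x) = x" for x
    by (simp_all only: matrix_vector_mul_assoc B matrix_vector_mul_lid)
  have "elliptic_frame c ((*v) B)"
  proof (rule elliptic_frame.intro)
    show "linear ((*v) B)" by (rule matrix_vector_mul_linear)
    have "transpose C *v axis i 1 = c i" for i
      by (simp add: matrix_vector_mult_basis C_def column_def transpose_def vec_eq_iff)
    then show "B *v c i = axis i 1" for i using TB(2) by metis
    show "x = (\<Sum>i\<in>UNIV. (B *v x) $ i *\<^sub>R c i)" for x using TB(1) T by metis
  qed
  then show ?thesis by (rule that)
qed

section \<open>Caloric extensions of polynomials\<close>

definition dder :: "'a::real_normed_vector \<Rightarrow> ('a \<Rightarrow> real) \<Rightarrow> 'a \<Rightarrow> real" where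
  "dder u p = (\<lambda>x. deriv (\<lambda>s. p (x + s *\<^sub>R u)) 0)"

abbreviation rpf :: "('a::real_normed_vector \<Rightarrow> real) \<Rightarrow> bool" where
  "rpf \<equiv> real_polynomial_function"

lemmas rpf_linear = real_polynomial_function.intros(1)
  and rpf_const = real_polynomial_function.intros(2)
  and rpf_add = real_polynomial_function.intros(3)
  and rpf_mult = real_polynomial_function.intros(4)

text \<open>\<open>dder\<close> is a value of \<open>deriv\<close> and carries information only
  where the derivative exists. One induction yields existence and polynomiality together;
  \<open>dder_eqI\<close> then turns the witness into \<open>dder\<close>.\<close>

lemma dder_polynomial_aux:
  assumes "rpf p"
  shows "\<exists>q. rpf q \<and> (\<forall>x. ((\<lambda>s. p (x + s *\<^sub>R u)) has_real_derivative q x) (at 0))"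
  using assms
proof (induction p rule: real_polynomial_function.induct)
  case (linear f)
  interpret f: bounded_linear f by fact
  have "((\<lambda>s. f (x + s *\<^sub>R u)) has_real_derivative f u) (at 0)" for x
    unfolding f.add f.scaleR by (auto intro!: derivative_eq_intros)
  then show ?case by (intro exI[of _ "\<lambda>x. f u"]) auto
next
  case (const c)
  then show ?case by (intro exI[of _ "\<lambda>x. 0"]) auto
next
  case (add f g)
  then obtain q r where q: "rpf q" "\<And>x. ((\<lambda>s. f (x + s *\<^sub>R u)) has_real_derivative q x) (at 0)"
    and r: "rpf r" "\<And>x. ((\<lambda>s. g (x + s *\<^sub>R u)) has_real_derivative r x) (at 0)" by blast
  show ?case
    by (rule exI[of _ "\<lambda>x. q x + r x"]) (auto intro!: DERIV_add q r)
next
  case (mult f g)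
  then obtain q r where q: "rpf q" "\<And>x. ((\<lambda>s. f (x + s *\<^sub>R u)) has_real_derivative q x) (at 0)"
    and r: "rpf r" "\<And>x. ((\<lambda>s. g (x + s *\<^sub>R u)) has_real_derivative r x) (at 0)" by blast
  have "((\<lambda>s. f (x + s *\<^sub>R u) * g (x + s *\<^sub>R u)) has_real_derivative q x * g x + r x * f x) (at 0)" for x
    using DERIV_mult[OF q(2)[of x] r(2)[of x]] by simp
  then show ?case
    by (intro exI[of _ "\<lambda>x. q x * g x + r x * f x"]) (auto intro!: q r mult)
qed

lemma dder_eqI:
  assumes "\<And>x. ((\<lambda>s. p (x + s *\<^sub>R u)) has_real_derivative q x) (at 0)"
  shows "dder u p = q"
  unfolding dder_def by (rule ext) (rule DERIV_imp_deriv[OF assms])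

lemma rpf_dder [intro]: "rpf p \<Longrightarrow> rpf (dder u p)"
  using dder_polynomial_aux[of p u] dder_eqI[of p u] by metis

lemma has_dder0: "rpf p \<Longrightarrow> ((\<lambda>s. p (x + s *\<^sub>R u)) has_real_derivative dder u p x) (at 0)"
  using dder_polynomial_aux[of p u] dder_eqI[of p u] by metis

lemma dder_const [simp]: "dder u (\<lambda>x. a) = (\<lambda>x. 0)"
  by (rule dder_eqI) auto

lemma dder_linear:
  assumes "bounded_linear f"
  shows "dder u f = (\<lambda>x. f u)"
proof (rule dder_eqI)
  interpret f: bounded_linear f by fact
  show "((\<lambda>s. f (x + s *\<^sub>R u)) has_real_derivative f u) (at 0)" for x
    unfolding f.add f.scaleR by (auto intro!: derivative_eq_intros)
qed

lemma dder_add: "rpf p \<Longrightarrow> rpf q \<Longrightarrow> dder u (\<lambda>x. p x + q x) = (\<lambda>x. dder u p x + dder u q x)"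
  by (rule dder_eqI) (intro DERIV_add has_dder0)

lemma dder_mult:
  "rpf p \<Longrightarrow> rpf q \<Longrightarrow> dder u (\<lambda>x. p x * q x) = (\<lambda>x. dder u p x * q x + dder u q x * p x)"
  by (rule dder_eqI) (use DERIV_mult[OF has_dder0 has_dder0] in simp)

lemma dder_cmult: "rpf p \<Longrightarrow> dder u (\<lambda>x. a * p x) = (\<lambda>x. a * dder u p x)"
  by (rule dder_eqI) (intro DERIV_cmult has_dder0)

lemma dder_sum:
  assumes "finite I" "\<And>i. i \<in> I \<Longrightarrow> rpf (p i)"
  shows "dder u (\<lambda>x. \<Sum>i\<in>I. p i x) = (\<lambda>x. \<Sum>i\<in>I. dder u (p i) x)"
  by (rule dder_eqI) (intro DERIV_sum has_dder0 assms)

text \<open>The Leibniz rule expresses both mixed derivatives of a product symmetrically, so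
  commutation follows by induction from linear functions, whose second derivatives vanish.\<close>

lemma dder_commute: "rpf p \<Longrightarrow> dder u (dder w p) = dder w (dder u p)"
proof (induction p rule: real_polynomial_function.induct)
  case (linear f)
  then show ?case by (simp add: dder_linear)
next
  case (add f g)
  then show ?case by (simp add: dder_add rpf_dder)
next
  case (mult f g)
    have *: "dder u (dder w (\<lambda>x. f x * g x)) = (\<lambda>x. dder u (dder w f) x * g x + dder u g x * dder w f x
        + (dder u (dder w g) x * f x + dder u f x * dder w g x))" for u w
      by (simp only: dder_mult[OF mult.hyps] dder_add[OF rpf_mult rpf_mult] dder_mult rpf_dder mult.hyps)
    show ?case unfolding *[of u w] *[of w u] mult.IH by (simp add: algebra_simps)
qed simp

lemma dder_direction_sum:
  fixes u :: "'i \<Rightarrow> 'a::real_normed_vector"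
  assumes "rpf p" "finite I"
  shows "dder (\<Sum>i\<in>I. a i *\<^sub>R u i) p = (\<lambda>x. \<Sum>i\<in>I. a i * dder (u i) p x)"
  using assms(1)
proof (induction p rule: real_polynomial_function.induct)
  case (linear f)
  then interpret f: bounded_linear f .
  show ?case using linear by (simp add: dder_linear f.sum f.scaleR)
next
  case (add f g)
  then show ?case by (simp add: dder_add sum.distrib distrib_left)
next
  case (mult f g)
  then show ?case by (simp add: dder_mult sum.distrib distrib_left sum_distrib_left mult_ac)
qed simp

text \<open>Induction along monomials: only multiplication by a coordinate occurs.\<close>

inductive coord_poly :: "(real^'n \<Rightarrow> real) \<Rightarrow> bool" where
  const: "coord_poly (\<lambda>x. a)"
| add: "coord_poly p \<Longrightarrow> coord_poly q \<Longrightarrow> coord_poly (\<lambda>x. p x + q x)"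
| coord: "coord_poly p \<Longrightarrow> coord_poly (\<lambda>x. x $ k * p x)"

lemma rpf_coord: "rpf (\<lambda>x::real^'n. x $ k)"
  by (intro rpf_linear bounded_linear_vec_nth)

lemma coord_poly_rpf: "coord_poly p \<Longrightarrow> rpf p"
  by (induction rule: coord_poly.induct) (auto intro: rpf_coord)

lemma coord_poly_cmult: "coord_poly p \<Longrightarrow> coord_poly (\<lambda>x. a * p x)"
proof (induction rule: coord_poly.induct)
  case (coord p k)
  have "(\<lambda>x. a * (x $ k * p x)) = (\<lambda>x. x $ k * (a * p x))" by auto
  then show ?case using coord_poly.coord[OF coord(2)] by metis
qed (auto simp: distrib_left intro: coord_poly.intros)

lemma coord_poly_mult: "coord_poly p \<Longrightarrow> coord_poly q \<Longrightarrow> coord_poly (\<lambda>x. p x * q x)"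
proof (induction rule: coord_poly.induct)
  case (coord p k)
  then show ?case using coord_poly.coord[of "\<lambda>x. p x * q x" k] by (simp add: mult.assoc)
qed (auto simp: distrib_right intro: coord_poly.intros coord_poly_cmult)

lemma coord_poly_sum:
  "finite I \<Longrightarrow> (\<And>i. i \<in> I \<Longrightarrow> coord_poly (p i)) \<Longrightarrow> coord_poly (\<lambda>x. \<Sum>i\<in>I. p i x)"
  by (induction I rule: finite_induct) (auto intro: coord_poly.intros)

lemma rpf_coord_poly:
  fixes p :: "real^'n \<Rightarrow> real"
  shows "rpf p \<Longrightarrow> coord_poly p"
proof (induction p rule: real_polynomial_function.induct)
  case (linear f)
  then interpret f: bounded_linear f .
  have "f x = (\<Sum>k\<in>UNIV. x $ k * f (axis k 1))" for x
  proof -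
    have "f x = f (\<Sum>k\<in>UNIV. x $ k *\<^sub>R axis k 1)"
      by (simp add: basis_expansion flip: scalar_mult_eq_scaleR)
    then show ?thesis by (simp only: f.sum f.scaleR real_scaleR_def)
  qed
  then have "f = (\<lambda>x. \<Sum>k\<in>UNIV. x $ k * f (axis k 1))" by blast
  moreover have "coord_poly (\<lambda>x. \<Sum>k\<in>UNIV. x $ k * f (axis k 1))"
    by (intro coord_poly_sum coord_poly.coord coord_poly.const) auto
  ultimately show ?case by metis
qed (auto intro: coord_poly.intros coord_poly_mult)

text \<open>Indexed by lists like the iterated derivative in \<open>multi_deriv\<close>: each
  partial derivative in \<xi> will prepend one index.\<close>

definition monomial :: "'n list \<Rightarrow> real^'n \<Rightarrow> real" where
  "monomial ks x = (\<Prod>k\<leftarrow>ks. x $ k)"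

lemma monomial_simps [simp]:
  "monomial [] = (\<lambda>x. 1)" "monomial (k # ks) = (\<lambda>x. x $ k * monomial ks x)"
  by (auto simp: monomial_def)

lemma rpf_monomial: "rpf (monomial ks)"
  by (induction ks) (auto intro: rpf_coord)

lemma monomial_cong: "mset ks = mset ks' \<Longrightarrow> monomial ks = monomial ks'"
  unfolding monomial_def by (metis mset_map prod_mset_prod_list)

context elliptic_frame
begin

definition Lop :: "(real^'n \<Rightarrow> real) \<Rightarrow> real^'n \<Rightarrow> real" where
  "Lop p = (\<lambda>x. \<Sum>i\<in>UNIV. dder (c i) (dder (c i) p) x)"

lemma rpf_Lop: "rpf p \<Longrightarrow> rpf (Lop p)"
  unfolding Lop_def by (intro real_polynomial_function_sum rpf_dder) auto

lemma rpf_Lpow: "rpf p \<Longrightarrow> rpf ((Lop ^^ m) p)"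
  by (induction m) (auto intro: rpf_Lop)

lemma Lop_const [simp]: "Lop (\<lambda>x. a) = (\<lambda>x. 0)"
  by (simp add: Lop_def)

lemma Lop_add: "rpf p \<Longrightarrow> rpf q \<Longrightarrow> Lop (\<lambda>x. p x + q x) = (\<lambda>x. Lop p x + Lop q x)"
  by (simp add: Lop_def dder_add rpf_dder sum.distrib)

lemma Lop_cmult: "rpf p \<Longrightarrow> Lop (\<lambda>x. a * p x) = (\<lambda>x. a * Lop p x)"
  by (simp add: Lop_def dder_cmult rpf_dder sum_distrib_left)

lemma Lpow_const: "m > 0 \<Longrightarrow> (Lop ^^ m) (\<lambda>x. a) = (\<lambda>x. 0)"
  by (induction m arbitrary: a) (simp_all add: funpow_swap1, metis Lop_const funpow_0 neq0_conv)

lemma Lpow_add: "rpf p \<Longrightarrow> rpf q \<Longrightarrow> (Lop ^^ m) (\<lambda>x. p x + q x) = (\<lambda>x. (Lop ^^ m) p x + (Lop ^^ m) q x)"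
  by (induction m) (simp_all add: Lop_add rpf_Lpow)

lemma Lpow_cmult: "rpf p \<Longrightarrow> (Lop ^^ m) (\<lambda>x. a * p x) = (\<lambda>x. a * (Lop ^^ m) p x)"
  by (induction m) (simp_all add: Lop_cmult rpf_Lpow)

lemma Lop_sum:
  assumes "finite I" "\<And>i. i \<in> I \<Longrightarrow> rpf (p i)"
  shows "Lop (\<lambda>x. \<Sum>i\<in>I. p i x) = (\<lambda>x. \<Sum>i\<in>I. Lop (p i) x)"
  using assms
  by (induction I rule: finite_induct)
     (simp_all add: Lop_add real_polynomial_function_sum)

lemma dder_Lop: "rpf p \<Longrightarrow> dder u (Lop p) = Lop (dder u p)"
  by (simp add: Lop_def dder_sum rpf_dder dder_commute[of _ u])

lemma dder_Lpow: "rpf p \<Longrightarrow> dder u ((Lop ^^ m) p) = (Lop ^^ m) (dder u p)"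
  by (induction m) (simp_all add: dder_Lop rpf_Lpow)

lemma dder_coord: "dder u (\<lambda>x. x $ k) = (\<lambda>x. u $ k)"
  by (rule dder_linear) (rule bounded_linear_vec_nth)

text \<open>The commutator of \<open>Lop\<close> with multiplication by a coordinate is a
  first-order operator with constant coefficients.\<close>

lemma Lop_coord_mult:
  assumes "rpf p"
  shows "Lop (\<lambda>x. x $ k * p x) = (\<lambda>x. x $ k * Lop p x + 2 * (\<Sum>i\<in>UNIV. c i $ k * dder (c i) p x))"
proof -
  have "dder u (dder u (\<lambda>x. x $ k * p x)) = (\<lambda>x. x $ k * dder u (dder u p) x + 2 * (u $ k * dder u p x))" for u
    using assms
    by (simp add: dder_mult rpf_coord dder_coord dder_add dder_cmult rpf_dder
        real_polynomial_function.intros algebra_simps)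
  then show ?thesis
    by (simp add: Lop_def sum.distrib sum_distrib_left)
qed

text \<open>The commutator from \<open>Lop_coord_mult\<close> commutes with \<open>Lop\<close>, so
  moving the coordinate past \<open>Suc m\<close> factors produces it \<open>Suc m\<close>
  times.\<close>

lemma Lpow_coord_mult:
  assumes "rpf p"
  shows "(Lop ^^ Suc m) (\<lambda>x. x $ k * p x) = (\<lambda>x. x $ k * (Lop ^^ Suc m) p x
     + 2 * real (Suc m) * (\<Sum>i\<in>UNIV. c i $ k * (Lop ^^ m) (dder (c i) p) x))"
proof (induction m)
  case 0
  then show ?case using Lop_coord_mult[OF assms] by simp
next
  case (Suc m)
  have rp: "rpf ((Lop ^^ m) (dder (c i) p))" for i by (intro rpf_Lpow rpf_dder assms)
  have rs: "rpf (\<lambda>x. \<Sum>i\<in>UNIV. c i $ k * (Lop ^^ m) (dder (c i) p) x)"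
    by (intro real_polynomial_function_sum rpf_mult rp) auto
  have "(Lop ^^ Suc (Suc m)) (\<lambda>x. x $ k * p x)
     = Lop (\<lambda>x. x $ k * (Lop ^^ Suc m) p x
     + (2 * real (Suc m)) * (\<Sum>i\<in>UNIV. c i $ k * (Lop ^^ m) (dder (c i) p) x))"
    using Suc by simp
  also have "\<dots> = (\<lambda>x. Lop (\<lambda>x. x $ k * (Lop ^^ Suc m) p x) x
      + (2 * real (Suc m)) * (\<Sum>i\<in>UNIV. c i $ k * Lop ((Lop ^^ m) (dder (c i) p)) x))"
    using rp rs rpf_Lpow[OF assms, of "Suc m"]
    by (subst Lop_add)
       (auto simp del: funpow.simps
         simp: Lop_cmult Lop_sum rpf_mult rpf_const
         intro: rpf_mult rpf_coord)
  also have "Lop (\<lambda>x. x $ k * (Lop ^^ Suc m) p x) = (\<lambda>x. x $ k * Lop ((Lop ^^ Suc m) p) x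
      + 2 * (\<Sum>i\<in>UNIV. c i $ k * Lop ((Lop ^^ m) (dder (c i) p)) x))"
    by (subst Lop_coord_mult) (simp_all add: rpf_Lpow assms dder_Lop dder_Lpow rpf_Lop del: funpow.simps, simp_all add: dder_Lop dder_Lpow rpf_Lpow assms)
  finally show ?case by (simp add: algebra_simps)
qed

text \<open>\<open>Lop\<close> lowers the degree by two. In place of a degree the induction uses the
  commutator formula, whose extra terms are derivatives of \<open>(Lop ^^ m') p\<close> and vanish
  once this does.\<close>

lemma Lpow_eventually_zero:
  assumes "coord_poly p"
  shows "\<exists>d. \<forall>m\<ge>d. (Lop ^^ m) p = (\<lambda>x. 0)"
  using assms
proof (induction rule: coord_poly.induct)
  case (const a)
  then show ?case using Lpow_const by (intro exI[of _ 1]) auto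
next
  case (add p q)
  then obtain d e where "\<forall>m\<ge>d. (Lop ^^ m) p = (\<lambda>x. 0)" "\<forall>m\<ge>e. (Lop ^^ m) q = (\<lambda>x. 0)" by blast
  then show ?case
    by (intro exI[of _ "max d e"]) (simp add: Lpow_add coord_poly_rpf add.hyps)
next
  case (coord p k)
  then obtain d where d: "\<And>m. m \<ge> d \<Longrightarrow> (Lop ^^ m) p = (\<lambda>x. 0)" by blast
  have rp: "rpf p" using coord.hyps by (rule coord_poly_rpf)
  have "(Lop ^^ m) (\<lambda>x. x $ k * p x) = (\<lambda>x. 0)" if md: "m \<ge> Suc d" for m
  proof -
    obtain m' where "m = Suc m'" using Suc_le_D[OF md] by blast
    then have m': "m = Suc m'" "m' \<ge> d" using md by auto
    have "(Lop ^^ m') (dder (c i) p) = (\<lambda>x. 0)" for i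
      using d[OF m'(2)] by (simp flip: dder_Lpow[OF rp])
    then show ?thesis
      unfolding m'(1) Lpow_coord_mult[OF rp] using d[of "Suc m'"] m'(2) by simp
  qed
  then show ?case by blast
qed

text \<open>The series of \<open>exp (t L) p\<close>. For polynomial \<open>p\<close> only finitely
  many terms are nonzero, but the infinite sum avoids carrying a bound on the degree.\<close>

definition heat_ext :: "(real^'n \<Rightarrow> real) \<Rightarrow> real^'n \<Rightarrow> real \<Rightarrow> real" where
  "heat_ext p x t = (\<Sum>m. t ^ m / fact m * (Lop ^^ m) p x)"

lemma heat_ext_sums:
  assumes "rpf p"
  shows "(\<lambda>m. t ^ m / fact m * (Lop ^^ m) p x) sums heat_ext p x t"
proof -
  obtain d where d: "\<And>m. m \<ge> d \<Longrightarrow> (Lop ^^ m) p = (\<lambda>x. 0)"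
    using Lpow_eventually_zero[OF rpf_coord_poly[OF assms]] by blast
  have "summable (\<lambda>m. t ^ m / fact m * (Lop ^^ m) p x)"
    by (rule summable_finite[of "{..<d}"]) (use d in \<open>auto simp: not_less\<close>)
  then show ?thesis unfolding heat_ext_def by (rule summable_sums)
qed

lemma heat_ext_finite:
  assumes "rpf p"
  obtains d where "\<And>x t. heat_ext p x t = (\<Sum>m<d. t ^ m / fact m * (Lop ^^ m) p x)"
proof -
  obtain d where d: "\<And>m. m \<ge> d \<Longrightarrow> (Lop ^^ m) p = (\<lambda>x. 0)"
    using Lpow_eventually_zero[OF rpf_coord_poly[OF assms]] by blast
  have "heat_ext p x t = (\<Sum>m<d. t ^ m / fact m * (Lop ^^ m) p x)" for x t
    unfolding heat_ext_def by (rule suminf_finite) (use d in \<open>auto simp: not_less\<close>)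
  then show ?thesis by (rule that)
qed

lemma heat_ext_0: "heat_ext p x 0 = p x"
  unfolding heat_ext_def by (subst suminf_finite[of "{0}"]) auto

lemma heat_ext_const [simp]: "heat_ext (\<lambda>x. a) x t = a"
proof -
  have "heat_ext (\<lambda>x. a) x t = (\<Sum>m\<in>{0}. t ^ m / fact m * (Lop ^^ m) (\<lambda>x. a) x)"
    unfolding heat_ext_def by (rule suminf_finite) (auto simp: Lpow_const)
  then show ?thesis by simp
qed

lemma heat_ext_add:
  assumes "rpf p" "rpf q"
  shows "heat_ext (\<lambda>x. p x + q x) x t = heat_ext p x t + heat_ext q x t"
proof -
  have "(\<lambda>m. t ^ m / fact m * (Lop ^^ m) (\<lambda>x. p x + q x) x) sums (heat_ext p x t + heat_ext q x t)"
    using sums_add[OF heat_ext_sums[OF assms(1), of t x] heat_ext_sums[OF assms(2), of t x]] assms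
    by (simp add: Lpow_add distrib_left)
  moreover have "rpf (\<lambda>x. p x + q x)" using assms by auto
  ultimately show ?thesis using heat_ext_sums sums_unique2 by blast
qed

lemma heat_ext_cmult:
  assumes "rpf p"
  shows "heat_ext (\<lambda>x. a * p x) x t = a * heat_ext p x t"
proof -
  have "(\<lambda>m. t ^ m / fact m * (Lop ^^ m) (\<lambda>x. a * p x) x) sums (a * heat_ext p x t)"
    using sums_mult[OF heat_ext_sums[OF assms, of t x], of a] assms
    by (simp add: Lpow_cmult mult_ac)
  moreover have "rpf (\<lambda>x. a * p x)" using assms by auto
  ultimately show ?thesis using heat_ext_sums sums_unique2 by blast
qed

text \<open>Conjugation by \<open>exp (t L)\<close> turns multiplication by \<open>x $ k\<close>
  into that multiplication plus \<open>t\<close> times its commutator with \<open>L\<close>. The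
  \<xi>-derivatives of the generating function obey the same recursion, which is how the parabolic
  polynomials are identified.\<close>

lemma heat_ext_coord_mult:
  assumes "rpf p"
  shows "heat_ext (\<lambda>x. x $ k * p x) x t =
    x $ k * heat_ext p x t + 2 * t * (\<Sum>i\<in>UNIV. c i $ k * heat_ext (dder (c i) p) x t)"
proof -
  let ?a = "\<lambda>m. t ^ m / fact m * (Lop ^^ m) (\<lambda>x. x $ k * p x) x"
  let ?b = "\<lambda>m. t ^ m / fact m * (Lop ^^ m) p x"
  let ?S = "\<lambda>m. \<Sum>i\<in>UNIV. c i $ k * (t ^ m / fact m * (Lop ^^ m) (dder (c i) p) x)"
  have "?S sums (\<Sum>i\<in>UNIV. c i $ k * heat_ext (dder (c i) p) x t)"
    by (intro sums_sum sums_mult heat_ext_sums rpf_dder assms)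
  moreover have "(\<lambda>m. ?b (Suc m)) sums (heat_ext p x t - p x)"
    using heat_ext_sums[OF assms, of t x] by (subst sums_Suc_iff) simp
  ultimately have "(\<lambda>m. x $ k * ?b (Suc m) + 2 * t * ?S m) sums
      (x $ k * (heat_ext p x t - p x) + 2 * t * (\<Sum>i\<in>UNIV. c i $ k * heat_ext (dder (c i) p) x t))"
    by (intro sums_add sums_mult)
  also have "(\<lambda>m. x $ k * ?b (Suc m) + 2 * t * ?S m) = (\<lambda>m. ?a (Suc m))"
  proof
    fix m
    \<comment> \<open>The factor \<open>Suc m\<close> of the commutator formula cancels against
      \<open>fact (Suc m)\<close>, which shifts the series by one.\<close>
    have *: "t ^ Suc m / fact (Suc m) * (2 * real (Suc m) * X) = 2 * t * (t ^ m / fact m * X)" for X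
      by (simp add: divide_simps)
    have "?a (Suc m) = x $ k * ?b (Suc m) + t ^ Suc m / fact (Suc m) *
        (2 * real (Suc m) * (\<Sum>i\<in>UNIV. c i $ k * (Lop ^^ m) (dder (c i) p) x))"
      unfolding Lpow_coord_mult[OF assms] by (simp only: distrib_left mult_ac)
    also have "\<dots> = x $ k * ?b (Suc m) + 2 * t * ?S m"
      unfolding * by (simp add: sum_distrib_left mult_ac)
    finally show "x $ k * ?b (Suc m) + 2 * t * ?S m = ?a (Suc m)" ..
  qed
  finally have "?a sums (x $ k * (heat_ext p x t - p x)
      + 2 * t * (\<Sum>i\<in>UNIV. c i $ k * heat_ext (dder (c i) p) x t) + x $ k * p x)"
    by (subst (asm) sums_Suc_iff) simp
  moreover have "rpf (\<lambda>x. x $ k * p x)" using assms by (auto intro: rpf_coord)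
  ultimately show ?thesis
    using heat_ext_sums[of "\<lambda>x. x $ k * p x" t x] sums_unique2 by (fastforce simp: algebra_simps)
qed

lemma rpf_heat_ext:
  assumes "rpf p"
  shows "rpf (\<lambda>x. heat_ext p x t)" and "dder u (\<lambda>x. heat_ext p x t) = (\<lambda>x. heat_ext (dder u p) x t)"
proof -
  obtain d where d: "\<And>m. m \<ge> d \<Longrightarrow> (Lop ^^ m) p = (\<lambda>x. 0)"
    using Lpow_eventually_zero[OF rpf_coord_poly[OF assms]] by blast
  then have d': "(Lop ^^ m) (dder u p) = (\<lambda>x. 0)" if "m \<ge> d" for m
    using that by (simp flip: dder_Lpow[OF assms])
  have fin: "heat_ext p x t = (\<Sum>m<d. t ^ m / fact m * (Lop ^^ m) p x)"
     "heat_ext (dder u p) x t = (\<Sum>m<d. t ^ m / fact m * (Lop ^^ m) (dder u p) x)" for x t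
    unfolding heat_ext_def by (rule suminf_finite; simp add: d d' not_less)+
  show r: "rpf (\<lambda>x. heat_ext p x t)"
    unfolding fin(1) by (intro real_polynomial_function_sum rpf_mult rpf_Lpow assms) auto
  show "dder u (\<lambda>x. heat_ext p x t) = (\<lambda>x. heat_ext (dder u p) x t)"
    unfolding fin dder_Lpow[OF assms, symmetric]
    by (intro dder_eqI DERIV_sum DERIV_cmult has_dder0 rpf_Lpow assms)
qed

lemma continuous_heat_ext:
  assumes "rpf p"
  shows "continuous_on UNIV (\<lambda>(x, t). heat_ext p x t)"
proof -
  obtain d where d: "\<And>x t. heat_ext p x t = (\<Sum>m<d. t ^ m / fact m * (Lop ^^ m) p x)"
    using heat_ext_finite[OF assms] by blast
  have "continuous_on UNIV ((Lop ^^ m) p)" for m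
    using rpf_Lpow[OF assms, of m] continuous_on_polymonial_function real_polynomial_function_eq by blast
  then have "continuous_on UNIV (\<lambda>z::(real^'n) \<times> real. (Lop ^^ m) p (fst z))" for m
    by (rule continuous_on_compose2) (auto intro: continuous_intros)
  then show ?thesis
    unfolding d split_def by (intro continuous_intros) auto
qed

definition expo :: "real^'n \<Rightarrow> real \<Rightarrow> real^'n \<Rightarrow> real" where
  "expo x t \<xi> = exp (x \<bullet> \<xi> + t * (\<Sum>i\<in>UNIV. (c i \<bullet> \<xi>)\<^sup>2))"

text \<open>\<open>expo x t (\<xi> + \<eta>) = expo x t \<xi> * expo (x + 2 t A \<xi>) t \<eta>\<close>, so the derivatives at \<open>\<xi>\<close> are those
  at \<open>0\<close> with \<open>x\<close> shifted.\<close>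

lemma foldr_partial_deriv_expo:
  "foldr partial_deriv ks (expo x t) =
     (\<lambda>\<xi>. heat_ext (monomial ks) (x + \<xi>' \<xi>) t * expo x t \<xi>)"
  if "\<xi>' = (\<lambda>\<xi>. \<Sum>i\<in>UNIV. (2 * t * (c i \<bullet> \<xi>)) *\<^sub>R c i)"
proof (induction ks)
  case Nil
  then show ?case by simp
next
  case (Cons k ks)
  let ?e = "axis k 1 :: real^'n"
  let ?p = "heat_ext (monomial ks)"
  have e: "v \<bullet> ?e = v $ k" for v by (simp add: inner_axis)
  \<comment> \<open>Moving \<xi> in direction \<open>?e\<close> moves the spatial argument along a
    combination of the \<open>c i\<close>, so the derivative is a sum of the
    \<open>dder (c i)\<close>.\<close>
  have shift: "x + \<xi>' (\<xi> + s *\<^sub>R ?e) = (x + \<xi>' \<xi>) + s *\<^sub>R (\<Sum>i\<in>UNIV. (2 * t * c i $ k) *\<^sub>R c i)" for \<xi> s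
    by (simp add: that inner_add_right e algebra_simps sum.distrib scaleR_sum_right)
  have D1: "((\<lambda>s. ?p (x + \<xi>' (\<xi> + s *\<^sub>R ?e)) t) has_real_derivative
      (\<Sum>i\<in>UNIV. 2 * t * c i $ k * heat_ext (dder (c i) (monomial ks)) (x + \<xi>' \<xi>) t)) (at 0)" for \<xi>
    unfolding shift
    using has_dder0[OF rpf_heat_ext(1)[OF rpf_monomial[of ks], of t], of "x + \<xi>' \<xi>" "\<Sum>i\<in>UNIV. (2 * t * c i $ k) *\<^sub>R c i"]
    unfolding dder_direction_sum[OF rpf_heat_ext(1)[OF rpf_monomial] finite]
    unfolding rpf_heat_ext(2)[OF rpf_monomial] .
  have D2: "((\<lambda>s. expo x t (\<xi> + s *\<^sub>R ?e)) has_real_derivative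
      expo x t \<xi> * (x + \<xi>' \<xi>) $ k) (at 0)" for \<xi>
  proof -
    let ?g = "\<lambda>s. x \<bullet> \<xi> + s * x $ k + t * (\<Sum>i\<in>UNIV. (c i \<bullet> \<xi> + s * c i $ k)\<^sup>2)"
    have "((\<lambda>s. (c i \<bullet> \<xi> + s * c i $ k)\<^sup>2) has_real_derivative 2 * (c i \<bullet> \<xi>) * c i $ k) (at 0)" for i
      by (auto intro!: derivative_eq_intros)
    then have "((\<lambda>s. t * (\<Sum>i\<in>UNIV. (c i \<bullet> \<xi> + s * c i $ k)\<^sup>2)) has_real_derivative
        t * (\<Sum>i\<in>UNIV. 2 * (c i \<bullet> \<xi>) * c i $ k)) (at 0)"
      by (intro DERIV_cmult DERIV_sum)
    moreover have "((\<lambda>s. x \<bullet> \<xi> + s * x $ k) has_real_derivative x $ k) (at 0)"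
      by (auto intro!: derivative_eq_intros)
    ultimately have g: "(?g has_real_derivative x $ k + t * (\<Sum>i\<in>UNIV. 2 * (c i \<bullet> \<xi>) * c i $ k)) (at 0)"
      by (intro DERIV_add)
    have "expo x t (\<xi> + s *\<^sub>R ?e) = exp (?g s)" for s
      by (simp add: expo_def inner_add_right e)
    moreover have "x $ k + t * (\<Sum>i\<in>UNIV. 2 * (c i \<bullet> \<xi>) * c i $ k) = (x + \<xi>' \<xi>) $ k"
      by (simp add: that sum_distrib_left mult_ac)
    ultimately show ?thesis using DERIV_fun_exp[OF g] by (simp add: expo_def)
  qed
  \<comment> \<open>The two terms of the product rule are those of
    \<open>heat_ext_coord_mult\<close> at the shifted point.\<close>
  have "partial_deriv k (\<lambda>\<xi>. ?p (x + \<xi>' \<xi>) t * expo x t \<xi>) \<xi>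
      = heat_ext (\<lambda>x. x $ k * monomial ks x) (x + \<xi>' \<xi>) t * expo x t \<xi>" for \<xi>
    unfolding partial_deriv_def
    by (rule DERIV_imp_deriv, rule DERIV_cong[OF DERIV_mult[OF D1 D2]])
       (simp add: heat_ext_coord_mult rpf_monomial algebra_simps sum_distrib_left)
  then show ?case unfolding foldr.simps o_apply Cons monomial_simps by blast
qed

end

text \<open>The list chosen in \<open>multi_deriv\<close> is a permutation of \<open>ks\<close>,
  hence gives the same monomial; at \<xi> = 0 the shift vanishes and the exponential is one.\<close>

lemma parabolic_poly_monomial:
  assumes "elliptic_frame c \<beta>"
    and A: "\<And>\<xi>. (\<Sum>h\<in>UNIV. \<Sum>k\<in>UNIV. A $ h $ k * \<xi> $ h * \<xi> $ k) = (\<Sum>i\<in>UNIV. (c i \<bullet> \<xi>)\<^sup>2)"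
  shows "parabolic_poly A (count_list ks) (x, t) = elliptic_frame.heat_ext c (monomial ks) x t"
proof -
  interpret elliptic_frame c \<beta> by fact
  define ls where "ls = (SOME ls. \<forall>i. count_list ls i = count_list ks i)"
  have "\<forall>i. count_list ls i = count_list ks i"
    unfolding ls_def by (rule someI[of _ ks]) simp
  then have "mset ls = mset ks" by (simp add: multiset_eq_iff count_mset)
  then have *: "monomial ls = monomial ks" by (rule monomial_cong)
  have E: "(\<lambda>\<xi>. exp (x \<bullet> \<xi> + t * (\<Sum>h\<in>UNIV. \<Sum>k\<in>UNIV. A $ h $ k * \<xi> $ h * \<xi> $ k))) = expo x t"
    by (simp add: A expo_def fun_eq_iff)
  show ?thesis
    unfolding parabolic_poly_def split multi_deriv_def ls_def[symmetric] E foldr_partial_deriv_expo[OF refl]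
    by (simp add: * expo_def)
qed

section \<open>Uniform approximation by a family\<close>

text \<open>Membership in the uniform closure on \<open>K\<close> of the span of the
  \<open>v i\<close>; the lemmas below show that this is a closed linear subspace.\<close>

definition approx_on :: "'a set \<Rightarrow> ('i \<Rightarrow> 'a \<Rightarrow> real) \<Rightarrow> ('a \<Rightarrow> real) \<Rightarrow> bool" where
  "approx_on K v f \<longleftrightarrow> (\<forall>\<epsilon>>0. \<exists>F a. finite F \<and> (\<forall>x\<in>K. \<bar>f x - (\<Sum>i\<in>F. a i * v i x)\<bar> < \<epsilon>))"

lemma approx_on_member: "approx_on K v (v i)"
  unfolding approx_on_def
  by (rule allI, rule impI, rule exI[of _ "{i}"], rule exI[of _ "\<lambda>i. 1"]) simp

lemma approx_on_zero: "approx_on K v (\<lambda>x. 0)"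
  unfolding approx_on_def by (rule allI, rule impI, rule exI[of _ "{}"]) simp

lemma approx_on_add:
  assumes "approx_on K v f" "approx_on K v g"
  shows "approx_on K v (\<lambda>x. f x + g x)"
  unfolding approx_on_def
proof (intro allI impI)
  fix \<epsilon> :: real assume "\<epsilon> > 0"
  then obtain F a G b where F: "finite F" "\<forall>x\<in>K. \<bar>f x - (\<Sum>i\<in>F. a i * v i x)\<bar> < \<epsilon> / 2"
    and G: "finite G" "\<forall>x\<in>K. \<bar>g x - (\<Sum>i\<in>G. b i * v i x)\<bar> < \<epsilon> / 2"
    using assms unfolding approx_on_def by (meson half_gt_zero)
  define d where "d i = (if i \<in> F then a i else 0) + (if i \<in> G then b i else 0)" for i
  have "(\<Sum>i\<in>F \<union> G. d i * v i x) = (\<Sum>i\<in>F. a i * v i x) + (\<Sum>i\<in>G. b i * v i x)" for x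
  proof -
    have "(\<Sum>i\<in>F \<union> G. (if i \<in> F then a i else 0) * v i x) = (\<Sum>i\<in>F. a i * v i x)"
         "(\<Sum>i\<in>F \<union> G. (if i \<in> G then b i else 0) * v i x) = (\<Sum>i\<in>G. b i * v i x)"
      using F(1) G(1) by (auto intro!: sum.mono_neutral_cong_right)
    then show ?thesis by (simp add: d_def distrib_right sum.distrib)
  qed
  moreover have "\<bar>f x + g x - ((\<Sum>i\<in>F. a i * v i x) + (\<Sum>i\<in>G. b i * v i x))\<bar> < \<epsilon>" if "x \<in> K" for x
    using F(2)[rule_format, OF that] G(2)[rule_format, OF that] by linarith
  ultimately have "finite (F \<union> G) \<and> (\<forall>x\<in>K. \<bar>f x + g x - (\<Sum>i\<in>F \<union> G. d i * v i x)\<bar> < \<epsilon>)"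
    using F G by simp
  then show "\<exists>F a. finite F \<and> (\<forall>x\<in>K. \<bar>f x + g x - (\<Sum>i\<in>F. a i * v i x)\<bar> < \<epsilon>)" by blast
qed

lemma approx_on_cmult:
  assumes "approx_on K v f"
  shows "approx_on K v (\<lambda>x. r * f x)"
proof (cases "r = 0")
  case False
  show ?thesis unfolding approx_on_def
  proof (intro allI impI)
    fix \<epsilon> :: real assume "\<epsilon> > 0"
    then have "\<epsilon> / \<bar>r\<bar> > 0" using False by simp
    then obtain F a where F: "finite F" "\<forall>x\<in>K. \<bar>f x - (\<Sum>i\<in>F. a i * v i x)\<bar> < \<epsilon> / \<bar>r\<bar>"
      using assms unfolding approx_on_def by meson
    have "\<bar>r * f x - (\<Sum>i\<in>F. (r * a i) * v i x)\<bar> < \<epsilon>" if "x \<in> K" for x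
    proof -
      have "r * f x - (\<Sum>i\<in>F. (r * a i) * v i x) = r * (f x - (\<Sum>i\<in>F. a i * v i x))"
        by (simp add: right_diff_distrib sum_distrib_left mult.assoc)
      moreover have "\<bar>r\<bar> * \<bar>f x - (\<Sum>i\<in>F. a i * v i x)\<bar> < \<epsilon>"
        using F(2)[rule_format, OF that] False by (simp add: field_simps)
      ultimately show ?thesis by (simp only: abs_mult)
    qed
    then show "\<exists>F a. finite F \<and> (\<forall>x\<in>K. \<bar>r * f x - (\<Sum>i\<in>F. a i * v i x)\<bar> < \<epsilon>)"
      using F(1) by (intro exI[of _ F] exI[of _ "\<lambda>i. r * a i"]) simp
  qed
qed (simp add: approx_on_zero)

lemma approx_on_sum:
  "finite I \<Longrightarrow> (\<And>i. i \<in> I \<Longrightarrow> approx_on K v (f i)) \<Longrightarrow> approx_on K v (\<lambda>x. \<Sum>i\<in>I. f i x)"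
proof (induction I rule: finite_induct)
  case (insert i I)
  then have "approx_on K v (\<lambda>x. f i x + (\<Sum>i\<in>I. f i x))" by (intro approx_on_add) auto
  then show ?case using insert.hyps by simp
qed (simp add: approx_on_zero)

lemma approx_on_diff:
  assumes "approx_on K v f" "approx_on K v g"
  shows "approx_on K v (\<lambda>x. f x - g x)"
proof -
  have "approx_on K v (\<lambda>x. f x + (-1) * g x)" by (intro approx_on_add approx_on_cmult assms)
  then show ?thesis by simp
qed

lemma approx_on_limit:
  assumes "\<And>\<epsilon>. \<epsilon> > 0 \<Longrightarrow> \<exists>g. approx_on K v g \<and> (\<forall>x\<in>K. \<bar>f x - g x\<bar> \<le> \<epsilon>)"
  shows "approx_on K v f"
  unfolding approx_on_def
proof (intro allI impI)
  fix \<epsilon> :: real assume "\<epsilon> > 0"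
  then obtain g where g: "approx_on K v g" "\<forall>x\<in>K. \<bar>f x - g x\<bar> \<le> \<epsilon> / 2"
    using assms[of "\<epsilon> / 2"] by auto
  obtain F a where F: "finite F" "\<forall>x\<in>K. \<bar>g x - (\<Sum>i\<in>F. a i * v i x)\<bar> < \<epsilon> / 2"
    using g(1) \<open>\<epsilon> > 0\<close> unfolding approx_on_def by (meson half_gt_zero)
  have "\<bar>f x - (\<Sum>i\<in>F. a i * v i x)\<bar> < \<epsilon>" if "x \<in> K" for x
    using F(2)[rule_format, OF that] g(2)[rule_format, OF that] by linarith
  then show "\<exists>F a. finite F \<and> (\<forall>x\<in>K. \<bar>f x - (\<Sum>i\<in>F. a i * v i x)\<bar> < \<epsilon>)" using F(1) by blast
qed

lemma approx_on_heat_ext: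
  assumes "elliptic_frame c \<beta>"
    and "\<And>\<xi>. (\<Sum>h\<in>UNIV. \<Sum>k\<in>UNIV. A $ h $ k * \<xi> $ h * \<xi> $ k) = (\<Sum>i\<in>UNIV. (c i \<bullet> \<xi>)\<^sup>2)"
    and "rpf p"
  shows "approx_on K (parabolic_poly A) (\<lambda>(x, t). elliptic_frame.heat_ext c p x t)"
proof -
  interpret elliptic_frame c \<beta> by fact
  have mono: "approx_on K (parabolic_poly A) (\<lambda>(x, t). heat_ext (monomial ks) x t)" for ks
    using approx_on_member[of K "parabolic_poly A" "count_list ks"]
    by (rule back_subst[of "approx_on K _"])
       (auto simp: parabolic_poly_monomial[OF assms(1,2)])
  \<comment> \<open>The prefix \<open>monomial ks\<close> is generalised so that the coordinate in
    the induction step can be absorbed into the list.\<close>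
  have "approx_on K (parabolic_poly A) (\<lambda>(x, t). heat_ext (\<lambda>x. monomial ks x * p x) x t)" for ks
    using rpf_coord_poly[OF assms(3)]
  proof (induction arbitrary: ks rule: coord_poly.induct)
    case (const a)
    have "approx_on K (parabolic_poly A) (\<lambda>z. a * (case z of (x, t) \<Rightarrow> heat_ext (monomial ks) x t))"
      by (intro approx_on_cmult mono)
    also have "(\<lambda>z. a * (case z of (x, t) \<Rightarrow> heat_ext (monomial ks) x t))
        = (\<lambda>(x, t). heat_ext (\<lambda>x. monomial ks x * a) x t)"
      using heat_ext_cmult[OF rpf_monomial, of a ks] by (auto simp: mult.commute[of _ a])
    finally show ?case .
  next
    case (add p q)
    have "approx_on K (parabolic_poly A) (\<lambda>z. (case z of (x, t) \<Rightarrow> heat_ext (\<lambda>x. monomial ks x * p x) x t)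
        + (case z of (x, t) \<Rightarrow> heat_ext (\<lambda>x. monomial ks x * q x) x t))"
      by (intro approx_on_add add.IH)
    then show ?case
      by (rule back_subst[of "approx_on K _"])
         (auto simp: distrib_left heat_ext_add rpf_mult rpf_monomial coord_poly_rpf add.hyps)
  next
    case (coord p k)
    show ?case using coord.IH[of "k # ks"] by (simp add: mult_ac)
  qed
  from this[of "[]"] show ?thesis by simp
qed

section \<open>The resolvent kernel\<close>

text \<open>The exponent \<open>a\<close> stays free because each derivative in \<rho> raises it by
  one; the kernel itself has \<open>a = n / 2\<close>.\<close>

definition yint :: "real \<Rightarrow> real \<Rightarrow> real \<Rightarrow> real \<Rightarrow> real" where
  "yint a l \<rho> s = indicator {0<..} s * (s powr (- a) * exp (- l * s - \<rho> / (4 * s)))"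

text \<open>Up to a constant, \<open>yuk (n/2) \<lambda> \<parallel>\<beta> z\<parallel>\<^sup>2\<close> is the fundamental solution of \<open>\<lambda> - L\<close>: the Laplace transform of the
  heat kernel.\<close>

definition yuk :: "real \<Rightarrow> real \<Rightarrow> real \<Rightarrow> real" where
  "yuk a l \<rho> = (\<integral>s. yint a l \<rho> s \<partial>lborel)"

lemma exp_sums_real: "(\<lambda>n. x ^ n / fact n) sums exp (x::real)"
  using exp_converges[of x] by (simp add: field_simps)

lemma yint_nonneg: "yint a l \<rho> s \<ge> 0"
  by (simp add: yint_def)

lemma yint_measurable [measurable]: "yint a l \<rho> \<in> borel_measurable borel"
  unfolding yint_def by measurable

lemma exp_indicator_integrable:
  assumes "l > 0"
  shows "integrable lborel (\<lambda>s. indicator {0<..} s * exp (- l * s) :: real)"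
proof -
  have "set_integrable lebesgue {0..} (\<lambda>s. exp (- l * s))"
    using assms
    by (intro nonnegative_absolutely_integrable_1 integrable_on_exp_minus_to_infinity) auto
  then have "integrable lborel (\<lambda>s. indicator {0..} s * exp (- l * s) :: real)"
    unfolding set_integrable_def by (subst (asm) integrable_completion) auto
  then show ?thesis
    by (rule Bochner_Integration.integrable_bound) (auto simp: indicator_def)
qed

text \<open>\<open>x\<^sup>m \<le> m! e\<^sup>x\<close> with \<open>x = \<rho> / 4s\<close> controls the singularity at \<open>s = 0\<close>.\<close>

lemma yint_bound:
  assumes "\<rho> > 0" "a \<ge> 0"
  obtains C where "C > 0" "\<And>s l. yint a l \<rho> s \<le> C * (indicator {0<..} s * exp (- l * s))"
proof -
  define m where "m = nat \<lceil>a\<rceil>"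
  have ma: "a \<le> real m" unfolding m_def by (rule real_nat_ceiling_ge)
  define C where "C = 1 + fact m * (4 / \<rho>) ^ m"
  have "s powr (- a) * exp (- (\<rho> / (4 * s))) \<le> C" if "s > 0" for s
  proof (cases "s \<ge> 1")
    case True
    have "s powr (- a) * exp (- (\<rho> / (4 * s))) \<le> 1 * 1"
      using True assms powr_mono[of "- a" 0 s] by (intro mult_mono) auto
    also have "\<dots> \<le> C" using assms by (simp add: C_def)
    finally show ?thesis .
  next
    case False
    define x where "x = \<rho> / (4 * s)"
    have x: "x > 0" using assms that by (simp add: x_def)
    have "x ^ m / fact m \<le> exp x"
      using x exp_sums_real[of x] sum_le_suminf[of "\<lambda>n. x ^ n / fact n" "{m}"] by (simp add: sums_iff)
    then have *: "exp (- x) * x ^ m \<le> fact m"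
      by (simp add: exp_minus field_simps)
    have "s powr (- a) \<le> s powr (- real m)"
      using False that ma by (intro powr_mono') auto
    also have "\<dots> = (x * (4 / \<rho>)) ^ m"
      using that assms by (simp add: x_def powr_minus powr_realpow power_one_over inverse_eq_divide)
    finally have "s powr (- a) * exp (- x) \<le> (x * (4 / \<rho>)) ^ m * exp (- x)"
      by (rule mult_right_mono) simp
    also have "\<dots> = (4 / \<rho>) ^ m * (exp (- x) * x ^ m)" by (simp only: power_mult_distrib mult_ac)
    also have "\<dots> \<le> (4 / \<rho>) ^ m * fact m" using * assms by (intro mult_left_mono) auto
    also have "\<dots> \<le> C" by (simp add: C_def)
    finally show ?thesis by (simp add: x_def)
  qed
  then have "yint a l \<rho> s \<le> C * (indicator {0<..} s * exp (- l * s))" for s l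
  proof -
    assume *: "\<And>s. s > 0 \<Longrightarrow> s powr (- a) * exp (- (\<rho> / (4 * s))) \<le> C"
    have "exp (- l * s) * (s powr (- a) * exp (- (\<rho> / (4 * s)))) \<le> exp (- l * s) * C" if "s > 0"
      using *[OF that] by (intro mult_left_mono) auto
    then show ?thesis
      by (auto simp: yint_def indicator_def exp_diff exp_minus field_simps)
  qed
  moreover have "C > 0" using assms by (simp add: C_def add_pos_nonneg)
  ultimately show ?thesis using that by blast
qed

lemma yint_integrable:
  assumes "\<rho> > 0" "a \<ge> 0" "l > 0"
  shows "integrable lborel (yint a l \<rho>)"
proof -
  obtain C where C: "C > 0" "\<And>s l. yint a l \<rho> s \<le> C * (indicator {0<..} s * exp (- l * s))"
    using yint_bound[OF assms(1,2)] by metis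
  have "integrable lborel (\<lambda>s. C * (indicator {0<..} s * exp (- l * s)))"
    by (intro integrable_mult_right exp_indicator_integrable assms)
  then show ?thesis
    by (rule Bochner_Integration.integrable_bound)
       (use C(2)[of l] yint_nonneg in \<open>auto intro!: order_trans[OF _ abs_ge_self]\<close>)
qed

lemma yuk_nonneg: "yuk a l \<rho> \<ge> 0"
  unfolding yuk_def by (intro Bochner_Integration.integral_nonneg yint_nonneg)

lemma yuk_antimono:
  assumes "0 < \<rho>" "\<rho> \<le> \<rho>'" "a \<ge> 0" "l > 0"
  shows "yuk a l \<rho>' \<le> yuk a l \<rho>"
  unfolding yuk_def
proof (intro integral_mono yint_integrable)
  show "yint a l \<rho>' s \<le> yint a l \<rho> s" for s
    using assms by (auto simp: yint_def indicator_def intro!: mult_left_mono divide_right_mono)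
qed (use assms in auto)

lemma yint_shift:
  "yint (a + real m) l \<rho> s * (x / 4) ^ m = yint a l \<rho> s * (x / (4 * s)) ^ m"
proof (cases "s > 0")
  case True
  have "s powr (- (a + real m)) = s powr (- a - real m)" by (simp add: algebra_simps)
  also have "\<dots> = s powr (- a) / s ^ m" by (simp only: powr_diff powr_realpow[OF True])
  finally show ?thesis
    using True by (simp add: yint_def power_divide power_mult_distrib)
qed (simp add: yint_def)

lemma yint_exp: "yint a l \<rho> s * exp (x / (4 * s)) = yint a l (\<rho> - x) s"
  by (auto simp: yint_def indicator_def diff_divide_distrib simp flip: exp_add)

text \<open>Expand \<open>exp (- \<delta> / (4 s))\<close> under the integral. The absolute values
  of the terms add up to the integrand at \<open>\<rho> - \<bar>\<delta>\<bar>\<close>, which is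
  integrable since this is positive; hence sum and integral may be exchanged.\<close>

lemma yuk_taylor:
  assumes "\<bar>\<delta>\<bar> < \<rho>" "a \<ge> 0" "l > 0"
  shows "(\<lambda>m. yuk (a + real m) l \<rho> * (- \<delta> / 4) ^ m / fact m) sums yuk a l (\<rho> + \<delta>)"
    and "summable (\<lambda>m. \<bar>yuk (a + real m) l \<rho> * (- \<delta> / 4) ^ m / fact m\<bar>)"
proof -
  define g where "g x m s = yint (a + real m) l \<rho> s * (x / 4) ^ m / fact m" for x m s
  have g: "g x m s = yint a l \<rho> s * ((x / (4 * s)) ^ m / fact m)" for x m s
    by (simp add: g_def yint_shift)
  have g_sums: "(\<lambda>m. g x m s) sums yint a l (\<rho> - x) s" for x s
    unfolding g yint_exp[symmetric]
    by (intro sums_mult exp_sums_real)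
  have \<rho>: "\<rho> > 0" "\<rho> - \<bar>\<delta>\<bar> > 0" using assms by auto
  have g_int: "integrable lborel (g x m)" for x m
    unfolding g_def using assms \<rho> by (intro integrable_divide integrable_mult_left yint_integrable) auto
  have g_abs: "\<bar>g x m s\<bar> = g \<bar>x\<bar> m s" for x m s
    by (simp add: g_def abs_mult power_abs yint_nonneg)
  have g_integral: "(\<integral>s. g x m s \<partial>lborel) = yuk (a + real m) l \<rho> * (x / 4) ^ m / fact m" for x m
    by (simp add: g_def yuk_def)
  have sm: "summable (\<lambda>m. \<integral>s. norm (g x m s) \<partial>lborel)" if "\<bar>x\<bar> = \<bar>\<delta>\<bar>" for x
  proof (rule summableI_nonneg_bounded)
    show "(\<Sum>m<N. \<integral>s. norm (g x m s) \<partial>lborel) \<le> yuk a l (\<rho> - \<bar>\<delta>\<bar>)" for N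
    proof -
      have "(\<Sum>m<N. \<integral>s. norm (g x m s) \<partial>lborel) = (\<integral>s. (\<Sum>m<N. g \<bar>\<delta>\<bar> m s) \<partial>lborel)"
        using that by (simp add: g_abs g_int)
      also have "\<dots> \<le> yuk a l (\<rho> - \<bar>\<delta>\<bar>)"
        unfolding yuk_def
      proof (rule integral_mono)
        show "(\<Sum>m<N. g \<bar>\<delta>\<bar> m s) \<le> yint a l (\<rho> - \<bar>\<delta>\<bar>) s" for s
        proof -
          have "g \<bar>\<delta>\<bar> m s \<ge> 0" for m by (simp add: g_def yint_nonneg)
          then show ?thesis
            using sum_le_suminf[of "\<lambda>m. g \<bar>\<delta>\<bar> m s" "{..<N}"] g_sums[of "\<bar>\<delta>\<bar>" s]
            by (simp add: sums_iff)
        qed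
      qed (use assms \<rho> in \<open>auto intro!: yint_integrable g_int\<close>)
      finally show ?thesis .
    qed
  qed auto
  have "(\<lambda>m. \<integral>s. g (- \<delta>) m s \<partial>lborel) sums (\<integral>s. (\<Sum>m. g (- \<delta>) m s) \<partial>lborel)"
  proof (rule sums_integral)
    show "AE s in lborel. summable (\<lambda>m. norm (g (- \<delta>) m s))"
      using g_sums[of "\<bar>\<delta>\<bar>"] by (auto simp: g_abs sums_iff)
  qed (use g_int sm in auto)
  also have "(\<integral>s. (\<Sum>m. g (- \<delta>) m s) \<partial>lborel) = yuk a l (\<rho> + \<delta>)"
    unfolding yuk_def using g_sums[of "- \<delta>"] by (simp add: sums_iff)
  finally show "(\<lambda>m. yuk (a + real m) l \<rho> * (- \<delta> / 4) ^ m / fact m) sums yuk a l (\<rho> + \<delta>)"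
    by (simp add: g_integral)
  have "summable (\<lambda>m. \<bar>\<integral>s. g (- \<delta>) m s \<partial>lborel\<bar>)"
    by (rule summable_comparison_test'[OF sm[of "- \<delta>"], of 0])
       (auto intro: integral_abs_bound)
  then show "summable (\<lambda>m. \<bar>yuk (a + real m) l \<rho> * (- \<delta> / 4) ^ m / fact m\<bar>)"
    by (simp add: g_integral)
qed

text \<open>Read off as the linear coefficient of the Taylor series around \<rho>.\<close>

lemma yuk_deriv:
  assumes "\<rho> > 0" "a \<ge> 0" "l > 0"
  shows "((\<lambda>\<rho>. yuk a l \<rho>) has_real_derivative - yuk (a + 1) l \<rho> / 4) (at \<rho>)"
proof -
  define cc where "cc m = yuk (a + real m) l \<rho> * (- 1 / 4) ^ m / fact m" for m
  have cc: "(\<lambda>m. cc m * \<delta> ^ m) sums yuk a l (\<rho> + \<delta>)" if "\<bar>\<delta>\<bar> < \<rho>" for \<delta>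
  proof -
    have "cc m * \<delta> ^ m = yuk (a + real m) l \<rho> * (- \<delta> / 4) ^ m / fact m" for m
    proof -
      have "(- \<delta> / 4) ^ m = (- 1 / 4) ^ m * \<delta> ^ m" by (simp flip: power_mult_distrib)
      then show ?thesis by (simp add: cc_def)
    qed
    then show ?thesis using yuk_taylor(1)[OF that assms(2,3)] by simp
  qed
  have "DERIV (\<lambda>\<delta>. \<Sum>m. cc m * \<delta> ^ m) 0 :> (\<Sum>m. diffs cc m * 0 ^ m)"
    using assms cc[of "\<rho> / 2"] by (intro termdiffs_strong[where K = "\<rho> / 2"]) (auto simp: sums_iff)
  also have "(\<Sum>m. diffs cc m * 0 ^ m) = - yuk (a + 1) l \<rho> / 4"
    unfolding powser_zero by (simp add: diffs_def cc_def)
  finally have "((\<lambda>\<delta>. yuk a l (\<rho> + \<delta>)) has_real_derivative - yuk (a + 1) l \<rho> / 4) (at 0)"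
    by (rule has_field_derivative_transform_within[where d = \<rho>])
       (use assms cc in \<open>auto simp: sums_iff dist_real_def\<close>)
  then show ?thesis
    using DERIV_shift[of "\<lambda>x. yuk a l x" _ 0 \<rho>] by (simp add: add.commute)
qed

lemma yuk_isCont:
  assumes "\<rho> > 0" "a \<ge> 0" "l > 0"
  shows "isCont (yuk a l) \<rho>"
  using yuk_deriv[OF assms] by (rule DERIV_isCont)

text \<open>Integration by parts; in terms of the derivatives of \<open>yuk a l\<close> this is the radial form of
  the equation \<open>L \<Phi> = \<lambda> \<Phi>\<close>.\<close>

lemma yuk_recursion:
  assumes "\<rho> > 0" "a \<ge> 0" "l > 0"
  shows "\<rho> / 4 * yuk (a + 2) l \<rho> - a * yuk (a + 1) l \<rho> = l * yuk a l \<rho>"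
proof -
  let ?F = "\<lambda>s. s powr (- a) * exp (- l * s - \<rho> / (4 * s))"
  let ?f = "\<lambda>s. \<rho> / 4 * yint (a + 2) l \<rho> s - a * yint (a + 1) l \<rho> s - l * yint a l \<rho> s"
  have int: "integrable lborel ?f"
    using assms by (intro Bochner_Integration.integrable_diff integrable_mult_right yint_integrable) auto
  have val: "(\<integral>s. ?f s \<partial>lborel) = \<rho> / 4 * yuk (a + 2) l \<rho> - a * yuk (a + 1) l \<rho> - l * yuk a l \<rho>"
    unfolding yuk_def using assms
    by (simp add: Bochner_Integration.integral_diff yint_integrable)
  \<comment> \<open>\<open>?f\<close> is the derivative of \<open>?F\<close> on the positive axis,
    and \<open>?F\<close> tends to zero at both ends.\<close>
  have "(LBINT s=0..\<infinity>. ?f s) = 0 - 0"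
  proof (rule interval_integral_FTC_integrable)
    fix s :: real assume "0 < ereal s"
    then have s: "s > 0" by simp
    have "(?F has_real_derivative (- a * s powr (- a - 1) * exp (- l * s - \<rho> / (4 * s))
        + s powr (- a) * (exp (- l * s - \<rho> / (4 * s)) * (- l + \<rho> / (4 * s\<^sup>2))))) (at s)"
      using s by (auto intro!: derivative_eq_intros simp: field_simps power2_eq_square)
    moreover have "?f s = (- a * s powr (- a - 1) * exp (- l * s - \<rho> / (4 * s))
        + s powr (- a) * (exp (- l * s - \<rho> / (4 * s)) * (- l + \<rho> / (4 * s\<^sup>2))))"
    proof -
      have "s powr (- (a + 2)) = s powr (- a) / s\<^sup>2"
        using s by (simp add: powr_diff flip: powr_numeral)
      moreover have "s powr (- (a + 1)) = s powr (- a - 1)" by simp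
      ultimately show ?thesis using s by (simp add: yint_def field_simps)
    qed
    ultimately show "(?F has_vector_derivative ?f s) (at s)"
      by (simp add: has_real_derivative_iff_has_vector_derivative)
    have "isCont (yint b l \<rho>) s" for b
    proof -
      have "isCont (\<lambda>s. s powr (- b) * exp (- l * s - \<rho> / (4 * s))) s"
        using s by (intro continuous_intros) auto
      moreover have "\<forall>\<^sub>F r in nhds s. yint b l \<rho> r = r powr (- b) * exp (- l * r - \<rho> / (4 * r))"
        using eventually_nhds_in_open[of "{0<..}" s] s
        by (auto elim!: eventually_mono simp: yint_def)
      ultimately show ?thesis by (simp add: isCont_cong)
    qed
    then show "isCont ?f s" by (intro continuous_intros)
  next
    have "einterval 0 \<infinity> = {0<..}" by (auto simp: einterval_def)
    then show "set_integrable lborel (einterval 0 \<infinity>) ?f"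
      unfolding set_integrable_def
      by (intro Bochner_Integration.integrable_bound[OF int]) (auto simp: indicator_def)
  next
    obtain C where C: "C > 0" "\<And>s l. yint (a + 1) l \<rho> s \<le> C * (indicator {0<..} s * exp (- l * s))"
      using yint_bound[of \<rho> "a + 1"] assms by auto
    \<comment> \<open>Writing \<open>?F s\<close> as \<open>s * yint (a + 1) l \<rho> s\<close>
      gains the factor \<open>s\<close> that forces the limit zero at the origin.\<close>
    have bound: "\<bar>?F s\<bar> \<le> C * s * exp (- l * s)" if "s > 0" for s
    proof -
      have "?F s = s * yint (a + 1) l \<rho> s"
        using that by (simp add: yint_def powr_diff)
      then show ?thesis using C(2)[of l s] that by (simp add: abs_mult yint_nonneg)
    qed
    have "((\<lambda>s. C * s * exp (- l * s)) \<longlongrightarrow> C * 0 * exp (- l * 0)) (at_right 0)"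
      by (intro tendsto_intros)
    then have "((\<lambda>s. C * s * exp (- l * s)) \<longlongrightarrow> 0) (at_right 0)" by simp
    then have F0: "(?F \<longlongrightarrow> 0) (at_right 0)"
      by (rule Lim_null_comparison[rotated])
         (auto intro!: eventually_at_rightI[of 0 1] simp: bound[simplified])
    then show "((?F \<circ> real_of_ereal) \<longlongrightarrow> 0) (at_right 0)"
      by (simp add: zero_ereal_def ereal_tendsto_simps1)
    have "((\<lambda>s. C * s * exp (- l * s)) \<longlongrightarrow> 0) at_top"
    proof -
      have "((\<lambda>s. C / l * ((l * s) ^ 1 / exp (l * s))) \<longlongrightarrow> C / l * 0) at_top"
        using assms
        by (intro tendsto_mult tendsto_const filterlim_compose[OF tendsto_power_div_exp_0]
            filterlim_tendsto_pos_mult_at_top[OF tendsto_const] filterlim_ident)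
      then show ?thesis using assms by (simp add: exp_minus field_simps)
    qed
    then have "(?F \<longlongrightarrow> 0) at_top"
      by (rule Lim_null_comparison[rotated])
         (use bound in \<open>auto intro!: eventually_mono[OF eventually_gt_at_top[of 0]]\<close>)
    then show "((?F \<circ> real_of_ereal) \<longlongrightarrow> 0) (at_left \<infinity>)"
      by (simp add: ereal_tendsto_simps1)
  qed auto
  moreover have "(LBINT s=0..\<infinity>. ?f s) = (\<integral>s. ?f s \<partial>lborel)"
  proof -
    have e: "einterval 0 \<infinity> = {0<..}" by (auto simp: einterval_def)
    have "(LBINT s=0..\<infinity>. ?f s) = set_lebesgue_integral lborel {0<..} ?f"
      by (simp add: interval_lebesgue_integral_def e)
    also have "\<dots> = (\<integral>s. ?f s \<partial>lborel)"
      unfolding set_lebesgue_integral_def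
      by (intro Bochner_Integration.integral_cong refl) (simp add: yint_def indicator_def)
    finally show ?thesis .
  qed
  ultimately show ?thesis using val by simp
qed

section \<open>Power series of the kernel along a line\<close>

text \<open>Bounded absolute partial sums make the double series absolutely summable, so it may be
  summed by the weight \<open>a + 2 * b\<close>. The bound on the terms of a single weight serves
  later as a Cauchy estimate.\<close>

lemma sums_regroup_even:
  fixes G :: "nat \<Rightarrow> nat \<Rightarrow> real"
  assumes bd: "\<And>N. (\<Sum>b<N. \<Sum>a<N. \<bar>G b a\<bar>) \<le> C"
    and inner: "\<And>b. (\<lambda>a. G b a) sums g b" and outer: "g sums S"
  shows "(\<lambda>j. \<Sum>b\<le>j div 2. G b (j - 2 * b)) sums S"
    and "(\<Sum>b\<le>j div 2. \<bar>G b (j - 2 * b)\<bar>) \<le> C"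
proof -
  have bdP: "(\<Sum>p\<in>P. \<bar>case_prod G p\<bar>) \<le> C" if "finite P" for P
  proof -
    have "finite (fst ` P \<union> snd ` P)" using that by simp
    then obtain N where "\<forall>k\<in>fst ` P \<union> snd ` P. k < N"
      unfolding finite_nat_set_iff_bounded by blast
    then have N: "P \<subseteq> {..<N} \<times> {..<N}" by force
    have "(\<Sum>p\<in>P. \<bar>case_prod G p\<bar>) \<le> (\<Sum>p\<in>{..<N} \<times> {..<N}. \<bar>case_prod G p\<bar>)"
      by (rule sum_mono2) (use N in auto)
    also have "\<dots> = (\<Sum>b<N. \<Sum>a<N. \<bar>G b a\<bar>)" by (simp add: sum.cartesian_product split_def)
    finally show ?thesis using bd[of N] by simp
  qed
  have "(\<lambda>p. norm (case_prod G p)) summable_on UNIV"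
    by (rule nonneg_bounded_partial_sums_imp_summable_on[of _ _ C])
       (auto intro!: eventually_finite_subsets_at_top_weakI bdP)
  then have "case_prod G summable_on UNIV" by (rule abs_summable_summable)
  then obtain S' where S': "(case_prod G has_sum S') (UNIV \<times> UNIV)"
    by (auto simp: summable_on_def)
  have row: "summable (\<lambda>a. \<bar>G b a\<bar>)" for b
  proof (rule summableI_nonneg_bounded)
    show "(\<Sum>a<n. \<bar>G b a\<bar>) \<le> C" for n
      using bdP[of "Pair b ` {..<n}"] by (simp add: sum.reindex inj_on_def)
  qed auto
  have "(g has_sum S') UNIV"
    by (rule has_sum_SigmaD[OF S'])
       (use row in \<open>auto intro!: norm_summable_imp_has_sum inner\<close>)
  then have "S' = S" using has_sum_imp_sums outer sums_unique2 by blast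
  \<comment> \<open>Pairs \<open>(b, a)\<close> are enumerated by their weight
    \<open>j = a + 2 * b\<close> and by \<open>b\<close>.\<close>
  have bij: "bij_betw (\<lambda>(j::nat, b). (b, j - 2 * b)) (SIGMA j:UNIV. {..j div 2}) (UNIV \<times> UNIV)"
  proof (rule bij_betw_byWitness[where f' = "\<lambda>(b, a). (a + 2 * b, b)"])
  qed (auto simp: image_subset_iff)
  have "((\<lambda>p. case_prod G (case p of (j, b) \<Rightarrow> (b, j - 2 * b))) has_sum S) (SIGMA j:UNIV. {..j div 2})"
    using S' unfolding has_sum_reindex_bij_betw[OF bij] \<open>S' = S\<close> .
  then have "((\<lambda>j. \<Sum>b\<le>j div 2. G b (j - 2 * b)) has_sum S) UNIV"
    by (rule has_sum_SigmaD) (auto intro!: has_sum_finiteI)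
  then show "(\<lambda>j. \<Sum>b\<le>j div 2. G b (j - 2 * b)) sums S" by (rule has_sum_imp_sums)
  have "(\<Sum>b\<le>j div 2. \<bar>G b (j - 2 * b)\<bar>) = (\<Sum>p\<in>(\<lambda>b. (b, j - 2 * b)) ` {..j div 2}. \<bar>case_prod G p\<bar>)"
    by (subst sum.reindex) (auto simp: inj_on_def)
  also have "\<dots> \<le> C" by (rule bdP) simp
  finally show "(\<Sum>b\<le>j div 2. \<bar>G b (j - 2 * b)\<bar>) \<le> C" .
qed

text \<open>\<open>ydiff a l i\<close> is the \<open>i\<close>-th derivative of \<open>yuk a l\<close>.\<close>

definition ydiff :: "real \<Rightarrow> real \<Rightarrow> nat \<Rightarrow> real \<Rightarrow> real" where
  "ydiff a l i \<rho> = (- 1 / 4) ^ i * yuk (a + real i) l \<rho>"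

lemma ydiff_0 [simp]: "ydiff a l 0 = yuk a l"
  by (simp add: ydiff_def fun_eq_iff)

lemma ydiff_taylor:
  assumes "\<bar>\<delta>\<bar> < \<rho>" "a \<ge> 0" "l > 0"
  shows "(\<lambda>m. ydiff a l (i + m) \<rho> * \<delta> ^ m / fact m) sums ydiff a l i (\<rho> + \<delta>)"
proof -
  have "ydiff a l (i + m) \<rho> * \<delta> ^ m / fact m
      = (- 1 / 4) ^ i * (yuk (a + real i + real m) l \<rho> * (- \<delta> / 4) ^ m / fact m)" for m
  proof -
    have "(- \<delta> / 4) ^ m = (- 1 / 4) ^ m * \<delta> ^ m" by (simp flip: power_mult_distrib)
    then show ?thesis by (simp add: ydiff_def power_add algebra_simps)
  qed
  then show ?thesis
    using sums_mult[OF yuk_taylor(1)[OF assms(1), of "a + real i" l], of "(- 1 / 4) ^ i"] assms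
    by (simp add: ydiff_def)
qed

text \<open>The derivative of order \<open>i\<close> has the sign \<open>(- 1) ^ i\<close>, so the
  series of absolute values is, up to this sign, the Taylor series at \<open>- x\<close>.\<close>

lemma abs_ydiff_taylor:
  assumes "0 \<le> x" "x < \<rho>" "a \<ge> 0" "l > 0"
  shows "(\<lambda>m. \<bar>ydiff a l (i + m) \<rho>\<bar> * x ^ m / fact m) sums \<bar>ydiff a l i (\<rho> - x)\<bar>"
proof -
  have abs_y: "\<bar>ydiff a l i r\<bar> = (- 1) ^ i * ydiff a l i r" for i r
  proof -
    have "\<bar>ydiff a l i r\<bar> = (1 / 4) ^ i * yuk (a + real i) l r"
      by (simp add: ydiff_def abs_mult power_abs yuk_nonneg)
    also have "(1 / 4 :: real) ^ i = (- 1) ^ i * (- 1 / 4) ^ i" by (simp flip: power_mult_distrib)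
    finally show ?thesis by (simp add: ydiff_def)
  qed
  have "\<bar>ydiff a l (i + m) \<rho>\<bar> * x ^ m / fact m
      = (- 1) ^ i * (ydiff a l (i + m) \<rho> * (- x) ^ m / fact m)" for m
  proof -
    have "(- x) ^ m = (- 1) ^ m * x ^ m" by (simp flip: power_mult_distrib)
    then show ?thesis by (simp add: abs_y power_add)
  qed
  moreover have "(\<lambda>m. (- 1) ^ i * (ydiff a l (i + m) \<rho> * (- x) ^ m / fact m)) sums
      ((- 1) ^ i * ydiff a l i (\<rho> - x))"
    using sums_mult[OF ydiff_taylor[of "- x" \<rho> a l i], of "(- 1) ^ i"] assms by simp
  ultimately show ?thesis by (simp only: abs_y[of i "\<rho> - x"])
qed

text \<open>The coefficient of \<open>\<theta>\<^sup>j\<close> in \<open>yuk a l (\<rho> - 2 \<theta> B + \<theta>\<^sup>2 q)\<close>.\<close>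

definition tcoef :: "real \<Rightarrow> real \<Rightarrow> real \<Rightarrow> real \<Rightarrow> real \<Rightarrow> nat \<Rightarrow> real" where
  "tcoef a l \<rho> B q j = (\<Sum>b\<le>j div 2. ydiff a l (j - b) \<rho> * ((- 2 * B) ^ (j - 2 * b) * q ^ b / (fact (j - 2 * b) * fact b)))"

text \<open>The increment is made in two steps, first by the linear and then by the quadratic term
  in \<theta>, and the double series is regrouped by powers of \<theta>. Its absolute values are
  dominated by \<open>yuk\<close> at \<open>\<rho> - \<bar>\<alpha>\<bar> - \<gamma>\<close>, which
  therefore bounds every single power.\<close>

lemma tcoef_sums:
  assumes "a \<ge> 0" "l > 0" "q \<ge> 0" and X: "2 * \<bar>\<theta>\<bar> * \<bar>B\<bar> + \<theta>\<^sup>2 * q < \<rho>"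
  shows "(\<lambda>j. tcoef a l \<rho> B q j * \<theta> ^ j) sums yuk a l (\<rho> - 2 * \<theta> * B + \<theta>\<^sup>2 * q)"
    and "\<bar>tcoef a l \<rho> B q j\<bar> * \<bar>\<theta>\<bar> ^ j \<le> yuk a l (\<rho> - (2 * \<bar>\<theta>\<bar> * \<bar>B\<bar> + \<theta>\<^sup>2 * q))"
proof -
  define \<alpha> where "\<alpha> = - 2 * B * \<theta>"
  define \<gamma> where "\<gamma> = \<theta>\<^sup>2 * q"
  have \<gamma>: "\<gamma> \<ge> 0" using assms by (simp add: \<gamma>_def)
  have abs_\<alpha>: "\<bar>\<alpha>\<bar> = 2 * \<bar>\<theta>\<bar> * \<bar>B\<bar>" by (simp add: \<alpha>_def abs_mult)
  have X': "\<bar>\<alpha>\<bar> + \<gamma> < \<rho>" using X by (simp add: abs_\<alpha> \<gamma>_def)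
  define G where "G b k = ydiff a l (b + k) \<rho> * \<alpha> ^ k / fact k * (\<gamma> ^ b / fact b)" for b k
  have Gterm: "G b (j - 2 * b) = ydiff a l (j - b) \<rho> * ((- 2 * B) ^ (j - 2 * b) * q ^ b / (fact (j - 2 * b) * fact b)) * \<theta> ^ j"
    if "b \<le> j div 2" for j b
  proof -
    have 1: "b + (j - 2 * b) = j - b" using that by auto
    have "\<theta> ^ (j - 2 * b) * (\<theta>\<^sup>2) ^ b = \<theta> ^ (j - 2 * b + 2 * b)" by (simp only: power_add power_mult)
    also have "j - 2 * b + 2 * b = j" using that by auto
    finally have 2: "\<theta> ^ j = \<theta> ^ (j - 2 * b) * (\<theta>\<^sup>2) ^ b" ..
    show ?thesis
      unfolding G_def 1 2 \<alpha>_def \<gamma>_def power_mult_distrib by simp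
  qed
  have bd: "(\<Sum>b<N. \<Sum>k<N. \<bar>G b k\<bar>) \<le> yuk a l (\<rho> - (\<bar>\<alpha>\<bar> + \<gamma>))" for N
  proof -
    have "(\<Sum>k<N. \<bar>G b k\<bar>) \<le> \<bar>ydiff a l (0 + b) (\<rho> - \<bar>\<alpha>\<bar>)\<bar> * \<gamma> ^ b / fact b" for b
    proof -
      have "(\<Sum>k<N. \<bar>G b k\<bar>) = (\<Sum>k<N. \<bar>ydiff a l (b + k) \<rho>\<bar> * \<bar>\<alpha>\<bar> ^ k / fact k) * (\<gamma> ^ b / fact b)"
        unfolding sum_distrib_right
        by (intro sum.cong refl) (use \<gamma> in \<open>simp add: G_def abs_mult power_abs\<close>)
      moreover have "(\<Sum>k<N. \<bar>ydiff a l (b + k) \<rho>\<bar> * \<bar>\<alpha>\<bar> ^ k / fact k) \<le> \<bar>ydiff a l b (\<rho> - \<bar>\<alpha>\<bar>)\<bar>"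
        using abs_ydiff_taylor[of "\<bar>\<alpha>\<bar>" \<rho> a l b] assms X' \<gamma>
          sum_le_suminf[of "\<lambda>k. \<bar>ydiff a l (b + k) \<rho>\<bar> * \<bar>\<alpha>\<bar> ^ k / fact k" "{..<N}"]
        by (simp add: sums_iff)
      ultimately show ?thesis
        using \<gamma> mult_right_mono[of _ _ "\<gamma> ^ b / fact b"] by simp
    qed
    then have "(\<Sum>b<N. \<Sum>k<N. \<bar>G b k\<bar>) \<le> (\<Sum>b<N. \<bar>ydiff a l (0 + b) (\<rho> - \<bar>\<alpha>\<bar>)\<bar> * \<gamma> ^ b / fact b)"
      by (rule sum_mono)
    also have "\<dots> \<le> \<bar>ydiff a l 0 (\<rho> - \<bar>\<alpha>\<bar> - \<gamma>)\<bar>"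
      using abs_ydiff_taylor[of \<gamma> "\<rho> - \<bar>\<alpha>\<bar>" a l 0] assms X' \<gamma>
        sum_le_suminf[of "\<lambda>b. \<bar>ydiff a l (0 + b) (\<rho> - \<bar>\<alpha>\<bar>)\<bar> * \<gamma> ^ b / fact b" "{..<N}"]
      by (simp add: sums_iff)
    finally show ?thesis by (simp add: yuk_nonneg diff_diff_eq)
  qed
  have inner: "(\<lambda>k. G b k) sums (ydiff a l (0 + b) (\<rho> + \<alpha>) * (\<gamma> ^ b / fact b))" for b
    unfolding G_def by (intro sums_mult2) (use ydiff_taylor[of \<alpha> \<rho> a l b] assms X' \<gamma> in simp)
  have outer: "(\<lambda>b. ydiff a l (0 + b) (\<rho> + \<alpha>) * (\<gamma> ^ b / fact b)) sums yuk a l (\<rho> + \<alpha> + \<gamma>)"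
    using ydiff_taylor[of \<gamma> "\<rho> + \<alpha>" a l 0] assms X' \<gamma> by simp
  have regrouped: "(\<Sum>b\<le>j div 2. G b (j - 2 * b)) = tcoef a l \<rho> B q j * \<theta> ^ j" for j
    unfolding tcoef_def sum_distrib_right by (intro sum.cong refl Gterm) simp
  show "(\<lambda>j. tcoef a l \<rho> B q j * \<theta> ^ j) sums yuk a l (\<rho> - 2 * \<theta> * B + \<theta>\<^sup>2 * q)"
    using sums_regroup_even(1)[OF bd inner outer, unfolded regrouped] by (simp add: \<alpha>_def \<gamma>_def mult_ac)
  have "\<bar>tcoef a l \<rho> B q j\<bar> * \<bar>\<theta>\<bar> ^ j = \<bar>\<Sum>b\<le>j div 2. G b (j - 2 * b)\<bar>"
    by (simp add: regrouped abs_mult power_abs)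
  also have "\<dots> \<le> (\<Sum>b\<le>j div 2. \<bar>G b (j - 2 * b)\<bar>)" by (rule sum_abs)
  also have "\<dots> \<le> yuk a l (\<rho> - (2 * \<bar>\<theta>\<bar> * \<bar>B\<bar> + \<theta>\<^sup>2 * q))"
    using sums_regroup_even(2)[OF bd inner outer] by (simp add: abs_\<alpha> \<gamma>_def)
  finally show "\<bar>tcoef a l \<rho> B q j\<bar> * \<bar>\<theta>\<bar> ^ j \<le> yuk a l (\<rho> - (2 * \<bar>\<theta>\<bar> * \<bar>B\<bar> + \<theta>\<^sup>2 * q))" .
qed

text \<open>The members of a closed subspace: if an analytic curve starts in it, so do its Taylor coefficients,
  hence the whole curve.\<close>

lemma approx_on_power_series:
  fixes F :: "real \<Rightarrow> 'a \<Rightarrow> real"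
  assumes bound: "\<And>j x. x \<in> K \<Longrightarrow> \<bar>P j x\<bar> \<le> D * (1 / 2) ^ j"
    and sums: "\<And>s x. x \<in> K \<Longrightarrow> 0 \<le> s \<Longrightarrow> s \<le> 1 \<Longrightarrow> (\<lambda>j. P j x * s ^ j) sums F s x"
    and "\<delta> > 0" and small: "\<And>s. 0 < s \<Longrightarrow> s < \<delta> \<Longrightarrow> approx_on K v (F s)"
  shows "approx_on K v (F 1)"
proof (cases "K = {}")
  case True
  then show ?thesis by (auto simp: approx_on_def)
next
  case False
  then have D: "D \<ge> 0" using bound[of _ 0] by fastforce
  have tail: "\<bar>F s x - (\<Sum>i<N. P i x * s ^ i)\<bar> \<le> s ^ N * (D * (1 / 2) ^ N * 2)"
    if "x \<in> K" "0 \<le> s" "s \<le> 1" for s x N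
  proof -
    have sm: "summable (\<lambda>j. P j x * s ^ j)" and F: "F s x = (\<Sum>j. P j x * s ^ j)"
      using sums[OF that] by (auto simp: sums_iff)
    have geo: "(\<lambda>i. s ^ N * (D * (1 / 2) ^ N * (1 / 2) ^ i)) sums (s ^ N * (D * (1 / 2) ^ N * 2))"
      using geometric_sums[of "1 / 2 :: real"] by (intro sums_mult) simp
    have le: "\<bar>P (i + N) x * s ^ (i + N)\<bar> \<le> s ^ N * (D * (1 / 2) ^ N * (1 / 2) ^ i)" for i
    proof -
      have "\<bar>P (i + N) x * s ^ (i + N)\<bar> = \<bar>P (i + N) x\<bar> * s ^ i * s ^ N"
        using that by (simp add: abs_mult power_add)
      also have "\<dots> \<le> D * (1 / 2) ^ (i + N) * 1 * s ^ N"
        using bound[OF that(1)] that by (intro mult_right_mono mult_mono power_le_one) (auto simp: D)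
      finally show ?thesis by (simp add: power_add mult_ac)
    qed
    have "F s x - (\<Sum>i<N. P i x * s ^ i) = (\<Sum>i. P (i + N) x * s ^ (i + N))"
      unfolding F using suminf_minus_initial_segment[OF sm, of N] by simp
    also have "\<bar>\<dots>\<bar> \<le> (\<Sum>i. s ^ N * (D * (1 / 2) ^ N * (1 / 2) ^ i))"
    proof -
      have sm': "summable (\<lambda>i. \<bar>P (i + N) x * s ^ (i + N)\<bar>)"
        by (rule summable_comparison_test'[OF sums_summable[OF geo], of 0]) (use le in simp)
      have "\<bar>\<Sum>i. P (i + N) x * s ^ (i + N)\<bar> \<le> (\<Sum>i. \<bar>P (i + N) x * s ^ (i + N)\<bar>)"
        using sm' by (rule summable_rabs)
      also have "\<dots> \<le> (\<Sum>i. s ^ N * (D * (1 / 2) ^ N * (1 / 2) ^ i))"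
        using le sm' geo by (intro suminf_le) (auto simp: sums_iff)
      finally show ?thesis .
    qed
    also have "\<dots> = s ^ N * (D * (1 / 2) ^ N * 2)" using geo by (simp add: sums_iff)
    finally show ?thesis .
  qed
  have coeff: "approx_on K v (P j)" for j
  proof (induction j rule: less_induct)
    case (less j)
    show ?case
    proof (rule approx_on_limit)
      fix \<epsilon> :: real assume "\<epsilon> > 0"
      \<comment> \<open>Below \<delta> so that \<open>F s\<close> is in the closure, and so small
        that the error \<open>s * D\<close> of the next coefficient is at most \<epsilon>.\<close>
      define s where "s = min (min (\<delta> / 2) 1) (\<epsilon> / (D + 1))"
      have s: "0 < s" "s < \<delta>" "s \<le> 1" "s * (D + 1) \<le> \<epsilon>"
      proof -
        have "s \<le> \<epsilon> / (D + 1)" by (simp add: s_def)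
        then show "s * (D + 1) \<le> \<epsilon>" using D by (simp add: field_simps)
        have "s \<le> \<delta> / 2" unfolding s_def by (meson min.cobounded1 order_trans)
        then show "s < \<delta>" using \<open>\<delta> > 0\<close> by simp
      qed (use \<open>\<delta> > 0\<close> \<open>\<epsilon> > 0\<close> D in \<open>auto simp: s_def\<close>)
      \<comment> \<open>The terms below \<open>j\<close> are in the closure by induction; removing
        them and dividing by \<open>s ^ j\<close> isolates \<open>P j\<close> up to terms of order
        \<open>s\<close>.\<close>
      define g where "g x = (1 / s ^ j) * (F s x - (\<Sum>i<j. s ^ i * P i x))" for x
      have "approx_on K v g"
        unfolding g_def
        by (intro approx_on_cmult approx_on_diff approx_on_sum small s less) auto
      moreover have "\<bar>P j x - g x\<bar> \<le> \<epsilon>" if "x \<in> K" for x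
      proof -
        have "\<bar>F s x - (\<Sum>i<Suc j. P i x * s ^ i)\<bar> \<le> s ^ Suc j * (D * (1 / 2) ^ Suc j * 2)"
          using tail[OF that, of s "Suc j"] s by simp
        also have "\<dots> \<le> s ^ Suc j * D"
          using s D by (intro mult_left_mono) (auto simp: mult_left_le power_le_one)
        also have "\<dots> \<le> s ^ j * \<epsilon>"
        proof -
          have "s * D \<le> \<epsilon>" using s D by (simp add: algebra_simps)
          then show ?thesis using s by (simp add: mult_left_mono mult.assoc)
        qed
        finally have "\<bar>F s x - (\<Sum>i<Suc j. P i x * s ^ i)\<bar> \<le> s ^ j * \<epsilon>" .
        moreover have "P j x - g x = - (F s x - (\<Sum>i<Suc j. P i x * s ^ i)) / s ^ j"
          using s by (simp add: g_def field_simps)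
        moreover have "\<bar>- X / s ^ j\<bar> = \<bar>X\<bar> / s ^ j" for X using s by (simp add: abs_divide)
        ultimately show ?thesis using s by (simp add: pos_divide_le_eq mult.commute)
      qed
      ultimately show "\<exists>g. approx_on K v g \<and> (\<forall>x\<in>K. \<bar>P j x - g x\<bar> \<le> \<epsilon>)" by blast
    qed
  qed
  show ?thesis
  proof (rule approx_on_limit)
    fix \<epsilon> :: real assume "\<epsilon> > 0"
    have "(\<lambda>N. D * (1 / 2) ^ N * 2) \<longlonglongrightarrow> D * 0 * 2"
      by (intro tendsto_intros LIMSEQ_power_zero) simp
    then have "\<forall>\<^sub>F N in sequentially. D * (1 / 2) ^ N * 2 < \<epsilon>"
      using \<open>\<epsilon> > 0\<close> by (intro order_tendstoD(2)) auto
    then obtain N where N: "D * (1 / 2) ^ N * 2 < \<epsilon>"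
      unfolding eventually_sequentially by blast
    have "approx_on K v (\<lambda>x. \<Sum>i<N. P i x)" by (intro approx_on_sum coeff) auto
    moreover have "\<bar>F 1 x - (\<Sum>i<N. P i x)\<bar> \<le> \<epsilon>" if "x \<in> K" for x
      using tail[OF that, of 1 N] N by simp
    ultimately show "\<exists>g. approx_on K v g \<and> (\<forall>x\<in>K. \<bar>F 1 x - g x\<bar> \<le> \<epsilon>)" by blast
  qed
qed

section \<open>Approximation of the kernel by parabolic polynomials\<close>

context elliptic_frame
begin

lemma \<beta>_bounded_linear: "bounded_linear \<beta>"
  using linear_\<beta> by (simp add: linear_conv_bounded_linear)

lemma \<beta>_add: "\<beta> (x + y) = \<beta> x + \<beta> y" and \<beta>_scaleR: "\<beta> (r *\<^sub>R x) = r *\<^sub>R \<beta> x"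
  and \<beta>_diff: "\<beta> (x - y) = \<beta> x - \<beta> y"
  using linear_\<beta> by (simp_all add: linear_add linear_scale linear_diff)

lemma \<beta>_lower: obtains m where "m > 0" "\<And>x. m * norm x \<le> norm (\<beta> x)"
proof -
  have "inj \<beta>"
    unfolding linear_injective_0[OF linear_\<beta>]
  proof (intro allI impI)
    fix x assume "\<beta> x = 0"
    then show "x = 0" using \<beta>_expand[of x] by simp
  qed
  then show ?thesis
    using linear_inj_bounded_below_pos[OF linear_\<beta>] that by (metis mult.commute)
qed

lemma \<beta>_upper: obtains M where "M > 0" "\<And>x. norm (\<beta> x) \<le> M * norm x"
  using bounded_linear.pos_bounded[OF \<beta>_bounded_linear] by (metis mult.commute)

lemma \<beta>_eq_0_iff: "\<beta> x = 0 \<longleftrightarrow> x = 0"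
proof -
  obtain m where "m > 0" "\<And>x. m * norm x \<le> norm (\<beta> x)" by (rule \<beta>_lower) blast
  then show ?thesis using linear_0[OF linear_\<beta>] by (metis mult_le_0_iff norm_le_zero_iff norm_zero not_le)
qed

definition yukawa :: "real \<Rightarrow> real^'n \<Rightarrow> real" where
  "yukawa l z = yuk (real CARD('n) / 2) l ((norm (\<beta> z))\<^sup>2)"

lemma norm_sq_expand:
  fixes u w :: "real^'n"
  shows "(norm (u - s *\<^sub>R w))\<^sup>2 = (norm u)\<^sup>2 - 2 * s * (u \<bullet> w) + s\<^sup>2 * (norm w)\<^sup>2"
  unfolding power2_norm_eq_inner
  by (simp add: inner_diff_left inner_diff_right inner_commute power2_eq_square algebra_simps)

text \<open>The smallness assumption leaves room for \<open>\<bar>s\<bar> \<le> 2\<close>.\<close>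

lemma yukawa_taylor:
  assumes "l > 0" "z \<noteq> 0" and h: "16 * norm (\<beta> h) \<le> norm (\<beta> z)"
  defines "P \<equiv> \<lambda>j. tcoef (real CARD('n) / 2) l ((norm (\<beta> z))\<^sup>2) (\<beta> z \<bullet> \<beta> h) ((norm (\<beta> h))\<^sup>2) j"
  shows "\<bar>s\<bar> \<le> 1 \<Longrightarrow> (\<lambda>j. P j * s ^ j) sums yukawa l (z - s *\<^sub>R h)"
    and "\<bar>P j\<bar> \<le> yuk (real CARD('n) / 2) l ((norm (\<beta> z))\<^sup>2 / 2) * (1 / 2) ^ j"
proof -
  let ?r = "norm (\<beta> z)" and ?q = "norm (\<beta> h)"
  have r: "?r > 0" using \<open>z \<noteq> 0\<close> by (simp add: \<beta>_eq_0_iff)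
  have B: "\<bar>\<beta> z \<bullet> \<beta> h\<bar> \<le> ?r * (?r / 16)"
  proof -
    have "?r * ?q \<le> ?r * (?r / 16)" using h r by (intro mult_left_mono) auto
    then show ?thesis using Cauchy_Schwarz_ineq2[of "\<beta> z" "\<beta> h"] by linarith
  qed
  have q: "?q\<^sup>2 \<le> ?r\<^sup>2 / 256"
  proof -
    have "?q\<^sup>2 \<le> (?r / 16)\<^sup>2" using h by (intro power_mono) auto
    then show ?thesis by (simp add: power_divide)
  qed
  \<comment> \<open>For \<bar>s\<bar> up to two, the factor sixteen leaves at most
    \<open>1/4 + 1/64\<close> of \<open>?r\<^sup>2\<close>.\<close>
  have X: "2 * \<bar>s\<bar> * \<bar>\<beta> z \<bullet> \<beta> h\<bar> + s\<^sup>2 * ?q\<^sup>2 \<le> ?r\<^sup>2 / 2" if "\<bar>s\<bar> \<le> 2" for s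
  proof -
    have "2 * \<bar>s\<bar> * \<bar>\<beta> z \<bullet> \<beta> h\<bar> \<le> 4 * (?r * (?r / 16))"
      using B that by (intro mult_mono) auto
    moreover have "s\<^sup>2 * ?q\<^sup>2 \<le> 4 * (?r\<^sup>2 / 256)"
      using q that abs_le_square_iff[of s 2] by (intro mult_mono) auto
    moreover have "?r * (?r / 16) = ?r\<^sup>2 / 16" by (simp add: power2_eq_square)
    moreover have "?r\<^sup>2 \<ge> 0" by simp
    ultimately show ?thesis by linarith
  qed
  have r2: "?r\<^sup>2 > 0" using r by simp
  show "(\<lambda>j. P j * s ^ j) sums yukawa l (z - s *\<^sub>R h)" if "\<bar>s\<bar> \<le> 1"
  proof -
    have "2 * \<bar>s\<bar> * \<bar>\<beta> z \<bullet> \<beta> h\<bar> + s\<^sup>2 * ?q\<^sup>2 < ?r\<^sup>2" using X[of s] r2 that by linarith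
    then show ?thesis
      using tcoef_sums(1)[of "real CARD('n) / 2" l "?q\<^sup>2" s "\<beta> z \<bullet> \<beta> h" "?r\<^sup>2"] assms
      by (simp add: yukawa_def \<beta>_diff \<beta>_scaleR norm_sq_expand)
  qed
  have X2: "2 * \<bar>2\<bar> * \<bar>\<beta> z \<bullet> \<beta> h\<bar> + 2\<^sup>2 * ?q\<^sup>2 < ?r\<^sup>2"
  proof -
    have "2 * \<bar>2\<bar> * \<bar>\<beta> z \<bullet> \<beta> h\<bar> + 2\<^sup>2 * ?q\<^sup>2 \<le> ?r\<^sup>2 / 2" by (rule X) simp
    then show ?thesis using r2 by linarith
  qed
  \<comment> \<open>The coefficient bound at \<theta> = 2 yields the geometric factor.\<close>
  have "\<bar>P j\<bar> * \<bar>2\<bar> ^ j \<le> yuk (real CARD('n) / 2) l (?r\<^sup>2 - (2 * \<bar>2\<bar> * \<bar>\<beta> z \<bullet> \<beta> h\<bar> + 2\<^sup>2 * ?q\<^sup>2))"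
    unfolding P_def using X2 assms by (intro tcoef_sums(2)) auto
  also have "\<dots> \<le> yuk (real CARD('n) / 2) l (?r\<^sup>2 / 2)"
    using X[of 2] r2 assms by (intro yuk_antimono) auto
  finally show "\<bar>P j\<bar> \<le> yuk (real CARD('n) / 2) l (?r\<^sup>2 / 2) * (1 / 2) ^ j"
    by (simp add: power_divide field_simps)
qed

text \<open>As a function of \<open>s\<close> the kernel with pole \<open>y + s *\<^sub>R h\<close>
  is a power series that converges uniformly over \<open>S\<close> up to \<open>s = 1\<close>, so
  approximability for small \<open>s\<close> carries over to the end point. The bound on
  \<open>I\<close> makes the coefficients uniform in time.\<close>

lemma yukawa_step:
  assumes "l > 0" "d > 0" "\<delta> > 0"
    and far: "\<And>x. x \<in> S \<Longrightarrow> d \<le> norm (\<beta> (x - y))" and h: "16 * norm (\<beta> h) \<le> d"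
    and small: "\<And>s. 0 < s \<Longrightarrow> s < \<delta> \<Longrightarrow> approx_on (S \<times> I) v (\<lambda>(x, t). exp (l * t) * yukawa l (x - (y + s *\<^sub>R h)))"
    and I: "I \<subseteq> {0..T}"
  shows "approx_on (S \<times> I) v (\<lambda>(x, t). exp (l * t) * yukawa l (x - (y + h)))"
proof -
  let ?P = "\<lambda>x j. tcoef (real CARD('n) / 2) l ((norm (\<beta> (x - y)))\<^sup>2) (\<beta> (x - y) \<bullet> \<beta> h) ((norm (\<beta> h))\<^sup>2) j"
  let ?F = "\<lambda>s (x, t). exp (l * t) * yukawa l (x - (y + s *\<^sub>R h))"
  have ne: "x - y \<noteq> 0" if "x \<in> S" for x
    using far[OF that] \<open>d > 0\<close> by (auto simp: linear_0[OF linear_\<beta>])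
  have h': "16 * norm (\<beta> h) \<le> norm (\<beta> (x - y))" if "x \<in> S" for x
    using far[OF that] h by linarith
  have "approx_on (S \<times> I) v (?F 1)"
  proof (rule approx_on_power_series[where F = ?F and \<delta> = \<delta> and P = "\<lambda>j (x, t). exp (l * t) * ?P x j"
        and D = "exp (l * T) * yuk (real CARD('n) / 2) l (d\<^sup>2 / 2)"])
    fix j z assume "z \<in> S \<times> I"
    then obtain x t where z: "z = (x, t)" "x \<in> S" "t \<in> I" by auto
    have "\<bar>?P x j\<bar> \<le> yuk (real CARD('n) / 2) l ((norm (\<beta> (x - y)))\<^sup>2 / 2) * (1 / 2) ^ j"
      by (rule yukawa_taylor(2)) (use assms z ne h' in auto)
    also have "\<dots> \<le> yuk (real CARD('n) / 2) l (d\<^sup>2 / 2) * (1 / 2) ^ j"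
      using far[OF z(2)] assms by (intro mult_right_mono yuk_antimono) (auto intro!: power_mono divide_right_mono)
    finally have "\<bar>?P x j\<bar> \<le> yuk (real CARD('n) / 2) l (d\<^sup>2 / 2) * (1 / 2) ^ j" .
    moreover have "exp (l * t) \<le> exp (l * T)" using z I \<open>l > 0\<close> by auto
    ultimately have "exp (l * t) * \<bar>?P x j\<bar> \<le> exp (l * T) * (yuk (real CARD('n) / 2) l (d\<^sup>2 / 2) * (1 / 2) ^ j)"
      by (intro mult_mono) auto
    then show "\<bar>case z of (x, t) \<Rightarrow> exp (l * t) * ?P x j\<bar> \<le> exp (l * T) * yuk (real CARD('n) / 2) l (d\<^sup>2 / 2) * (1 / 2) ^ j"
      by (simp add: z abs_mult mult.assoc)
  next
    fix s z assume "z \<in> S \<times> I" and s: "0 \<le> s" "s \<le> (1::real)"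
    then obtain x t where z: "z = (x, t)" "x \<in> S" "t \<in> I" by auto
    have "(\<lambda>j. ?P x j * s ^ j) sums yukawa l (x - y - s *\<^sub>R h)"
      by (rule yukawa_taylor(1)) (use assms z ne h' s in auto)
    then show "(\<lambda>j. (case z of (x, t) \<Rightarrow> exp (l * t) * ?P x j) * s ^ j) sums ?F s z"
      using sums_mult[of _ _ "exp (l * t)"] by (simp add: z mult.assoc diff_diff_eq)
  qed (use assms in auto)
  then show ?thesis by simp
qed

section \<open>Homogeneous components of the kernel and their caloric extensions\<close>

lemma rpf_\<beta>: "rpf (\<lambda>x. \<beta> x $ i)" and rpf_\<beta>_inner: "rpf (\<lambda>x. w \<bullet> \<beta> x)"
  by (intro rpf_linear bounded_linear_compose[OF bounded_linear_vec_nth \<beta>_bounded_linear]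
      bounded_linear_compose[OF bounded_linear_inner_right \<beta>_bounded_linear])+

lemma rpf_\<beta>_norm: "rpf (\<lambda>x. (norm (\<beta> x))\<^sup>2)"
proof -
  have "rpf (\<lambda>x. \<Sum>i\<in>UNIV. \<beta> x $ i * \<beta> x $ i)"
    by (intro real_polynomial_function_sum rpf_mult rpf_\<beta>) auto
  then show ?thesis by (simp add: power2_norm_eq_inner inner_vec_def)
qed

text \<open>The products of powers occurring in \<open>tcoef\<close>, homogeneous of degree
  \<open>a + 2 * b\<close> in \<open>x\<close>. The factorials make the coefficients under
  \<open>Lop\<close> match the equation for \<open>ydiff\<close>.\<close>

definition radial_mono :: "real^'n \<Rightarrow> nat \<Rightarrow> nat \<Rightarrow> real^'n \<Rightarrow> real" where
  "radial_mono w a b x = (- 2 * (w \<bullet> \<beta> x)) ^ a * ((norm (\<beta> x))\<^sup>2) ^ b / (fact a * fact b)"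

lemma rpf_radial_mono: "rpf (radial_mono w a b)"
proof -
  have "rpf (\<lambda>x. ((- 2 * (w \<bullet> \<beta> x)) ^ a * ((norm (\<beta> x))\<^sup>2) ^ b) / (fact a * fact b))"
    by (intro real_polynomial_function_divide rpf_mult real_polynomial_function_power rpf_\<beta>_norm rpf_\<beta>_inner rpf_const)
  then show ?thesis by (simp add: radial_mono_def[abs_def])
qed

lemma \<beta>_line:
  "w \<bullet> \<beta> (x + s *\<^sub>R c i) = w \<bullet> \<beta> x + s * w $ i"
  "(norm (\<beta> (x + s *\<^sub>R c i)))\<^sup>2 = (norm (\<beta> x))\<^sup>2 + 2 * s * \<beta> x $ i + s\<^sup>2"
proof -
  show "w \<bullet> \<beta> (x + s *\<^sub>R c i) = w \<bullet> \<beta> x + s * w $ i"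
    by (simp add: \<beta>_add \<beta>_scaleR \<beta>_c inner_add_right inner_axis)
  show "(norm (\<beta> (x + s *\<^sub>R c i)))\<^sup>2 = (norm (\<beta> x))\<^sup>2 + 2 * s * \<beta> x $ i + s\<^sup>2"
    using norm_sq_expand[of "\<beta> x" "- s" "axis i 1"]
    by (simp add: \<beta>_add \<beta>_scaleR \<beta>_c inner_axis)
qed

lemma dder_radial_pow:
  "dder (c i) (\<lambda>x. (w \<bullet> \<beta> x) ^ a * ((norm (\<beta> x))\<^sup>2) ^ b) =
    (\<lambda>x. real a * w $ i * ((w \<bullet> \<beta> x) ^ (a - 1) * ((norm (\<beta> x))\<^sup>2) ^ b)
       + 2 * real b * (\<beta> x $ i * ((w \<bullet> \<beta> x) ^ a * ((norm (\<beta> x))\<^sup>2) ^ (b - 1))))"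
  by (rule dder_eqI) (auto simp: \<beta>_line intro!: derivative_eq_intros)

lemma rpf_radial_pow: "rpf (\<lambda>x. (w \<bullet> \<beta> x) ^ a * ((norm (\<beta> x))\<^sup>2) ^ b)"
  by (intro rpf_mult real_polynomial_function_power rpf_\<beta>_norm rpf_\<beta>_inner)

lemma dder_\<beta>_coord: "dder (c i) (\<lambda>x. \<beta> x $ i) = (\<lambda>x. 1)"
  by (subst dder_linear[OF bounded_linear_compose[OF bounded_linear_vec_nth \<beta>_bounded_linear]])
     (simp add: \<beta>_c)

text \<open>In the coordinates \<open>\<beta> x\<close> the operator is the Laplacian, the linear
  form has gradient \<open>w\<close> and the squared norm has gradient \<open>2 \<beta> x\<close>.
  Truncated exponents are harmless: each comes with a factor that vanishes when truncation takes
  place.\<close>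

lemma Lop_radial_pow:
  "Lop (\<lambda>x. (w \<bullet> \<beta> x) ^ a * ((norm (\<beta> x))\<^sup>2) ^ b) = (\<lambda>x.
     real a * real (a - 1) * (norm w)\<^sup>2 * ((w \<bullet> \<beta> x) ^ (a - 2) * ((norm (\<beta> x))\<^sup>2) ^ b)
     + (4 * real a * real b + 4 * real b * real (b - 1) + 2 * real CARD('n) * real b) *
       ((w \<bullet> \<beta> x) ^ a * ((norm (\<beta> x))\<^sup>2) ^ (b - 1)))"
proof -
  let ?B = "\<lambda>x. w \<bullet> \<beta> x" and ?Q = "\<lambda>x. (norm (\<beta> x))\<^sup>2"
  let ?u = "\<lambda>a b x. ?B x ^ a * ?Q x ^ b"
  have ru: "rpf (?u a b)" for a b by (rule rpf_radial_pow)
  have D: "dder (c i) (?u a b) = (\<lambda>x. real a * w $ i * ?u (a - 1) b x + 2 * real b * (\<beta> x $ i * ?u a (b - 1) x))"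
    for i a b by (rule dder_radial_pow)
  have DD: "dder (c i) (dder (c i) (?u a b)) = (\<lambda>x.
      real a * w $ i * dder (c i) (?u (a - 1) b) x
      + 2 * real b * (?u a (b - 1) x + dder (c i) (?u a (b - 1)) x * \<beta> x $ i))" for i
    unfolding D[of i a b]
    by (subst dder_add dder_cmult dder_mult,
        (intro rpf_mult rpf_add rpf_const ru rpf_\<beta>)+)+
       (simp only: dder_\<beta>_coord mult_1)
  have DD': "dder (c i) (dder (c i) (?u a b)) x =
      real a * real (a - 1) * (w $ i * w $ i) * ?u (a - 2) b x
      + 4 * real a * real b * (w $ i * \<beta> x $ i) * ?u (a - 1) (b - 1) x
      + 2 * real b * ?u a (b - 1) x
      + 4 * real b * real (b - 1) * (\<beta> x $ i * \<beta> x $ i) * ?u a (b - 2) x" for i x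
  proof -
    have e: "a - 1 - 1 = a - 2" "b - 1 - 1 = b - 2" by auto
    show ?thesis unfolding DD unfolding D e by (simp only: algebra_simps)
  qed
  have s1: "(\<Sum>i\<in>UNIV. w $ i * w $ i) = (norm w)\<^sup>2"
    and s2: "(\<Sum>i\<in>UNIV. w $ i * \<beta> x $ i) = ?B x"
    and s3: "(\<Sum>i\<in>UNIV. \<beta> x $ i * \<beta> x $ i) = ?Q x" for x
    by (simp_all add: power2_norm_eq_inner inner_vec_def)
  have "Lop (?u a b) x = real a * real (a - 1) * (norm w)\<^sup>2 * ?u (a - 2) b x
      + 4 * real a * real b * ?B x * ?u (a - 1) (b - 1) x
      + 2 * real b * real CARD('n) * ?u a (b - 1) x
      + 4 * real b * real (b - 1) * ?Q x * ?u a (b - 2) x" for x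
  proof -
    have "Lop (?u a b) x = real a * real (a - 1) * (\<Sum>i\<in>UNIV. w $ i * w $ i) * ?u (a - 2) b x
      + 4 * real a * real b * (\<Sum>i\<in>UNIV. w $ i * \<beta> x $ i) * ?u (a - 1) (b - 1) x
      + 2 * real b * real CARD('n) * ?u a (b - 1) x
      + 4 * real b * real (b - 1) * (\<Sum>i\<in>UNIV. \<beta> x $ i * \<beta> x $ i) * ?u a (b - 2) x"
      unfolding Lop_def DD' by (simp add: sum.distrib sum_distrib_left sum_distrib_right mult_ac)
    then show ?thesis by (simp only: s1 s2 s3)
  qed
  moreover have "4 * real a * real b * ?B x * ?u (a - 1) (b - 1) x = 4 * real a * real b * ?u a (b - 1) x" for x
    by (cases a) (simp_all add: mult_ac)
  moreover have "4 * real b * real (b - 1) * ?Q x * ?u a (b - 2) x = 4 * real b * real (b - 1) * ?u a (b - 1) x" for x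
  proof (cases "b \<ge> 2")
    case True
    then have "b - 1 = Suc (b - 2)" by simp
    then show ?thesis by (simp only: power_Suc mult_ac)
  qed auto
  ultimately have "Lop (?u a b) x = real a * real (a - 1) * (norm w)\<^sup>2 * ?u (a - 2) b x
      + 4 * real a * real b * ?u a (b - 1) x
      + 2 * real b * real CARD('n) * ?u a (b - 1) x
      + 4 * real b * real (b - 1) * ?u a (b - 1) x" for x
    by (simp only:)
  then show ?thesis by (intro ext) (simp only: algebra_simps)
qed

lemma Lop_radial_mono:
  "Lop (radial_mono w a b) x =
     (if a \<ge> 2 then 4 * (norm w)\<^sup>2 * radial_mono w (a - 2) b x else 0)
     + (if b \<ge> 1 then (4 * real (a + b - 1) + 2 * real CARD('n)) * radial_mono w a (b - 1) x else 0)"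
proof -
  define U where "U a b = (w \<bullet> \<beta> x) ^ a * ((norm (\<beta> x))\<^sup>2) ^ b" for a b
  have R: "radial_mono w a b x = (- 2) ^ a / (fact a * fact b) * U a b" for a b
    by (simp only: radial_mono_def U_def power_mult_distrib times_divide_eq_left mult.assoc)
  have "radial_mono w a b = (\<lambda>x. (- 2) ^ a / (fact a * fact b) * ((w \<bullet> \<beta> x) ^ a * ((norm (\<beta> x))\<^sup>2) ^ b))"
    using power_mult_distrib[of "- 2" "w \<bullet> \<beta> _" a]
    by (intro ext) (simp only: radial_mono_def power_mult_distrib times_divide_eq_left mult.assoc)
  then have "Lop (radial_mono w a b) x = (- 2) ^ a / (fact a * fact b) *
      (real a * real (a - 1) * (norm w)\<^sup>2 * U (a - 2) b
        + (4 * real a * real b + 4 * real b * real (b - 1) + 2 * real CARD('n) * real b) * U a (b - 1))"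
    by (simp only: Lop_cmult[OF rpf_radial_pow] Lop_radial_pow U_def)
  also have "\<dots> = (- 2) ^ a / (fact a * fact b) * (real a * real (a - 1) * (norm w)\<^sup>2 * U (a - 2) b)
      + (- 2) ^ a / (fact a * fact b) * (real b * (4 * real a + 4 * real (b - 1) + 2 * real CARD('n)) * U a (b - 1))"
    by (simp add: algebra_simps)
  also have "(- 2) ^ a / (fact a * fact b) * (real a * real (a - 1) * (norm w)\<^sup>2 * U (a - 2) b)
      = (if a \<ge> 2 then 4 * (norm w)\<^sup>2 * radial_mono w (a - 2) b x else 0)"
  proof (cases "a \<ge> 2")
    case True
    then obtain k where "a = Suc (Suc k)" by (metis add_2_eq_Suc le_Suc_ex)
    then show ?thesis by (simp add: R divide_simps)
  next
    case False
    then have "a = 0 \<or> a = 1" by auto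
    then show ?thesis by auto
  qed
  also have "(- 2) ^ a / (fact a * fact b) * (real b * (4 * real a + 4 * real (b - 1) + 2 * real CARD('n)) * U a (b - 1))
      = (if b \<ge> 1 then (4 * real (a + b - 1) + 2 * real CARD('n)) * radial_mono w a (b - 1) x else 0)"
  proof (cases b)
    case (Suc k)
    then show ?thesis by (simp add: R divide_simps)
  qed simp
  finally show ?thesis .
qed

text \<open>The homogeneous components of \<open>x \<mapsto> yukawa l (y - x)\<close>, with \<open>w = \<beta> y\<close>.\<close>

definition ycomp :: "real \<Rightarrow> real^'n \<Rightarrow> nat \<Rightarrow> real^'n \<Rightarrow> real" where
  "ycomp l w j x = (\<Sum>b\<le>j div 2. ydiff (real CARD('n) / 2) l (j - b) ((norm w)\<^sup>2) * radial_mono w (j - 2 * b) b x)"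

lemma ycomp_tcoef: "ycomp l w j x = tcoef (real CARD('n) / 2) l ((norm w)\<^sup>2) (w \<bullet> \<beta> x) ((norm (\<beta> x))\<^sup>2) j"
  by (simp add: ycomp_def tcoef_def radial_mono_def)

lemma rpf_ycomp: "rpf (ycomp l w j)"
  unfolding ycomp_def[abs_def]
  by (intro real_polynomial_function_sum rpf_mult rpf_const rpf_radial_mono) auto

text \<open>The radial equation \<open>4 \<rho> f'' + 4 a f' = l f\<close> differentiated
  \<open>i\<close> times. In terms of \<open>yuk\<close> it is \<open>yuk_recursion\<close> with
  exponent \<open>a + i\<close>.\<close>

lemma ydiff_recursion:
  assumes "\<rho> > 0" "l > 0" "a \<ge> 0"
  shows "4 * \<rho> * ydiff a l (i + 2) \<rho> + (4 * (real i + a)) * ydiff a l (i + 1) \<rho> = l * ydiff a l i \<rho>"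
proof -
  have "\<rho> / 4 * yuk (a + real i + 2) l \<rho> - (a + real i) * yuk (a + real i + 1) l \<rho> = l * yuk (a + real i) l \<rho>"
    using assms by (intro yuk_recursion) auto
  then have "(- 1 / 4) ^ i * (\<rho> / 4 * yuk (a + real i + 2) l \<rho> - (a + real i) * yuk (a + real i + 1) l \<rho>)
      = (- 1 / 4) ^ i * (l * yuk (a + real i) l \<rho>)" by simp
  then show ?thesis
    by (simp add: ydiff_def power_add power2_eq_square algebra_simps)
qed

text \<open>Homogeneous components of \<open>L \<Phi> = l \<Phi>\<close>, as \<open>Lop\<close>
  lowers the degree by two. With \<open>k = j - 2\<close>, each
  \<open>radial_mono w (k - 2 * b) b\<close> arises from two terms, and
  \<open>ydiff_recursion\<close> adds up their coefficients.\<close>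

lemma Lop_ycomp:
  assumes "l > 0" "w \<noteq> 0"
  shows "Lop (ycomp l w j) = (\<lambda>x. if j \<ge> 2 then l * ycomp l w (j - 2) x else 0)"
proof
  fix x
  let ?f = "\<lambda>i. ydiff (real CARD('n) / 2) l i ((norm w)\<^sup>2)"
  have "Lop (ycomp l w j) x = (\<Sum>b\<le>j div 2. ?f (j - b) * Lop (radial_mono w (j - 2 * b) b) x)"
    unfolding ycomp_def[abs_def]
    by (subst Lop_sum) (auto simp: Lop_cmult rpf_radial_mono intro!: rpf_mult rpf_const rpf_radial_mono)
  also have "\<dots> = (\<Sum>b\<le>j div 2. ?f (j - b) * (if j - 2 * b \<ge> 2 then 4 * (norm w)\<^sup>2 * radial_mono w (j - 2 * b - 2) b x else 0))
     + (\<Sum>b\<le>j div 2. ?f (j - b) * (if b \<ge> 1 then (4 * real (j - 2 * b + b - 1) + 2 * real CARD('n)) * radial_mono w (j - 2 * b) (b - 1) x else 0))"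
    unfolding Lop_radial_mono distrib_left sum.distrib ..
  finally have L: "Lop (ycomp l w j) x = \<dots>" .
  show "Lop (ycomp l w j) x = (if j \<ge> 2 then l * ycomp l w (j - 2) x else 0)"
  proof (cases "j \<ge> 2")
    case False
    then have "j div 2 = 0" by auto
    then show ?thesis unfolding L using False by simp
  next
    case True
    define k where "k = j - 2"
    have j: "j = k + 2" using True by (simp add: k_def)
    have jd: "j div 2 = Suc (k div 2)" by (simp add: j)
    have S1: "(\<Sum>b\<le>j div 2. ?f (j - b) * (if j - 2 * b \<ge> 2 then 4 * (norm w)\<^sup>2 * radial_mono w (j - 2 * b - 2) b x else 0))
      = (\<Sum>b\<le>k div 2. (4 * (norm w)\<^sup>2 * ?f (k - b + 2)) * radial_mono w (k - 2 * b) b x)"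
    proof -
      have "(\<Sum>b\<le>k div 2. ?f (j - b) * (if j - 2 * b \<ge> 2 then 4 * (norm w)\<^sup>2 * radial_mono w (j - 2 * b - 2) b x else 0))
        = (\<Sum>b\<le>k div 2. (4 * (norm w)\<^sup>2 * ?f (k - b + 2)) * radial_mono w (k - 2 * b) b x)"
      proof (intro sum.cong refl)
        fix b assume "b \<in> {..k div 2}"
        then have "2 * b \<le> k" by auto
        then have "j - b = k - b + 2" "j - 2 * b \<ge> 2" "j - 2 * b - 2 = k - 2 * b" by (auto simp: j)
        then show "?f (j - b) * (if j - 2 * b \<ge> 2 then 4 * (norm w)\<^sup>2 * radial_mono w (j - 2 * b - 2) b x else 0)
          = (4 * (norm w)\<^sup>2 * ?f (k - b + 2)) * radial_mono w (k - 2 * b) b x" by simp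
      qed
      \<comment> \<open>The top index contributes nothing to the first sum; in the second it is the
        index zero that drops out, which allows the shift to \<open>Suc b\<close>.\<close>
      moreover have "\<not> j - 2 * Suc (k div 2) \<ge> 2" by (auto simp: j)
      ultimately show ?thesis unfolding jd sum.atMost_Suc by simp
    qed
    have S2: "(\<Sum>b\<le>j div 2. ?f (j - b) * (if b \<ge> 1 then (4 * real (j - 2 * b + b - 1) + 2 * real CARD('n)) * radial_mono w (j - 2 * b) (b - 1) x else 0))
      = (\<Sum>b\<le>k div 2. ((4 * (real (k - b) + real CARD('n) / 2)) * ?f (k - b + 1)) * radial_mono w (k - 2 * b) b x)"
    proof -
      define g where "g b = ?f (j - b) * (if b \<ge> 1 then (4 * real (j - 2 * b + b - 1) + 2 * real CARD('n)) * radial_mono w (j - 2 * b) (b - 1) x else 0)" for b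
      have g0: "g 0 = 0" by (simp add: g_def)
      have gS: "g (Suc b) = ((4 * (real (k - b) + real CARD('n) / 2)) * ?f (k - b + 1)) * radial_mono w (k - 2 * b) b x"
        if "b \<in> {..k div 2}" for b
      proof -
        have b: "2 * b \<le> k" using that by auto
        have e: "j - Suc b = k - b + 1" "j - 2 * Suc b + Suc b - 1 = k - b" "j - 2 * Suc b = k - 2 * b" "Suc b - 1 = b"
          using b by (auto simp: j)
        have "4 * real (k - 2 * b) + 4 * real b = 4 * real (k - b)" using b by (simp add: of_nat_diff)
        then show ?thesis unfolding g_def e by simp
      qed
      have "(\<Sum>b\<le>j div 2. g b) = (\<Sum>b\<le>k div 2. g (Suc b))"
        unfolding jd sum.atMost_Suc_shift g0 by simp
      also have "\<dots> = (\<Sum>b\<le>k div 2. ((4 * (real (k - b) + real CARD('n) / 2)) * ?f (k - b + 1)) * radial_mono w (k - 2 * b) b x)"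
        by (rule sum.cong[OF refl gS])
      finally show ?thesis unfolding g_def .
    qed
    have "Lop (ycomp l w j) x = (\<Sum>b\<le>k div 2. (4 * (norm w)\<^sup>2 * ?f (k - b + 2) + (4 * (real (k - b) + real CARD('n) / 2)) * ?f (k - b + 1)) * radial_mono w (k - 2 * b) b x)"
      unfolding L S1 S2 by (simp only: sum.distrib distrib_right)
    also have "\<dots> = (\<Sum>b\<le>k div 2. (l * ?f (k - b)) * radial_mono w (k - 2 * b) b x)"
      using assms by (subst ydiff_recursion) auto
    also have "\<dots> = l * ycomp l w k x"
      unfolding ycomp_def sum_distrib_left by (simp add: mult.assoc)
    finally show ?thesis using True by (simp add: k_def)
  qed
qed

lemma Lpow_ycomp:
  assumes "l > 0" "w \<noteq> 0"
  shows "(Lop ^^ m) (ycomp l w j) = (\<lambda>x. if 2 * m \<le> j then l ^ m * ycomp l w (j - 2 * m) x else 0)"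
proof (induction m)
  case (Suc m)
  have "(Lop ^^ Suc m) (ycomp l w j) = Lop (\<lambda>x. if 2 * m \<le> j then l ^ m * ycomp l w (j - 2 * m) x else 0)"
    using Suc by simp
  also have "\<dots> = (\<lambda>x. if 2 * Suc m \<le> j then l ^ Suc m * ycomp l w (j - 2 * Suc m) x else 0)"
  proof (cases "2 * m \<le> j")
    case True
    have "(\<lambda>x. if 2 * m \<le> j then l ^ m * ycomp l w (j - 2 * m) x else 0) = (\<lambda>x. l ^ m * ycomp l w (j - 2 * m) x)"
      using True by simp
    moreover have "2 \<le> j - 2 * m \<longleftrightarrow> 2 * Suc m \<le> j" "j - 2 * m - 2 = j - 2 * Suc m" using True by auto
    ultimately show ?thesis
      by (simp add: Lop_cmult rpf_ycomp Lop_ycomp[OF assms] fun_eq_iff)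
  next
    case False
    then show ?thesis by simp
  qed
  finally show ?case .
qed simp

text \<open>The part of weight \<open>j\<close> in the product of the series of
  \<open>exp (l * t)\<close> and of the kernel, where \<open>x\<close> has weight one and
  \<open>t\<close> weight two.\<close>

lemma heat_ext_ycomp:
  assumes "l > 0" "w \<noteq> 0"
  shows "heat_ext (ycomp l w j) x t = (\<Sum>b\<le>j div 2. (l * t) ^ b / fact b * ycomp l w (j - 2 * b) x)"
proof -
  have "heat_ext (ycomp l w j) x t = (\<Sum>b\<le>j div 2. t ^ b / fact b * (Lop ^^ b) (ycomp l w j) x)"
    unfolding heat_ext_def by (rule suminf_finite) (auto simp: Lpow_ycomp[OF assms])
  also have "\<dots> = (\<Sum>b\<le>j div 2. (l * t) ^ b / fact b * ycomp l w (j - 2 * b) x)"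
    by (intro sum.cong refl) (auto simp: Lpow_ycomp[OF assms] power_mult_distrib)
  finally show ?thesis .
qed

text \<open>Regrouping the product of the two series by parabolic weight writes
  \<open>exp (l * t)\<close> times the kernel as a series of caloric extensions of the
  \<open>ycomp\<close>, which converges geometrically on \<open>S \<times> I\<close>.\<close>

lemma yukawa_far:
  assumes "l > 0" "y \<noteq> 0"
    and far: "\<And>x. x \<in> S \<Longrightarrow> 16 * norm (\<beta> x) \<le> norm (\<beta> y)"
    and I: "I \<subseteq> {0..T}"
    and v: "\<And>p. rpf p \<Longrightarrow> approx_on (S \<times> I) v (\<lambda>(x, t). heat_ext p x t)"
  shows "approx_on (S \<times> I) v (\<lambda>(x, t). exp (l * t) * yukawa l (x - y))"
proof (rule approx_on_limit)
  fix \<epsilon> :: real assume "\<epsilon> > 0"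
  let ?w = "\<beta> y"
  define D where "D = yuk (real CARD('n) / 2) l ((norm ?w)\<^sup>2 / 2)"
  have w: "?w \<noteq> 0" using assms by (simp add: \<beta>_eq_0_iff)
  have D: "D \<ge> 0" by (simp add: D_def yuk_nonneg)
  define C where "C = exp (4 * l * T) * (D * 2)"
  have p_sums: "(\<lambda>j. ycomp l ?w j x) sums yukawa l (x - y)" and p_bound: "\<bar>ycomp l ?w j x\<bar> \<le> D * (1 / 2) ^ j"
    if "x \<in> S" for x j
  proof -
    have "(\<lambda>j. ycomp l ?w j x * 1 ^ j) sums yukawa l (y - 1 *\<^sub>R x)"
      unfolding ycomp_tcoef by (rule yukawa_taylor(1)) (use assms far[OF that] in auto)
    moreover have "yukawa l (y - x) = yukawa l (x - y)"
      by (simp add: yukawa_def \<beta>_diff norm_minus_commute)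
    ultimately show "(\<lambda>j. ycomp l ?w j x) sums yukawa l (x - y)" by simp
    show "\<bar>ycomp l ?w j x\<bar> \<le> D * (1 / 2) ^ j"
      unfolding ycomp_tcoef D_def by (rule yukawa_taylor(2)) (use assms far[OF that] in auto)
  qed
  have geo: "(\<Sum>k<N. (1 / 2) ^ k) \<le> (2::real)" for N
    using geometric_sums[of "1 / 2 :: real"] sum_le_suminf[of "\<lambda>k. (1 / 2 :: real) ^ k" "{..<N}"]
    by (simp add: sums_iff)
  have w_sums: "(\<lambda>j. heat_ext (ycomp l ?w j) x t) sums (exp (l * t) * yukawa l (x - y))"
    and w_bound: "\<bar>heat_ext (ycomp l ?w j) x t\<bar> \<le> C * (1 / 2) ^ j" if x: "x \<in> S" and t: "t \<in> I" for x t j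
  proof -
    have t: "0 \<le> t" "t \<le> T" using t I by auto
    have exp_le: "(\<Sum>b<N. (r * (l * t)) ^ b / fact b) \<le> exp (r * l * T)" if "r \<ge> 0" for N r
    proof -
      have "(\<Sum>b<N. (r * (l * t)) ^ b / fact b) \<le> exp (r * (l * t))"
        using exp_sums_real[of "r * (l * t)"] sum_le_suminf[of "\<lambda>b. (r * (l * t)) ^ b / fact b" "{..<N}"] that t \<open>l > 0\<close>
        by (simp add: sums_iff)
      also have "\<dots> \<le> exp (r * l * T)"
        using that t \<open>l > 0\<close> by (auto intro!: mult_left_mono simp: mult.assoc)
      finally show ?thesis .
    qed
    \<comment> \<open>the factor \<open>r\<^sup>j\<close> with \<open>r = 2\<close> yields the geometric bound\<close>
    have main: "(\<Sum>b<N. \<Sum>k<N. \<bar>(r\<^sup>2 * (l * t)) ^ b / fact b * (r ^ k * ycomp l ?w k x)\<bar>) \<le> exp (r\<^sup>2 * l * T) * M"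
      if r: "r \<ge> 0" and M: "\<And>N. (\<Sum>k<N. \<bar>r ^ k * ycomp l ?w k x\<bar>) \<le> M" for r M N
    proof -
      have "(\<Sum>b<N. \<Sum>k<N. \<bar>(r\<^sup>2 * (l * t)) ^ b / fact b * (r ^ k * ycomp l ?w k x)\<bar>)
        = (\<Sum>b<N. (r\<^sup>2 * (l * t)) ^ b / fact b) * (\<Sum>k<N. \<bar>r ^ k * ycomp l ?w k x\<bar>)"
        unfolding sum_product using r t \<open>l > 0\<close> by (simp add: abs_mult)
      also have "\<dots> \<le> exp (r\<^sup>2 * l * T) * M"
        using M[of N] by (intro mult_mono exp_le sum_nonneg) auto
      finally show ?thesis .
    qed
    have "(\<Sum>k<N. \<bar>ycomp l ?w k x\<bar>) \<le> D * 2" for N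
    proof -
      have "(\<Sum>k<N. \<bar>ycomp l ?w k x\<bar>) \<le> (\<Sum>k<N. D * (1 / 2) ^ k)" by (intro sum_mono p_bound x)
      also have "\<dots> \<le> D * 2" unfolding sum_distrib_left[symmetric] using D geo by (intro mult_left_mono)
      finally show ?thesis .
    qed
    then have bd: "(\<Sum>b<N. \<Sum>k<N. \<bar>(l * t) ^ b / fact b * ycomp l ?w k x\<bar>) \<le> exp (1 * l * T) * (D * 2)" for N
      using main[of 1 "D * 2" N] by simp
    have "(\<lambda>j. \<Sum>b\<le>j div 2. (l * t) ^ b / fact b * ycomp l ?w (j - 2 * b) x) sums (exp (l * t) * yukawa l (x - y))"
      by (rule sums_regroup_even(1)[OF bd sums_mult[OF p_sums[OF x]] sums_mult2[OF exp_sums_real]])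
    then show "(\<lambda>j. heat_ext (ycomp l ?w j) x t) sums (exp (l * t) * yukawa l (x - y))"
      by (simp add: heat_ext_ycomp[OF \<open>l > 0\<close> w])
    have "\<bar>heat_ext (ycomp l ?w j) x t\<bar> \<le> (\<Sum>b\<le>j div 2. \<bar>(l * t) ^ b / fact b * ycomp l ?w (j - 2 * b) x\<bar>)"
      unfolding heat_ext_ycomp[OF \<open>l > 0\<close> w] by (rule sum_abs)
    also have "\<dots> \<le> (\<Sum>b\<le>j div 2. (4 * (l * t)) ^ b / fact b * (D * (1 / 2) ^ j))"
    proof (intro sum_mono)
      fix b assume "b \<in> {..j div 2}"
      then have "2 * b \<le> j" by auto
      \<comment> \<open>A degree lower by \<open>2 * b\<close> costs \<open>4 ^ b\<close>, which the
        exponential series absorbs; this is the factor \<open>exp (4 * l * T)\<close> in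
        \<open>C\<close>.\<close>
      then have e: "(1 / 2 :: real) ^ (j - 2 * b) = 4 ^ b * (1 / 2) ^ j"
        by (simp add: power_diff power_mult power_one_over divide_simps)
      have "\<bar>(l * t) ^ b / fact b * ycomp l ?w (j - 2 * b) x\<bar> \<le> (l * t) ^ b / fact b * (D * (1 / 2) ^ (j - 2 * b))"
        unfolding abs_mult using t \<open>l > 0\<close> p_bound[OF x, of "j - 2 * b"] by (intro mult_mono) auto
      then show "\<bar>(l * t) ^ b / fact b * ycomp l ?w (j - 2 * b) x\<bar> \<le> (4 * (l * t)) ^ b / fact b * (D * (1 / 2) ^ j)"
        unfolding e power_mult_distrib[of 4] by (simp add: mult_ac)
    qed
    also have "\<dots> = (\<Sum>b<Suc (j div 2). (4 * (l * t)) ^ b / fact b) * (D * (1 / 2) ^ j)"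
      unfolding sum_distrib_right lessThan_Suc_atMost ..
    also have "\<dots> \<le> exp (4 * l * T) * (D * (1 / 2) ^ j)"
      using D by (intro mult_right_mono exp_le) auto
    also have "\<dots> \<le> C * (1 / 2) ^ j"
      using D by (simp add: C_def)
    finally show "\<bar>heat_ext (ycomp l ?w j) x t\<bar> \<le> C * (1 / 2) ^ j" .
  qed
  have "(\<lambda>N. C * (1 / 2) ^ N * 2) \<longlonglongrightarrow> C * 0 * 2"
    by (intro tendsto_intros LIMSEQ_power_zero) simp
  then have "\<forall>\<^sub>F N in sequentially. C * (1 / 2) ^ N * 2 < \<epsilon>"
    using \<open>\<epsilon> > 0\<close> by (intro order_tendstoD(2)) auto
  then obtain N where N: "C * (1 / 2) ^ N * 2 < \<epsilon>"
    unfolding eventually_sequentially by blast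
  let ?g = "\<lambda>z. \<Sum>j<N. (case z of (x, t) \<Rightarrow> heat_ext (ycomp l ?w j) x t)"
  have "approx_on (S \<times> I) v ?g"
    by (intro approx_on_sum v rpf_ycomp) auto
  moreover have "\<bar>(case z of (x, t) \<Rightarrow> exp (l * t) * yukawa l (x - y)) - ?g z\<bar> \<le> \<epsilon>" if zSI: "z \<in> S \<times> I" for z
  proof -
    obtain x t where z: "z = (x, t)" "x \<in> S" "t \<in> I" using zSI by auto
    let ?h = "\<lambda>j. heat_ext (ycomp l ?w j) x t"
    have s: "summable ?h" using w_sums[OF z(2,3)] by (simp add: sums_iff)
    have gs: "(\<lambda>i. C * (1 / 2) ^ N * (1 / 2) ^ i) sums (C * (1 / 2) ^ N * 2)"
      using geometric_sums[of "1 / 2 :: real"] by (intro sums_mult) simp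
    have hb: "\<bar>?h (i + N)\<bar> \<le> C * (1 / 2) ^ N * (1 / 2) ^ i" for i
      using w_bound[OF z(2,3), of "i + N"] by (simp add: power_add mult_ac)
    have sa: "summable (\<lambda>i. \<bar>?h (i + N)\<bar>)"
      by (rule summable_comparison_test'[OF sums_summable[OF gs], of 0]) (use hb in simp)
    have "exp (l * t) * yukawa l (x - y) - (\<Sum>j<N. ?h j) = (\<Sum>i. ?h (i + N))"
      using suminf_minus_initial_segment[OF s, of N] w_sums[OF z(2,3)] by (simp add: sums_iff)
    moreover have "\<bar>\<Sum>i. ?h (i + N)\<bar> \<le> (\<Sum>i. \<bar>?h (i + N)\<bar>)" using sa by (rule summable_rabs)
    moreover have "(\<Sum>i. \<bar>?h (i + N)\<bar>) \<le> C * (1 / 2) ^ N * 2"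
      using suminf_le[OF _ sa sums_summable[OF gs]] hb gs by (simp add: sums_iff)
    ultimately show ?thesis using N by (simp add: z)
  qed
  ultimately show "\<exists>g. approx_on (S \<times> I) v g \<and>
      (\<forall>z\<in>S \<times> I. \<bar>(case z of (x, t) \<Rightarrow> exp (l * t) * yukawa l (x - y)) - g z\<bar> \<le> \<epsilon>)" by blast
qed

text \<open>Runge's theorem: the pole \<open>y\<close> can be pushed to infinity inside the connected complement of \<open>S\<close>.\<close>

lemma yukawa_runge:
  assumes "l > 0" "compact S" "connected (- S)" "y \<notin> S"
    and I: "I \<subseteq> {0..T}"
    and v: "\<And>p. rpf p \<Longrightarrow> approx_on (S \<times> I) v (\<lambda>(x, t). heat_ext p x t)"
  shows "approx_on (S \<times> I) v (\<lambda>(x, t). exp (l * t) * yukawa l (x - y))"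
proof (cases "S = {}")
  case True
  then show ?thesis by (auto simp: approx_on_def)
next
  case ne: False
  let ?app = "\<lambda>y. approx_on (S \<times> I) v (\<lambda>(x, t). exp (l * t) * yukawa l (x - y))"
  obtain m where m: "m > 0" "\<And>x. m * norm x \<le> norm (\<beta> x)" by (rule \<beta>_lower) blast
  obtain M where M: "M > 0" "\<And>x. norm (\<beta> x) \<le> M * norm x" by (rule \<beta>_upper) blast
  \<comment> \<open>A whole ball of admissible poles is demanded: this makes \<open>G\<close> open
    and supplies the short initial segment for \<open>yukawa_step\<close>.\<close>
  define G where "G = {y \<in> - S. \<exists>e>0. \<forall>y'\<in>ball y e. ?app y'}"
  have opS: "open (- S)" using assms(2) by (simp add: compact_imp_closed open_Compl)
  have "open G"
    unfolding open_contains_ball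
  proof
    fix y assume "y \<in> G"
    then obtain e where e: "e > 0" "\<forall>y'\<in>ball y e. ?app y'" and yS: "y \<in> - S" by (auto simp: G_def)
    obtain e' where e': "e' > 0" "ball y e' \<subseteq> - S" using opS yS unfolding open_contains_ball by blast
    have "ball y (min e e') \<subseteq> G"
    proof
      fix y1 assume y1: "y1 \<in> ball y (min e e')"
      have "ball y1 (e - dist y y1) \<subseteq> ball y e"
      proof
        fix x assume "x \<in> ball y1 (e - dist y y1)"
        then show "x \<in> ball y e" using dist_triangle[of y x y1] by simp
      qed
      then show "y1 \<in> G" using e e' y1 unfolding G_def by (auto intro!: exI[of _ "e - dist y y1"])
    qed
    then show "\<exists>e>0. ball y e \<subseteq> G" using e e' by (intro exI[of _ "min e e'"]) auto
  qed
  moreover have "G \<noteq> {}"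
  proof -
    obtain R where R: "R > 0" "\<And>x. x \<in> S \<Longrightarrow> norm x \<le> R"
      using compact_imp_bounded[OF assms(2)] by (auto simp: bounded_pos)
    \<comment> \<open>Large enough for the separation in \<open>yukawa_far\<close>, given the bounds
      \<open>m\<close> and \<open>M\<close> for \<beta>, and larger than the radius of
      \<open>S\<close>.\<close>
    define r where "r = 16 * M * R / m + R + 1"
    obtain e1 :: "real^'n" where e1: "norm e1 = 1" using vector_choose_size[of 1] by auto
    have app: "?app y" if "norm y \<ge> r" for y
    proof (rule yukawa_far[OF assms(1) _ _ I v])
      have r: "r > 0" using R M m by (simp add: r_def add_pos_pos)
      then show "y \<noteq> 0" using that by auto
      fix x assume "x \<in> S"
      have "16 * norm (\<beta> x) \<le> 16 * (M * R)"
        using M R(2)[OF \<open>x \<in> S\<close>] by (intro mult_left_mono order_trans[OF M(2)]) auto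
      also have "\<dots> \<le> m * r" using m R by (simp add: r_def field_simps)
      also have "\<dots> \<le> m * norm y" using that m by simp
      also have "\<dots> \<le> norm (\<beta> y)" by (rule m)
      finally show "16 * norm (\<beta> x) \<le> norm (\<beta> y)" .
    qed auto
    have rR: "r > R" using R M m by (simp add: r_def add_nonneg_pos)
    define y where "y = (r + 1) *\<^sub>R e1"
    have ny: "norm y = r + 1" using rR R e1 by (simp add: y_def)
    have "norm y' \<ge> r" if "y' \<in> ball y 1" for y'
      using that ny norm_triangle_ineq2[of y y'] by (simp add: dist_norm)
    then have "\<forall>y'\<in>ball y 1. ?app y'" using app by blast
    moreover have "y \<notin> S" using R(2)[of y] ny rR by auto
    ultimately have "y \<in> G" unfolding G_def by (auto intro!: exI[of _ 1])
    then show ?thesis by blast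
  qed
  moreover have closG: "- S \<inter> closure G \<subseteq> G"
  proof
    fix y assume y: "y \<in> - S \<inter> closure G"
    define r where "r = infdist y S"
    have r: "r > 0"
      using y ne assms(2) unfolding r_def
      by (intro infdist_pos_not_in_closed) (auto simp: compact_imp_closed)
    \<comment> \<open>A fixed fraction of the distance to \<open>S\<close>: a pole \<open>y1\<close>
      this close to \<open>y\<close> is still at distance \<open>r / 2\<close> from
      \<open>S\<close>, and a jump of length \<open>2 * \<epsilon>\<close> respects the factor
      sixteen in \<open>yukawa_step\<close>.\<close>
    define \<epsilon> where "\<epsilon> = min (r / 2) (m * r / (64 * M))"
    have \<epsilon>: "\<epsilon> > 0" "\<epsilon> \<le> r / 2" "\<epsilon> \<le> m * r / (64 * M)" using r m M by (auto simp: \<epsilon>_def)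
    then have \<epsilon>': "16 * (M * (2 * \<epsilon>)) \<le> m * (r / 2)" using M m by (simp add: field_simps)
    obtain y1 where y1: "y1 \<in> G" "dist y1 y < \<epsilon>" using y \<epsilon>(1) by (auto simp: closure_approachable)
    obtain e where e: "e > 0" "\<forall>y'\<in>ball y1 e. ?app y'" using y1 by (auto simp: G_def)
    have "?app y'" if y': "y' \<in> ball y \<epsilon>" for y'
    proof -
      define h where "h = y' - y1"
      have h: "norm h \<le> 2 * \<epsilon>"
        using y1 y' dist_triangle[of y' y1 y] by (simp add: h_def dist_norm[symmetric] dist_commute)
      have far: "m * (r / 2) \<le> norm (\<beta> (x - y1))" if "x \<in> S" for x
      proof -
        have "r \<le> dist y x" unfolding r_def using that by (rule infdist_le)
        also have "\<dots> \<le> dist y y1 + dist y1 x" by (rule dist_triangle)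
        finally have "r / 2 \<le> norm (x - y1)" using y1 \<epsilon> by (simp add: dist_commute dist_norm[symmetric])
        then have "m * (r / 2) \<le> m * norm (x - y1)" using m by simp
        then show ?thesis using m(2) order_trans by blast
      qed
      have hb: "16 * norm (\<beta> h) \<le> m * (r / 2)"
        using M(2)[of h] h M(1) \<epsilon>' mult_left_mono[OF h, of M] by linarith
      have "?app (y1 + h)"
      proof (rule yukawa_step[OF assms(1) _ _ far hb _ I])
        show "m * (r / 2) > 0" using m r by simp
        show "e / (norm h + 1) > 0" using e by (simp add: add_nonneg_pos)
        fix s :: real assume s: "0 < s" "s < e / (norm h + 1)"
        have "s * norm h \<le> s * (norm h + 1)" using s by simp
        also have "\<dots> < e" using s by (simp add: pos_less_divide_eq add_nonneg_pos)
        finally have "y1 + s *\<^sub>R h \<in> ball y1 e" using s by (simp add: dist_norm)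
        then show "?app (y1 + s *\<^sub>R h)" using e by blast
      qed
      then show ?thesis by (simp add: h_def)
    qed
    then show "y \<in> G" using y \<epsilon> unfolding G_def by blast
  qed
  moreover have "G \<subseteq> - S" by (auto simp: G_def)
  ultimately have "- S \<subseteq> G"
    using connectedD[OF assms(3), of G "- closure G"] closure_subset[of G]
    by (auto simp: open_Compl)
  then have "y \<in> G" using assms(4) by blast
  then show ?thesis by (auto simp: G_def)
qed

end

section \<open>The resolvent\<close>

lemma nn_integral_lborel_affine:
  fixes f :: "'a::euclidean_space \<Rightarrow> ennreal"
  assumes [measurable]: "f \<in> borel_measurable borel" and "r \<noteq> 0"
  shows "(\<integral>\<^sup>+x. f x \<partial>lborel) = ennreal (\<bar>r\<bar> ^ DIM('a)) * (\<integral>\<^sup>+x. f (t + r *\<^sub>R x) \<partial>lborel)"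
  by (subst lborel_affine[OF \<open>r \<noteq> 0\<close>, of t])
     (simp add: nn_integral_density nn_integral_distr nn_integral_cmult)

lemma nn_integral_lborel_shift:
  fixes f :: "'a::euclidean_space \<Rightarrow> ennreal"
  assumes [measurable]: "f \<in> borel_measurable borel"
  shows "(\<integral>\<^sup>+x. f (x - t) \<partial>lborel) = (\<integral>\<^sup>+x. f x \<partial>lborel)"
  using nn_integral_lborel_affine[of f 1 "- t"] by simp

lemma nn_integral_lborel_reflect:
  fixes f :: "'a::euclidean_space \<Rightarrow> ennreal"
  assumes [measurable]: "f \<in> borel_measurable borel"
  shows "(\<integral>\<^sup>+x. f (t - x) \<partial>lborel) = (\<integral>\<^sup>+x. f x \<partial>lborel)"
  using nn_integral_lborel_affine[of f "-1" t] by simp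

lemma nn_integral_exp_atLeast:
  assumes "l > 0"
  shows "(\<integral>\<^sup>+s. ennreal (exp (- l * s)) * indicator {0..} s \<partial>lborel) = ennreal (1 / l)"
proof -
  have "(\<integral>\<^sup>+s. ennreal (exp (- l * s)) * indicator {0..} s \<partial>lborel) = ennreal (0 - (- exp (- l * 0) / l))"
  proof (rule nn_integral_FTC_atLeast)
    show "DERIV (\<lambda>s. - exp (- l * s) / l) s :> exp (- l * s)" for s
      using assms by (auto intro!: derivative_eq_intros)
    have "((\<lambda>s. - (1 / l) * ((l * s) ^ 0 / exp (l * s))) \<longlongrightarrow> - (1 / l) * 0) at_top"
      using assms
      by (intro tendsto_mult tendsto_const filterlim_compose[OF tendsto_power_div_exp_0]
          filterlim_tendsto_pos_mult_at_top[OF tendsto_const] filterlim_ident)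
    then show "((\<lambda>s. - exp (- l * s) / l) \<longlongrightarrow> 0) at_top"
      by (simp add: exp_minus field_simps)
  qed (use assms in auto)
  then show ?thesis by simp
qed

lemma nn_integral_exp_Icc:
  assumes "l < m" "u > 0"
  shows "ennreal (m - l) * (\<integral>\<^sup>+s. ennreal (exp ((m - l) * s)) * indicator {0<..<u} s \<partial>lborel)
    = ennreal (exp ((m - l) * u) - 1)"
proof -
  have "(\<integral>\<^sup>+s. ennreal (exp ((m - l) * s)) * indicator {0<..<u} s \<partial>lborel)
      = (\<integral>\<^sup>+s. ennreal (exp ((m - l) * s)) * indicator {0..u} s \<partial>lborel)"
  proof (rule nn_integral_cong_AE)
    have "AE s in lborel. s \<noteq> 0" "AE s in lborel. s \<noteq> u" by (rule AE_lborel_singleton)+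
    then show "AE s in lborel. ennreal (exp ((m - l) * s)) * indicator {0<..<u} s
        = ennreal (exp ((m - l) * s)) * indicator {0..u} s"
      by eventually_elim (auto simp: indicator_def)
  qed
  also have "\<dots> = ennreal (exp ((m - l) * u) / (m - l) - exp ((m - l) * 0) / (m - l))"
    using assms by (intro nn_integral_FTC_Icc) (auto intro!: derivative_eq_intros)
  finally show ?thesis
    using assms by (simp add: ennreal_mult[symmetric] diff_divide_distrib[symmetric])
qed

context elliptic_frame
begin

lemma \<beta>_measurable [measurable]: "\<beta> \<in> borel_measurable borel"
  by (intro borel_measurable_continuous_onI linear_continuous_on \<beta>_bounded_linear)

text \<open>The heat kernel times its normalising constant \<open>Zc\<close>.\<close>

definition hk :: "real \<Rightarrow> real^'n \<Rightarrow> real" where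
  "hk s z = s powr (- (real CARD('n) / 2)) * exp (- (norm (\<beta> z))\<^sup>2 / (4 * s))"

lemma hk_nonneg: "hk s z \<ge> 0" by (simp add: hk_def)

lemma hk_measurable [measurable (raw)]:
  assumes [measurable]: "f \<in> borel_measurable M" "g \<in> borel_measurable M"
  shows "(\<lambda>x. hk (f x) (g x)) \<in> borel_measurable M"
  unfolding hk_def by measurable

definition Zc :: ennreal where
  "Zc = (\<integral>\<^sup>+z. ennreal (exp (- (norm (\<beta> z))\<^sup>2 / 4)) \<partial>lborel)"

lemma hk_integral:
  assumes "s > 0"
  shows "(\<integral>\<^sup>+z. ennreal (hk s z) \<partial>lborel) = Zc"
proof -
  have "(\<integral>\<^sup>+z. ennreal (hk s z) \<partial>lborel)
      = ennreal (\<bar>sqrt s\<bar> ^ DIM(real^'n)) * (\<integral>\<^sup>+z. ennreal (hk s (0 + sqrt s *\<^sub>R z)) \<partial>lborel)"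
    using assms by (intro nn_integral_lborel_affine) auto
  also have "(\<lambda>z. ennreal (hk s (0 + sqrt s *\<^sub>R z)))
      = (\<lambda>z. ennreal (s powr (- (real CARD('n) / 2))) * ennreal (exp (- (norm (\<beta> z))\<^sup>2 / 4)))"
    using assms by (auto simp: hk_def \<beta>_scaleR power_mult_distrib ennreal_mult)
  also have "(\<integral>\<^sup>+z. \<dots> z \<partial>lborel) = ennreal (s powr (- (real CARD('n) / 2))) * Zc"
    unfolding Zc_def by (intro nn_integral_cmult) measurable
  also have "ennreal (\<bar>sqrt s\<bar> ^ DIM(real^'n)) * (ennreal (s powr (- (real CARD('n) / 2))) * Zc) = Zc"
  proof -
    have "\<bar>sqrt s\<bar> ^ DIM(real^'n) = s powr (real CARD('n) / 2)"
      using assms by (simp add: powr_half_sqrt[symmetric] powr_powr powr_realpow[symmetric])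
    then have "ennreal (\<bar>sqrt s\<bar> ^ DIM(real^'n)) * ennreal (s powr (- (real CARD('n) / 2))) = 1"
      using assms by (simp add: ennreal_mult[symmetric] powr_minus)
    then show ?thesis by (simp flip: mult.assoc)
  qed
  finally show ?thesis .
qed

text \<open>The lower bound for \<beta> reduces the claim to a product of one-dimensional Gaussians,
  and \<open>x\<^sup>2 \<ge> \<bar>x\<bar> - 1\<close> dominates each by two exponentials. The value
  of \<open>Zc\<close> is never computed.\<close>

lemma Zc_finite: "Zc < \<infinity>"
proof -
  obtain m where m: "m > 0" "\<And>x. m * norm x \<le> norm (\<beta> x)" by (rule \<beta>_lower) blast
  define k where "k = m\<^sup>2 / 4"
  have k: "k > 0" using m by (simp add: k_def)
  have one: "(\<integral>\<^sup>+x. ennreal (exp (- k * x\<^sup>2)) \<partial>lborel) < \<infinity>"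
  proof -
    have "ennreal (exp (- k * x\<^sup>2)) \<le> ennreal (exp k) *
       (ennreal (exp (- k * x)) * indicator {0..} x + ennreal (exp (- k * (- x))) * indicator {0..} (- x))" for x :: real
    proof -
      have "x\<^sup>2 \<ge> \<bar>x\<bar> - 1"
        using zero_le_power2[of "\<bar>x\<bar> - 1/2"] by (simp add: power2_eq_square algebra_simps)
      then have "k * (\<bar>x\<bar> - 1) \<le> k * x\<^sup>2" using k by (intro mult_left_mono) auto
      then have "exp (- k * x\<^sup>2) \<le> exp k * exp (- k * \<bar>x\<bar>)" by (simp add: algebra_simps flip: exp_add)
      then have "ennreal (exp (- k * x\<^sup>2)) \<le> ennreal (exp k) * ennreal (exp (- k * \<bar>x\<bar>))"
        by (simp add: ennreal_mult[symmetric])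
      also have "\<dots> \<le> ennreal (exp k) *
         (ennreal (exp (- k * x)) * indicator {0..} x + ennreal (exp (- k * (- x))) * indicator {0..} (- x))"
        by (intro mult_left_mono) (auto simp: indicator_def abs_if add_increasing2)
      finally show ?thesis .
    qed
    then have "(\<integral>\<^sup>+x. ennreal (exp (- k * x\<^sup>2)) \<partial>lborel) \<le> (\<integral>\<^sup>+x. ennreal (exp k) *
         (ennreal (exp (- k * x)) * indicator {0..} x + ennreal (exp (- k * (- x))) * indicator {0..} (- x)) \<partial>lborel)"
      by (intro nn_integral_mono)
    also have "\<dots> = ennreal (exp k) * ((\<integral>\<^sup>+x. ennreal (exp (- k * x)) * indicator {0..} x \<partial>lborel)
        + (\<integral>\<^sup>+x. ennreal (exp (- k * (0 - x))) * indicator {0..} (0 - x) \<partial>lborel))"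
      by (subst nn_integral_cmult nn_integral_add; simp)+
    also have "(\<integral>\<^sup>+x. ennreal (exp (- k * (0 - x))) * indicator {0..} (0 - x) \<partial>lborel)
        = (\<integral>\<^sup>+x. ennreal (exp (- k * x)) * indicator {0..} x \<partial>lborel)"
      by (rule nn_integral_lborel_reflect) measurable
    also have "ennreal (exp k) * (\<dots> + \<dots>) < \<infinity>"
      unfolding nn_integral_exp_atLeast[OF k] using k by (simp add: ennreal_mult_less_top flip: ennreal_plus)
    finally show ?thesis .
  qed
  have "Zc \<le> (\<integral>\<^sup>+z. (\<Prod>b\<in>Basis. ennreal (exp (- k * (z \<bullet> b)\<^sup>2))) \<partial>(lborel :: (real^'n) measure))"
    unfolding Zc_def
  proof (intro nn_integral_mono)
    fix z :: "real^'n"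
    have "(m * norm z)\<^sup>2 \<le> (norm (\<beta> z))\<^sup>2" using m by (intro power_mono) auto
    then have "exp (- (norm (\<beta> z))\<^sup>2 / 4) \<le> exp (- k * (norm z)\<^sup>2)"
      by (simp add: k_def power_mult_distrib)
    also have "(norm z)\<^sup>2 = (\<Sum>b\<in>Basis. (z \<bullet> b)\<^sup>2)"
      unfolding power2_norm_eq_inner by (subst euclidean_inner) (simp add: power2_eq_square)
    also have "exp (- k * (\<Sum>b\<in>Basis. (z \<bullet> b)\<^sup>2)) = (\<Prod>b\<in>Basis. exp (- k * (z \<bullet> b)\<^sup>2))"
      unfolding sum_distrib_left by (rule exp_sum) simp
    finally show "ennreal (exp (- (norm (\<beta> z))\<^sup>2 / 4)) \<le> (\<Prod>b\<in>Basis. ennreal (exp (- k * (z \<bullet> b)\<^sup>2)))"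
      by (simp add: prod_ennreal ennreal_leI)
  qed
  also have "\<dots> = (\<Prod>b\<in>(Basis :: (real^'n) set). (\<integral>\<^sup>+x. ennreal (exp (- k * x\<^sup>2)) \<partial>lborel))"
    by (rule nn_integral_lborel_prod) auto
  also have "\<dots> < \<infinity>"
  proof -
    obtain r where "r \<ge> 0" "(\<integral>\<^sup>+x. ennreal (exp (- k * x\<^sup>2)) \<partial>lborel) = ennreal r"
      using one by (cases "\<integral>\<^sup>+x. ennreal (exp (- k * x\<^sup>2)) \<partial>lborel") auto
    then show ?thesis by (simp only: prod_constant ennreal_power ennreal_less_top infinity_ennreal_def)
  qed
  finally show ?thesis .
qed

lemma Zc_pos: "Zc > 0"
proof (rule ccontr)
  assume "\<not> Zc > 0"
  then have "Zc = 0" by simp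
  then have "AE z in (lborel :: (real^'n) measure). ennreal (exp (- (norm (\<beta> z))\<^sup>2 / 4)) = 0"
    unfolding Zc_def by (subst (asm) nn_integral_0_iff_AE) auto
  then have "AE z in (lborel :: (real^'n) measure). False" by simp
  then show False by (simp add: AE_iff_null null_sets_def)
qed

text \<open>Completing the square in \<open>z\<close>: the product is a Gaussian in \<open>z\<close>
  with centre \<open>(t / (s + t)) x\<close> and time \<open>s t / (s + t)\<close>, times a factor
  independent of \<open>z\<close>.\<close>

lemma hk_convolution_pointwise:
  assumes "s > 0" "t > 0"
  shows "hk s (x - z) * hk t z = hk (s + t) x * hk (s * t / (s + t)) (z - (t / (s + t)) *\<^sub>R x)"
proof -
  let ?a = "- (real CARD('n) / 2)"
  let ?X = "\<beta> x \<bullet> \<beta> x" and ?Y = "\<beta> z \<bullet> \<beta> z" and ?B = "\<beta> x \<bullet> \<beta> z"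
  have 1: "s powr ?a * t powr ?a = (s + t) powr ?a * (s * t / (s + t)) powr ?a"
    using assms by (simp add: powr_mult[symmetric])
  have n1: "(norm (\<beta> (x - z)))\<^sup>2 = ?X - 2 * ?B + ?Y"
    by (simp add: \<beta>_diff power2_norm_eq_inner inner_diff_left inner_diff_right inner_commute)
  have n2: "(norm (\<beta> (z - (t / (s + t)) *\<^sub>R x)))\<^sup>2 = ?Y - 2 * (t / (s + t)) * ?B + (t / (s + t))\<^sup>2 * ?X"
    using norm_sq_expand[of "\<beta> z" "t / (s + t)" "\<beta> x"]
    by (simp add: \<beta>_diff \<beta>_scaleR power2_norm_eq_inner inner_commute)
  have "s + t \<noteq> 0" using assms by simp
  have 2: "(?X - 2 * ?B + ?Y) / (4 * s) + ?Y / (4 * t)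
      = ?X / (4 * (s + t)) + (?Y - 2 * (t / (s + t)) * ?B + (t / (s + t))\<^sup>2 * ?X) / (4 * (s * t / (s + t)))"
    using assms \<open>s + t \<noteq> 0\<close> by (simp add: divide_simps power2_eq_square) (simp add: algebra_simps)
  have ex: "exp (- (p + q)) = exp (- p) * exp (- q)" for p q :: real by (simp flip: exp_add)
  have "hk s (x - z) * hk t z = (s powr ?a * t powr ?a) * exp (- ((?X - 2 * ?B + ?Y) / (4 * s) + ?Y / (4 * t)))"
    unfolding hk_def unfolding n1 ex unfolding power2_norm_eq_inner by (simp only: minus_divide_left mult_ac)
  also have "\<dots> = hk (s + t) x * hk (s * t / (s + t)) (z - (t / (s + t)) *\<^sub>R x)"
    unfolding 1 2 hk_def unfolding n2 ex unfolding power2_norm_eq_inner by (simp only: minus_divide_left mult_ac)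
  finally show ?thesis .
qed

lemma hk_convolution:
  assumes "s > 0" "t > 0"
  shows "(\<integral>\<^sup>+z. ennreal (hk s (x - z)) * ennreal (hk t z) \<partial>lborel) = ennreal (hk (s + t) x) * Zc"
proof -
  have "(\<integral>\<^sup>+z. ennreal (hk s (x - z)) * ennreal (hk t z) \<partial>lborel)
      = (\<integral>\<^sup>+z. ennreal (hk (s + t) x) * ennreal (hk (s * t / (s + t)) (z - (t / (s + t)) *\<^sub>R x)) \<partial>lborel)"
    using hk_convolution_pointwise[OF assms]
    by (intro nn_integral_cong) (simp add: ennreal_mult[symmetric] hk_nonneg)
  also have "\<dots> = ennreal (hk (s + t) x) * (\<integral>\<^sup>+z. ennreal (hk (s * t / (s + t)) (z - (t / (s + t)) *\<^sub>R x)) \<partial>lborel)"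
    by (intro nn_integral_cmult) measurable
  also have "(\<integral>\<^sup>+z. ennreal (hk (s * t / (s + t)) (z - (t / (s + t)) *\<^sub>R x)) \<partial>lborel) = Zc"
    by (subst nn_integral_lborel_shift[of "\<lambda>z. ennreal (hk (s * t / (s + t)) z)"])
       (use assms in \<open>auto simp: hk_integral\<close>)
  finally show ?thesis .
qed

text \<open>The kernel of the inverse of \<open>l - L\<close>, normalised to mass
  \<open>1 / l\<close>. Values in \<open>ennreal\<close> let Tonelli's theorem be used without
  integrability and admit the pole at zero.\<close>

definition \<kappa> :: "real \<Rightarrow> real^'n \<Rightarrow> ennreal" where
  "\<kappa> l z = (\<integral>\<^sup>+s. indicator {0<..} s * (ennreal (exp (- l * s)) * ennreal (hk s z)) \<partial>lborel) / Zc"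

lemma \<kappa>_measurable [measurable]: "\<kappa> l \<in> borel_measurable borel"
  unfolding \<kappa>_def by measurable

lemma \<kappa>_yukawa:
  assumes "l > 0" "z \<noteq> 0"
  shows "\<kappa> l z = ennreal (yukawa l z) / Zc"
proof -
  have \<rho>: "(norm (\<beta> z))\<^sup>2 > 0" using assms by (simp add: \<beta>_eq_0_iff)
  have "(\<integral>\<^sup>+s. indicator {0<..} s * (ennreal (exp (- l * s)) * ennreal (hk s z)) \<partial>lborel)
      = (\<integral>\<^sup>+s. ennreal (yint (real CARD('n) / 2) l ((norm (\<beta> z))\<^sup>2) s) \<partial>lborel)"
  proof (intro nn_integral_cong)
    fix s :: real
    have "exp (- l * s - (norm (\<beta> z))\<^sup>2 / (4 * s)) = exp (- l * s) * exp (- (norm (\<beta> z))\<^sup>2 / (4 * s))"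
      by (simp flip: exp_add)
    then show "indicator {0<..} s * (ennreal (exp (- l * s)) * ennreal (hk s z))
        = ennreal (yint (real CARD('n) / 2) l ((norm (\<beta> z))\<^sup>2) s)"
      by (cases "s > 0") (simp_all add: yint_def hk_def ennreal_mult[symmetric] mult_ac)
  qed
  also have "\<dots> = ennreal (yukawa l z)"
    unfolding yukawa_def yuk_def using \<rho> assms
    by (intro nn_integral_eq_integral yint_integrable) (auto simp: yint_nonneg)
  finally show ?thesis by (simp add: \<kappa>_def)
qed

lemma \<kappa>_integral:
  assumes "l > 0"
  shows "(\<integral>\<^sup>+z. \<kappa> l z \<partial>lborel) = ennreal (1 / l)"
proof -
  have "(\<integral>\<^sup>+z. \<kappa> l z \<partial>lborel)
      = (\<integral>\<^sup>+z. (\<integral>\<^sup>+s. indicator {0<..} s * (ennreal (exp (- l * s)) * ennreal (hk s z)) \<partial>lborel) \<partial>lborel) / Zc"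
    unfolding \<kappa>_def by (intro nn_integral_divide) measurable
  also have "(\<integral>\<^sup>+z. (\<integral>\<^sup>+s. indicator {0<..} s * (ennreal (exp (- l * s)) * ennreal (hk s z)) \<partial>lborel) \<partial>(lborel :: (real^'n) measure))
      = (\<integral>\<^sup>+s. (\<integral>\<^sup>+z. indicator {0<..} s * (ennreal (exp (- l * s)) * ennreal (hk s z)) \<partial>lborel) \<partial>lborel)"
    by (rule lborel_pair.Fubini') measurable
  also have "\<dots> = (\<integral>\<^sup>+s. (ennreal (exp (- l * s)) * indicator {0<..} s) * Zc \<partial>lborel)"
  proof (intro nn_integral_cong)
    fix s :: real
    show "(\<integral>\<^sup>+z. indicator {0<..} s * (ennreal (exp (- l * s)) * ennreal (hk s z)) \<partial>lborel)
        = (ennreal (exp (- l * s)) * indicator {0<..} s) * Zc"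
      by (cases "s > 0") (simp_all add: nn_integral_cmult hk_integral)
  qed
  also have "\<dots> = (\<integral>\<^sup>+s. ennreal (exp (- l * s)) * indicator {0<..} s \<partial>lborel) * Zc"
    by (intro nn_integral_multc) measurable
  also have "(\<integral>\<^sup>+s. ennreal (exp (- l * s)) * indicator {0<..} s \<partial>lborel)
      = (\<integral>\<^sup>+s. ennreal (exp (- l * s)) * indicator {0..} s \<partial>lborel)"
  proof (rule nn_integral_cong_AE)
    have "AE s in lborel. s \<noteq> (0::real)" by (rule AE_lborel_singleton)
    then show "AE s in lborel. ennreal (exp (- l * s)) * indicator {0<..} s = ennreal (exp (- l * s)) * indicator {0..} s"
      by eventually_elim (auto simp: indicator_def)
  qed
  also have "\<dots> = ennreal (1 / l)" by (rule nn_integral_exp_atLeast[OF assms])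
  also have "ennreal (1 / l) * Zc / Zc = ennreal (1 / l)"
    using Zc_pos Zc_finite by (simp add: ennreal_mult_divide_eq)
  finally show ?thesis .
qed

text \<open>By the semigroup property both times add up to \<open>u = s + t\<close>, and integrating
  \<open>exp (- l * s - m * (u - s))\<close> over \<open>0 < s < u\<close> gives a difference of
  exponentials divided by \<open>m - l\<close>. The additive form avoids subtraction in
  \<open>ennreal\<close>.\<close>

lemma \<kappa>_convolution:
  assumes "0 < l" "l < m"
  shows "ennreal (m - l) * (\<integral>\<^sup>+z. \<kappa> l (x - z) * \<kappa> m z \<partial>lborel) + \<kappa> m x = \<kappa> l x"
proof -
  let ?e = "\<lambda>l s. indicator {0<..} s * ennreal (exp (- l * s))"
  let ?h = "\<lambda>s z. ennreal (hk s z)"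
  have K: "\<kappa> l z = (\<integral>\<^sup>+s. ?e l s * ?h s z \<partial>lborel) / Zc" for l z
    unfolding \<kappa>_def by (simp only: mult.assoc)
  have Z: "Zc \<noteq> 0" "Zc \<noteq> top" using Zc_pos Zc_finite by auto
  have "(\<integral>\<^sup>+z. \<kappa> l (x - z) * \<kappa> m z \<partial>lborel)
      = (\<integral>\<^sup>+z. (\<integral>\<^sup>+s. ?e l s * ?h s (x - z) \<partial>lborel) * (\<integral>\<^sup>+t. ?e m t * ?h t z \<partial>lborel) \<partial>lborel) / Zc / Zc"
  proof -
    have "\<kappa> l (x - z) * \<kappa> m z = (\<integral>\<^sup>+s. ?e l s * ?h s (x - z) \<partial>lborel) * (\<integral>\<^sup>+t. ?e m t * ?h t z \<partial>lborel) / Zc / Zc" for z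
      unfolding K divide_ennreal_def by (simp only: mult_ac)
    then show ?thesis by (simp add: nn_integral_divide)
  qed
  also have "(\<integral>\<^sup>+z. (\<integral>\<^sup>+s. ?e l s * ?h s (x - z) \<partial>lborel) * (\<integral>\<^sup>+t. ?e m t * ?h t z \<partial>lborel) \<partial>lborel)
      = (\<integral>\<^sup>+z. (\<integral>\<^sup>+s. (\<integral>\<^sup>+t. (?e l s * ?e m t) * (?h s (x - z) * ?h t z) \<partial>lborel) \<partial>lborel) \<partial>lborel)"
  proof (intro nn_integral_cong)
    fix z
    have "(\<integral>\<^sup>+t. (?e l s * ?e m t) * (?h s (x - z) * ?h t z) \<partial>lborel)
        = (?e l s * ?h s (x - z)) * (\<integral>\<^sup>+t. ?e m t * ?h t z \<partial>lborel)" for s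
      by (subst nn_integral_cmult[symmetric]) (auto intro!: nn_integral_cong simp: mult_ac)
    then show "(\<integral>\<^sup>+s. ?e l s * ?h s (x - z) \<partial>lborel) * (\<integral>\<^sup>+t. ?e m t * ?h t z \<partial>lborel)
        = (\<integral>\<^sup>+s. (\<integral>\<^sup>+t. (?e l s * ?e m t) * (?h s (x - z) * ?h t z) \<partial>lborel) \<partial>lborel)"
      by (simp add: nn_integral_multc)
  qed
  also have "\<dots> = (\<integral>\<^sup>+s. (\<integral>\<^sup>+z. (\<integral>\<^sup>+t. (?e l s * ?e m t) * (?h s (x - z) * ?h t z) \<partial>lborel) \<partial>lborel) \<partial>lborel)"
    by (rule lborel_pair.Fubini') measurable
  also have "\<dots> = (\<integral>\<^sup>+s. (\<integral>\<^sup>+t. (\<integral>\<^sup>+z. (?e l s * ?e m t) * (?h s (x - z) * ?h t z) \<partial>lborel) \<partial>lborel) \<partial>lborel)"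
    by (intro nn_integral_cong, rule lborel_pair.Fubini') measurable
  also have "\<dots> = (\<integral>\<^sup>+s. (\<integral>\<^sup>+t. (?e l s * ?e m t) * (?h (s + t) x * Zc) \<partial>lborel) \<partial>lborel)"
  proof (intro nn_integral_cong)
    fix s t :: real
    show "(\<integral>\<^sup>+z. (?e l s * ?e m t) * (?h s (x - z) * ?h t z) \<partial>lborel) = (?e l s * ?e m t) * (?h (s + t) x * Zc)"
      by (subst nn_integral_cmult) (auto simp: indicator_def hk_convolution)
  qed
  also have "\<dots> = (\<integral>\<^sup>+s. (\<integral>\<^sup>+u. (?e l s * ?e m (u - s)) * (?h u x * Zc) \<partial>lborel) \<partial>lborel)"
  proof (rule nn_integral_cong)
    fix s :: real
    show "(\<integral>\<^sup>+t. (?e l s * ?e m t) * (?h (s + t) x * Zc) \<partial>lborel) = (\<integral>\<^sup>+u. (?e l s * ?e m (u - s)) * (?h u x * Zc) \<partial>lborel)"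
      using nn_integral_lborel_shift[of "\<lambda>t. (?e l s * ?e m t) * (?h (s + t) x * Zc)" s] by simp
  qed
  also have "\<dots> = (\<integral>\<^sup>+u. (\<integral>\<^sup>+s. (?e l s * ?e m (u - s)) * (?h u x * Zc) \<partial>lborel) \<partial>lborel)"
    by (rule lborel_pair.Fubini') measurable
  finally have conv: "(\<integral>\<^sup>+z. \<kappa> l (x - z) * \<kappa> m z \<partial>lborel)
      = (\<integral>\<^sup>+u. (\<integral>\<^sup>+s. (?e l s * ?e m (u - s)) * (?h u x * Zc) \<partial>lborel) \<partial>lborel) / Zc / Zc" .
  have inner: "ennreal (m - l) * (\<integral>\<^sup>+s. (?e l s * ?e m (u - s)) * (?h u x * Zc) \<partial>lborel)
      = (?h u x * Zc) * (indicator {0<..} u * ennreal (exp (- l * u) - exp (- m * u)))" for u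
  proof (cases "u > 0")
    case True
    have "?e l s * ?e m (u - s) = ennreal (exp (- m * u)) * (ennreal (exp ((m - l) * s)) * indicator {0<..<u} s)" for s
      by (auto simp: indicator_def ennreal_mult[symmetric] exp_add[symmetric] algebra_simps)
    then have "(\<integral>\<^sup>+s. (?e l s * ?e m (u - s)) * (?h u x * Zc) \<partial>lborel)
        = (\<integral>\<^sup>+s. (ennreal (exp (- m * u)) * (ennreal (exp ((m - l) * s)) * indicator {0<..<u} s)) * (?h u x * Zc) \<partial>lborel)"
      by simp
    also have "\<dots> = ennreal (exp (- m * u)) * (\<integral>\<^sup>+s. ennreal (exp ((m - l) * s)) * indicator {0<..<u} s \<partial>lborel) * (?h u x * Zc)"
      by (simp add: nn_integral_multc nn_integral_cmult)
    finally have "ennreal (m - l) * (\<integral>\<^sup>+s. (?e l s * ?e m (u - s)) * (?h u x * Zc) \<partial>lborel)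
        = ennreal (exp (- m * u)) * (ennreal (m - l) * (\<integral>\<^sup>+s. ennreal (exp ((m - l) * s)) * indicator {0<..<u} s \<partial>lborel)) * (?h u x * Zc)"
      by (simp add: mult_ac)
    also have "\<dots> = ennreal (exp (- m * u)) * ennreal (exp ((m - l) * u) - 1) * (?h u x * Zc)"
      using nn_integral_exp_Icc[OF assms(2) True] by simp
    also have "ennreal (exp (- m * u)) * ennreal (exp ((m - l) * u) - 1) = ennreal (exp (- l * u) - exp (- m * u))"
      using True assms by (simp add: ennreal_mult[symmetric] algebra_simps flip: exp_add)
    finally show ?thesis using True by (simp add: mult_ac)
  next
    case False
    then have "?e l s * ?e m (u - s) = 0" for s by (auto simp: indicator_def)
    then have "(\<integral>\<^sup>+s. (?e l s * ?e m (u - s)) * (?h u x * Zc) \<partial>lborel) = (\<integral>\<^sup>+s. 0 \<partial>(lborel :: real measure))"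
      by (simp only: mult_zero_left)
    then show ?thesis using False by (simp only:) simp
  qed
  have "ennreal (m - l) * (\<integral>\<^sup>+z. \<kappa> l (x - z) * \<kappa> m z \<partial>lborel)
     = (\<integral>\<^sup>+u. ennreal (m - l) * (\<integral>\<^sup>+s. (?e l s * ?e m (u - s)) * (?h u x * Zc) \<partial>lborel) \<partial>lborel) / Zc / Zc"
    unfolding conv by (subst nn_integral_cmult) (auto simp: ennreal_times_divide)
  also have "\<dots> = (\<integral>\<^sup>+u. (?h u x * (indicator {0<..} u * ennreal (exp (- l * u) - exp (- m * u)))) * Zc \<partial>lborel) / Zc / Zc"
    unfolding inner by (simp add: mult_ac)
  also have "\<dots> = (\<integral>\<^sup>+u. ?h u x * (indicator {0<..} u * ennreal (exp (- l * u) - exp (- m * u))) \<partial>lborel) / Zc"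
    using Z by (subst nn_integral_multc) (auto simp: ennreal_mult_divide_eq)
  finally have "ennreal (m - l) * (\<integral>\<^sup>+z. \<kappa> l (x - z) * \<kappa> m z \<partial>lborel) + \<kappa> m x
     = ((\<integral>\<^sup>+u. ?h u x * (indicator {0<..} u * ennreal (exp (- l * u) - exp (- m * u))) \<partial>lborel)
        + (\<integral>\<^sup>+u. ?e m u * ?h u x \<partial>lborel)) / Zc"
    by (simp add: K add_divide_distrib_ennreal)
  also have "(\<integral>\<^sup>+u. ?h u x * (indicator {0<..} u * ennreal (exp (- l * u) - exp (- m * u))) \<partial>lborel)
        + (\<integral>\<^sup>+u. ?e m u * ?h u x \<partial>lborel)
     = (\<integral>\<^sup>+u. ?h u x * (indicator {0<..} u * ennreal (exp (- l * u) - exp (- m * u))) + ?e m u * ?h u x \<partial>lborel)"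
    by (rule nn_integral_add[symmetric]) measurable
  also have "\<dots> = (\<integral>\<^sup>+u. ?e l u * ?h u x \<partial>lborel)"
  proof (intro nn_integral_cong)
    fix u :: real
    show "?h u x * (indicator {0<..} u * ennreal (exp (- l * u) - exp (- m * u))) + ?e m u * ?h u x = ?e l u * ?h u x"
    proof (cases "u > 0")
      case True
      then have "exp (- m * u) \<le> exp (- l * u)" using assms by simp
      then have "ennreal (exp (- l * u)) = ennreal (exp (- l * u) - exp (- m * u)) + ennreal (exp (- m * u))"
        by (simp flip: ennreal_plus)
      then show ?thesis using True by (simp add: distrib_left mult_ac)
    qed simp
  qed
  finally show ?thesis by (simp add: K)
qed

end

section \<open>The resolvent operator and absorption on a set\<close>

context elliptic_frame
begin

lemma \<kappa>_convolution':
  assumes "0 < l" "l < m"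
  shows "ennreal (m - l) * (\<integral>\<^sup>+z. \<kappa> m (x - z) * \<kappa> l z \<partial>lborel) + \<kappa> m x = \<kappa> l x"
proof -
  have "(\<integral>\<^sup>+z. \<kappa> m (x - z) * \<kappa> l z \<partial>lborel) = (\<integral>\<^sup>+z. \<kappa> l (x - z) * \<kappa> m z \<partial>lborel)"
    using nn_integral_lborel_reflect[of "\<lambda>z. \<kappa> m (x - z) * \<kappa> l z" x] by (simp add: mult.commute)
  then show ?thesis using \<kappa>_convolution[OF assms] by simp
qed

definition Res :: "real \<Rightarrow> (real^'n \<Rightarrow> ennreal) \<Rightarrow> real^'n \<Rightarrow> ennreal" where
  "Res l g x = (\<integral>\<^sup>+z. \<kappa> l (x - z) * g z \<partial>lborel)"

lemma Res_measurable [measurable]: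
  assumes [measurable]: "g \<in> borel_measurable borel"
  shows "Res l g \<in> borel_measurable borel"
  unfolding Res_def by measurable

lemma Res_mono: "(\<And>z. g z \<le> h z) \<Longrightarrow> Res l g x \<le> Res l h x"
  unfolding Res_def by (intro nn_integral_mono mult_left_mono) auto

lemma Res_add:
  assumes [measurable]: "g \<in> borel_measurable borel" "h \<in> borel_measurable borel"
  shows "Res l (\<lambda>z. g z + h z) x = Res l g x + Res l h x"
  unfolding Res_def distrib_left by (intro nn_integral_add) measurable

lemma Res_cmult:
  assumes [measurable]: "g \<in> borel_measurable borel"
  shows "Res l (\<lambda>z. a * g z) x = a * Res l g x"
  unfolding Res_def by (subst nn_integral_cmult[symmetric]) (auto simp: mult_ac)

lemma \<kappa>_integral_reflect: "l > 0 \<Longrightarrow> (\<integral>\<^sup>+z. \<kappa> l (x - z) \<partial>lborel) = ennreal (1 / l)"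
  by (subst nn_integral_lborel_reflect) (auto simp: \<kappa>_integral)

lemma Res_const:
  assumes "l > 0"
  shows "Res l (\<lambda>z. a) x = ennreal (1 / l) * a"
  unfolding Res_def by (subst nn_integral_multc) (auto simp: \<kappa>_integral_reflect assms)

lemma Res_le_const:
  assumes "l > 0" "\<And>z. g z \<le> a"
  shows "Res l g x \<le> ennreal (1 / l) * a"
  using Res_mono[of g "\<lambda>z. a" l x] assms by (simp add: Res_const)

lemma Res_Res:
  assumes [measurable]: "g \<in> borel_measurable borel"
  shows "Res l (Res m g) x = (\<integral>\<^sup>+y. (\<integral>\<^sup>+z. \<kappa> l (x - y - z) * \<kappa> m z \<partial>lborel) * g y \<partial>lborel)"
proof -
  have "Res l (Res m g) x = (\<integral>\<^sup>+z. (\<integral>\<^sup>+y. \<kappa> l (x - z) * (\<kappa> m (z - y) * g y) \<partial>lborel) \<partial>lborel)"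
    unfolding Res_def by (simp add: nn_integral_cmult)
  also have "\<dots> = (\<integral>\<^sup>+y. (\<integral>\<^sup>+z. \<kappa> l (x - z) * (\<kappa> m (z - y) * g y) \<partial>lborel) \<partial>lborel)"
    by (rule lborel_pair.Fubini') measurable
  also have "\<dots> = (\<integral>\<^sup>+y. (\<integral>\<^sup>+z. \<kappa> l (x - y - z) * \<kappa> m z \<partial>lborel) * g y \<partial>lborel)"
  proof (rule nn_integral_cong)
    fix y
    have "(\<integral>\<^sup>+z. \<kappa> l (x - z) * (\<kappa> m (z - y) * g y) \<partial>lborel) = (\<integral>\<^sup>+z. \<kappa> l (x - z) * \<kappa> m (z - y) \<partial>lborel) * g y"
      by (simp add: mult.assoc[symmetric] nn_integral_multc)
    also have "(\<integral>\<^sup>+z. \<kappa> l (x - z) * \<kappa> m (z - y) \<partial>lborel) = (\<integral>\<^sup>+z. \<kappa> l (x - y - z) * \<kappa> m z \<partial>lborel)"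
      using nn_integral_lborel_shift[of "\<lambda>z. \<kappa> l (x - y - z) * \<kappa> m z" y] by simp
    finally show "(\<integral>\<^sup>+z. \<kappa> l (x - z) * (\<kappa> m (z - y) * g y) \<partial>lborel)
        = (\<integral>\<^sup>+z. \<kappa> l (x - y - z) * \<kappa> m z \<partial>lborel) * g y" .
  qed
  finally show ?thesis .
qed

text \<open>The kernel identities integrated against \<open>g\<close>. Both orders of composition
  are recorded: \<open>Res l\<close> outside for representing potentials with parameter
  \<open>l\<close>, \<open>Res m\<close> outside for changing the parameter to
  \<open>m\<close>.\<close>

lemma resolvent_identity:
  assumes [measurable]: "g \<in> borel_measurable borel" and lm: "0 < l" "l < m"
  shows "ennreal (m - l) * Res l (Res m g) x + Res m g x = Res l g x"
    and "ennreal (m - l) * Res m (Res l g) x + Res m g x = Res l g x"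
proof -
  have conv: "ennreal (m - l) * (\<integral>\<^sup>+y. f y * g y \<partial>lborel) + Res m g x = Res l g x"
    if [measurable]: "f \<in> borel_measurable borel"
      and f: "\<And>y. ennreal (m - l) * f y + \<kappa> m (x - y) = \<kappa> l (x - y)" for f
  proof -
    have "ennreal (m - l) * (\<integral>\<^sup>+y. f y * g y \<partial>lborel) + Res m g x
        = (\<integral>\<^sup>+y. ennreal (m - l) * (f y * g y) + \<kappa> m (x - y) * g y \<partial>lborel)"
      unfolding Res_def by (subst nn_integral_add) (auto simp: nn_integral_cmult)
    also have "\<dots> = Res l g x"
      unfolding Res_def f[symmetric] by (intro nn_integral_cong) (simp add: distrib_left distrib_right mult_ac)
    finally show ?thesis .
  qed
  show "ennreal (m - l) * Res l (Res m g) x + Res m g x = Res l g x"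
    unfolding Res_Res[OF assms(1)] by (rule conv) (measurable, rule \<kappa>_convolution[OF lm])
  show "ennreal (m - l) * Res m (Res l g) x + Res m g x = Res l g x"
    unfolding Res_Res[OF assms(1)] by (rule conv) (measurable, rule \<kappa>_convolution'[OF lm])
qed

text \<open>
  The solution \<open>w\<close> of \<open>(\<lambda> - L + N 1\<^sub>K) w = F\<close> differs from \<open>Res l F\<close> by the potential of a density
  living on \<open>K\<close>. It is the fixed point of
  \<open>h \<mapsto> Res (l + N) (F + N 1\<^bsub>-K\<^esub> h)\<close>.
\<close>

lemma penalised_solution:
  assumes [measurable]: "F \<in> borel_measurable borel" "K \<in> sets borel"
    and "l > 0" "N > 0" "C \<ge> 0" and FC: "\<And>z. F z \<le> ennreal C"
  obtains w where "w \<in> borel_measurable borel" "\<And>x. w x \<le> ennreal (C / l)"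
    "\<And>x. Res l F x = w x + Res l (\<lambda>z. ennreal N * indicator K z * w z) x"
    "\<And>m x. l < m \<Longrightarrow> m \<le> N \<Longrightarrow> w x \<le> ennreal (C / m) + ennreal m * Res m (\<lambda>z. indicator (- K) z * w z) x"
proof -
  \<comment> \<open>Adding \<open>N * w\<close> on the complement of \<open>K\<close> to both sides
    of the equation leaves the constant absorption \<open>l + N\<close> on the left and a
    nonnegative source on the right, so \<open>T\<close> is monotone and can be iterated from
    zero.\<close>
  define T where "T h = Res (l + N) (\<lambda>z. F z + ennreal N * indicator (- K) z * h z)" for h
  have Tm [measurable]: "T h \<in> borel_measurable borel" if [measurable]: "h \<in> borel_measurable borel" for h
    unfolding T_def by measurable
  have Tmono: "T g x \<le> T h x" if "\<And>z. g z \<le> h z" for g h x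
    unfolding T_def by (intro Res_mono add_left_mono mult_left_mono that) auto
  define W where "W i = (T ^^ i) (\<lambda>z. 0)" for i
  have WS: "W (Suc i) = T (W i)" for i by (simp add: W_def)
  have Wm [measurable]: "W i \<in> borel_measurable borel" for i
    by (induction i) (simp_all add: WS, simp add: W_def)
  have Winc: "W i x \<le> W (Suc i) x" for i x
  proof (induction i arbitrary: x)
    case (Suc i)
    then show ?case unfolding WS[of "Suc i"] by (subst WS) (rule Tmono)
  qed (simp add: W_def)
  then have Wincseq: "incseq (\<lambda>i. W i x)" for x by (rule incseq_SucI)
  have Wbound: "W i x \<le> ennreal (C / l)" for i x
  proof (induction i arbitrary: x)
    case (Suc i)
    have "W (Suc i) x \<le> Res (l + N) (\<lambda>z. ennreal C + ennreal N * ennreal (C / l)) x"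
      unfolding WS T_def
    proof (rule Res_mono)
      fix z
      have "ennreal N * indicator (- K) z * W i z \<le> ennreal N * ennreal (C / l)"
        using Suc[of z] by (cases "z \<in> K") (auto intro: mult_left_mono)
      then show "F z + ennreal N * indicator (- K) z * W i z \<le> ennreal C + ennreal N * ennreal (C / l)"
        by (intro add_mono FC)
    qed
    also have "\<dots> = ennreal (1 / (l + N)) * (ennreal C + ennreal N * ennreal (C / l))"
      using assms by (intro Res_const) auto
    also have "\<dots> = ennreal (1 / (l + N) * (C + N * (C / l)))"
        using assms by (simp add: ennreal_mult[symmetric] ennreal_plus[symmetric] del: ennreal_plus)
    \<comment> \<open>The constant \<open>C / l\<close> is reproduced by the iteration, hence the
      bound persists.\<close>
    also have "1 / (l + N) * (C + N * (C / l)) = C / l"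
      using assms by (simp add: divide_simps) (simp add: algebra_simps)
    finally show ?case .
  qed (simp add: W_def)
  define w where "w x = (SUP i. W i x)" for x
  have wm [measurable]: "w \<in> borel_measurable borel" unfolding w_def by measurable
  have wbound: "w x \<le> ennreal (C / l)" for x unfolding w_def by (intro SUP_least Wbound)
  have "T w x = w x" for x
  proof -
    have "T w x = (\<integral>\<^sup>+z. (SUP i. \<kappa> (l + N) (x - z) * (F z + ennreal N * indicator (- K) z * W i z)) \<partial>lborel)"
      unfolding T_def Res_def w_def
      by (intro nn_integral_cong) (simp add: SUP_mult_left_ennreal ennreal_SUP_add_right)
    also have "\<dots> = (SUP i. (\<integral>\<^sup>+z. \<kappa> (l + N) (x - z) * (F z + ennreal N * indicator (- K) z * W i z) \<partial>lborel))"
      by (intro nn_integral_monotone_convergence_SUP)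
         (auto simp: incseq_def le_fun_def intro!: mult_left_mono add_left_mono monoD[OF Wincseq, unfolded mono_def])
    also have "\<dots> = (SUP i. W (Suc i) x)" by (simp add: WS T_def Res_def)
    also have "\<dots> = w x"
      unfolding w_def
      by (intro antisym SUP_least SUP_mono) (auto intro: Winc SUP_upper)
    finally show ?thesis .
  qed
  then have w: "w x = Res (l + N) (\<lambda>z. F z + ennreal N * indicator (- K) z * w z) x" for x by (simp add: T_def)
  have fin: "Res l (\<lambda>z. ennreal N * indicator A z * w z) x < \<infinity>" if "l > 0" for A x l
  proof -
    have "Res l (\<lambda>z. ennreal N * indicator A z * w z) x \<le> ennreal (1 / l) * (ennreal N * ennreal (C / l'))" if "\<And>x. w x \<le> ennreal (C / l')" for l'
      by (rule Res_le_const[OF \<open>l > 0\<close>]) (use that in \<open>auto simp: indicator_def intro!: mult_left_mono\<close>)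
    from this[OF wbound] show ?thesis
      by (rule le_less_trans) (simp add: ennreal_mult_less_top)
  qed
  \<comment> \<open>The potential of the whole source \<open>?g\<close> is computed once by
    additivity and once by the resolvent identity, in which \<open>Res (l + N) ?g\<close> is
    \<open>w\<close>; the finite common term \<open>?A\<close> cancels.\<close>
  have id: "Res l F x = w x + Res l (\<lambda>z. ennreal N * indicator K z * w z) x" for x
  proof -
    let ?g = "\<lambda>z. F z + ennreal N * indicator (- K) z * w z"
    let ?A = "Res l (\<lambda>z. ennreal N * indicator (- K) z * w z) x"
    let ?B = "Res l (\<lambda>z. ennreal N * indicator K z * w z) x"
    have "Res l F x + ?A = Res l ?g x" by (intro Res_add[symmetric]) measurable
    also have "\<dots> = ennreal N * Res l (Res (l + N) ?g) x + Res (l + N) ?g x"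
      using resolvent_identity(1)[of ?g l "l + N" x] assms by simp
    also have "Res (l + N) ?g = w" by (rule ext) (rule w[symmetric])
    also have "ennreal N * Res l w x = Res l (\<lambda>z. ennreal N * w z) x" by (intro Res_cmult[symmetric]) measurable
    also have "(\<lambda>z. ennreal N * w z) = (\<lambda>z. ennreal N * indicator K z * w z + ennreal N * indicator (- K) z * w z)"
      by (auto simp: indicator_def)
    also have "Res l \<dots> x = ?B + ?A" by (intro Res_add) measurable
    finally have "?A + Res l F x = ?A + (w x + ?B)" by (simp add: ac_simps)
    then show ?thesis using fin[OF \<open>l > 0\<close>, of "- K" x] by (simp only: ennreal_add_left_cancel) auto
  qed
  \<comment> \<open>With parameter \<open>m\<close> the source is \<open>F + (m - l) w\<close> minus
    the absorption. As \<open>m - l \<le> N\<close>, the absorption outweighs the new source on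
    \<open>K\<close>, so only the part off \<open>K\<close> remains.\<close>
  have le: "w x \<le> ennreal (C / m) + ennreal m * Res m (\<lambda>z. indicator (- K) z * w z) x" if m: "l < m" "m \<le> N" for m x
  proof -
    let ?\<nu> = "\<lambda>z. ennreal N * indicator K z * w z"
    have m0: "m > 0" using m \<open>l > 0\<close> by simp
    let ?X = "ennreal (m - l) * Res m (Res l ?\<nu>) x"
    have Rl\<nu>: "Res l ?\<nu> z \<le> ennreal (1 / l) * (ennreal N * ennreal (C / l))" for z
      by (rule Res_le_const[OF \<open>l > 0\<close>]) (use wbound in \<open>auto simp: indicator_def intro!: mult_left_mono\<close>)
    have X: "?X < \<infinity>"
    proof -
      have "Res m (Res l ?\<nu>) x \<le> ennreal (1 / m) * (ennreal (1 / l) * (ennreal N * ennreal (C / l)))"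
        by (rule Res_le_const[OF m0 Rl\<nu>])
      also have "\<dots> < \<infinity>" by (simp add: ennreal_mult_less_top)
      finally show ?thesis by (simp add: ennreal_mult_less_top)
    qed
    have "w x + (?X + Res m ?\<nu> x) = w x + Res l ?\<nu> x"
      using resolvent_identity(2)[of ?\<nu> l m x] m assms by simp
    also have "\<dots> = Res l F x" using id by simp
    also have "\<dots> = ennreal (m - l) * Res m (Res l F) x + Res m F x"
      using resolvent_identity(2)[of F l m x] m assms by simp
    also have "Res l F = (\<lambda>z. w z + Res l ?\<nu> z)" using id by auto
    also have "Res m (\<lambda>z. w z + Res l ?\<nu> z) x = Res m w x + Res m (Res l ?\<nu>) x" by (intro Res_add) measurable
    finally have "?X + (w x + Res m ?\<nu> x) = ?X + (Res m F x + ennreal (m - l) * Res m w x)"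
      by (simp add: distrib_left ac_simps)
    then have eq: "w x + Res m ?\<nu> x = Res m F x + ennreal (m - l) * Res m w x"
      using X by (simp only: ennreal_add_left_cancel) auto
    let ?Y = "ennreal (m - l) * Res m (\<lambda>z. indicator K z * w z) x"
    have "?Y = Res m (\<lambda>z. ennreal (m - l) * (indicator K z * w z)) x" by (intro Res_cmult[symmetric]) measurable
    also have "\<dots> \<le> Res m ?\<nu> x"
      using m \<open>l > 0\<close> by (intro Res_mono) (auto simp: indicator_def intro!: mult_right_mono ennreal_leI)
    finally have Y: "?Y \<le> Res m ?\<nu> x" .
    then have Yfin: "?Y < \<infinity>" using fin[OF m0, of K x] by simp
    have split: "Res m w x = Res m (\<lambda>z. indicator K z * w z) x + Res m (\<lambda>z. indicator (- K) z * w z) x"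
    proof -
      have "w = (\<lambda>z. indicator K z * w z + indicator (- K) z * w z)" by (auto simp: indicator_def)
      then have "Res m w x = Res m (\<lambda>z. indicator K z * w z + indicator (- K) z * w z) x" by metis
      then show ?thesis by (simp add: Res_add)
    qed
    have "?Y + w x \<le> w x + Res m ?\<nu> x" using Y by (simp add: add.commute[of ?Y] add_left_mono)
    also have "\<dots> = ?Y + (Res m F x + ennreal (m - l) * Res m (\<lambda>z. indicator (- K) z * w z) x)"
      unfolding eq split distrib_left by (simp add: ac_simps)
    finally have "w x \<le> Res m F x + ennreal (m - l) * Res m (\<lambda>z. indicator (- K) z * w z) x"
      using Yfin by (simp only: ennreal_add_left_cancel_le) auto
    also have "\<dots> \<le> ennreal (1 / m) * ennreal C + ennreal m * Res m (\<lambda>z. indicator (- K) z * w z) x"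
      using m \<open>l > 0\<close> by (intro add_mono Res_le_const FC mult_right_mono ennreal_leI) auto
    also have "ennreal (1 / m) * ennreal C = ennreal (C / m)" using m0 \<open>C \<ge> 0\<close> by (simp flip: ennreal_mult)
    finally show ?thesis .
  qed
  show ?thesis by (rule that[OF wm wbound id le])
qed

end

section \<open>Scaling, and smallness at the boundary\<close>

context elliptic_frame
begin

text \<open>Parabolic scaling: substitute \<open>r\<^sup>2 * s\<close> for the time.\<close>

lemma \<kappa>_scale:
  assumes "r > 0"
  shows "\<kappa> (1 / r\<^sup>2) (r *\<^sub>R z) = ennreal (r\<^sup>2 / r ^ CARD('n)) * \<kappa> 1 z"
proof -
  let ?g = "\<lambda>l z s. indicator {0<..} s * (ennreal (exp (- l * s)) * ennreal (hk s z))"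
  have "(\<integral>\<^sup>+s. ?g (1 / r\<^sup>2) (r *\<^sub>R z) s \<partial>lborel) = ennreal \<bar>r\<^sup>2\<bar> * (\<integral>\<^sup>+s. ?g (1 / r\<^sup>2) (r *\<^sub>R z) (0 + r\<^sup>2 * s) \<partial>lborel)"
    using assms by (intro nn_integral_real_affine) auto
  also have "(\<lambda>s. ?g (1 / r\<^sup>2) (r *\<^sub>R z) (0 + r\<^sup>2 * s)) = (\<lambda>s. ennreal (1 / r ^ CARD('n)) * ?g 1 z s)"
  proof
    fix s
    show "?g (1 / r\<^sup>2) (r *\<^sub>R z) (0 + r\<^sup>2 * s) = ennreal (1 / r ^ CARD('n)) * ?g 1 z s"
    proof (cases "s > 0")
      case True
      have "(r\<^sup>2) powr (- (real CARD('n) / 2)) = (r powr 2) powr (- (real CARD('n) / 2))"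
        using assms by simp
      also have "\<dots> = r powr (2 * (- (real CARD('n) / 2)))" by (rule powr_powr)
      also have "2 * (- (real CARD('n) / 2)) = - real CARD('n)" by simp
      also have "r powr (- real CARD('n)) = 1 / r ^ CARD('n)"
        using assms by (simp only: powr_minus powr_realpow divide_inverse mult_1)
      finally have "hk (r\<^sup>2 * s) (r *\<^sub>R z) = 1 / r ^ CARD('n) * hk s z"
        using assms True by (simp add: hk_def \<beta>_scaleR power_mult_distrib powr_mult)
      then show ?thesis using True assms
        by (simp add: ennreal_mult[symmetric] hk_nonneg)
    next
      case False
      then have "\<not> 0 < r\<^sup>2 * s" using assms by (simp add: zero_less_mult_iff)
      then show ?thesis using False by simp
    qed
  qed
  also have "(\<integral>\<^sup>+s. ennreal (1 / r ^ CARD('n)) * ?g 1 z s \<partial>lborel) = ennreal (1 / r ^ CARD('n)) * (\<integral>\<^sup>+s. ?g 1 z s \<partial>lborel)"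
    by (intro nn_integral_cmult) measurable
  finally have "(\<integral>\<^sup>+s. ?g (1 / r\<^sup>2) (r *\<^sub>R z) s \<partial>lborel) = ennreal (r\<^sup>2 / r ^ CARD('n)) * (\<integral>\<^sup>+s. ?g 1 z s \<partial>lborel)"
    using assms by (simp add: mult.assoc[symmetric] ennreal_mult[symmetric])
  then show ?thesis unfolding \<kappa>_def by (simp add: ennreal_times_divide)
qed

lemma Res_scale:
  assumes [measurable]: "h \<in> borel_measurable borel" and "r > 0"
  shows "ennreal (1 / r\<^sup>2) * Res (1 / r\<^sup>2) h y = (\<integral>\<^sup>+z. \<kappa> 1 z * h (y - r *\<^sub>R z) \<partial>lborel)"
proof -
  let ?m = "1 / r\<^sup>2"
  have "Res ?m h y = (\<integral>\<^sup>+z. \<kappa> ?m z * h (y - z) \<partial>lborel)"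
    unfolding Res_def using nn_integral_lborel_reflect[of "\<lambda>z. \<kappa> ?m z * h (y - z)" y] by simp
  also have "\<dots> = ennreal (\<bar>r\<bar> ^ DIM(real^'n)) * (\<integral>\<^sup>+z. \<kappa> ?m (0 + r *\<^sub>R z) * h (y - (0 + r *\<^sub>R z)) \<partial>lborel)"
    using assms by (intro nn_integral_lborel_affine) auto
  also have "(\<integral>\<^sup>+z. \<kappa> ?m (0 + r *\<^sub>R z) * h (y - (0 + r *\<^sub>R z)) \<partial>lborel)
      = ennreal (r\<^sup>2 / r ^ CARD('n)) * (\<integral>\<^sup>+z. \<kappa> 1 z * h (y - r *\<^sub>R z) \<partial>lborel)"
    using assms by (simp add: \<kappa>_scale nn_integral_cmult mult.assoc)
  finally show ?thesis
    using assms by (simp add: mult.assoc[symmetric] ennreal_mult[symmetric])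
qed

text \<open>After rescaling by \<open>r = 1 / sqrt m\<close> the operator \<open>m * Res m\<close>
  averages over this probability measure. It serves as approximate identity and for estimates at
  scale \<open>r\<close>.\<close>

definition yprob :: "(real^'n) measure" where
  "yprob = density lborel (\<kappa> 1)"

lemma sets_yprob [simp, measurable_cong]: "sets yprob = sets borel"
  by (simp add: yprob_def)

lemma space_yprob [simp]: "space yprob = UNIV"
  by (simp add: yprob_def)

lemma emeasure_yprob_UNIV: "emeasure yprob UNIV = 1"
  by (simp add: yprob_def emeasure_density \<kappa>_integral)

lemma nn_integral_yprob:
  assumes [measurable]: "h \<in> borel_measurable borel"
  shows "(\<integral>\<^sup>+z. h z \<partial>yprob) = (\<integral>\<^sup>+z. \<kappa> 1 z * h z \<partial>lborel)"
  by (simp add: yprob_def nn_integral_density)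

lemma finite_yprob: "finite_measure yprob"
  by (rule finite_measureI) (simp add: emeasure_yprob_UNIV)

lemma yprob_tail:
  assumes "\<delta> > 0"
  obtains R where "R > 0" "emeasure yprob {z. norm z \<ge> R} \<le> ennreal \<delta>"
proof -
  have "(\<lambda>i. emeasure yprob {z. norm z \<ge> real i}) \<longlonglongrightarrow> emeasure yprob (\<Inter>i. {z. norm z \<ge> real i})"
  proof (rule Lim_emeasure_decseq)
    show "range (\<lambda>i. {z. norm z \<ge> real i}) \<subseteq> sets yprob" by (auto intro!: borel_closed closed_Collect_le continuous_intros)
    show "decseq (\<lambda>i. {z :: real^'n. norm z \<ge> real i})" by (auto simp: decseq_def)
    show "emeasure yprob {z. norm z \<ge> real i} \<noteq> \<infinity>" for i
      using finite_measure.emeasure_finite[OF finite_yprob] by simp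
  qed
  also have "(\<Inter>i. {z :: real^'n. norm z \<ge> real i}) = {}"
  proof -
    have "\<exists>i. \<not> norm z \<ge> real i" for z :: "real^'n" by (metis not_le reals_Archimedean2)
    then show ?thesis by blast
  qed
  finally have "(\<lambda>i. emeasure yprob {z. norm z \<ge> real i}) \<longlonglongrightarrow> 0" by simp
  then have "\<forall>\<^sub>F i in sequentially. emeasure yprob {z. norm z \<ge> real i} < ennreal \<delta>"
    using assms by (intro order_tendstoD(2)) auto
  then have "\<forall>\<^sub>F i in sequentially. emeasure yprob {z. norm z \<ge> real i} < ennreal \<delta> \<and> i > 0"
    using eventually_gt_at_top[of 0] by (rule eventually_conj)
  then obtain i where "emeasure yprob {z. norm z \<ge> real i} < ennreal \<delta>" "i > 0"
    unfolding eventually_sequentially by blast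
  then show ?thesis by (intro that[of "real i"]) auto
qed

text \<open>Restrict the time integral to \<open>{1..2}\<close>, where the integrand is bounded
  below. Radius three covers balls of radius at most one with centre of norm at most two.\<close>

lemma \<kappa>_lower:
  obtains k where "k > 0" "\<And>z. norm z \<le> 3 \<Longrightarrow> ennreal k \<le> \<kappa> 1 z"
proof -
  obtain M where M: "M > 0" "\<And>x. norm (\<beta> x) \<le> M * norm x" by (rule \<beta>_upper) blast
  obtain z0 where z0: "z0 > 0" "Zc = ennreal z0"
    using Zc_pos Zc_finite by (cases Zc) auto
  define q where "q = exp (- 2) * (2 powr (- (real CARD('n) / 2)) * exp (- (M * 3)\<^sup>2 / 4))"
  have q: "q > 0" by (simp add: q_def)
  have "ennreal (q / z0) \<le> \<kappa> 1 z" if "norm z \<le> 3" for z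
  proof -
    have "(\<integral>\<^sup>+s. ennreal q * indicator {1..2::real} s \<partial>lborel)
      \<le> (\<integral>\<^sup>+s. indicator {0<..} s * (ennreal (exp (- 1 * s)) * ennreal (hk s z)) \<partial>lborel)"
    proof (rule nn_integral_mono)
      fix s :: real
      show "ennreal q * indicator {1..2} s \<le> indicator {0<..} s * (ennreal (exp (- 1 * s)) * ennreal (hk s z))"
      proof (cases "s \<in> {1..2}")
        case True
        have "norm (\<beta> z) \<le> M * 3" using M that by (meson mult_left_mono order_trans less_imp_le)
        then have "(norm (\<beta> z))\<^sup>2 \<le> (M * 3)\<^sup>2" by (intro power_mono) auto
        moreover have "(norm (\<beta> z))\<^sup>2 / (4 * s) \<le> (norm (\<beta> z))\<^sup>2 / 4"
          using True by (intro divide_left_mono) auto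
        ultimately have "exp (- (M * 3)\<^sup>2 / 4) \<le> exp (- (norm (\<beta> z))\<^sup>2 / (4 * s))" by simp
        moreover have "2 powr (- (real CARD('n) / 2)) \<le> s powr (- (real CARD('n) / 2))"
          using True by (intro powr_mono2') auto
        ultimately have "2 powr (- (real CARD('n) / 2)) * exp (- (M * 3)\<^sup>2 / 4) \<le> hk s z"
          unfolding hk_def by (intro mult_mono) auto
        then have "q \<le> exp (- 1 * s) * hk s z"
          unfolding q_def using True by (intro mult_mono) auto
        then show ?thesis using True by (simp add: ennreal_mult[symmetric] hk_nonneg ennreal_leI)
      qed simp
    qed
    then have "ennreal q \<le> (\<integral>\<^sup>+s. indicator {0<..} s * (ennreal (exp (- 1 * s)) * ennreal (hk s z)) \<partial>lborel)"
      by (simp add: nn_integral_cmult)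
    then have "ennreal q / Zc \<le> \<kappa> 1 z" unfolding \<kappa>_def by (rule divide_right_mono_ennreal)
    then show ?thesis using q z0 by (simp add: divide_ennreal)
  qed
  then show ?thesis using q z0 by (intro that[of "q / z0"]) auto
qed

lemma yprob_ball_lower:
  assumes "0 < \<eta>" "\<eta> \<le> 1"
  obtains c' where "0 < c'" "c' \<le> 1" "\<And>p. norm p \<le> 2 \<Longrightarrow> ennreal c' \<le> emeasure yprob (ball p \<eta>)"
proof -
  obtain k where k: "k > 0" "\<And>z. norm z \<le> 3 \<Longrightarrow> ennreal k \<le> \<kappa> 1 z" by (rule \<kappa>_lower) blast
  define V where "V = unit_ball_vol (real DIM(real^'n)) * \<eta> ^ DIM(real^'n)"
  have V: "V > 0" using assms by (simp add: V_def)
  have "ennreal (k * V) \<le> emeasure yprob (ball p \<eta>)" if "norm p \<le> 2" for p :: "real^'n"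
  proof -
    have "ennreal (k * V) = (\<integral>\<^sup>+z. ennreal k * indicator (ball p \<eta>) z \<partial>lborel)"
      using assms k V by (simp add: nn_integral_cmult_indicator emeasure_ball V_def ennreal_mult)
    also have "\<dots> \<le> (\<integral>\<^sup>+z. \<kappa> 1 z * indicator (ball p \<eta>) z \<partial>lborel)"
    proof (intro nn_integral_mono)
      fix z
      show "ennreal k * indicator (ball p \<eta>) z \<le> \<kappa> 1 z * indicator (ball p \<eta>) z"
      proof (cases "z \<in> ball p \<eta>")
        case True
        then have "norm z \<le> 3"
          using that assms norm_triangle_ineq2[of z p] by (simp add: dist_norm norm_minus_commute)
        then show ?thesis using k(2) True by simp
      qed simp
    qed
    also have "\<dots> = emeasure yprob (ball p \<eta>)" by (simp add: yprob_def emeasure_density)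
    finally show ?thesis .
  qed
  then have "ennreal (min 1 (k * V)) \<le> emeasure yprob (ball p \<eta>)" if "norm p \<le> 2" for p :: "real^'n"
    using that by (meson ennreal_leI min.cobounded2 order_trans)
  then show ?thesis using k V by (intro that[of "min 1 (k * V)"]) auto
qed

end

definition obstacle :: "'a::euclidean_space set \<Rightarrow> nat \<Rightarrow> 'a set" where
  "obstacle S k = {y. 1 / (real k + 1) \<le> infdist y S} \<inter> cball 0 (real k)"

lemma compact_obstacle: "compact (obstacle S k)"
  unfolding obstacle_def by (intro closed_Int_compact closed_Collect_le continuous_intros) auto

lemma obstacle_disjoint: "obstacle S k \<inter> S = {}"
  by (auto simp: obstacle_def)

lemma ball_subset_obstacle:
  fixes z :: "'a::euclidean_space"
  assumes "S \<noteq> {}" "ball z (2 * \<rho>) \<inter> S = {}" "\<rho> > 0" "1 / (real k + 1) \<le> \<rho>" "norm z + \<rho> \<le> real k"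
  shows "ball z \<rho> \<subseteq> obstacle S k"
proof
  fix y assume y: "y \<in> ball z \<rho>"
  have "\<rho> \<le> dist y s" if "s \<in> S" for s
  proof (rule ccontr)
    assume "\<not> \<rho> \<le> dist y s"
    then have "s \<in> ball z (2 * \<rho>)" using y dist_triangle[of z s y] by auto
    then show False using assms that by blast
  qed
  then have "\<rho> \<le> infdist y S" using assms(1) by (simp add: infdist_def cINF_greatest)
  moreover have "norm y \<le> real k"
    using y assms norm_triangle_ineq2[of y z] by (simp add: dist_norm norm_minus_commute)
  ultimately show "y \<in> obstacle S k" using assms by (simp add: obstacle_def)
qed

text \<open>The constants may depend on \<open>x0\<close>; uniformity over the boundary is recovered
  by compactness in \<open>Res_swept\<close>.\<close>

definition exterior_corkscrew :: "'a::metric_space set \<Rightarrow> 'a \<Rightarrow> bool" where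
  "exterior_corkscrew S x0 \<longleftrightarrow> (\<exists>\<eta>>0. \<exists>r0>0. \<forall>r. 0 < r \<and> r \<le> r0 \<longrightarrow> (\<exists>z. ball z (\<eta> * r) \<subseteq> ball x0 r - S))"

context elliptic_frame
begin

text \<open>A bound \<open>q\<close> near \<open>x0\<close> improves by a fixed factor at a smaller
  scale: \<open>step\<close> with \<open>m = 1 / r\<^sup>2\<close> averages \<open>w k\<close> over
  the complement of the obstacle, and the corkscrew ball inside the obstacle removes mass at least
  \<open>c'\<close> from this average. Iteration brings the bound below \<epsilon>.\<close>

lemma penalised_small_at_boundary:
  fixes w :: "nat \<Rightarrow> real^'n \<Rightarrow> ennreal"
  assumes ck: "exterior_corkscrew S x0" and "S \<noteq> {}" and "W \<ge> 0" "C \<ge> 0" "l > 0"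
    and [measurable]: "\<And>k. w k \<in> borel_measurable borel"
    and W: "\<And>k x. k > 0 \<Longrightarrow> w k x \<le> ennreal W"
    and step: "\<And>k m x. l < m \<Longrightarrow> m \<le> real k \<Longrightarrow>
        w k x \<le> ennreal (C / m) + ennreal m * Res m (\<lambda>z. indicator (- obstacle S k) z * w k z) x"
    and "\<epsilon> > 0"
  shows "\<exists>r>0. \<exists>k0. \<forall>k\<ge>k0. \<forall>y\<in>ball x0 r. w k y \<le> ennreal \<epsilon>"
proof -
  define P where "P q \<longleftrightarrow> (\<exists>r>0. \<exists>k0. \<forall>k\<ge>k0. \<forall>y\<in>ball x0 r. w k y \<le> ennreal q)" for q
  obtain \<eta>0 r0 where \<eta>0: "\<eta>0 > 0" "r0 > 0" and ck': "\<And>r. 0 < r \<Longrightarrow> r \<le> r0 \<Longrightarrow> \<exists>z. ball z (\<eta>0 * r) \<subseteq> ball x0 r - S"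
    using ck unfolding exterior_corkscrew_def by blast
  \<comment> \<open>Half the corkscrew constant: the ball of twice the radius avoids
    \<open>S\<close>, so the smaller one keeps a positive distance and ends up in the
    obstacle.\<close>
  define \<eta> where "\<eta> = min 1 (\<eta>0 / 2)"
  have \<eta>: "0 < \<eta>" "\<eta> \<le> 1" "2 * \<eta> \<le> \<eta>0" using \<eta>0 by (auto simp: \<eta>_def)
  obtain c' where c': "0 < c'" "c' \<le> 1" and ball_lower: "\<And>p. norm p \<le> 2 \<Longrightarrow> ennreal c' \<le> emeasure yprob (ball p \<eta>)"
    by (rule yprob_ball_lower[OF \<eta>(1,2)]) blast
  have improve: "P ((1 - c' / 2) * q)" if "P q" "q > 0" for q
  proof -
    obtain r1 k1 where r1: "r1 > 0" "\<And>k y. k \<ge> k1 \<Longrightarrow> y \<in> ball x0 r1 \<Longrightarrow> w k y \<le> ennreal q"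
      using \<open>P q\<close> unfolding P_def by blast
    \<comment> \<open>Two errors of size \<delta>, from \<open>C * r\<^sup>2\<close> and from the
      tail, cost \<open>c' * q / 2\<close>; half of the gain \<open>c' * q\<close> remains.\<close>
    define \<delta> where "\<delta> = c' * q / 4"
    have \<delta>: "\<delta> > 0" using c' \<open>q > 0\<close> by (simp add: \<delta>_def)
    obtain R where R: "R > 0" "emeasure yprob {z. norm z \<ge> R} \<le> ennreal (\<delta> / (W + 1))"
      using yprob_tail[of "\<delta> / (W + 1)"] \<delta> \<open>W \<ge> 0\<close> by (auto intro: divide_pos_pos)
    \<comment> \<open>In this order: the corkscrew exists at scale \<open>r\<close>; points within
      \<open>(R + 1) * r\<close> of \<open>x0\<close> still obey the old bound; \<open>C / m\<close>
      is at most \<delta>; and \<open>m = 1 / r\<^sup>2\<close> exceeds \<open>l\<close>.\<close>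
    define r where "r = min (min r0 (r1 / (R + 1))) (min (sqrt (\<delta> / (C + 1))) (sqrt (1 / (l + 1))))"
    have r: "r > 0" "r \<le> r0" "r \<le> r1 / (R + 1)" "r \<le> sqrt (\<delta> / (C + 1))" "r \<le> sqrt (1 / (l + 1))"
      using \<eta>0 r1 R \<delta> \<open>C \<ge> 0\<close> \<open>l > 0\<close> by (auto simp: r_def)
    have rR: "r * (R + 1) \<le> r1" using r R by (simp add: field_simps)
    have r\<delta>: "C * r\<^sup>2 \<le> \<delta>"
    proof -
      have "r\<^sup>2 \<le> (sqrt (\<delta> / (C + 1)))\<^sup>2" using r by (intro power_mono) auto
      then have "r\<^sup>2 * (C + 1) \<le> \<delta>" using \<delta> \<open>C \<ge> 0\<close> by (simp add: field_simps)
      moreover have "r\<^sup>2 * (C + 1) = C * r\<^sup>2 + r\<^sup>2" by (simp add: algebra_simps)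
      ultimately show ?thesis using zero_le_power2[of r] by linarith
    qed
    have rl: "l < 1 / r\<^sup>2"
    proof -
      have "r\<^sup>2 \<le> (sqrt (1 / (l + 1)))\<^sup>2" using r by (intro power_mono) auto
      then have "r\<^sup>2 \<le> 1 / (l + 1)" using \<open>l > 0\<close> by simp
      then have "l + 1 \<le> 1 / r\<^sup>2" using r \<open>l > 0\<close> by (simp add: field_simps)
      then show ?thesis by simp
    qed
    obtain z0 where z0: "ball z0 (\<eta>0 * r) \<subseteq> ball x0 r - S" using ck'[OF r(1,2)] by blast
    have z0': "ball z0 (2 * (\<eta> * r)) \<subseteq> ball x0 r - S"
    proof -
      have "2 * (\<eta> * r) \<le> \<eta>0 * r" using \<eta>(3) r(1) by (simp flip: mult.assoc)
      then show ?thesis using z0 subset_ball by blast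
    qed
    have z0x0: "z0 \<in> ball x0 r" using z0' \<eta> r by (auto dest!: subsetD[of _ _ z0])
    \<comment> \<open>From this index on the obstacle contains the ball around \<open>z0\<close>,
      and \<open>m\<close> is at most the absorption strength.\<close>
    obtain k2 :: nat where k2: "real k2 \<ge> max (max (1 / (\<eta> * r)) (norm z0 + \<eta> * r)) (1 / r\<^sup>2)"
      using real_arch_simple by blast
    have "w k y \<le> ennreal ((1 - c' / 2) * q)" if k: "k \<ge> max k1 k2" and y: "y \<in> ball x0 r" for k y
    proof -
      have kk: "real k \<ge> 1 / (\<eta> * r)" "real k \<ge> norm z0 + \<eta> * r" "real k \<ge> 1 / r\<^sup>2"
        using k k2 by (auto intro: order_trans)
      have "k > 0" using kk(3) r by (metis gr0I not_less of_nat_0 zero_less_divide_1_iff zero_less_power)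
      have obst: "ball z0 (\<eta> * r) \<subseteq> obstacle S k"
      proof (rule ball_subset_obstacle)
        have "1 / (real k + 1) \<le> 1 / (1 / (\<eta> * r))"
          using kk(1) \<eta> r by (intro divide_left_mono) auto
        then show "1 / (real k + 1) \<le> \<eta> * r" by simp
      qed (use z0' \<eta> r kk \<open>S \<noteq> {}\<close> in auto)
      define p where "p = (1 / r) *\<^sub>R (y - z0)"
      have "norm (y - z0) \<le> 2 * r"
        using y z0x0 dist_triangle[of y z0 x0] by (simp add: dist_norm[symmetric] dist_commute)
      then have p: "norm p \<le> 2" unfolding p_def norm_scaleR using r by (simp add: field_simps)
      have in_obst: "y - r *\<^sub>R z \<in> obstacle S k" if "z \<in> ball p \<eta>" for z
      proof -
        have "y - r *\<^sub>R z - z0 = r *\<^sub>R (p - z)" using r by (simp add: p_def scaleR_diff_right)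
        then have "norm (y - r *\<^sub>R z - z0) < r * \<eta>" using that r by (simp add: dist_norm)
        then have "y - r *\<^sub>R z \<in> ball z0 (\<eta> * r)" by (simp add: dist_norm norm_minus_commute mult.commute)
        then show ?thesis using obst by blast
      qed
      \<comment> \<open>Three regions: zero on the rescaled obstacle ball, the global bound
        \<open>W\<close> in the tail, the old bound \<open>q\<close> elsewhere.\<close>
      have pt: "indicator (- obstacle S k) (y - r *\<^sub>R z) * w k (y - r *\<^sub>R z)
          \<le> ennreal W * indicator {z. norm z \<ge> R} z + ennreal q * indicator (- ball p \<eta>) z" for z
      proof (cases "z \<in> ball p \<eta>")
        case True
        then show ?thesis using in_obst by simp
      next
        case z: False
        have le1: "indicator (- obstacle S k) (y - r *\<^sub>R z) * w k (y - r *\<^sub>R z) \<le> w k (y - r *\<^sub>R z)"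
          by (simp add: indicator_def)
        show ?thesis
        proof (cases "norm z \<ge> R")
          case True
          have "w k (y - r *\<^sub>R z) \<le> ennreal W * indicator {z. norm z \<ge> R} z"
            using True W[OF \<open>k > 0\<close>] by simp
          then show ?thesis using le1 by (meson add_increasing2 order_trans zero_le)
        next
          case False
          have "norm (y - r *\<^sub>R z - x0) \<le> norm (y - x0) + norm (r *\<^sub>R z)"
            using norm_triangle_ineq4[of "y - x0" "r *\<^sub>R z"] by (simp add: algebra_simps)
          also have "\<dots> < r + r * R" using y False r by (intro add_less_le_mono) (auto simp: dist_norm norm_minus_commute)
          finally have "y - r *\<^sub>R z \<in> ball x0 r1" using rR by (simp add: dist_norm norm_minus_commute algebra_simps)
          then have "w k (y - r *\<^sub>R z) \<le> ennreal q * indicator (- ball p \<eta>) z" using z r1(2) k by simp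
          then show ?thesis using le1 by (meson add_increasing order_trans zero_le)
        qed
      qed
      have "w k y \<le> ennreal (C / (1 / r\<^sup>2)) + ennreal (1 / r\<^sup>2) * Res (1 / r\<^sup>2) (\<lambda>z. indicator (- obstacle S k) z * w k z) y"
        using rl kk(3) by (rule step)
      also have "ennreal (1 / r\<^sup>2) * Res (1 / r\<^sup>2) (\<lambda>z. indicator (- obstacle S k) z * w k z) y
          = (\<integral>\<^sup>+z. \<kappa> 1 z * (indicator (- obstacle S k) (y - r *\<^sub>R z) * w k (y - r *\<^sub>R z)) \<partial>lborel)"
      proof (rule Res_scale[OF _ r(1)])
        have [measurable]: "obstacle S k \<in> sets borel" by (intro borel_compact compact_obstacle)
        show "(\<lambda>z. indicator (- obstacle S k) z * w k z) \<in> borel_measurable borel" by measurable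
      qed
      also have "\<dots> \<le> (\<integral>\<^sup>+z. \<kappa> 1 z * (ennreal W * indicator {z. norm z \<ge> R} z + ennreal q * indicator (- ball p \<eta>) z) \<partial>lborel)"
        by (intro nn_integral_mono mult_left_mono pt) auto
      also have "\<dots> = (\<integral>\<^sup>+z. ennreal W * indicator {z. norm z \<ge> R} z + ennreal q * indicator (- ball p \<eta>) z \<partial>yprob)"
        by (rule nn_integral_yprob[symmetric]) measurable
      also have "\<dots> = ennreal W * emeasure yprob {z. norm z \<ge> R} + ennreal q * emeasure yprob (- ball p \<eta>)"
        by (subst nn_integral_add) (auto simp: nn_integral_cmult_indicator)
      also have "\<dots> \<le> ennreal W * ennreal (\<delta> / (W + 1)) + ennreal q * ennreal (1 - c')"
      proof (intro add_mono mult_left_mono R)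
        have "emeasure yprob (- ball p \<eta>) = emeasure yprob UNIV - emeasure yprob (ball p \<eta>)"
          using emeasure_compl[of "ball p \<eta>" yprob] finite_measure.emeasure_finite[OF finite_yprob]
          by (simp add: Compl_eq_Diff_UNIV)
        also have "\<dots> \<le> 1 - ennreal c'"
          unfolding emeasure_yprob_UNIV by (intro ennreal_minus_mono ball_lower p) simp
        also have "\<dots> = ennreal (1 - c')" using c' by (simp flip: ennreal_1 add: ennreal_minus)
        finally show "emeasure yprob (- ball p \<eta>) \<le> ennreal (1 - c')" .
      qed auto
      also have "\<dots> = ennreal (W * (\<delta> / (W + 1)) + q * (1 - c'))"
        using \<open>W \<ge> 0\<close> \<delta> \<open>q > 0\<close> c' by (simp add: ennreal_mult[symmetric] ennreal_plus[symmetric] del: ennreal_plus)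
      finally have "w k y \<le> ennreal (C * r\<^sup>2) + ennreal (W * (\<delta> / (W + 1)) + q * (1 - c'))"
        by (simp add: add_left_mono)
      also have "\<dots> \<le> ennreal \<delta> + ennreal (\<delta> + q * (1 - c'))"
      proof (intro add_mono ennreal_leI r\<delta> order_refl)
        show "W * (\<delta> / (W + 1)) \<le> \<delta>" using \<open>W \<ge> 0\<close> \<delta> by (simp add: field_simps)
      qed
      also have "\<dots> = ennreal ((1 - c' / 2) * q)"
        using \<delta> \<open>q > 0\<close> c' by (subst ennreal_plus[symmetric]) (auto simp: \<delta>_def algebra_simps)
      finally show ?thesis .
    qed
    then show ?thesis unfolding P_def using r(1) by blast
  qed
  \<comment> \<open>Starting from \<open>W + 1\<close> rather than \<open>W\<close> keeps the bound
    positive, as \<open>improve\<close> requires.\<close>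
  have iter: "P ((1 - c' / 2) ^ j * (W + 1))" for j
  proof (induction j)
    case 0
    have "w k y \<le> ennreal (W + 1)" if "k \<ge> 1" for k y
    proof -
      have "w k y \<le> ennreal W" using that by (intro W) auto
      also have "\<dots> \<le> ennreal (W + 1)" by (intro ennreal_leI) simp
      finally show ?thesis .
    qed
    then show ?case unfolding P_def by (auto intro!: exI[of _ 1])
  next
    case (Suc j)
    have "(1 - c' / 2) ^ j * (W + 1) > 0" using c' \<open>W \<ge> 0\<close> by simp
    then show ?case using improve[OF Suc] by (simp add: mult.assoc)
  qed
  have "(\<lambda>j. (1 - c' / 2) ^ j * (W + 1)) \<longlonglongrightarrow> 0 * (W + 1)"
    using c' by (intro tendsto_intros LIMSEQ_power_zero) auto
  then have "\<forall>\<^sub>F j in sequentially. (1 - c' / 2) ^ j * (W + 1) < \<epsilon>"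
    using \<open>\<epsilon> > 0\<close> by (intro order_tendstoD(2)) auto
  then obtain j where "(1 - c' / 2) ^ j * (W + 1) < \<epsilon>" unfolding eventually_sequentially by blast
  then show ?thesis
    using iter[of j] unfolding P_def by (meson ennreal_leI less_imp_le order_trans)
qed

end

section \<open>Density of the kernels on the boundary\<close>

context elliptic_frame
begin

text \<open>The density is \<open>real k\<close> times the penalised solution on the obstacle; its
  potential falls short of \<open>Res l F\<close> by exactly \<open>w k\<close>, which is small on
  \<open>B\<close> for large \<open>k\<close>. Compactness of \<open>B\<close> selects one
  \<open>k\<close>.\<close>

lemma Res_swept:
  assumes [measurable]: "F \<in> borel_measurable borel" and FC: "\<And>z. F z \<le> ennreal C" and "C \<ge> 0" "l > 0"
    and "compact B" "S \<noteq> {}" and ck: "\<And>x. x \<in> B \<Longrightarrow> exterior_corkscrew S x" and "\<epsilon> > 0"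
  obtains \<nu> K D where "\<nu> \<in> borel_measurable borel" "compact K" "K \<inter> S = {}"
    "\<And>z. \<nu> z \<le> ennreal D" "\<And>z. z \<notin> K \<Longrightarrow> \<nu> z = 0"
    "\<And>x. x \<in> B \<Longrightarrow> Res l \<nu> x \<le> Res l F x" "\<And>x. x \<in> B \<Longrightarrow> Res l F x \<le> Res l \<nu> x + ennreal \<epsilon>"
proof -
  have [measurable]: "obstacle S k \<in> sets borel" for k by (intro borel_compact compact_obstacle)
  define Q where "Q k w \<longleftrightarrow> w \<in> borel_measurable borel \<and> (\<forall>x. w x \<le> ennreal (C / l)) \<and>
      (\<forall>x. Res l F x = w x + Res l (\<lambda>z. ennreal (real k) * indicator (obstacle S k) z * w z) x) \<and>
      (\<forall>m x. l < m \<longrightarrow> m \<le> real k \<longrightarrow>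
        w x \<le> ennreal (C / m) + ennreal m * Res m (\<lambda>z. indicator (- obstacle S k) z * w z) x)" for k w
  have "\<exists>w. Q k w" if "k > 0" for k
  proof -
    have k: "real k > 0" using that by simp
    show ?thesis
    proof (rule penalised_solution[OF assms(1) _ \<open>l > 0\<close> k \<open>C \<ge> 0\<close> FC, of "obstacle S k"])
      show "obstacle S k \<in> sets borel" by simp
    qed (unfold Q_def, blast)
  qed
  then have "\<forall>k. \<exists>w. k > 0 \<longrightarrow> Q k w" by blast
  from choice[OF this] obtain w' where Q: "\<And>k. k > 0 \<Longrightarrow> Q k (w' k)" by blast
  have w': "w' k \<in> borel_measurable borel" "w' k x \<le> ennreal (C / l)"
      "Res l F x = w' k x + Res l (\<lambda>z. ennreal (real k) * indicator (obstacle S k) z * w' k z) x"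
      "l < m \<Longrightarrow> m \<le> real k \<Longrightarrow>
        w' k x \<le> ennreal (C / m) + ennreal m * Res m (\<lambda>z. indicator (- obstacle S k) z * w' k z) x"
    if "k > 0" for k m x
    using Q[OF that] unfolding Q_def by auto
  \<comment> \<open>\<open>penalised_solution\<close> requires positive absorption; the value at
    \<open>k = 0\<close> is a placeholder.\<close>
  define w where "w k = (if k > 0 then w' k else (\<lambda>_. 0))" for k
  have wm [measurable]: "w k \<in> borel_measurable borel" for k using w'(1) by (auto simp: w_def)
  have small: "\<exists>r>0. \<exists>k0. \<forall>k\<ge>k0. \<forall>y\<in>ball x r. w k y \<le> ennreal \<epsilon>" if "x \<in> B" for x
  proof (rule penalised_small_at_boundary[OF ck[OF that] \<open>S \<noteq> {}\<close> _ \<open>C \<ge> 0\<close> \<open>l > 0\<close> wm _ _ \<open>\<epsilon> > 0\<close>])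
    show "C / l \<ge> 0" using \<open>C \<ge> 0\<close> \<open>l > 0\<close> by simp
    show "w k x \<le> ennreal (C / l)" if "k > 0" for k x using w'(2) that by (simp add: w_def)
    show "w k x \<le> ennreal (C / m) + ennreal m * Res m (\<lambda>z. indicator (- obstacle S k) z * w k z) x"
      if "l < m" "m \<le> real k" for k m x
    proof -
      have "k > 0" using that \<open>l > 0\<close> by (cases k) auto
      then show ?thesis using w'(4) that by (simp add: w_def)
    qed
  qed
  obtain r k0 where r: "\<And>x. x \<in> B \<Longrightarrow> r x > (0::real)"
    and k0: "\<And>x k y. x \<in> B \<Longrightarrow> k \<ge> k0 x \<Longrightarrow> y \<in> ball x (r x) \<Longrightarrow> w k y \<le> ennreal \<epsilon>"
    using small by metis
  obtain B' where B': "B' \<subseteq> B" "finite B'" "B \<subseteq> (\<Union>x\<in>B'. ball x (r x))"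
  proof (rule compactE_image[OF \<open>compact B\<close>, of B "\<lambda>x. ball x (r x)"])
    show "B \<subseteq> (\<Union>x\<in>B. ball x (r x))" using r by force
  qed auto
  define k where "k = Suc (\<Sum>x\<in>B'. k0 x)"
  have k: "k > 0" and kk: "k \<ge> k0 x" if "x \<in> B'" for x
    using member_le_sum[OF that, of k0] B'(2) by (auto simp: k_def)
  have k: "k > 0" by (simp add: k_def)
  have wk: "w k x \<le> ennreal \<epsilon>" if "x \<in> B" for x
    using that B' kk k0 by blast
  define \<nu> where "\<nu> z = ennreal (real k) * indicator (obstacle S k) z * w k z" for z
  have id: "Res l F x = w k x + Res l \<nu> x" for x
    using w'(3)[OF k, of x] k by (simp add: w_def \<nu>_def[abs_def])
  show ?thesis
  proof (rule that[of \<nu> "obstacle S k" "real k * (C / l)"])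
    show "\<nu> \<in> borel_measurable borel" unfolding \<nu>_def by measurable
    show "\<nu> z \<le> ennreal (real k * (C / l))" for z
    proof -
      have "ennreal (real k) * w' k z \<le> ennreal (real k) * ennreal (C / l)"
        using w'(2)[OF k, of z] by (intro mult_left_mono) auto
      also have "\<dots> = ennreal (real k * (C / l))"
        using \<open>C \<ge> 0\<close> \<open>l > 0\<close> by (intro ennreal_mult[symmetric]) auto
      finally show ?thesis using k by (auto simp: \<nu>_def w_def indicator_def)
    qed
    show "Res l \<nu> x \<le> Res l F x" for x unfolding id by simp
    show "Res l F x \<le> Res l \<nu> x + ennreal \<epsilon>" if "x \<in> B" for x
      unfolding id using wk[OF that] by (simp add: add.commute add_mono)
  qed (auto simp: \<nu>_def compact_obstacle obstacle_disjoint)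
qed

lemma yukawa_continuous:
  assumes "l > 0"
  shows "continuous_on (- {0}) (yukawa l)"
proof (rule continuous_at_imp_continuous_on, rule ballI)
  fix z :: "real^'n" assume "z \<in> - {0}"
  then have \<rho>: "(norm (\<beta> z))\<^sup>2 > 0" by (simp add: \<beta>_eq_0_iff)
  have "isCont (\<lambda>z. (norm (\<beta> z))\<^sup>2) z"
    by (intro continuous_intros linear_continuous_at \<beta>_bounded_linear)
  then show "isCont (yukawa l) z"
    unfolding yukawa_def[abs_def]
    by (rule isCont_o2) (intro yuk_isCont \<rho> assms, simp)
qed

lemma yukawa_nonneg: "yukawa l z \<ge> 0"
  by (simp add: yukawa_def yuk_nonneg)

text \<open>\<open>B\<close> and \<open>K\<close> are disjoint compact sets, so the kernel is
  uniformly continuous on \<open>B \<times> K\<close>, and concentrating the mass of each small cell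
  of \<open>K\<close> in one point changes the potential uniformly little.\<close>

lemma Res_riemann:
  assumes [measurable]: "\<nu> \<in> borel_measurable borel" and "compact K" "compact B" "K \<inter> B = {}" "l > 0"
    and \<nu>D: "\<And>z. \<nu> z \<le> ennreal D" and \<nu>0: "\<And>z. z \<notin> K \<Longrightarrow> \<nu> z = 0" and "\<epsilon> > 0"
  obtains Y a where "finite Y" "Y \<subseteq> K"
    "\<And>x. x \<in> B \<Longrightarrow> Res l \<nu> x < \<infinity> \<and> \<bar>enn2real (Res l \<nu> x) - (\<Sum>y\<in>Y. a y * yukawa l (x - y))\<bar> \<le> \<epsilon>"
proof -
  have [measurable]: "K \<in> sets borel" by (intro borel_compact assms)
  obtain z0 where z0: "z0 > 0" "Zc = ennreal z0" using Zc_pos Zc_finite by (cases Zc) auto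
  define \<mu> where "\<mu> = density lborel \<nu>"
  have sets_\<mu> [simp, measurable_cong]: "sets \<mu> = sets borel" and space_\<mu> [simp]: "space \<mu> = UNIV" by (auto simp: \<mu>_def)
  have "emeasure \<mu> UNIV < \<infinity>"
  proof -
    have "emeasure \<mu> UNIV = (\<integral>\<^sup>+z. \<nu> z \<partial>lborel)" by (simp add: \<mu>_def emeasure_density)
    also have "\<dots> \<le> (\<integral>\<^sup>+z. ennreal D * indicator K z \<partial>lborel)"
      using \<nu>D \<nu>0 by (intro nn_integral_mono) (auto simp: indicator_def)
    also have "\<dots> = ennreal D * emeasure lborel K" by (simp add: nn_integral_cmult_indicator)
    also have "\<dots> < \<infinity>" using emeasure_compact_finite[OF \<open>compact K\<close>] by (simp add: ennreal_mult_less_top)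
    finally show ?thesis .
  qed
  then interpret \<mu>: finite_measure \<mu> by (intro finite_measureI) auto
  define m where "m = measure \<mu> UNIV"
  have m: "m \<ge> 0" by (simp add: m_def)
  let ?f = "\<lambda>x z. indicator K z * yukawa l (x - z)"
  have cont: "continuous_on (B \<times> K) (\<lambda>(x, z). yukawa l (x - z))"
    unfolding split_def
    by (rule continuous_on_compose2[OF yukawa_continuous[OF \<open>l > 0\<close>]])
       (use \<open>K \<inter> B = {}\<close> in \<open>auto intro!: continuous_intros\<close>)
  define \<epsilon>' where "\<epsilon>' = \<epsilon> * z0 / (m + 1)"
  have \<epsilon>': "\<epsilon>' > 0" using \<open>\<epsilon> > 0\<close> z0 m by (simp add: \<epsilon>'_def)
  have "uniformly_continuous_on (B \<times> K) (\<lambda>(x, z). yukawa l (x - z))"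
    using assms by (intro compact_uniformly_continuous cont compact_Times)
  then obtain d where d: "d > 0" "\<And>p q. p \<in> B \<times> K \<Longrightarrow> q \<in> B \<times> K \<Longrightarrow> dist p q < d \<Longrightarrow>
      dist (case p of (x, z) \<Rightarrow> yukawa l (x - z)) (case q of (x, z) \<Rightarrow> yukawa l (x - z)) < \<epsilon>'"
    unfolding uniformly_continuous_on_def using \<epsilon>' by (metis dist_commute)
  obtain Y where Y: "Y \<subseteq> K" "finite Y" "K \<subseteq> (\<Union>y\<in>Y. ball y d)"
  proof (rule compactE_image[OF \<open>compact K\<close>, of K "\<lambda>y. ball y d"])
    show "K \<subseteq> (\<Union>y\<in>K. ball y d)" using d by force
  qed auto
  obtain e :: "nat \<Rightarrow> real^'n" and n where en: "Y = e ` {i. i < n}" "inj_on e {i. i < n}"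
    using finite_imp_nat_seg_image_inj_on[OF Y(2)] by metis
  \<comment> \<open>Each ball minus the earlier ones: disjoint cells covering \<open>K\<close>, some
    possibly empty.\<close>
  define A where "A i = K \<inter> ball (e i) d - (\<Union>j<i. ball (e j) d)" for i
  have Am [measurable]: "A i \<in> sets borel" for i by (simp add: A_def)
  have disj: "disjoint_family_on A {..<n}"
    unfolding disjoint_family_on_def
  proof (intro ballI impI)
    fix i j assume "i \<in> {..<n}" "j \<in> {..<n}" "i \<noteq> j"
    then show "A i \<inter> A j = {}" by (cases i j rule: linorder_cases) (auto simp: A_def)
  qed
  have cover: "K = (\<Union>i<n. A i)"
  proof
    show "K \<subseteq> (\<Union>i<n. A i)"
    proof
      fix z assume z: "z \<in> K"
      then have ex: "\<exists>i. i < n \<and> z \<in> ball (e i) d" using Y(3) en by blast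
      define i where "i = (LEAST i. i < n \<and> z \<in> ball (e i) d)"
      have i: "i < n" "z \<in> ball (e i) d" using LeastI_ex[OF ex] by (auto simp: i_def)
      have "z \<notin> ball (e j) d" if "j < i" for j
        using not_less_Least[OF that[unfolded i_def]] that i(1) by auto
      then have "z \<in> A i" using z i by (auto simp: A_def)
      then show "z \<in> (\<Union>i<n. A i)" using i by blast
    qed
  qed (auto simp: A_def)
  define a where "a y = measure \<mu> (A (inv_into {i. i < n} e y)) / z0" for y
  have fm: "?f x \<in> borel_measurable borel" if "x \<in> B" for x
  proof -
    have "continuous_on K (\<lambda>z. yukawa l (x - z))"
      by (rule continuous_on_compose2[OF yukawa_continuous[OF \<open>l > 0\<close>]])
         (use that \<open>K \<inter> B = {}\<close> in \<open>auto intro!: continuous_intros\<close>)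
    then show ?thesis
      using borel_measurable_continuous_on_indicator[of K "\<lambda>z. yukawa l (x - z)"] by simp
  qed
  have fint: "integrable \<mu> (?f x)" if x: "x \<in> B" for x
  proof -
    have "bounded ((\<lambda>(x, z). yukawa l (x - z)) ` (B \<times> K))"
      using assms by (intro compact_imp_bounded compact_continuous_image cont compact_Times)
    then obtain c where "\<And>z. z \<in> K \<Longrightarrow> norm (yukawa l (x - z)) \<le> c"
      unfolding bounded_iff using x by fastforce
    then have "norm (?f x z) \<le> \<bar>c\<bar>" for z by (cases "z \<in> K") force+
    then show ?thesis using fm[OF x] by (intro \<mu>.integrable_const_bound[of _ "\<bar>c\<bar>"]) (auto simp: measurable_def)
  qed
  have res: "Res l \<nu> x = ennreal ((\<integral>z. ?f x z \<partial>\<mu>) / z0)" if x: "x \<in> B" for x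
  proof -
    have "Res l \<nu> x = (\<integral>\<^sup>+z. (\<nu> z * ennreal (?f x z)) / Zc \<partial>lborel)"
      unfolding Res_def
    proof (intro nn_integral_cong)
      fix z
      show "\<kappa> l (x - z) * \<nu> z = \<nu> z * ennreal (?f x z) / Zc"
      proof (cases "z \<in> K")
        case True
        then have "x - z \<noteq> 0" using x \<open>K \<inter> B = {}\<close> by auto
        then show ?thesis using True \<open>l > 0\<close> by (simp add: \<kappa>_yukawa divide_ennreal_def mult_ac)
      qed (simp add: \<nu>0)
    qed
    also have "\<dots> = (\<integral>\<^sup>+z. ennreal (?f x z) \<partial>\<mu>) / Zc"
      unfolding \<mu>_def using fm[OF x] by (simp add: nn_integral_divide nn_integral_density)
    also have "(\<integral>\<^sup>+z. ennreal (?f x z) \<partial>\<mu>) = ennreal (\<integral>z. ?f x z \<partial>\<mu>)"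
      by (intro nn_integral_eq_integral fint x) (auto simp: yukawa_nonneg)
    finally show ?thesis
      using z0 by (simp add: divide_ennreal integral_nonneg_AE yukawa_nonneg)
  qed
  have "\<bar>(\<integral>z. ?f x z \<partial>\<mu>) / z0 - (\<Sum>y\<in>Y. a y * yukawa l (x - y))\<bar> \<le> \<epsilon>" if x: "x \<in> B" for x
  proof -
    let ?g = "\<lambda>z. \<Sum>i<n. yukawa l (x - e i) * indicator (A i) z"
    have gint: "integrable \<mu> ?g" by (intro Bochner_Integration.integrable_sum integrable_mult_right integrable_real_indicator,
        auto simp: \<mu>.emeasure_finite less_top[symmetric])
    have "(\<integral>z. ?g z \<partial>\<mu>) = (\<Sum>i<n. yukawa l (x - e i) * measure \<mu> (A i))"
      by (subst Bochner_Integration.integral_sum)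
         (auto intro!: integrable_mult_right integrable_real_indicator simp: \<mu>.emeasure_finite less_top[symmetric])
    also have "\<dots> / z0 = (\<Sum>y\<in>Y. a y * yukawa l (x - y))"
    proof -
      have "(\<Sum>y\<in>Y. a y * yukawa l (x - y)) = (\<Sum>i\<in>{i. i < n}. a (e i) * yukawa l (x - e i))"
        unfolding en(1) by (rule sum.reindex_cong[OF en(2)]) auto
      also have "\<dots> = (\<Sum>i<n. yukawa l (x - e i) * measure \<mu> (A i) / z0)"
        by (rule sum.cong) (auto simp: a_def inv_into_f_f[OF en(2)])
      finally show ?thesis by (simp add: sum_divide_distrib)
    qed
    finally have g: "(\<integral>z. ?g z \<partial>\<mu>) / z0 = (\<Sum>y\<in>Y. a y * yukawa l (x - y))" .
    have fg: "\<bar>?f x z - ?g z\<bar> \<le> \<epsilon>'" for z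
    proof (cases "z \<in> K")
      case True
      then obtain i where i: "i < n" "z \<in> A i" using cover by blast
      have "?g z = (\<Sum>j<n. if j = i then yukawa l (x - e i) else 0)"
        using disj i by (intro sum.cong refl) (auto simp: disjoint_family_on_def indicator_def)
      also have "\<dots> = yukawa l (x - e i)" using i by simp
      finally have gz: "?g z = yukawa l (x - e i)" .
      have "e i \<in> K" "dist z (e i) < d" using i Y en by (auto simp: A_def dist_commute)
      then have "dist (x, z) (x, e i) < d" by (simp add: dist_Pair_Pair)
      then show ?thesis using d(2)[of "(x, z)" "(x, e i)"] x True \<open>e i \<in> K\<close> by (simp add: gz dist_real_def)
    next
      case False
      then have "indicator (A i) z = (0::real)" for i by (simp add: A_def)
      then show ?thesis using False \<epsilon>' by simp
    qed
    have "(\<integral>z. ?f x z \<partial>\<mu>) - (\<integral>z. ?g z \<partial>\<mu>) = (\<integral>z. ?f x z - ?g z \<partial>\<mu>)"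
      by (intro Bochner_Integration.integral_diff[symmetric] fint gint x)
    also have "\<bar>\<dots>\<bar> \<le> (\<integral>z. \<bar>?f x z - ?g z\<bar> \<partial>\<mu>)" by (rule integral_abs_bound)
    also have "\<dots> \<le> (\<integral>z. \<epsilon>' \<partial>\<mu>)"
      by (intro integral_mono fg integrable_abs Bochner_Integration.integrable_diff fint gint x) auto
    also have "\<dots> = \<epsilon>' * m" by (simp add: m_def)
    also have "\<dots> \<le> \<epsilon> * z0" using \<open>\<epsilon> > 0\<close> z0 m by (simp add: \<epsilon>'_def field_simps)
    finally have "\<bar>(\<integral>z. ?f x z \<partial>\<mu>) - (\<integral>z. ?g z \<partial>\<mu>)\<bar> \<le> \<epsilon> * z0" .
    then have "\<bar>(\<integral>z. ?f x z \<partial>\<mu>) / z0 - (\<integral>z. ?g z \<partial>\<mu>) / z0\<bar> \<le> \<epsilon>"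
      using z0 by (simp add: diff_divide_distrib[symmetric] abs_divide field_simps)
    then show ?thesis by (simp only: g)
  qed
  then show ?thesis
    using res Y by (intro that[of Y a]) (auto simp: enn2real_ennreal integral_nonneg_AE yukawa_nonneg z0 less_imp_le)
qed

text \<open>By the resolvent identity the smoothing \<open>m Res m g\<close> is \<open>Res l\<close>
  of \<open>m g\<close> minus \<open>Res l\<close> of \<open>(m - l) m Res m g\<close>. Both
  densities are bounded and nonnegative, so both can be swept off \<open>S\<close> and replaced by
  finitely many poles.\<close>

lemma yukawa_dense_nonneg:
  fixes g :: "real^'n \<Rightarrow> real"
  assumes g: "continuous_on UNIV g" "\<And>x. 0 \<le> g x" "\<And>x. g x \<le> C" and "l > 0"
    and "compact B" "B \<subseteq> S" "S \<noteq> {}" and ck: "\<And>x. x \<in> B \<Longrightarrow> exterior_corkscrew S x" and "\<epsilon> > 0"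
  obtains Y a where "finite Y" "Y \<inter> S = {}" "\<And>x. x \<in> B \<Longrightarrow> \<bar>g x - (\<Sum>y\<in>Y. a y * yukawa l (x - y))\<bar> \<le> \<epsilon>"
proof -
  have C: "C \<ge> 0" using g(2,3)[of 0] by linarith
  have gm [measurable]: "g \<in> borel_measurable borel" using g(1) by (rule borel_measurable_continuous_onI)
  interpret yp: finite_measure yprob by (rule finite_yprob)
  have prob1: "measure yprob UNIV = 1" by (simp add: measure_def emeasure_yprob_UNIV)
  \<comment> \<open>approximate identity\<close>
  obtain R where R: "R > 0" "emeasure yprob {z. norm z \<ge> R} \<le> ennreal (\<epsilon> / (8 * (C + 1)))"
    using yprob_tail[of "\<epsilon> / (8 * (C + 1))"] \<open>\<epsilon> > 0\<close> C by auto
  obtain R1 where R1: "R1 > 0" "\<And>x. x \<in> B \<Longrightarrow> norm x \<le> R1"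
    using compact_imp_bounded[OF \<open>compact B\<close>] by (auto simp: bounded_pos)
  have "uniformly_continuous_on (cball 0 (R1 + R)) g"
    using g(1) by (intro compact_uniformly_continuous) (auto intro: continuous_on_subset)
  then obtain d where d: "d > 0" "\<And>x y. x \<in> cball 0 (R1 + R) \<Longrightarrow> y \<in> cball 0 (R1 + R) \<Longrightarrow> dist x y < d \<Longrightarrow> dist (g x) (g y) < \<epsilon> / 8"
    unfolding uniformly_continuous_on_def using \<open>\<epsilon> > 0\<close> by (metis dist_commute zero_less_divide_iff zero_less_numeral)
  \<comment> \<open>Displacements \<open>r *\<^sub>R z\<close> with \<open>norm z < R\<close> stay
    below the modulus of continuity \<open>d\<close> and inside the ball of radius
    \<open>R1 + R\<close>, and \<open>m = 1 / r\<^sup>2\<close> exceeds \<open>l\<close>.\<close>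
  define r where "r = min (min 1 (d / (2 * R))) (sqrt (1 / (l + 1)))"
  have r: "0 < r" "r \<le> 1" "r \<le> d / (2 * R)" "r \<le> sqrt (1 / (l + 1))" using d R \<open>l > 0\<close> by (auto simp: r_def)
  define m where "m = 1 / r\<^sup>2"
  have lm: "l < m"
  proof -
    have "r\<^sup>2 \<le> (sqrt (1 / (l + 1)))\<^sup>2" using r by (intro power_mono) auto
    then have "r\<^sup>2 \<le> 1 / (l + 1)" using \<open>l > 0\<close> by simp
    then have "l + 1 \<le> 1 / r\<^sup>2" using r \<open>l > 0\<close> by (simp add: field_simps)
    then show ?thesis by (simp add: m_def)
  qed
  let ?G = "\<lambda>z. ennreal (g z)"
  have int: "integrable yprob (\<lambda>z. g (x - r *\<^sub>R z))" for x
    by (rule yp.integrable_const_bound[of _ C]) (use g in auto)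
  have mean: "ennreal m * Res m ?G x = ennreal (\<integral>z. g (x - r *\<^sub>R z) \<partial>yprob)" for x
  proof -
    have "ennreal m * Res m ?G x = (\<integral>\<^sup>+z. \<kappa> 1 z * ennreal (g (x - r *\<^sub>R z)) \<partial>lborel)"
      unfolding m_def by (rule Res_scale) (use r in auto)
    also have "\<dots> = (\<integral>\<^sup>+z. ennreal (g (x - r *\<^sub>R z)) \<partial>yprob)" by (rule nn_integral_yprob[symmetric]) measurable
    also have "\<dots> = ennreal (\<integral>z. g (x - r *\<^sub>R z) \<partial>yprob)" by (rule nn_integral_eq_integral[OF int]) (simp add: g)
    finally show ?thesis .
  qed
  have appr: "\<bar>(\<integral>z. g (x - r *\<^sub>R z) \<partial>yprob) - g x\<bar> \<le> \<epsilon> / 4" if x: "x \<in> B" for x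
  proof -
    have "(\<integral>z. g (x - r *\<^sub>R z) \<partial>yprob) - g x = (\<integral>z. g (x - r *\<^sub>R z) - g x \<partial>yprob)"
      using int by (simp add: Bochner_Integration.integral_diff prob1)
    also have "\<bar>\<dots>\<bar> \<le> (\<integral>z. \<bar>g (x - r *\<^sub>R z) - g x\<bar> \<partial>yprob)" by (rule integral_abs_bound)
    also have "\<dots> \<le> (\<integral>z. \<epsilon> / 8 + C * indicator {z. norm z \<ge> R} z \<partial>yprob)"
    proof (rule integral_mono)
      show "integrable yprob (\<lambda>z. \<bar>g (x - r *\<^sub>R z) - g x\<bar>)" using int by auto
      show "integrable yprob (\<lambda>z. \<epsilon> / 8 + C * indicator {z. norm z \<ge> R} z)"
        by (rule yp.integrable_const_bound[of _ "\<epsilon> / 8 + C"]) (use C \<open>\<epsilon> > 0\<close> in \<open>auto simp: indicator_def\<close>)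
      fix z
      show "\<bar>g (x - r *\<^sub>R z) - g x\<bar> \<le> \<epsilon> / 8 + C * indicator {z. norm z \<ge> R} z"
      proof (cases "norm z \<ge> R")
        case True
        have "\<bar>g (x - r *\<^sub>R z) - g x\<bar> \<le> C" using g(2,3)[of x] g(2,3)[of "x - r *\<^sub>R z"] by linarith
        then show ?thesis using True \<open>\<epsilon> > 0\<close> by simp
      next
        case False
        have rz: "norm (r *\<^sub>R z) \<le> r * R" using False r by simp
        have "r * R \<le> d / 2" using r(3) R by (simp add: field_simps)
        then have "dist (x - r *\<^sub>R z) x < d" using rz d by (simp add: dist_norm)
        moreover have "r * R \<le> R" using r R by simp
        then have "norm (x - r *\<^sub>R z) \<le> R1 + R" using norm_triangle_ineq4[of x "r *\<^sub>R z"] R1(2)[OF x] rz by linarith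
        ultimately have "dist (g (x - r *\<^sub>R z)) (g x) < \<epsilon> / 8" using d(2) R1(2)[OF x] R by simp
        then show ?thesis using False by (simp add: dist_real_def)
      qed
    qed
    also have "\<dots> = \<epsilon> / 8 + C * measure yprob {z. norm z \<ge> R}"
      by (subst Bochner_Integration.integral_add)
         (auto intro!: integrable_mult_right integrable_real_indicator simp: prob1 yp.emeasure_finite less_top[symmetric])
    also have "\<dots> \<le> \<epsilon> / 8 + C * (\<epsilon> / (8 * (C + 1)))"
    proof (intro add_left_mono mult_left_mono C)
      show "measure yprob {z. norm z \<ge> R} \<le> \<epsilon> / (8 * (C + 1))"
        using R(2) C \<open>\<epsilon> > 0\<close> by (simp add: yp.emeasure_eq_measure)
    qed
    also have "C * (\<epsilon> / (8 * (C + 1))) \<le> \<epsilon> / 8" using C \<open>\<epsilon> > 0\<close> by (simp add: field_simps)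
    finally show ?thesis by simp
  qed
  \<comment> \<open>\<open>m Res m g\<close> is a difference of two potentials with parameter \<open>l\<close>\<close>
  let ?F1 = "\<lambda>z. ennreal m * ?G z"
  let ?F2 = "\<lambda>z. ennreal (m - l) * (ennreal m * Res m ?G z)"
  have m0: "m > 0" using lm \<open>l > 0\<close> by simp
  have id: "Res l ?F2 x + ennreal m * Res m ?G x = Res l ?F1 x" for x
  proof -
    have "Res l ?F1 x = ennreal m * Res l ?G x" by (intro Res_cmult) measurable
    also have "\<dots> = ennreal m * (ennreal (m - l) * Res l (Res m ?G) x + Res m ?G x)"
      using resolvent_identity(1)[of ?G l m x] lm \<open>l > 0\<close> by simp
    also have "\<dots> = ennreal (m - l) * (ennreal m * Res l (Res m ?G) x) + ennreal m * Res m ?G x"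
      by (simp add: distrib_left mult_ac)
    also have "ennreal (m - l) * (ennreal m * Res l (Res m ?G) x) = Res l ?F2 x"
      by (simp add: Res_cmult)
    finally show ?thesis ..
  qed
  have F1: "?F1 z \<le> ennreal (m * C)" for z using m0 g C by (simp add: ennreal_mult[symmetric] ennreal_leI)
  have F2: "?F2 z \<le> ennreal ((m - l) * C)" for z
  proof -
    have "(\<integral>x. g (z - r *\<^sub>R x) \<partial>yprob) \<le> (\<integral>x. C \<partial>yprob)" by (intro integral_mono int g) auto
    then have "(\<integral>x. g (z - r *\<^sub>R x) \<partial>yprob) \<le> C" by (simp add: prob1)
    then show ?thesis unfolding mean using lm C by (simp add: ennreal_mult[symmetric] ennreal_leI mult_left_mono integral_nonneg_AE g)
  qed
  \<comment> \<open>Each potential costs \<open>\<epsilon> / 8\<close> for sweeping and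
    \<open>\<epsilon> / 8\<close> for discretisation; with the smoothing error
    \<open>\<epsilon> / 4\<close> the total stays below \<epsilon>.\<close>
  have sweep: "\<exists>Y a. finite Y \<and> Y \<inter> S = {} \<and> (\<forall>x\<in>B. Res l F x < \<infinity> \<and> \<bar>enn2real (Res l F x) - (\<Sum>y\<in>Y. a y * yukawa l (x - y))\<bar> \<le> \<epsilon> / 4)"
    if Fm: "F \<in> borel_measurable borel" and FC: "\<And>z. F z \<le> ennreal C'" and "C' \<ge> 0" for F C'
  proof -
    have e8: "\<epsilon> / 8 > 0" using \<open>\<epsilon> > 0\<close> by simp
    obtain \<nu> K D where \<nu>: "\<nu> \<in> borel_measurable borel" "compact K" "K \<inter> S = {}" "\<And>z. \<nu> z \<le> ennreal D" "\<And>z. z \<notin> K \<Longrightarrow> \<nu> z = 0"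
      "\<And>x. x \<in> B \<Longrightarrow> Res l \<nu> x \<le> Res l F x" "\<And>x. x \<in> B \<Longrightarrow> Res l F x \<le> Res l \<nu> x + ennreal (\<epsilon> / 8)"
      by (rule Res_swept[OF Fm FC \<open>C' \<ge> 0\<close> \<open>l > 0\<close> \<open>compact B\<close> \<open>S \<noteq> {}\<close> ck e8]) (assumption, rule that)
    obtain Y a where Y: "finite Y" "Y \<subseteq> K" and a: "\<And>x. x \<in> B \<Longrightarrow> Res l \<nu> x < \<infinity> \<and> \<bar>enn2real (Res l \<nu> x) - (\<Sum>y\<in>Y. a y * yukawa l (x - y))\<bar> \<le> \<epsilon> / 8"
    proof (rule Res_riemann[OF \<nu>(1,2) \<open>compact B\<close> _ \<open>l > 0\<close> \<nu>(4,5) e8])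
      show "K \<inter> B = {}" using \<nu>(3) \<open>B \<subseteq> S\<close> by blast
    qed auto
    have "Res l F x < \<infinity> \<and> \<bar>enn2real (Res l F x) - (\<Sum>y\<in>Y. a y * yukawa l (x - y))\<bar> \<le> \<epsilon> / 4" if x: "x \<in> B" for x
    proof -
      obtain q where q: "Res l \<nu> x = ennreal q" "q \<ge> 0" using a[OF x] by (cases "Res l \<nu> x") auto
      have "Res l F x \<le> ennreal (q + \<epsilon> / 8)" using \<nu>(7)[OF x] q \<open>\<epsilon> > 0\<close> by simp
      moreover from this obtain p where p: "Res l F x = ennreal p" "p \<ge> 0" by (cases "Res l F x") (auto simp: top_unique)
      ultimately have "ennreal p \<le> ennreal (q + \<epsilon> / 8)" by simp
      then have "p \<le> q + \<epsilon> / 8" using q \<open>\<epsilon> > 0\<close> by (subst (asm) ennreal_le_iff) auto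
      moreover have "q \<le> p" using \<nu>(6)[OF x] p q by simp
      moreover have "\<bar>q - (\<Sum>y\<in>Y. a y * yukawa l (x - y))\<bar> \<le> \<epsilon> / 8" using a[OF x] q by simp
      ultimately have "\<bar>p - (\<Sum>y\<in>Y. a y * yukawa l (x - y))\<bar> \<le> \<epsilon> / 4" by linarith
      then show ?thesis using p by simp
    qed
    moreover have "Y \<inter> S = {}" using Y \<nu>(3) by blast
    ultimately show ?thesis using Y(1) by blast
  qed
  obtain Y1 a1 where 1: "finite Y1" "Y1 \<inter> S = {}" "\<And>x. x \<in> B \<Longrightarrow> Res l ?F1 x < \<infinity> \<and> \<bar>enn2real (Res l ?F1 x) - (\<Sum>y\<in>Y1. a1 y * yukawa l (x - y))\<bar> \<le> \<epsilon> / 4"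
  proof -
    have "?F1 \<in> borel_measurable borel" "m * C \<ge> 0" using m0 C by auto
    from sweep[OF this(1) F1 this(2)] show thesis using that by blast
  qed
  obtain Y2 a2 where 2: "finite Y2" "Y2 \<inter> S = {}" "\<And>x. x \<in> B \<Longrightarrow> Res l ?F2 x < \<infinity> \<and> \<bar>enn2real (Res l ?F2 x) - (\<Sum>y\<in>Y2. a2 y * yukawa l (x - y))\<bar> \<le> \<epsilon> / 4"
  proof -
    have "?F2 \<in> borel_measurable borel" "(m - l) * C \<ge> 0" using lm C by auto
    from sweep[OF this(1) F2 this(2)] show thesis using that by blast
  qed
  define a where "a y = (if y \<in> Y1 then a1 y else 0) - (if y \<in> Y2 then a2 y else 0)" for y
  have sum_a: "(\<Sum>y\<in>Y1 \<union> Y2. a y * yukawa l (x - y)) = (\<Sum>y\<in>Y1. a1 y * yukawa l (x - y)) - (\<Sum>y\<in>Y2. a2 y * yukawa l (x - y))" for x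
  proof -
    have "(\<Sum>y\<in>Y1 \<union> Y2. (if y \<in> Y1 then a1 y else 0) * yukawa l (x - y)) = (\<Sum>y\<in>Y1. a1 y * yukawa l (x - y))"
         "(\<Sum>y\<in>Y1 \<union> Y2. (if y \<in> Y2 then a2 y else 0) * yukawa l (x - y)) = (\<Sum>y\<in>Y2. a2 y * yukawa l (x - y))"
      using 1 2 by (auto intro!: sum.mono_neutral_cong_right)
    then show ?thesis by (simp add: a_def left_diff_distrib sum_subtractf)
  qed
  have "\<bar>g x - (\<Sum>y\<in>Y1 \<union> Y2. a y * yukawa l (x - y))\<bar> \<le> \<epsilon>" if x: "x \<in> B" for x
  proof -
    let ?I = "\<integral>z. g (x - r *\<^sub>R z) \<partial>yprob"
    have I: "?I \<ge> 0" by (simp add: integral_nonneg_AE g)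
    obtain p q where pq: "Res l ?F1 x = ennreal p" "p \<ge> 0" "Res l ?F2 x = ennreal q" "q \<ge> 0"
      using 1(3)[OF x] 2(3)[OF x] by (cases "Res l ?F1 x"; cases "Res l ?F2 x") auto
    have "ennreal (q + ?I) = ennreal p" using id[of x] pq I by (simp add: mean)
    then have "p = q + ?I" using pq I by (subst (asm) ennreal_inj) auto
    moreover have "\<bar>p - (\<Sum>y\<in>Y1. a1 y * yukawa l (x - y))\<bar> \<le> \<epsilon> / 4"
      "\<bar>q - (\<Sum>y\<in>Y2. a2 y * yukawa l (x - y))\<bar> \<le> \<epsilon> / 4"
      using 1(3)[OF x] 2(3)[OF x] pq by simp_all
    ultimately show ?thesis unfolding sum_a using appr[OF x] \<open>\<epsilon> > 0\<close> by linarith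
  qed
  then show ?thesis using 1 2 by (intro that[of "Y1 \<union> Y2" a]) auto
qed

end

section \<open>The maximum principle\<close>

text \<open>At the maximum \<open>h 0 = 0\<close>, so a positive \<open>d\<close> would make
  \<open>h\<close> positive just to the right of zero and \<open>f\<close> larger there.\<close>

lemma second_derivative_at_max:
  fixes f h :: "real \<Rightarrow> real"
  assumes f: "\<forall>\<^sub>F s in nhds 0. (f has_real_derivative h s) (at s)" and h: "(h has_real_derivative d) (at 0)"
    and "\<delta> > 0" and max: "\<And>s. \<bar>s\<bar> < \<delta> \<Longrightarrow> f s \<le> f 0"
  shows "d \<le> 0"
proof (rule ccontr)
  assume "\<not> d \<le> 0"
  then obtain e where e: "e > 0" "\<And>s. 0 < s \<Longrightarrow> s < e \<Longrightarrow> h 0 < h s"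
    using DERIV_pos_inc_right[OF h] by auto
  obtain r where r: "r > 0" "\<And>s. \<bar>s\<bar> < r \<Longrightarrow> (f has_real_derivative h s) (at s)"
    using f unfolding eventually_nhds_metric by (auto simp: dist_real_def)
  have "h 0 = 0"
    using DERIV_local_max[OF r(2)[of 0] \<open>\<delta> > 0\<close>] max r(1) by auto
  define s where "s = min (min e r) \<delta> / 2"
  have s: "0 < s" "s < e" "s < r" "s < \<delta>" using e r \<open>\<delta> > 0\<close> by (auto simp: s_def)
  have "\<exists>\<xi>. 0 < \<xi> \<and> \<xi> < s \<and> f s - f 0 = (s - 0) * h \<xi>"
    using s r by (intro MVT2) auto
  then obtain \<xi> where \<xi>: "0 < \<xi>" "\<xi> < s" "f s - f 0 = s * h \<xi>" by auto
  then have "f s - f 0 > 0" using s e(2)[of \<xi>] \<open>h 0 = 0\<close> by simp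
  then show False using max[of s] s by simp
qed

text \<open>One-sided because the maximum may be attained at the final time, where only earlier
  times are available.\<close>

lemma left_derivative_at_max:
  fixes f :: "real \<Rightarrow> real"
  assumes "(f has_real_derivative d) (at t)" "\<delta> > 0" "\<And>s. t - \<delta> < s \<Longrightarrow> s < t \<Longrightarrow> f s \<le> f t"
  shows "d \<ge> 0"
proof (rule ccontr)
  assume "\<not> d \<ge> 0"
  then obtain e where e: "e > 0" "\<And>s. 0 < s \<Longrightarrow> s < e \<Longrightarrow> f t < f (t - s)"
    using DERIV_neg_dec_left[OF assms(1)] by auto
  define s where "s = min e \<delta> / 2"
  have "0 < s" "s < e" "s < \<delta>" using e assms(2) by (auto simp: s_def)
  then show False using e(2)[of s] assms(3)[of "t - s"] by simp
qed

context elliptic_frame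
begin

text \<open>The decay as \<open>t\<close> tends to \<open>-\<infinity>\<close> replaces an initial condition in the maximum principle.\<close>

definition caloric_on :: "(real^'n) set \<Rightarrow> (real^'n \<Rightarrow> real \<Rightarrow> real) \<Rightarrow> bool" where
  "caloric_on S W \<longleftrightarrow>
     (\<forall>x\<in>S. \<forall>t. \<exists>wt h d. ((\<lambda>t. W x t) has_real_derivative wt) (at t) \<and>
        (\<forall>i. (\<forall>\<^sub>F s in nhds 0. ((\<lambda>s. W (x + s *\<^sub>R c i) t) has_real_derivative h i s) (at s)) \<and>
           (h i has_real_derivative d i) (at 0)) \<and> (\<Sum>i\<in>UNIV. d i) = wt) \<and>
     continuous_on (S \<times> UNIV) (\<lambda>(x, t). W x t) \<and>
     (\<exists>D\<ge>0. \<forall>x\<in>S. \<forall>t\<le>0. \<bar>W x t\<bar> \<le> D * exp (2 * t))"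

lemma caloric_on_zero: "caloric_on S (\<lambda>x t. 0)"
  unfolding caloric_on_def
  by (intro conjI ballI allI exI[of _ 0] exI[of _ "\<lambda>i s. 0"] exI[of _ "\<lambda>i. 0"]) auto

lemma caloric_on_add:
  assumes "caloric_on S V" "caloric_on S W"
  shows "caloric_on S (\<lambda>x t. V x t + W x t)"
  unfolding caloric_on_def
proof (intro conjI ballI allI)
  fix x t assume "x \<in> S"
  then obtain wt h d where
    1: "((\<lambda>t. V x t) has_real_derivative wt) (at t)"
       "\<And>i. \<forall>\<^sub>F s in nhds 0. ((\<lambda>s. V (x + s *\<^sub>R c i) t) has_real_derivative h i s) (at s)"
       "\<And>i. (h i has_real_derivative d i) (at 0)" "(\<Sum>i\<in>UNIV. d i) = wt"
    using assms(1) unfolding caloric_on_def by blast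
  obtain wt' h' d' where
    2: "((\<lambda>t. W x t) has_real_derivative wt') (at t)"
       "\<And>i. \<forall>\<^sub>F s in nhds 0. ((\<lambda>s. W (x + s *\<^sub>R c i) t) has_real_derivative h' i s) (at s)"
       "\<And>i. (h' i has_real_derivative d' i) (at 0)" "(\<Sum>i\<in>UNIV. d' i) = wt'"
    using assms(2) \<open>x \<in> S\<close> unfolding caloric_on_def by blast
  have "\<forall>\<^sub>F s in nhds 0. ((\<lambda>s. V (x + s *\<^sub>R c i) t + W (x + s *\<^sub>R c i) t) has_real_derivative h i s + h' i s) (at s)" for i
    using 1(2)[of i] 2(2)[of i] by eventually_elim (rule DERIV_add)
  then show "\<exists>wt h d. ((\<lambda>t. V x t + W x t) has_real_derivative wt) (at t) \<and>
        (\<forall>i. (\<forall>\<^sub>F s in nhds 0. ((\<lambda>s. V (x + s *\<^sub>R c i) t + W (x + s *\<^sub>R c i) t) has_real_derivative h i s) (at s)) \<and>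
           (h i has_real_derivative d i) (at 0)) \<and> (\<Sum>i\<in>UNIV. d i) = wt"
    by (intro exI[of _ "wt + wt'"] exI[of _ "\<lambda>i s. h i s + h' i s"] exI[of _ "\<lambda>i. d i + d' i"])
       (auto intro!: DERIV_add 1 2 simp: sum.distrib 1(4) 2(4))
next
  have "continuous_on (S \<times> UNIV) (\<lambda>z. (case z of (x, t) \<Rightarrow> V x t) + (case z of (x, t) \<Rightarrow> W x t))"
    using assms by (intro continuous_on_add) (auto simp: caloric_on_def)
  then show "continuous_on (S \<times> UNIV) (\<lambda>(x, t). V x t + W x t)" by (simp add: split_def)
next
  obtain D where D: "D \<ge> 0" "\<And>x t. x \<in> S \<Longrightarrow> t \<le> 0 \<Longrightarrow> \<bar>V x t\<bar> \<le> D * exp (2 * t)"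
    using assms(1) unfolding caloric_on_def by blast
  obtain D' where D': "D' \<ge> 0" "\<And>x t. x \<in> S \<Longrightarrow> t \<le> 0 \<Longrightarrow> \<bar>W x t\<bar> \<le> D' * exp (2 * t)"
    using assms(2) unfolding caloric_on_def by blast
  note DD = D D'
  show "\<exists>D\<ge>0. \<forall>x\<in>S. \<forall>t\<le>0. \<bar>V x t + W x t\<bar> \<le> D * exp (2 * t)"
  proof (intro exI[of _ "D + D'"] conjI ballI allI impI)
    fix x and t :: real assume "x \<in> S" "t \<le> 0"
    note DD(2)[OF this] DD(4)[OF this]
    then show "\<bar>V x t + W x t\<bar> \<le> (D + D') * exp (2 * t)" by (simp add: distrib_right)
  qed (use DD in auto)
qed

text \<open>Along the directions \<open>c i\<close> the squared norm is a quadratic polynomial, and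
  the equation becomes \<open>ydiff_recursion\<close> for \<open>i = 0\<close>. The decay comes from
  \<open>exp (l * t) \<le> exp (2 * t)\<close> for \<open>t \<le> 0\<close>.\<close>

lemma caloric_on_yukawa:
  assumes "l \<ge> 2" "y \<notin> S" "compact S"
  shows "caloric_on S (\<lambda>x t. a * (exp (l * t) * yukawa l (x - y)))"
  unfolding caloric_on_def
proof (intro conjI ballI allI)
  let ?n = "real CARD('n) / 2"
  have l: "l > 0" using assms by simp
  fix x t assume "x \<in> S"
  define z where "z = x - y"
  have "z \<noteq> 0" using \<open>x \<in> S\<close> assms by (auto simp: z_def)
  define \<rho> where "\<rho> = (norm (\<beta> z))\<^sup>2"
  have \<rho>: "\<rho> > 0" using \<open>z \<noteq> 0\<close> by (simp add: \<rho>_def \<beta>_eq_0_iff)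
  define b where "b i = \<beta> z $ i" for i
  define \<rho>s where "\<rho>s i s = \<rho> + 2 * s * b i + s\<^sup>2" for i s
  have yl: "yukawa l (x + s *\<^sub>R c i - y) = yuk ?n l (\<rho>s i s)" for i s
  proof -
    have "x + s *\<^sub>R c i - y = z + s *\<^sub>R c i" by (simp add: z_def)
    then show ?thesis by (simp only: yukawa_def \<beta>_line(2) \<rho>s_def \<rho>_def b_def)
  qed
  have D\<rho>: "(\<rho>s i has_real_derivative 2 * b i + 2 * s) (at s)" for i s
    unfolding \<rho>s_def[abs_def] by (auto intro!: derivative_eq_intros)
  have dy: "(yuk ?n l has_real_derivative ydiff ?n l 1 r) (at r)" if "r > 0" for r
    using yuk_deriv[of r ?n l] that l by (simp add: ydiff_def)
  have dy1: "(ydiff ?n l 1 has_real_derivative ydiff ?n l 2 r) (at r)" if "r > 0" for r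
  proof -
    have "((\<lambda>r. (- 1 / 4) * yuk (?n + 1) l r) has_real_derivative (- 1 / 4) * (- yuk (?n + 1 + 1) l r / 4)) (at r)"
      using that l by (intro DERIV_cmult yuk_deriv) auto
    then show ?thesis by (simp add: ydiff_def[abs_def] power2_eq_square add.assoc)
  qed
  define A where "A = a * exp (l * t)"
  define h where "h i s = A * (ydiff ?n l 1 (\<rho>s i s) * (2 * b i + 2 * s))" for i s
  define d where "d i = A * (ydiff ?n l 2 \<rho> * (2 * b i) * (2 * b i) + 2 * ydiff ?n l 1 \<rho>)" for i
  have "((\<lambda>t. a * (exp (l * t) * yukawa l (x - y))) has_real_derivative l * (A * yukawa l z)) (at t)"
    by (auto intro!: derivative_eq_intros simp: A_def z_def)
  moreover have "\<forall>\<^sub>F s in nhds 0. ((\<lambda>s. a * (exp (l * t) * yukawa l (x + s *\<^sub>R c i - y))) has_real_derivative h i s) (at s)" for i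
  proof -
    have "isCont (\<rho>s i) 0" using D\<rho>[of i 0] by (rule DERIV_isCont)
    then have "(\<rho>s i \<longlongrightarrow> \<rho>) (nhds 0)" unfolding isCont_def by (simp add: \<rho>s_def tendsto_nhds_iff)
    then have "\<forall>\<^sub>F s in nhds 0. \<rho>s i s > 0" using \<rho> by (rule order_tendstoD)
    then show ?thesis
    proof eventually_elim
      case (elim s)
      have "((\<lambda>s. A * yuk ?n l (\<rho>s i s)) has_real_derivative h i s) (at s)"
        unfolding h_def by (intro DERIV_cmult DERIV_chain2[OF dy[OF elim] D\<rho>])
      then show ?case by (simp add: yl A_def mult.assoc)
    qed
  qed
  moreover have "(h i has_real_derivative d i) (at 0)" for i
  proof -
    have \<rho>0: "\<rho>s i 0 = \<rho>" by (simp add: \<rho>s_def)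
    have "((\<lambda>s. ydiff ?n l 1 (\<rho>s i s)) has_real_derivative ydiff ?n l 2 \<rho> * (2 * b i)) (at 0)"
      using DERIV_chain2[OF dy1[OF \<rho>[folded \<rho>0]] D\<rho>[of i 0]] by (simp add: \<rho>s_def)
    moreover have "((\<lambda>s. 2 * b i + 2 * s) has_real_derivative 2) (at 0)" by (auto intro!: derivative_eq_intros)
    ultimately have "((\<lambda>s. ydiff ?n l 1 (\<rho>s i s) * (2 * b i + 2 * s)) has_real_derivative
        ydiff ?n l 2 \<rho> * (2 * b i) * (2 * b i + 2 * 0) + 2 * ydiff ?n l 1 (\<rho>s i 0)) (at 0)"
      by (rule DERIV_mult)
    then show ?thesis unfolding h_def[abs_def] d_def \<rho>0 by (intro DERIV_cmult) simp
  qed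
  moreover have "(\<Sum>i\<in>UNIV. d i) = l * (A * yukawa l z)"
  proof -
    have "(\<Sum>i\<in>UNIV. b i * b i) = \<rho>" by (simp add: \<rho>_def b_def power2_norm_eq_inner inner_vec_def)
    moreover have "(\<Sum>i\<in>UNIV. d i) = A * (4 * ydiff ?n l 2 \<rho> * (\<Sum>i\<in>UNIV. b i * b i) + 2 * real CARD('n) * ydiff ?n l 1 \<rho>)"
      unfolding d_def by (simp add: sum.distrib sum_distrib_left sum_distrib_right distrib_left mult_ac)
    ultimately have "(\<Sum>i\<in>UNIV. d i) = A * (4 * \<rho> * ydiff ?n l (0 + 2) \<rho> + (4 * (real 0 + ?n)) * ydiff ?n l (0 + 1) \<rho>)"
      by (simp del: add_2_eq_Suc add_2_eq_Suc')
    then show ?thesis using ydiff_recursion[of \<rho> l ?n 0] \<rho> l by (simp add: yukawa_def \<rho>_def)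
  qed
  ultimately show "\<exists>wt h d. ((\<lambda>t. a * (exp (l * t) * yukawa l (x - y))) has_real_derivative wt) (at t) \<and>
        (\<forall>i. (\<forall>\<^sub>F s in nhds 0. ((\<lambda>s. a * (exp (l * t) * yukawa l (x + s *\<^sub>R c i - y))) has_real_derivative h i s) (at s)) \<and>
           (h i has_real_derivative d i) (at 0)) \<and> (\<Sum>i\<in>UNIV. d i) = wt" by blast
next
  have yc: "continuous_on S (\<lambda>x. yukawa l (x - y))"
    by (rule continuous_on_compose2[OF yukawa_continuous]) (use assms in \<open>auto intro!: continuous_intros\<close>)
  show "continuous_on (S \<times> UNIV) (\<lambda>(x, t). a * (exp (l * t) * yukawa l (x - y)))"
    unfolding split_def
    by (intro continuous_intros continuous_on_compose2[OF yc]) auto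
  have "bounded ((\<lambda>x. yukawa l (x - y)) ` S)"
    using assms yc by (intro compact_imp_bounded compact_continuous_image)
  then obtain q where q: "\<And>x. x \<in> S \<Longrightarrow> \<bar>yukawa l (x - y)\<bar> \<le> q" by (auto simp: bounded_iff)
  show "\<exists>D\<ge>0. \<forall>x\<in>S. \<forall>t\<le>0. \<bar>a * (exp (l * t) * yukawa l (x - y))\<bar> \<le> D * exp (2 * t)"
  proof (intro exI[of _ "\<bar>a\<bar> * \<bar>q\<bar>"] conjI ballI allI impI)
    fix x and t :: real assume "x \<in> S" "t \<le> 0"
    have "exp (l * t) * \<bar>yukawa l (x - y)\<bar> \<le> exp (2 * t) * \<bar>q\<bar>"
      using q[OF \<open>x \<in> S\<close>] \<open>t \<le> 0\<close> assms mult_right_mono_neg[of 2 l t] by (intro mult_mono) auto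
    then have "\<bar>a\<bar> * (exp (l * t) * \<bar>yukawa l (x - y)\<bar>) \<le> \<bar>a\<bar> * (exp (2 * t) * \<bar>q\<bar>)" by (intro mult_left_mono) auto
    then show "\<bar>a * (exp (l * t) * yukawa l (x - y))\<bar> \<le> \<bar>a\<bar> * \<bar>q\<bar> * exp (2 * t)" by (simp add: abs_mult mult_ac)
  qed auto
qed

text \<open>Applied to \<open>e\<^bsup>-t\<^esup> W\<close>, for which a positive interior maximum contradicts the equation.\<close>

lemma maximum_principle:
  assumes "open \<Omega>" "bounded \<Omega>" and W: "caloric_on (closure \<Omega>) W"
    and bd: "\<And>x t. x \<in> frontier \<Omega> \<Longrightarrow> t \<le> 0 \<Longrightarrow> W x t \<le> \<epsilon> * exp (2 * t)" and "\<epsilon> > 0" and x1: "x1 \<in> \<Omega>"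
  shows "W x1 0 \<le> \<epsilon>"
proof (rule ccontr)
  assume "\<not> W x1 0 \<le> \<epsilon>"
  then have big: "W x1 0 > \<epsilon>" by simp
  let ?S = "closure \<Omega>"
  obtain D where D: "D \<ge> 0" "\<And>x t. x \<in> ?S \<Longrightarrow> t \<le> 0 \<Longrightarrow> \<bar>W x t\<bar> \<le> D * exp (2 * t)"
    using W unfolding caloric_on_def by blast
  \<comment> \<open>At time \<open>- T0\<close> the decay already gives
    \<open>Z \<le> D * exp (- T0) \<le> \<epsilon>\<close>, so the bottom of the cylinder
    \<open>?K\<close> needs no data.\<close>
  define T0 where "T0 = max 1 (ln ((D + 1) / \<epsilon>))"
  have T0: "T0 > 0" by (simp add: T0_def)
  have DT: "D * exp (- T0) \<le> \<epsilon>"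
  proof -
    have "(D + 1) / \<epsilon> = exp (ln ((D + 1) / \<epsilon>))" using D \<open>\<epsilon> > 0\<close> by simp
    also have "\<dots> \<le> exp T0" by (simp add: T0_def)
    finally have "D + 1 \<le> exp T0 * \<epsilon>" using \<open>\<epsilon> > 0\<close> by (simp add: pos_divide_le_eq)
    then show ?thesis by (simp add: exp_minus field_simps)
  qed
  define Z where "Z x t = exp (- t) * W x t" for x t
  let ?K = "?S \<times> {- T0..0}"
  have "compact ?K" using assms by (intro compact_Times) (auto simp: compact_closure)
  moreover have "?K \<noteq> {}" using x1 T0 closure_subset by fastforce
  moreover have "continuous_on ?K (\<lambda>(x, t). Z x t)"
  proof -
    have "continuous_on ?K (\<lambda>(x, t). W x t)"
      using W unfolding caloric_on_def by (auto intro: continuous_on_subset)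
    then show ?thesis unfolding Z_def split_def by (intro continuous_intros)
  qed
  ultimately obtain p where p: "p \<in> ?K" "\<forall>q\<in>?K. (case q of (x, t) \<Rightarrow> Z x t) \<le> (case p of (x, t) \<Rightarrow> Z x t)"
    using continuous_attains_sup[of ?K "\<lambda>(x, t). Z x t"] by blast
  obtain xs ts where pe: "p = (xs, ts)" by (cases p)
  have xs: "xs \<in> ?S" and ts: "- T0 \<le> ts" "ts \<le> 0" using p(1) by (auto simp: pe)
  have max: "Z x t \<le> Z xs ts" if "x \<in> ?S" "- T0 \<le> t" "t \<le> 0" for x t
    using p(2)[rule_format, of "(x, t)"] that by (simp add: pe)
  have Zbig: "Z xs ts > \<epsilon>"
  proof -
    have "Z x1 0 \<le> Z xs ts" using x1 closure_subset T0 by (intro max) auto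
    then show ?thesis using big by (simp add: Z_def)
  qed
  have "xs \<notin> frontier \<Omega>"
  proof
    assume "xs \<in> frontier \<Omega>"
    then have "Z xs ts \<le> exp (- ts) * (\<epsilon> * exp (2 * ts))" unfolding Z_def using bd ts by (intro mult_left_mono) auto
    also have "\<dots> = \<epsilon> * exp ts" by (simp flip: exp_add)
    also have "\<dots> \<le> \<epsilon>" using ts \<open>\<epsilon> > 0\<close> by simp
    finally show False using Zbig by simp
  qed
  then have xs\<Omega>: "xs \<in> \<Omega>" using xs \<open>open \<Omega>\<close> by (simp add: frontier_def interior_open)
  have "ts \<noteq> - T0"
  proof
    assume e: "ts = - T0"
    have "Z xs ts \<le> exp (- ts) * (D * exp (2 * ts))"
      unfolding Z_def using D(2)[OF xs ts(2)] by (intro mult_left_mono) auto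
    also have "\<dots> = D * exp ts" by (simp flip: exp_add)
    also have "\<dots> = D * exp (- T0)" by (simp add: e)
    finally show False using Zbig DT by simp
  qed
  then have ts': "- T0 < ts" using ts by simp
  obtain wt h d where wt: "((\<lambda>t. W xs t) has_real_derivative wt) (at ts)"
    and h: "\<And>i. \<forall>\<^sub>F s in nhds 0. ((\<lambda>s. W (xs + s *\<^sub>R c i) ts) has_real_derivative h i s) (at s)"
    and d: "\<And>i. (h i has_real_derivative d i) (at 0)" and sum: "(\<Sum>i\<in>UNIV. d i) = wt"
    using W xs unfolding caloric_on_def by blast
  have "d i \<le> 0" for i
  proof -
    obtain e where e: "e > 0" "ball xs e \<subseteq> \<Omega>" using \<open>open \<Omega>\<close> xs\<Omega> open_contains_ball by blast
    define \<delta> where "\<delta> = e / (norm (c i) + 1)"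
    have np: "norm (c i) + 1 > 0" by (simp add: add_nonneg_pos)
    show ?thesis
    proof (rule second_derivative_at_max[OF h d])
      show "\<delta> > 0" using e np by (simp add: \<delta>_def)
      fix s :: real assume s: "\<bar>s\<bar> < \<delta>"
      have "\<bar>s\<bar> * norm (c i) \<le> \<bar>s\<bar> * (norm (c i) + 1)" by (simp add: mult_left_mono)
      also have "\<dots> < e" using s np by (simp add: \<delta>_def pos_less_divide_eq)
      finally have "xs + s *\<^sub>R c i \<in> ball xs e" by (simp add: dist_norm)
      then have "xs + s *\<^sub>R c i \<in> ?S" using e closure_subset by blast
      then have "Z (xs + s *\<^sub>R c i) ts \<le> Z xs ts" using ts by (intro max)
      then show "W (xs + s *\<^sub>R c i) ts \<le> W (xs + 0 *\<^sub>R c i) ts" by (simp add: Z_def)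
    qed
  qed
  \<comment> \<open>The second derivatives at the spatial maximum give \<open>wt \<le> 0\<close>,
    while maximality of \<open>Z\<close> up to time \<open>ts\<close> gives
    \<open>wt \<ge> W xs ts > 0\<close>.\<close>
  then have "wt \<le> 0" unfolding sum[symmetric] by (intro sum_nonpos) auto
  moreover have "exp (- ts) * (wt - W xs ts) \<ge> 0"
  proof (rule left_derivative_at_max)
    show "((\<lambda>t. Z xs t) has_real_derivative exp (- ts) * (wt - W xs ts)) (at ts)"
      unfolding Z_def by (auto intro!: derivative_eq_intros wt simp: algebra_simps)
    show "ts + T0 > 0" using ts' by simp
    show "Z xs s \<le> Z xs ts" if "ts - (ts + T0) < s" "s < ts" for s
      using that ts by (intro max xs) auto
  qed
  then have "wt \<ge> W xs ts" by (simp add: zero_le_mult_iff)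
  moreover have "W xs ts > 0" using Zbig \<open>\<epsilon> > 0\<close> unfolding Z_def by (smt (verit) exp_gt_zero mult_nonneg_nonpos)
  ultimately show False by simp
qed

end

section \<open>Uniform approximation on the parabolic boundary\<close>

context elliptic_frame
begin

text \<open>The caloric functions that match the lateral data; \<open>l \<ge> 2\<close> yields the decay \<open>e\<^bsup>2t\<^esup>\<close>.\<close>

inductive packet :: "(real^'n) set \<Rightarrow> (real^'n \<Rightarrow> real \<Rightarrow> real) \<Rightarrow> bool" for S where
  packet_zero: "packet S (\<lambda>x t. 0)"
| packet_add: "packet S V \<Longrightarrow> packet S W \<Longrightarrow> packet S (\<lambda>x t. V x t + W x t)"
| packet_yukawa: "l \<ge> 2 \<Longrightarrow> y \<notin> S \<Longrightarrow> packet S (\<lambda>x t. a * (exp (l * t) * yukawa l (x - y)))"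

lemma packet_caloric_on: "packet S W \<Longrightarrow> compact S \<Longrightarrow> caloric_on S W"
  by (induction rule: packet.induct) (auto intro: caloric_on_zero caloric_on_add caloric_on_yukawa)

lemma packet_uminus: "packet S W \<Longrightarrow> packet S (\<lambda>x t. - W x t)"
proof (induction rule: packet.induct)
  case packet_zero
  show ?case using packet.packet_zero by simp
next
  case (packet_add V W)
  then show ?case using packet.packet_add[OF packet_add.IH] by simp
next
  case (packet_yukawa l y a)
  then show ?case using packet.packet_yukawa[of l y S "- a"] by simp
qed

lemma packet_sum:
  "finite I \<Longrightarrow> (\<And>i. i \<in> I \<Longrightarrow> packet S (f i)) \<Longrightarrow> packet S (\<lambda>x t. \<Sum>i\<in>I. f i x t)"
  by (induction I rule: finite_induct) (auto intro: packet.intros)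

lemma packet_approx_on:
  assumes "packet S W" "compact S" "connected (- S)" "I \<subseteq> {0..T}"
    and v: "\<And>p. rpf p \<Longrightarrow> approx_on (S \<times> I) v (\<lambda>(x, t). heat_ext p x t)"
  shows "approx_on (S \<times> I) v (\<lambda>(x, t). W x t)"
  using assms(1)
proof (induction rule: packet.induct)
  case packet_zero
  show ?case using approx_on_zero[of "S \<times> I" v] by (simp add: split_def)
next
  case (packet_add V W)
  then show ?case using approx_on_add[OF packet_add.IH] by (simp add: split_def)
next
  case (packet_yukawa l y a)
  have "approx_on (S \<times> I) v (\<lambda>(x, t). exp (l * t) * yukawa l (x - y))"
    using packet_yukawa assms(2-4) v by (intro yukawa_runge) auto
  then show ?case using approx_on_cmult[of "S \<times> I" v _ a] by (simp add: split_def)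
qed

text \<open>Positive and negative parts are treated separately and cut off at a bound for
  \<open>g\<close> on \<open>B\<close>, since \<open>yukawa_dense_nonneg\<close> asks for
  nonnegative bounded functions on the whole space.\<close>

lemma packet_dense:
  fixes g :: "real^'n \<Rightarrow> real"
  assumes g: "continuous_on UNIV g" and l: "l \<ge> 2"
    and B: "compact B" "B \<subseteq> S" "S \<noteq> {}" and ck: "\<And>x. x \<in> B \<Longrightarrow> exterior_corkscrew S x" and "\<epsilon> > 0"
  obtains W where "packet S W" "\<And>x t. x \<in> B \<Longrightarrow> \<bar>exp (l * t) * g x - W x t\<bar> \<le> \<epsilon> * exp (l * t)"
proof -
  have "bounded (g ` B)"
    using B continuous_on_subset[OF g] by (intro compact_imp_bounded compact_continuous_image) auto
  then obtain C where C: "\<And>x. x \<in> B \<Longrightarrow> \<bar>g x\<bar> \<le> C" by (auto simp: bounded_iff)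
  define D where "D = max 0 C"
  have part: "\<exists>Y a. finite Y \<and> Y \<inter> S = {} \<and>
      (\<forall>x\<in>B. \<bar>min D (max 0 (r * g x)) - (\<Sum>y\<in>Y. a y * yukawa l (x - y))\<bar> \<le> \<epsilon> / 2)" for r
  proof -
    have "continuous_on UNIV (\<lambda>x. min D (max 0 (r * g x)))" by (intro continuous_intros g)
    moreover have "0 \<le> min D (max 0 (r * g x))" "min D (max 0 (r * g x)) \<le> D" for x by (auto simp: D_def)
    moreover have "l > 0" "\<epsilon> / 2 > 0" using l \<open>\<epsilon> > 0\<close> by auto
    ultimately obtain Y a where "finite Y" "Y \<inter> S = {}"
      "\<And>x. x \<in> B \<Longrightarrow> \<bar>min D (max 0 (r * g x)) - (\<Sum>y\<in>Y. a y * yukawa l (x - y))\<bar> \<le> \<epsilon> / 2"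
      using yukawa_dense_nonneg[of "\<lambda>x. min D (max 0 (r * g x))" D l B S "\<epsilon> / 2"] B ck by blast
    then show ?thesis by blast
  qed
  obtain Y a where Y: "finite Y" "Y \<inter> S = {}"
    "\<And>x. x \<in> B \<Longrightarrow> \<bar>min D (max 0 (1 * g x)) - (\<Sum>y\<in>Y. a y * yukawa l (x - y))\<bar> \<le> \<epsilon> / 2"
    using part[of 1] by blast
  obtain Z b where Z: "finite Z" "Z \<inter> S = {}"
    "\<And>x. x \<in> B \<Longrightarrow> \<bar>min D (max 0 (- 1 * g x)) - (\<Sum>y\<in>Z. b y * yukawa l (x - y))\<bar> \<le> \<epsilon> / 2"
    using part[of "- 1"] by blast
  define W where "W x t = (\<Sum>y\<in>Y. a y * (exp (l * t) * yukawa l (x - y))) +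
      (\<Sum>y\<in>Z. - b y * (exp (l * t) * yukawa l (x - y)))" for x t
  show ?thesis
  proof (rule that[of W])
    show "packet S W" unfolding W_def[abs_def]
      using Y Z l by (intro packet_add packet_sum packet_yukawa) auto
    fix x t assume x: "x \<in> B"
    let ?s = "\<Sum>y\<in>Y. a y * yukawa l (x - y)" and ?s' = "\<Sum>y\<in>Z. b y * yukawa l (x - y)"
    have W: "W x t = exp (l * t) * (?s - ?s')"
      by (simp add: W_def sum_distrib_left right_diff_distrib sum_negf mult_ac)
    have "g x = min D (max 0 (1 * g x)) - min D (max 0 (- 1 * g x))"
      using C[OF x] by (auto simp: D_def)
    then have "\<bar>g x - (?s - ?s')\<bar> \<le> \<epsilon>" using Y(3)[OF x] Z(3)[OF x] by linarith
    then have "exp (l * t) * \<bar>g x - (?s - ?s')\<bar> \<le> exp (l * t) * \<epsilon>" by (intro mult_left_mono) auto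
    moreover have "\<bar>exp (l * t) * g x - W x t\<bar> = exp (l * t) * \<bar>g x - (?s - ?s')\<bar>"
      unfolding W right_diff_distrib[symmetric] by (simp add: abs_mult)
    ultimately show "\<bar>exp (l * t) * g x - W x t\<bar> \<le> \<epsilon> * exp (l * t)" by (simp add: mult.commute)
  qed
qed

end

text \<open>Polynomials on the product become sums of \<open>g x * s ^ k\<close>, and each power of
  \<open>s = exp t\<close> fixes one exponent \<open>l\<close>. The coefficients are merely
  continuous, which is all that \<open>packet_dense\<close> asks for.\<close>

inductive separated_sum :: "('a::topological_space \<times> real \<Rightarrow> real) \<Rightarrow> bool" where
  separated_sum_power: "continuous_on UNIV g \<Longrightarrow> separated_sum (\<lambda>z. g (fst z) * snd z ^ k)"
| separated_sum_add: "separated_sum p \<Longrightarrow> separated_sum q \<Longrightarrow> separated_sum (\<lambda>z. p z + q z)"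

lemma separated_sum_mult:
  assumes "separated_sum p" "separated_sum q"
  shows "separated_sum (\<lambda>z. p z * q z)"
  using assms(1)
proof (induction rule: separated_sum.induct)
  case (separated_sum_power g k)
  show ?case using assms(2)
  proof (induction rule: separated_sum.induct)
    case (separated_sum_power g' k')
    have "separated_sum (\<lambda>z. (g (fst z) * g' (fst z)) * snd z ^ (k + k'))"
      by (rule separated_sum.separated_sum_power[of "\<lambda>x. g x * g' x"])
         (intro continuous_intros separated_sum_power \<open>continuous_on UNIV g\<close>)
    then show ?case by (simp add: power_add mult_ac)
  next
    case (separated_sum_add p q)
    then show ?case using separated_sum.separated_sum_add[OF separated_sum_add.IH]
      by (simp add: distrib_left)
  qed
next
  case (separated_sum_add p q)
  then show ?case using separated_sum.separated_sum_add[OF separated_sum_add.IH]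
    by (simp add: distrib_right)
qed

lemma rpf_separated_sum:
  fixes p :: "'a::real_normed_vector \<times> real \<Rightarrow> real"
  assumes "rpf p"
  shows "separated_sum p"
  using assms
proof (induction rule: real_polynomial_function.induct)
  case (linear f)
  then interpret f: bounded_linear f .
  have "bounded_linear (\<lambda>x. f (x, 0))"
    by (rule bounded_linear_compose[OF linear bounded_linear_Pair[OF bounded_linear_ident bounded_linear_zero]])
  then have "continuous_on UNIV (\<lambda>x. f (x, 0))" by (rule linear_continuous_on)
  then have "separated_sum (\<lambda>z. f (fst z, 0) * snd z ^ 0)"
    by (rule separated_sum_power)
  moreover have "separated_sum (\<lambda>z::'a \<times> real. f (0, 1) * snd z ^ 1)"
    by (rule separated_sum_power[of "\<lambda>x. f (0, 1)"]) simp
  ultimately have "separated_sum (\<lambda>z. f (fst z, 0) * snd z ^ 0 + f (0, 1) * snd z ^ 1)"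
    by (rule separated_sum_add)
  moreover have "(\<lambda>z. f (fst z, 0) * snd z ^ 0 + f (0, 1) * snd z ^ 1) = f"
  proof
    fix z
    show "f (fst z, 0) * snd z ^ 0 + f (0, 1) * snd z ^ 1 = f z"
      using f.add[of "(fst z, 0)" "snd z *\<^sub>R (0, 1)"] f.scaleR[of "snd z" "(0, 1)"] by (cases z) simp
  qed
  ultimately show ?case by simp
next
  case (const a)
  show ?case using separated_sum_power[of "\<lambda>x. a" 0] by simp
qed (auto intro: separated_sum_add separated_sum_mult)

context elliptic_frame
begin

lemma packet_separated_sum:
  assumes "separated_sum q" and B: "compact B" "B \<subseteq> S" "S \<noteq> {}"
    and ck: "\<And>x. x \<in> B \<Longrightarrow> exterior_corkscrew S x" and "\<epsilon> > 0"
  shows "\<exists>W. packet S W \<and> (\<forall>x\<in>B. \<forall>t\<le>T. \<bar>exp (2 * t) * q (x, exp t) - W x t\<bar> \<le> \<epsilon> * exp (2 * t))"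
  using assms(1) \<open>\<epsilon> > 0\<close>
proof (induction arbitrary: \<epsilon> rule: separated_sum.induct)
  case (separated_sum_power g k)
  define l where "l = real k + 2"
  have l: "l \<ge> 2" by (simp add: l_def)
  \<comment> \<open>The error contains \<open>exp t ^ k\<close>, which is at most
    \<open>exp T ^ k\<close>; dividing by this in advance leaves
    \<open>\<epsilon> * exp (2 * t)\<close>.\<close>
  have "\<epsilon> / exp T ^ k > 0" using separated_sum_power by simp
  then obtain W where W: "packet S W"
    "\<And>x t. x \<in> B \<Longrightarrow> \<bar>exp (l * t) * g x - W x t\<bar> \<le> \<epsilon> / exp T ^ k * exp (l * t)"
    using packet_dense[OF separated_sum_power(1) l B ck] by blast
  have "\<bar>exp (2 * t) * (g x * exp t ^ k) - W x t\<bar> \<le> \<epsilon> * exp (2 * t)" if "x \<in> B" "t \<le> T" for x t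
  proof -
    have e: "exp (l * t) = exp (2 * t) * exp t ^ k"
      by (simp add: l_def distrib_right exp_add exp_of_nat_mult)
    have "exp t ^ k \<le> exp T ^ k" using that by (intro power_mono) auto
    then have "\<epsilon> / exp T ^ k * exp (l * t) \<le> \<epsilon> / exp T ^ k * (exp (2 * t) * exp T ^ k)"
      unfolding e using separated_sum_power by (intro mult_left_mono) auto
    then show ?thesis using W(2)[OF that(1), of t] by (simp add: e mult_ac)
  qed
  then show ?case using W(1) by (intro exI[of _ W]) simp
next
  case (separated_sum_add p q)
  then have "\<epsilon> / 2 > 0" by simp
  obtain V where "packet S V"
    and V: "\<forall>x\<in>B. \<forall>t\<le>T. \<bar>exp (2 * t) * p (x, exp t) - V x t\<bar> \<le> \<epsilon> / 2 * exp (2 * t)"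
    using separated_sum_add.IH(1)[OF \<open>\<epsilon> / 2 > 0\<close>] by blast
  obtain W where "packet S W"
    and W: "\<forall>x\<in>B. \<forall>t\<le>T. \<bar>exp (2 * t) * q (x, exp t) - W x t\<bar> \<le> \<epsilon> / 2 * exp (2 * t)"
    using separated_sum_add.IH(2)[OF \<open>\<epsilon> / 2 > 0\<close>] by blast
  have "\<bar>exp (2 * t) * (p (x, exp t) + q (x, exp t)) - (V x t + W x t)\<bar> \<le> \<epsilon> * exp (2 * t)"
    if "x \<in> B" "t \<le> T" for x t
  proof -
    have "\<bar>P * (a + b) - (c + d)\<bar> \<le> \<epsilon> * P" if "\<bar>P * a - c\<bar> \<le> \<epsilon> / 2 * P" "\<bar>P * b - d\<bar> \<le> \<epsilon> / 2 * P" for P a b c d :: real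
      using add_mono[OF that] abs_triangle_ineq[of "P * a - c" "P * b - d"] by (simp add: algebra_simps)
    then show ?thesis using V[rule_format, OF that] W[rule_format, OF that] by blast
  qed
  then show ?case using packet_add[OF \<open>packet S V\<close> \<open>packet S W\<close>]
    by (intro exI[of _ "\<lambda>x t. V x t + W x t"]) simp
qed

text \<open>In the variable \<open>s = e\<^sup>t\<close> the half-line \<open>t \<le> T\<close> becomes bounded, and \<open>s\<^sup>k\<^sup>+\<^sup>2 g(x)\<close> corresponds to
  the admissible exponent \<open>l = k + 2\<close>.\<close>

lemma packet_lateral:
  fixes h :: "(real^'n) \<times> real \<Rightarrow> real"
  assumes h: "continuous_on (B \<times> UNIV) h" "\<And>x t. x \<in> B \<Longrightarrow> t \<le> 0 \<Longrightarrow> h (x, t) = 0"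
    and B: "compact B" "B \<subseteq> S" "S \<noteq> {}" and ck: "\<And>x. x \<in> B \<Longrightarrow> exterior_corkscrew S x" and "\<epsilon> > 0"
  obtains W where "packet S W" "\<And>x t. x \<in> B \<Longrightarrow> t \<le> T \<Longrightarrow> \<bar>h (x, t) - W x t\<bar> \<le> \<epsilon> * exp (2 * t)"
proof -
  \<comment> \<open>With \<open>s = exp t\<close> this is \<open>h / s\<^sup>2\<close> for
    \<open>s \<ge> 1\<close>, and over \<open>B\<close> it is zero for \<open>s \<le> 1\<close>,
    where the data vanish. Dividing by \<open>s\<^sup>2\<close> turns a uniform error into one
    proportional to \<open>exp (2 * t)\<close>.\<close>
  define f where "f z = h (fst z, ln (max 1 (snd z))) / (max 1 (snd z))\<^sup>2" for z
  have "continuous_on (B \<times> {0..exp T}) (\<lambda>z. (fst z, ln (max 1 (snd z))))"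
    by (intro continuous_intros) auto
  then have "continuous_on (B \<times> {0..exp T}) (\<lambda>z. h (fst z, ln (max 1 (snd z))))"
    by (rule continuous_on_compose2[OF h(1)]) auto
  then have "continuous_on (B \<times> {0..exp T}) f"
    unfolding f_def by (intro continuous_intros) auto
  moreover have "compact (B \<times> {0..exp T})" using B by (intro compact_Times) auto
  ultimately obtain q where q: "rpf q" "\<And>z. z \<in> B \<times> {0..exp T} \<Longrightarrow> \<bar>f z - q z\<bar> < \<epsilon> / 2"
    using Stone_Weierstrass_real_polynomial_function[of "B \<times> {0..exp T}" f "\<epsilon> / 2"] \<open>\<epsilon> > 0\<close> by auto
  obtain W where W: "packet S W"
    "\<forall>x\<in>B. \<forall>t\<le>T. \<bar>exp (2 * t) * q (x, exp t) - W x t\<bar> \<le> \<epsilon> / 2 * exp (2 * t)"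
    using packet_separated_sum[OF rpf_separated_sum[OF q(1)] B ck, of "\<epsilon> / 2" T] \<open>\<epsilon> > 0\<close> by auto
  show ?thesis
  proof (rule that[OF W(1)])
    fix x t assume x: "x \<in> B" and t: "t \<le> T"
    have "h (x, t) = exp (2 * t) * f (x, exp t)"
    proof (cases "t \<le> 0")
      case True
      then have "max 1 (exp t) = 1" by simp
      then show ?thesis using h(2)[OF x] True by (simp add: f_def)
    next
      case False
      then have "max 1 (exp t) = exp t" by simp
      then show ?thesis by (simp add: f_def exp_double)
    qed
    then have "\<bar>h (x, t) - exp (2 * t) * q (x, exp t)\<bar> = exp (2 * t) * \<bar>f (x, exp t) - q (x, exp t)\<bar>"
      by (simp add: right_diff_distrib[symmetric] abs_mult)
    also have "\<dots> \<le> exp (2 * t) * (\<epsilon> / 2)"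
      using q(2)[of "(x, exp t)"] x t by (intro mult_left_mono) auto
    finally have "\<bar>h (x, t) - exp (2 * t) * q (x, exp t)\<bar> \<le> \<epsilon> / 2 * exp (2 * t)"
      by (simp only: mult.commute)
    then show "\<bar>h (x, t) - W x t\<bar> \<le> \<epsilon> * exp (2 * t)"
      using W(2)[rule_format, OF x t] by linarith
  qed
qed

theorem approx_on_parabolic_boundary:
  assumes "open \<Omega>" "bounded \<Omega>" "\<Omega> \<noteq> {}" "connected (- closure \<Omega>)"
    and ck: "\<And>x. x \<in> frontier \<Omega> \<Longrightarrow> exterior_corkscrew (closure \<Omega>) x"
    and "T > 0" and F: "continuous_on UNIV F"
    and v: "\<And>p. rpf p \<Longrightarrow> approx_on (closure \<Omega> \<times> {0..T}) v (\<lambda>(x, t). heat_ext p x t)"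
  shows "approx_on (parabolic_boundary \<Omega> T) v F"
proof (rule approx_on_limit)
  fix \<epsilon> :: real assume "\<epsilon> > 0"
  let ?S = "closure \<Omega>" and ?B = "frontier \<Omega>"
  have S: "compact ?S" "?B \<subseteq> ?S" "?S \<noteq> {}" "compact ?B"
    using assms by (auto simp: compact_closure frontier_def intro: compact_frontier_bounded[unfolded frontier_def])
  have "continuous_on ?S (\<lambda>x. F (x, 0))"
    by (rule continuous_on_compose2[OF F]) (auto intro!: continuous_intros)
  then obtain p where p: "rpf p" "\<And>x. x \<in> ?S \<Longrightarrow> \<bar>F (x, 0) - p x\<bar> < \<epsilon> / 4"
    using Stone_Weierstrass_real_polynomial_function[OF S(1), of "\<lambda>x. F (x, 0)" "\<epsilon> / 4"] \<open>\<epsilon> > 0\<close> by auto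
  \<comment> \<open>The data left after removing the caloric extension of \<open>p\<close>. The last
    bracket, below \<open>\<epsilon> / 4\<close> in size, makes them vanish at \<open>t = 0\<close>,
    so that their extension by zero to negative times is continuous.\<close>
  define k where "k x t = F (x, t) - heat_ext p x t - (F (x, 0) - p x)" for x t
  define h where "h z = k (fst z) (max 0 (snd z))" for z
  have "continuous_on UNIV (\<lambda>z. F (fst z, max 0 (snd z)))"
       "continuous_on UNIV (\<lambda>z. F (fst z, 0))"
    by (rule continuous_on_compose2[OF F], intro continuous_intros, simp)+
  moreover have "continuous_on UNIV (\<lambda>z. heat_ext p (fst z) (max 0 (snd z)))"
  proof -
    have "continuous_on UNIV (\<lambda>z::(real^'n) \<times> real. (fst z, max 0 (snd z)))" by (intro continuous_intros)
    then show ?thesis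
      using continuous_on_compose2[OF continuous_heat_ext[OF p(1)], of UNIV "\<lambda>z. (fst z, max 0 (snd z))"]
      by simp
  qed
  moreover have "continuous_on UNIV (\<lambda>z. p (fst z))"
    by (rule continuous_on_compose2[OF continuous_on_polymonial_function[OF p(1)[unfolded real_polynomial_function_eq]]])
       (auto intro!: continuous_intros)
  ultimately have "continuous_on UNIV h"
    unfolding h_def k_def by (intro continuous_intros)
  then have hc: "continuous_on (?B \<times> UNIV) h" by (rule continuous_on_subset) simp
  have h0: "h (x, t) = 0" if "t \<le> 0" for x t
    using that by (simp add: h_def k_def heat_ext_0)
  define \<delta> where "\<delta> = \<epsilon> / (4 * exp (2 * T))"
  have \<delta>: "\<delta> > 0" "\<delta> * exp (2 * T) = \<epsilon> / 4" using \<open>\<epsilon> > 0\<close> by (auto simp: \<delta>_def)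
  obtain W where W: "packet ?S W" "\<And>x t. x \<in> ?B \<Longrightarrow> t \<le> T \<Longrightarrow> \<bar>h (x, t) - W x t\<bar> \<le> \<delta> * exp (2 * t)"
    using packet_lateral[OF hc h0 S(4,2,3) ck \<delta>(1), of T] by blast
  have \<delta>t: "\<delta> * exp (2 * t) \<le> \<epsilon> / 4" if "t \<le> T" for t
    using that \<delta> by (subst \<delta>(2)[symmetric]) (intro mult_left_mono, auto)
  have bd: "\<bar>W x t\<bar> \<le> \<delta> * exp (2 * t)" if "x \<in> ?B" "t \<le> 0" for x t
    using W(2)[of x t] h0[of t x] that \<open>T > 0\<close> by simp
  \<comment> \<open>For \<open>t \<le> 0\<close> the lateral data are zero, so the lateral error
    bounds \<open>W\<close> itself; the maximum principle for \<open>W\<close> and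
    \<open>- W\<close> carries this bound to the bottom.\<close>
  have W0: "\<bar>W x 0\<bar> \<le> \<delta>" if "x \<in> \<Omega>" for x
  proof -
    have "W x 0 \<le> \<delta>"
      using bd by (intro maximum_principle[OF assms(1,2) packet_caloric_on[OF W(1) S(1)] _ \<delta>(1) that])
        (auto simp: abs_le_iff)
    moreover have "- W x 0 \<le> \<delta>"
      using bd by (intro maximum_principle[OF assms(1,2) packet_caloric_on[OF packet_uminus[OF W(1)] S(1)] _ \<delta>(1) that])
        (auto simp: abs_le_iff)
    ultimately show ?thesis by (simp add: abs_le_iff)
  qed
  define G where "G = (\<lambda>(x, t). heat_ext p x t + W x t)"
  have "approx_on (?S \<times> {0..T}) v (\<lambda>z. (case z of (x, t) \<Rightarrow> heat_ext p x t) + (case z of (x, t) \<Rightarrow> W x t))"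
    using assms S by (intro approx_on_add v p(1) packet_approx_on[OF W(1), where T = T]) auto
  then have "approx_on (?S \<times> {0..T}) v G" by (simp add: G_def split_def)
  moreover have "parabolic_boundary \<Omega> T \<subseteq> ?S \<times> {0..T}"
    using \<open>T > 0\<close> S(2) closure_subset by (auto simp: parabolic_boundary_def)
  ultimately have "approx_on (parabolic_boundary \<Omega> T) v G"
    unfolding approx_on_def by (meson subsetD)
  moreover have "\<bar>F z - G z\<bar> \<le> \<epsilon>" if z: "z \<in> parabolic_boundary \<Omega> T" for z
  proof (cases z)
    case (Pair x t)
    consider "x \<in> \<Omega>" "t = 0" | "x \<in> ?B" "0 < t" "t < T"
      using z Pair by (auto simp: parabolic_boundary_def)
    then show ?thesis
    proof cases
      case 1
      have "x \<in> ?S" using 1 closure_subset by blast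
      then have "\<bar>F (x, 0) - p x\<bar> < \<epsilon> / 4" by (rule p)
      moreover have "\<bar>W x 0\<bar> \<le> \<delta>" "\<delta> \<le> \<epsilon> / 4" using 1 W0[of x] \<delta>t[of 0] \<open>T > 0\<close> by auto
      moreover have "F z - G z = F (x, 0) - p x - W x 0" using 1 by (simp add: Pair G_def heat_ext_0)
      ultimately show ?thesis using \<open>\<epsilon> > 0\<close> by linarith
    next
      case 2
      then have "x \<in> ?S" using S by blast
      then have "\<bar>F (x, 0) - p x\<bar> < \<epsilon> / 4" by (rule p)
      moreover have "\<bar>h (x, t) - W x t\<bar> \<le> \<epsilon> / 4"
        using W(2)[of x t] \<delta>t[of t] 2 by simp
      moreover have "h (x, t) = F (x, t) - heat_ext p x t - (F (x, 0) - p x)"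
        using 2 by (simp add: h_def k_def)
      moreover have "F z - G z = F (x, t) - heat_ext p x t - W x t" by (simp add: Pair G_def)
      ultimately show ?thesis using \<open>\<epsilon> > 0\<close> by linarith
    qed
  qed
  ultimately show "\<exists>g. approx_on (parabolic_boundary \<Omega> T) v g \<and> (\<forall>z\<in>parabolic_boundary \<Omega> T. \<bar>F z - g z\<bar> \<le> \<epsilon>)"
    by blast
qed

end

section \<open>Geometry of \<open>C\<^sup>1\<close> boundaries\<close>

text \<open>The continuous gradient is bounded on a compact ball, hence \<gamma> is Lipschitz there.
  The radius \<open>3 * r\<close> leaves room for auxiliary points outside the ball of radius
  \<open>r\<close>.\<close>

lemma C1_boundary_graph:
  assumes "C1_boundary \<Omega>" "open \<Omega>" and x0: "x0 \<in> frontier \<Omega>"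
  obtains r M e \<gamma> where "r > 0" "M \<ge> 0" "norm e = 1" "\<And>x s. \<gamma> (x + s *\<^sub>R e) = \<gamma> x"
    "\<And>x y. x \<in> cball x0 (3 * r) \<Longrightarrow> y \<in> cball x0 (3 * r) \<Longrightarrow> \<bar>\<gamma> x - \<gamma> y\<bar> \<le> M * norm (x - y)"
    "\<And>x. x \<in> ball x0 r \<Longrightarrow> x \<bullet> e < \<gamma> x \<Longrightarrow> x \<notin> closure \<Omega>"
    "\<And>x. x \<in> ball x0 r \<Longrightarrow> x \<in> frontier \<Omega> \<Longrightarrow> x \<bullet> e = \<gamma> x"
proof -
  obtain r e \<gamma> g where r: "r > 0" and e: "norm e = 1" and D: "\<And>x. GDERIV \<gamma> x :> g x" and g: "continuous_on UNIV g"
    and shift: "\<And>x s. \<gamma> (x + s *\<^sub>R e) = \<gamma> x" and loc: "\<Omega> \<inter> ball x0 r = {x \<in> ball x0 r. \<gamma> x < x \<bullet> e}"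
    using assms unfolding C1_boundary_def by blast
  have der: "(\<gamma> has_derivative (\<lambda>h. h \<bullet> g x)) (at x)" for x using D[of x] unfolding gderiv_def .
  then have "continuous_on UNIV \<gamma>"
    by (intro continuous_at_imp_continuous_on ballI) (rule has_derivative_continuous)
  then have op: "open {x. x \<bullet> e < \<gamma> x}" by (intro open_Collect_less continuous_intros)
  have "bounded (g ` cball x0 (3 * r))"
    using g by (intro compact_imp_bounded compact_continuous_image) (auto intro: continuous_on_subset)
  then obtain M where M: "\<And>x. x \<in> cball x0 (3 * r) \<Longrightarrow> norm (g x) \<le> M"
    unfolding bounded_iff by blast
  have M0: "M \<ge> 0" using order_trans[OF norm_ge_zero M[of x0]] r by simp
  have lip: "\<bar>\<gamma> x - \<gamma> y\<bar> \<le> M * norm (x - y)" if "x \<in> cball x0 (3 * r)" "y \<in> cball x0 (3 * r)" for x y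
  proof -
    have "onorm (\<lambda>h. h \<bullet> g x) \<le> M" if "x \<in> cball x0 (3 * r)" for x
    proof (rule onorm_le)
      fix h
      have "norm (h \<bullet> g x) \<le> norm h * norm (g x)" by (simp add: Cauchy_Schwarz_ineq2)
      also have "\<dots> \<le> norm h * M" using M[OF that] by (intro mult_left_mono) auto
      finally show "norm (h \<bullet> g x) \<le> M * norm h" by (simp add: mult.commute)
    qed
    then show ?thesis
      using differentiable_bound[of "cball x0 (3 * r)" \<gamma> "\<lambda>x h. h \<bullet> g x" M x y] der that
      by (auto intro: has_derivative_at_withinI)
  qed
  have below: "x \<notin> closure \<Omega>" if "x \<in> ball x0 r" "x \<bullet> e < \<gamma> x" for x
  proof -
    let ?U = "ball x0 r \<inter> {x. x \<bullet> e < \<gamma> x}"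
    have "x \<notin> \<Omega>" if "x \<in> ?U" for x
    proof
      assume "x \<in> \<Omega>"
      then have "x \<in> {x \<in> ball x0 r. \<gamma> x < x \<bullet> e}" using that loc by blast
      then show False using that by simp
    qed
    then have "?U \<inter> \<Omega> = {}" by blast
    moreover have "open ?U" using op by blast
    ultimately have "?U \<inter> closure \<Omega> = {}" by (simp add: open_Int_closure_eq_empty)
    then show ?thesis using that by blast
  qed
  have on: "x \<bullet> e = \<gamma> x" if "x \<in> ball x0 r" "x \<in> frontier \<Omega>" for x
  proof -
    have "x \<in> closure \<Omega>" "x \<notin> \<Omega>" using that(2) assms(2) by (auto simp: frontier_def interior_open)
    moreover have "\<not> \<gamma> x < x \<bullet> e"
    proof
      assume "\<gamma> x < x \<bullet> e"
      then have "x \<in> \<Omega> \<inter> ball x0 r" using that(1) unfolding loc by blast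
      then show False using \<open>x \<notin> \<Omega>\<close> by blast
    qed
    ultimately show ?thesis using below[OF that(1)] by (metis linorder_less_linear)
  qed
  show ?thesis using that[OF r M0 e shift lip below on] .
qed

text \<open>The point reached from \<open>x0\<close> by going \<open>s / 2\<close> against
  \<open>e\<close> lies that far below the graph, and a displacement \<open>u\<close> changes the
  height over the graph by at most \<open>(1 + M) * norm u\<close>; this determines \<eta>.\<close>

lemma C1_boundary_exterior_corkscrew:
  assumes "C1_boundary \<Omega>" "open \<Omega>" "x0 \<in> frontier \<Omega>"
  shows "exterior_corkscrew (closure \<Omega>) x0"
proof -
  obtain r M e \<gamma> where r: "r > 0" "M \<ge> 0" "norm e = 1" and shift: "\<And>x s. \<gamma> (x + s *\<^sub>R e) = \<gamma> x"
    and lip: "\<And>x y. x \<in> cball x0 (3 * r) \<Longrightarrow> y \<in> cball x0 (3 * r) \<Longrightarrow> \<bar>\<gamma> x - \<gamma> y\<bar> \<le> M * norm (x - y)"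
    and below: "\<And>x. x \<in> ball x0 r \<Longrightarrow> x \<bullet> e < \<gamma> x \<Longrightarrow> x \<notin> closure \<Omega>"
    and on: "\<And>x. x \<in> ball x0 r \<Longrightarrow> x \<in> frontier \<Omega> \<Longrightarrow> x \<bullet> e = \<gamma> x"
    by (rule C1_boundary_graph[OF assms]) blast
  define \<eta> where "\<eta> = 1 / (2 * (1 + M))"
  have \<eta>: "\<eta> > 0" "\<eta> \<le> 1 / 2" "(1 + M) * \<eta> = 1 / 2" using r by (auto simp: \<eta>_def field_simps)
  have ball: "ball (x0 - (s / 2) *\<^sub>R e) (\<eta> * s) \<subseteq> ball x0 s - closure \<Omega>" if s: "0 < s" "s \<le> r" for s
  proof
    fix y assume y: "y \<in> ball (x0 - (s / 2) *\<^sub>R e) (\<eta> * s)"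
    define u where "u = y - (x0 - (s / 2) *\<^sub>R e)"
    have u: "norm u < \<eta> * s" using y by (simp add: u_def dist_norm norm_minus_commute)
    have y_eq: "y = x0 - (s / 2) *\<^sub>R e + u" by (simp add: u_def)
    have "\<eta> * s \<le> s / 2" using \<eta> s mult_right_mono[of \<eta> "1/2" s] by simp
    have "norm (x0 - y) = norm ((s / 2) *\<^sub>R e - u)" by (simp add: y_eq)
    also have "\<dots> \<le> norm ((s / 2) *\<^sub>R e) + norm u" by (rule norm_triangle_ineq4)
    also have "norm ((s / 2) *\<^sub>R e) = s / 2" using s r(3) by simp
    also have "s / 2 + norm u < s" using u \<open>\<eta> * s \<le> s / 2\<close> by linarith
    finally have ys: "y \<in> ball x0 s" by (simp add: dist_norm)
    have "\<gamma> y = \<gamma> (x0 + u)" using shift[of y "s / 2"] by (simp add: y_eq add.commute)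
    moreover have "norm u \<le> 3 * r" using u \<open>\<eta> * s \<le> s / 2\<close> s by linarith
    then have "\<bar>\<gamma> (x0 + u) - \<gamma> x0\<bar> \<le> M * norm (x0 + u - x0)"
      using r by (intro lip) (auto simp: dist_norm)
    moreover have "x0 \<bullet> e = \<gamma> x0" using on[of x0] assms r by simp
    moreover have "y \<bullet> e = x0 \<bullet> e - s / 2 + u \<bullet> e"
      using r by (simp add: y_eq inner_add_left inner_diff_left dot_square_norm)
    moreover have "u \<bullet> e \<le> norm u" using norm_cauchy_schwarz[of u e] r by simp
    moreover have "M * norm u \<le> M * (\<eta> * s)" using u r by (intro mult_left_mono) auto
    moreover have "\<eta> * s + M * (\<eta> * s) = s / 2"
      using arg_cong[OF \<eta>(3), of "\<lambda>a. a * s"] by (simp add: algebra_simps)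
    ultimately have "y \<bullet> e < \<gamma> y" using u by simp
    moreover have "y \<in> ball x0 r" using ys s by auto
    ultimately show "y \<in> ball x0 s - closure \<Omega>" using ys below by blast
  qed
  show ?thesis unfolding exterior_corkscrew_def
    using \<eta>(1) r(1) ball by blast
qed

section \<open>Finiteness of the boundary measure\<close>

lemma hausdorff_content_le_sum:
  assumes "finite I" "A \<subseteq> (\<Union>i\<in>I. U i)" "\<And>i. i \<in> I \<Longrightarrow> bounded (U i)" "\<And>i. i \<in> I \<Longrightarrow> diameter (U i) \<le> \<delta>" "\<delta> > 0"
  shows "hausdorff_content d \<delta> A \<le> (\<Sum>i\<in>I. hausdorff_gauge d (U i))"
proof -
  obtain f where f: "bij_betw f {0..<card I} I" using ex_bij_betw_nat_finite[OF assms(1)] by blast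
  define V where "V k = (if k < card I then U (f k) else {})" for k
  have fI: "f k \<in> I" if "k < card I" for k using f that by (auto simp: bij_betw_def)
  have "A \<subseteq> (\<Union>k. V k)"
  proof
    fix x assume "x \<in> A"
    then obtain i where i: "i \<in> I" "x \<in> U i" using assms(2) by blast
    then have "i \<in> f ` {0..<card I}" using f by (simp add: bij_betw_def)
    then obtain k where "k < card I" "f k = i" by auto
    then have "x \<in> V k" using i by (simp add: V_def)
    then show "x \<in> (\<Union>k. V k)" by blast
  qed
  then have "V \<in> hausdorff_covers \<delta> A"
    using assms fI by (auto simp: hausdorff_covers_def V_def)
  then have "hausdorff_content d \<delta> A \<le> (\<Sum>k. hausdorff_gauge d (V k))"
    unfolding hausdorff_content_def by (rule INF_lower)
  also have "\<dots> = (\<Sum>k\<in>{0..<card I}. hausdorff_gauge d (V k))"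
    by (rule suminf_finite) (auto simp: V_def hausdorff_gauge_def)
  also have "\<dots> = (\<Sum>k\<in>{0..<card I}. hausdorff_gauge d (U (f k)))"
    by (rule sum.cong) (auto simp: V_def)
  also have "\<dots> = (\<Sum>i\<in>I. hausdorff_gauge d (U i))" by (rule sum.reindex_bij_betw[OF f])
  finally show ?thesis .
qed

text \<open>Cut the projection along \<open>e\<close> into \<open>N ^ ?d\<close> cells of side
  \<open>h = 2 * R / N\<close>, with \<open>?d\<close> one less than the dimension. By the Lipschitz
  bound the piece of \<open>P\<close> over a cell has diameter at most \<open>C * h\<close>, so the
  resulting bound on the sum of the gauges does not depend on \<open>N\<close>.\<close>

lemma hausdorff_outer_graph_finite:
  fixes P :: "'a::euclidean_space set"
  assumes "norm e = 1" "bounded P" "M \<ge> 0"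
    and lip: "\<And>x y. x \<in> P \<Longrightarrow> y \<in> P \<Longrightarrow> \<bar>(x - y) \<bullet> e\<bar> \<le> M * norm (x - y - ((x - y) \<bullet> e) *\<^sub>R e)"
  shows "hausdorff_outer (DIM('a) - 1) P < \<infinity>"
proof -
  obtain R where R: "R > 0" "\<And>x. x \<in> P \<Longrightarrow> norm x < R"
    using \<open>bounded P\<close> unfolding bounded_pos_less by blast
  obtain S where S: "e \<in> S" "pairwise orthogonal S" "\<And>x. x \<in> S \<Longrightarrow> norm x = 1" "card S = DIM('a)" "span S = UNIV"
    "independent S"
    using vector_in_orthonormal_basis[OF \<open>norm e = 1\<close>] by metis
  have fin: "finite S" using S by (simp add: independent_imp_finite)
  define E where "E = S - {e}"
  have E: "finite E" "card E = DIM('a) - 1" using fin S by (auto simp: E_def)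
  let ?d = "DIM('a) - 1"
  have expand: "x - (x \<bullet> e) *\<^sub>R e = (\<Sum>b\<in>E. (x \<bullet> b) *\<^sub>R b)" for x
  proof -
    have "(\<Sum>b\<in>S. (x \<bullet> b) *\<^sub>R b) = x"
      by (rule orthonormal_basis_expand) (use S fin in auto)
    then show ?thesis using fin S(1) by (simp add: E_def sum_diff1)
  qed
  define C where "C = (1 + M) * real DIM('a)"
  have C: "C > 0" unfolding C_def using \<open>M \<ge> 0\<close> DIM_positive[where 'a='a] by (intro mult_pos_pos) auto
  have main: "hausdorff_content ?d \<delta> P \<le> ennreal (unit_ball_vol (real ?d) * (C * R) ^ ?d)" if "\<delta> > 0" for \<delta>
  proof -
    obtain N where N: "C * 2 * R / \<delta> < real N" using reals_Archimedean2 by blast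
    moreover have "C * 2 * R / \<delta> > 0" using C R \<open>\<delta> > 0\<close> by simp
    ultimately have N0: "N > 0" by (intro gr0I) auto
    define h where "h = 2 * R / real N"
    have h: "h > 0" "real N * h = 2 * R" "C * h \<le> \<delta>"
      using N N0 R \<open>\<delta> > 0\<close> by (auto simp: h_def field_simps)
    define U where "U k = {x\<in>P. \<forall>b\<in>E. - R + real (k b) * h \<le> x \<bullet> b \<and> x \<bullet> b \<le> - R + (real (k b) + 1) * h}" for k
    let ?I = "PiE E (\<lambda>_. {..<N})"
    have cover: "P \<subseteq> (\<Union>k\<in>?I. U k)"
    proof
      fix x assume x: "x \<in> P"
      define k where "k = restrict (\<lambda>b. nat \<lfloor>(x \<bullet> b + R) / h\<rfloor>) E"
      have "k b < N \<and> - R + real (k b) * h \<le> x \<bullet> b \<and> x \<bullet> b \<le> - R + (real (k b) + 1) * h" if b: "b \<in> E" for b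
      proof -
        have "\<bar>x \<bullet> b\<bar> \<le> norm x" using Cauchy_Schwarz_ineq2[of x b] S(3)[of b] b by (simp add: E_def)
        then have xb: "\<bar>x \<bullet> b\<bar> < R" using R(2)[OF x] by simp
        then have q: "0 \<le> (x \<bullet> b + R) / h" "(x \<bullet> b + R) / h < real N" using h(1,2) by (auto simp: field_simps)
        then have kb: "real (k b) = of_int \<lfloor>(x \<bullet> b + R) / h\<rfloor>" using b by (simp add: k_def)
        have "real (k b) \<le> (x \<bullet> b + R) / h" "(x \<bullet> b + R) / h \<le> real (k b) + 1" unfolding kb by linarith+
        moreover have "k b < N" using q(2) \<open>real (k b) \<le> (x \<bullet> b + R) / h\<close> by simp
        ultimately show ?thesis using h(1) by (auto simp: field_simps)
      qed
      then have "k \<in> ?I" "x \<in> U k" using x by (auto simp: U_def k_def)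
      then show "x \<in> (\<Union>k\<in>?I. U k)" by blast
    qed
    have diam: "diameter (U k) \<le> C * h" for k
    proof (rule diameter_le)
      show "U k \<noteq> {} \<or> 0 \<le> C * h" using C h by simp
      fix x y assume xy: "x \<in> U k" "y \<in> U k"
      let ?u = "x - y"
      have comp: "\<bar>?u \<bullet> b\<bar> \<le> h" if "b \<in> E" for b
      proof -
        have "- R + real (k b) * h \<le> x \<bullet> b" "x \<bullet> b \<le> - R + (real (k b) + 1) * h"
             "- R + real (k b) * h \<le> y \<bullet> b" "y \<bullet> b \<le> - R + (real (k b) + 1) * h"
          using xy that by (auto simp: U_def)
        then show ?thesis by (simp add: inner_diff_left distrib_right abs_le_iff)
      qed
      let ?w = "?u - (?u \<bullet> e) *\<^sub>R e"
      have "norm ?w \<le> (\<Sum>b\<in>E. norm ((?u \<bullet> b) *\<^sub>R b))" unfolding expand by (rule norm_sum)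
      also have "\<dots> \<le> (\<Sum>b\<in>E. h)" using comp S(3) by (intro sum_mono) (auto simp: E_def)
      also have "\<dots> \<le> real DIM('a) * h" using E h(1) by (simp add: mult_right_mono)
      finally have w: "norm ?w \<le> real DIM('a) * h" .
      have "norm ?u = norm (?w + (?u \<bullet> e) *\<^sub>R e)" by simp
      also have "\<dots> \<le> norm ?w + norm ((?u \<bullet> e) *\<^sub>R e)" by (rule norm_triangle_ineq)
      also have "\<dots> \<le> norm ?w + M * norm ?w"
        using lip[of x y] xy \<open>norm e = 1\<close> by (simp add: U_def)
      also have "\<dots> = (1 + M) * norm ?w" by (simp add: distrib_right)
      also have "\<dots> \<le> (1 + M) * (real DIM('a) * h)" using w \<open>M \<ge> 0\<close> by (intro mult_left_mono) auto
      finally show "norm (x - y) \<le> C * h" by (simp add: C_def mult.assoc)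
    qed
    have bdd: "bounded (U k)" for k by (rule bounded_subset[OF \<open>bounded P\<close>]) (auto simp: U_def)
    have finI: "finite ?I" using E by (intro finite_PiE) auto
    have "hausdorff_content ?d \<delta> P \<le> (\<Sum>k\<in>?I. hausdorff_gauge ?d (U k))"
      using cover bdd diam h(3) \<open>\<delta> > 0\<close> finI by (intro hausdorff_content_le_sum) (blast intro: order_trans)+
    also have "\<dots> \<le> (\<Sum>k\<in>?I. ennreal (unit_ball_vol (real ?d) * (C * h / 2) ^ ?d))"
    proof (rule sum_mono)
      fix k
      show "hausdorff_gauge ?d (U k) \<le> ennreal (unit_ball_vol (real ?d) * (C * h / 2) ^ ?d)"
        using diam[of k] diameter_ge_0[OF bdd[of k]]
        by (auto simp: hausdorff_gauge_def intro!: ennreal_leI mult_left_mono power_mono)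
    qed
    also have "\<dots> = ennreal (real (N ^ ?d) * (unit_ball_vol (real ?d) * (C * h / 2) ^ ?d))"
      using E C h(1) by (simp add: card_PiE ennreal_mult'' ennreal_of_nat_eq_real_of_nat)
    also have "real (N ^ ?d) * (unit_ball_vol (real ?d) * (C * h / 2) ^ ?d) = unit_ball_vol (real ?d) * (C * R) ^ ?d"
    proof -
      have "C * R = real N * (C * h / 2)" using h(2) by simp
      then have "(C * R) ^ ?d = real N ^ ?d * (C * h / 2) ^ ?d" by (simp only: power_mult_distrib)
      then show ?thesis by simp
    qed
    finally show ?thesis .
  qed
  have "hausdorff_outer ?d P \<le> ennreal (unit_ball_vol (real ?d) * (C * R) ^ ?d)"
    unfolding hausdorff_outer_def by (rule SUP_least) (use main in auto)
  then show ?thesis by (rule order_le_less_trans) simp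
qed

lemma hausdorff_outer_C1_boundary_finite:
  fixes \<Omega> :: "'a::euclidean_space set"
  assumes "C1_boundary \<Omega>" "open \<Omega>" "bounded \<Omega>"
  shows "hausdorff_outer (DIM('a) - 1) (frontier \<Omega>) < \<infinity>"
proof -
  let ?H = "hausdorff_outer (DIM('a) - 1) :: 'a set \<Rightarrow> ennreal"
  have "\<exists>r>0. ?H (frontier \<Omega> \<inter> ball x0 r) < \<infinity>" if x0: "x0 \<in> frontier \<Omega>" for x0
  proof -
    obtain r M e \<gamma> where r: "r > 0" "M \<ge> 0" "norm e = 1" and shift: "\<And>x s. \<gamma> (x + s *\<^sub>R e) = \<gamma> x"
      and lip: "\<And>x y. x \<in> cball x0 (3 * r) \<Longrightarrow> y \<in> cball x0 (3 * r) \<Longrightarrow> \<bar>\<gamma> x - \<gamma> y\<bar> \<le> M * norm (x - y)"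
      and on: "\<And>x. x \<in> ball x0 r \<Longrightarrow> x \<in> frontier \<Omega> \<Longrightarrow> x \<bullet> e = \<gamma> x"
      by (rule C1_boundary_graph[OF assms(1,2) x0]) blast
    have "?H (frontier \<Omega> \<inter> ball x0 r) < \<infinity>"
    proof (rule hausdorff_outer_graph_finite[OF r(3) _ r(2)])
      show "bounded (frontier \<Omega> \<inter> ball x0 r)" by (simp add: bounded_Int)
      fix x y assume x: "x \<in> frontier \<Omega> \<inter> ball x0 r" and y: "y \<in> frontier \<Omega> \<inter> ball x0 r"
      let ?u = "x - y"
      let ?w = "?u - (?u \<bullet> e) *\<^sub>R e"
      have "(norm (u - (u \<bullet> e) *\<^sub>R e))\<^sup>2 = (norm u)\<^sup>2 - (u \<bullet> e)\<^sup>2" for u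
      proof -
        have "e \<bullet> e = 1" using r(3) by (simp add: norm_eq_1)
        moreover have "e \<bullet> u = u \<bullet> e" by (rule inner_commute)
        ultimately show ?thesis
          unfolding power2_norm_eq_inner by (simp add: inner_diff_left inner_diff_right power2_eq_square)
      qed
      from this[of ?u] have "(norm ?w)\<^sup>2 \<le> (norm ?u)\<^sup>2" by simp
      then have "norm ?w \<le> norm ?u" by (rule power2_le_imp_le) (rule norm_ge_zero)
      also have "norm ?u \<le> norm (x - x0) + norm (y - x0)"
        using norm_triangle_ineq4[of "x - x0" "y - x0"] by simp
      finally have w: "norm ?w < 2 * r" using x y by (simp add: dist_norm norm_minus_commute)
      \<comment> \<open>The point \<open>y + ?w\<close> lies on the line through \<open>x\<close> in
        direction \<open>e\<close>, so it has the same value of \<gamma>; it may leave the ball of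
        radius \<open>r\<close> but not that of radius \<open>3 * r\<close>.\<close>
      have "y + ?w + (?u \<bullet> e) *\<^sub>R e = x" by simp
      then have \<gamma>x: "\<gamma> (y + ?w) = \<gamma> x" using shift[of "y + ?w" "?u \<bullet> e"] by simp
      have "norm (y + ?w - x0) \<le> norm (y - x0) + norm ?w"
        using norm_triangle_ineq[of "y - x0" ?w] by (simp add: algebra_simps)
      then have "y + ?w \<in> cball x0 (3 * r)" using w y by (simp add: dist_norm norm_minus_commute)
      moreover have "y \<in> cball x0 (3 * r)" using y r by (simp add: dist_norm)
      ultimately have "\<bar>\<gamma> (y + ?w) - \<gamma> y\<bar> \<le> M * norm (y + ?w - y)" by (rule lip)
      then show "\<bar>?u \<bullet> e\<bar> \<le> M * norm ?w"
        unfolding \<gamma>x using on[of x] on[of y] x y by (simp only: Int_iff add_diff_cancel_left' inner_diff_left)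
    qed
    then show ?thesis using r by blast
  qed
  then obtain r where r: "\<And>x. x \<in> frontier \<Omega> \<Longrightarrow> r x > 0 \<and> ?H (frontier \<Omega> \<inter> ball x (r x)) < \<infinity>" by metis
  have "compact (frontier \<Omega>)" using assms(3) by (rule compact_frontier_bounded)
  moreover have "frontier \<Omega> \<subseteq> (\<Union>x\<in>frontier \<Omega>. ball x (r x))" using r by force
  ultimately obtain X where X: "X \<subseteq> frontier \<Omega>" "finite X" "frontier \<Omega> \<subseteq> (\<Union>x\<in>X. ball x (r x))"
    by (elim compactE_image[of _ "frontier \<Omega>" "\<lambda>x. ball x (r x)"]) auto
  have "?H (\<Union>x\<in>X. frontier \<Omega> \<inter> ball x (r x)) < \<infinity>"
    using X(2,1)
  proof (induction X rule: finite_induct)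
    case (insert x X)
    have "?H (\<Union>y\<in>insert x X. frontier \<Omega> \<inter> ball y (r y))
        \<le> ?H (frontier \<Omega> \<inter> ball x (r x)) + ?H (\<Union>y\<in>X. frontier \<Omega> \<inter> ball y (r y))"
      using hausdorff_outer_Un by simp
    also have "\<dots> < \<infinity>" using insert r by (auto simp: ennreal_add_less_top infinity_ennreal_def)
    finally show ?case .
  qed simp
  moreover have "frontier \<Omega> = (\<Union>x\<in>X. frontier \<Omega> \<inter> ball x (r x))" using X by blast
  ultimately show ?thesis by simp
qed

lemma finite_measure_parabolic_boundary:
  fixes \<Omega> :: "(real^'n) set"
  assumes "C1_boundary \<Omega>" "open \<Omega>" "bounded \<Omega>" "T > 0"
  shows "finite_measure (parabolic_boundary_measure \<Omega> T)"
proof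
  let ?P = "parabolic_boundary \<Omega> T" and ?N = "restrict_space lborel {0<..<T} :: real measure"
  have "?P \<in> sets (restrict_space borel ?P)"
    using sets.top[of "restrict_space borel ?P"] by (simp add: space_restrict_space)
  then have "emeasure (parabolic_boundary_measure \<Omega> T) ?P = emeasure lborel {x\<in>\<Omega>. (x, 0) \<in> ?P} +
      emeasure (surface_measure (frontier \<Omega>) \<Otimes>\<^sub>M ?N) (?P \<inter> frontier \<Omega> \<times> {0<..<T})"
    by (rule emeasure_parabolic_boundary_measure[OF assms(2)])
  moreover have "{x\<in>\<Omega>. (x, 0) \<in> ?P} = \<Omega>" by (auto simp: parabolic_boundary_def)
  moreover have "?P \<inter> frontier \<Omega> \<times> {0<..<T} = frontier \<Omega> \<times> {0<..<T}" by (auto simp: parabolic_boundary_def)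
  moreover have "emeasure lborel \<Omega> \<noteq> \<infinity>" using emeasure_bounded_finite[OF assms(3)] by simp
  moreover have "emeasure (surface_measure (frontier \<Omega>) \<Otimes>\<^sub>M ?N) (frontier \<Omega> \<times> {0<..<T}) \<noteq> \<infinity>"
  proof -
    have sp: "frontier \<Omega> = space (surface_measure (frontier \<Omega>))"
      by (simp add: surface_measure_def space_restrict_space)
    have s1: "frontier \<Omega> \<in> sets (surface_measure (frontier \<Omega>))" using sp sets.top by metis
    have s2: "{0<..<T} \<in> sets ?N" using sets.top[of ?N] by (simp add: space_restrict_space)
    have N: "emeasure ?N {0<..<T} = ennreal T"
      using assms(4) by (simp add: emeasure_restrict_space)
    interpret N: finite_measure ?N
      by standard (use N in \<open>simp add: space_restrict_space\<close>)
    have "emeasure (surface_measure (frontier \<Omega>)) (frontier \<Omega>) = hausdorff_outer (CARD('n) - 1) (frontier \<Omega>)"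
      unfolding surface_measure_def
      by (subst emeasure_restrict_space) (auto simp: emeasure_hausdorff_measure)
    also have "\<dots> < \<infinity>" using hausdorff_outer_C1_boundary_finite[OF assms(1-3)] by simp
    finally have "emeasure (surface_measure (frontier \<Omega>)) (frontier \<Omega>) < \<infinity>" .
    then show ?thesis
      unfolding N.emeasure_pair_measure_Times[OF s1 s2] N by (auto simp: ennreal_mult_eq_top_iff)
  qed
  ultimately show "emeasure (parabolic_boundary_measure \<Omega> T) (space (parabolic_boundary_measure \<Omega> T)) \<noteq> \<infinity>"
    by simp
qed

section \<open>Completeness in \<open>L\<^sup>p\<close>\<close>

lemma borel_measurable_restrict_continuous:
  fixes g :: "'a::euclidean_space \<Rightarrow> real"
  assumes "sets M = sets (restrict_space borel K)" "continuous_on UNIV g"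
  shows "g \<in> borel_measurable M"
proof -
  have "g \<in> borel_measurable (restrict_space borel K)"
    using assms(2) by (intro measurable_restrict_space1 borel_measurable_continuous_onI)
  then show ?thesis by (simp add: measurable_cong_sets[OF assms(1) refl])
qed

text \<open>Indicators are approximated by Urysohn functions through outer regularity; sums and
  dominated limits follow the induction for integrable functions.\<close>

lemma continuous_dense_in_L1:
  fixes M :: "'a::euclidean_space measure" and f :: "'a \<Rightarrow> real"
  assumes "finite_measure M" and sets: "sets M = sets (restrict_space borel K)" and f: "integrable M f" and "\<epsilon> > 0"
  shows "\<exists>g. continuous_on UNIV g \<and> integrable M g \<and> (\<integral>x. \<bar>f x - g x\<bar> \<partial>M) < \<epsilon>"
  using f \<open>\<epsilon> > 0\<close>
proof (induction arbitrary: \<epsilon> rule: integrable_induct)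
  case (base A c)
  interpret M: finite_measure M by fact
  \<comment> \<open>\<open>M\<close> lives on the trace of the Borel sets on \<open>K\<close>;
    regularity is applied to its image on the whole space.\<close>
  define N where "N = distr M borel (\<lambda>x. x)"
  have space: "space M = K" using sets_eq_imp_space_eq[OF sets] by (simp add: space_restrict_space)
  have id: "(\<lambda>x. x) \<in> measurable M borel"
    using measurable_restrict_space1[OF measurable_ident, of borel K]
    by (simp add: measurable_cong_sets[OF sets refl] id_def)
  interpret N: finite_measure N unfolding N_def by (rule M.finite_measure_distr[OF id])
  have setsN: "sets N = sets borel" by (simp add: N_def)
  obtain B where B: "B \<in> sets borel" "A = K \<inter> B"
    using base(1) unfolding sets by (auto simp: sets_restrict_space)
  define \<delta> where "\<delta> = \<epsilon> / (2 * (\<bar>c\<bar> + 1))"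
  have \<delta>: "\<delta> > 0" using base by (simp add: \<delta>_def)
  have reg: "\<exists>U. open U \<and> S \<subseteq> U \<and> measure N (U - S) < \<delta>" if S: "S \<in> sets borel" for S
  proof -
    have "emeasure N S < emeasure N S + ennreal \<delta>" using \<delta> by (simp add: N.emeasure_eq_measure ennreal_less_iff flip: ennreal_plus)
    then have "(INF U \<in> {U. S \<subseteq> U \<and> open U}. emeasure N U) < emeasure N S + ennreal \<delta>"
      using outer_regular[OF setsN _ S] by simp
    then obtain U where U: "S \<subseteq> U" "open U" "emeasure N U < emeasure N S + ennreal \<delta>"
      unfolding INF_less_iff by blast
    then have "measure N U < measure N S + \<delta>"
      using \<delta> by (simp add: N.emeasure_eq_measure ennreal_less_iff flip: ennreal_plus)
    moreover have "measure N (U - S) = measure N U - measure N S"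
      using U S by (intro N.finite_measure_Diff) (auto simp: setsN)
    ultimately show ?thesis using U by auto
  qed
  obtain U where U: "open U" "B \<subseteq> U" "measure N (U - B) < \<delta>" using reg[OF B(1)] by blast
  \<comment> \<open>Outer regularity of the complement replaces inner regularity: \<open>- V\<close>
    is a closed subset of \<open>B\<close>, and the Urysohn function separates it from
    \<open>- U\<close>.\<close>
  obtain V where V: "open V" "- B \<subseteq> V" "measure N (V - (- B)) < \<delta>" using reg[of "- B"] B(1) by auto
  obtain g :: "'a \<Rightarrow> real" where g: "continuous_on UNIV g" "\<And>x. g x \<in> closed_segment 1 0"
    "\<And>x. x \<in> - V \<Longrightarrow> g x = 1" "\<And>x. x \<in> - U \<Longrightarrow> g x = 0"
    using Urysohn[of "- V" "- U" 1 "0::real"] U V by (auto simp: closed_Compl)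
  have g01: "0 \<le> g x" "g x \<le> 1" for x using g(2)[of x] by (auto simp: closed_segment_eq_real_ivl)
  let ?h = "\<lambda>x. \<bar>c\<bar> * (indicator (U - B) x + indicator (V - (- B)) x)"
  have diff: "\<bar>indicator B x *\<^sub>R c - c * g x\<bar> \<le> ?h x" for x
  proof -
    have "\<bar>indicator B x - g x\<bar> \<le> indicator (U - B) x + indicator (V - (- B)) x"
      using g(3,4)[of x] g01[of x] U(2) V(2) by (auto simp: indicator_def)
    then have "\<bar>c\<bar> * \<bar>indicator B x - g x\<bar> \<le> ?h x" by (intro mult_left_mono) auto
    moreover have "indicator B x *\<^sub>R c - c * g x = c * (indicator B x - g x)" by (simp add: algebra_simps)
    ultimately show ?thesis by (simp only: abs_mult)
  qed
  have sb: "U - B \<in> sets borel" "V - (- B) \<in> sets borel" using U V B(1) by auto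
  have gN: "g \<in> borel_measurable borel" using g(1) by (rule borel_measurable_continuous_onI)
  have "(\<integral>x. \<bar>indicator A x *\<^sub>R c - c * g x\<bar> \<partial>M) = (\<integral>x. \<bar>indicator B x *\<^sub>R c - c * g x\<bar> \<partial>M)"
    by (rule Bochner_Integration.integral_cong) (auto simp: B(2) space indicator_def)
  also have "\<dots> = (\<integral>x. \<bar>indicator B x *\<^sub>R c - c * g x\<bar> \<partial>N)"
    unfolding N_def using id gN B(1) by (subst integral_distr) auto
  also have "\<dots> \<le> (\<integral>x. ?h x \<partial>N)"
    using sb diff by (intro integral_mono') (auto simp: setsN N.emeasure_eq_measure)
  also have "\<dots> = \<bar>c\<bar> * (measure N (U - B) + measure N (V - (- B)))"
    using sb by (simp add: setsN N.emeasure_eq_measure)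
  also have "\<dots> \<le> \<bar>c\<bar> * (2 * \<delta>)" using U V by (intro mult_left_mono) auto
  also have "\<dots> < (\<bar>c\<bar> + 1) * (2 * \<delta>)" using \<delta> by (intro mult_strict_right_mono) auto
  also have "\<dots> = \<epsilon>"
  proof -
    have "\<bar>c\<bar> + 1 \<noteq> 0" by simp
    then show ?thesis by (simp add: \<delta>_def del: distrib_left_numeral)
  qed
  finally have "(\<integral>x. \<bar>indicator A x *\<^sub>R c - c * g x\<bar> \<partial>M) < \<epsilon>" .
  moreover have gc: "continuous_on UNIV (\<lambda>x. c * g x)" by (intro continuous_intros g)
  moreover have "integrable M (\<lambda>x. c * g x)"
  proof (rule M.integrable_const_bound)
    show "AE x in M. norm (c * g x) \<le> \<bar>c\<bar>"
      using g01 by (intro AE_I2) (simp add: abs_mult mult_left_le)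
    show "(\<lambda>x. c * g x) \<in> borel_measurable M" by (rule borel_measurable_restrict_continuous[OF sets gc])
  qed
  ultimately show ?case by (intro exI[of _ "\<lambda>x. c * g x"]) simp
next
  case (add f1 f2)
  obtain g1 where g1: "continuous_on UNIV g1" "integrable M g1" "(\<integral>x. \<bar>f1 x - g1 x\<bar> \<partial>M) < \<epsilon> / 2"
    using add.IH(1)[of "\<epsilon> / 2"] add.prems by auto
  obtain g2 where g2: "continuous_on UNIV g2" "integrable M g2" "(\<integral>x. \<bar>f2 x - g2 x\<bar> \<partial>M) < \<epsilon> / 2"
    using add.IH(2)[of "\<epsilon> / 2"] add.prems by auto
  have "(\<integral>x. \<bar>f1 x + f2 x - (g1 x + g2 x)\<bar> \<partial>M) \<le> (\<integral>x. \<bar>f1 x - g1 x\<bar> + \<bar>f2 x - g2 x\<bar> \<partial>M)"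
    using add.hyps g1 g2 by (intro integral_mono) auto
  also have "\<dots> = (\<integral>x. \<bar>f1 x - g1 x\<bar> \<partial>M) + (\<integral>x. \<bar>f2 x - g2 x\<bar> \<partial>M)"
    using add.hyps g1 g2 by (intro Bochner_Integration.integral_add) auto
  finally show ?case using g1 g2 by (intro exI[of _ "\<lambda>x. g1 x + g2 x"]) (auto intro!: continuous_intros)
next
  case (lim f s)
  have "(\<lambda>i. \<integral>x. \<bar>f x - s i x\<bar> \<partial>M) \<longlonglongrightarrow> (\<integral>x. 0 \<partial>M)"
  proof (rule integral_dominated_convergence[where w = "\<lambda>x. 3 * \<bar>f x\<bar>"])
    show "AE x in M. (\<lambda>i. \<bar>f x - s i x\<bar>) \<longlonglongrightarrow> 0"
    proof (rule AE_I2)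
      fix x assume "x \<in> space M"
      then have "(\<lambda>i. f x - s i x) \<longlonglongrightarrow> f x - f x" by (intro tendsto_intros lim)
      then show "(\<lambda>i. \<bar>f x - s i x\<bar>) \<longlonglongrightarrow> 0" by (simp add: tendsto_rabs_zero)
    qed
    show "AE x in M. norm \<bar>f x - s i x\<bar> \<le> 3 * \<bar>f x\<bar>" for i
    proof (rule AE_I2)
      fix x assume "x \<in> space M"
      then have "\<bar>s i x\<bar> \<le> 2 * \<bar>f x\<bar>" using lim.hyps(3) by simp
      then show "norm \<bar>f x - s i x\<bar> \<le> 3 * \<bar>f x\<bar>" using abs_triangle_ineq4[of "f x" "s i x"] by simp
    qed
  qed (use lim.hyps(1,4) in auto)
  then have "\<forall>\<^sub>F i in sequentially. (\<integral>x. \<bar>f x - s i x\<bar> \<partial>M) < \<epsilon> / 2"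
    by (rule order_tendstoD) (use lim.prems in simp)
  then obtain i where i: "(\<integral>x. \<bar>f x - s i x\<bar> \<partial>M) < \<epsilon> / 2" by (auto simp: eventually_sequentially)
  obtain g where g: "continuous_on UNIV g" "integrable M g" "(\<integral>x. \<bar>s i x - g x\<bar> \<partial>M) < \<epsilon> / 2"
    using lim.IH[of "\<epsilon> / 2" i] lim.prems by auto
  have "(\<integral>x. \<bar>f x - g x\<bar> \<partial>M) \<le> (\<integral>x. \<bar>f x - s i x\<bar> + \<bar>s i x - g x\<bar> \<partial>M)"
    using lim.hyps(1,4) g by (intro integral_mono) auto
  also have "\<dots> = (\<integral>x. \<bar>f x - s i x\<bar> \<partial>M) + (\<integral>x. \<bar>s i x - g x\<bar> \<partial>M)"
    using lim.hyps(1,4) g by (intro Bochner_Integration.integral_add) auto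
  finally show ?case using g i by (intro exI[of _ g]) auto
qed

lemma Lp_fun_continuous:
  fixes M :: "'a::euclidean_space measure"
  assumes "finite_measure M" and sets: "sets M = sets (restrict_space borel K)" and "bounded K"
    and g: "continuous_on UNIV g" and "p \<ge> 0"
  shows "g \<in> Lp_fun M p"
proof -
  interpret M: finite_measure M by fact
  have space: "space M = K" using sets_eq_imp_space_eq[OF sets] by (simp add: space_restrict_space)
  note [measurable] = borel_measurable_restrict_continuous[OF sets g]
  have "bounded (g ` closure K)"
    using \<open>bounded K\<close> continuous_on_subset[OF g] by (intro compact_imp_bounded compact_continuous_image) (auto simp: compact_closure)
  then obtain C where "\<And>x. x \<in> closure K \<Longrightarrow> \<bar>g x\<bar> \<le> C" by (auto simp: bounded_iff)
  then have "norm (\<bar>g x\<bar> powr p) \<le> C powr p" if "x \<in> K" for x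
    using that closure_subset \<open>p \<ge> 0\<close> by (auto intro!: powr_mono2)
  then have "integrable M (\<lambda>x. \<bar>g x\<bar> powr p)"
    by (intro M.integrable_const_bound[of _ "C powr p"] AE_I2) (auto simp: space)
  then show ?thesis by (simp add: Lp_fun_def)
qed

text \<open>A crude substitute for Minkowski's inequality; the constant is absorbed into \<kappa> in
  the next proof.\<close>

lemma powr_sum_le:
  fixes a b p :: real
  assumes "a \<ge> 0" "b \<ge> 0" "p \<ge> 0"
  shows "(a + b) powr p \<le> 2 powr p * (a powr p + b powr p)"
proof -
  have "(a + b) powr p \<le> (2 * max a b) powr p" using assms by (intro powr_mono2) auto
  also have "\<dots> = 2 powr p * max a b powr p" using assms by (simp add: powr_mult)
  also have "max a b powr p \<le> a powr p + b powr p" by (auto simp: max_def)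
  finally show ?thesis by (simp add: mult_left_mono)
qed

text \<open>Truncating \<open>f\<close> at height \<open>n\<close> reduces \<open>L\<^sup>p\<close> to \<open>L\<^sup>1\<close>: on functions bounded by \<open>L\<close>,
  \<open>|u|\<^sup>p \<le> L\<^bsup>p-1\<^esup> |u|\<close>.\<close>

lemma complete_in_Lp_if_uniformly_dense:
  fixes M :: "'a::euclidean_space measure" and v :: "'i \<Rightarrow> 'a \<Rightarrow> real"
  assumes "finite_measure M" and sets: "sets M = sets (restrict_space borel K)" and p: "1 \<le> p"
    and v: "\<And>i. v i \<in> Lp_fun M p" and dense: "\<And>g. continuous_on UNIV g \<Longrightarrow> approx_on K v g"
  shows "complete_in_Lp M p v"
  unfolding complete_in_Lp_def
proof (intro conjI ballI allI impI v)
  interpret M: finite_measure M by fact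
  have space: "space M = K" using sets_eq_imp_space_eq[OF sets] by (simp add: space_restrict_space)
  have [measurable]: "v i \<in> borel_measurable M" for i using v by (simp add: Lp_fun_def)
  fix f and \<epsilon> :: real assume f: "f \<in> Lp_fun M p" and "\<epsilon> > 0"
  have [measurable]: "f \<in> borel_measurable M" and fp: "integrable M (\<lambda>x. \<bar>f x\<bar> powr p)"
    using f by (auto simp: Lp_fun_def)
  define tr where "tr n y = max (- real n) (min (real n) y)" for n and y :: real
  have tr_le: "\<bar>tr n y\<bar> \<le> real n" for n y by (auto simp: tr_def)
  have tr_lip: "\<bar>tr n y - tr n z\<bar> \<le> \<bar>y - z\<bar>" for n y z by (auto simp: tr_def)
  have tr_diff: "\<bar>y - tr n y\<bar> \<le> \<bar>y\<bar>" for n y by (auto simp: tr_def)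
  have [measurable]: "(\<lambda>x. tr n (f x)) \<in> borel_measurable M" for n unfolding tr_def by measurable
  \<comment> \<open>Chosen with \<open>2 powr p * (\<kappa> + \<kappa>) = \<epsilon> powr p\<close>,
    one share for truncation and one for approximation.\<close>
  define \<kappa> where "\<kappa> = \<epsilon> powr p / (2 * 2 powr p)"
  have \<kappa>: "\<kappa> > 0" using \<open>\<epsilon> > 0\<close> by (simp add: \<kappa>_def)
  have "(\<lambda>n. \<integral>x. \<bar>f x - tr n (f x)\<bar> powr p \<partial>M) \<longlonglongrightarrow> (\<integral>x. 0 \<partial>M)"
  proof (rule integral_dominated_convergence[where w = "\<lambda>x. \<bar>f x\<bar> powr p"])
    show "AE x in M. (\<lambda>n. \<bar>f x - tr n (f x)\<bar> powr p) \<longlonglongrightarrow> 0"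
    proof (rule AE_I2)
      fix x
      obtain m :: nat where m: "\<bar>f x\<bar> \<le> real m" using real_arch_simple by blast
      have "\<bar>f x - tr n (f x)\<bar> powr p = 0" if "n \<ge> m" for n
        using m that by (auto simp: tr_def)
      then show "(\<lambda>n. \<bar>f x - tr n (f x)\<bar> powr p) \<longlonglongrightarrow> 0"
        by (intro tendsto_eventually) (auto simp: eventually_sequentially)
    qed
    show "AE x in M. norm (\<bar>f x - tr n (f x)\<bar> powr p) \<le> \<bar>f x\<bar> powr p" for n
      using tr_diff p by (intro AE_I2) (auto intro!: powr_mono2)
  qed (use fp in auto)
  then have "\<forall>\<^sub>F n in sequentially. (\<integral>x. \<bar>f x - tr n (f x)\<bar> powr p \<partial>M) < \<kappa>"
    by (rule order_tendstoD) (use \<kappa> in simp)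
  then obtain n where n: "(\<integral>x. \<bar>f x - tr n (f x)\<bar> powr p \<partial>M) < \<kappa>" by (auto simp: eventually_sequentially)
  \<comment> \<open>A pointwise bound for the error: two truncations of size \<open>n\<close> and an
    approximation error of at most one.\<close>
  define L where "L = 2 * real n + 1"
  have L: "L \<ge> 1" by (simp add: L_def)
  \<comment> \<open>The budget for the integral of the absolute error: multiplied by
    \<open>L powr (p - 1)\<close> it becomes \<kappa>.\<close>
  define \<theta> where "\<theta> = \<kappa> / L powr (p - 1)"
  have \<theta>: "\<theta> > 0" using \<kappa> L by (simp add: \<theta>_def)
  have tr_int: "integrable M (\<lambda>x. tr n (f x))"
    by (rule M.integrable_const_bound[of _ "real n"]) (use tr_le in auto)
  then obtain g where g: "continuous_on UNIV g" "integrable M g" "(\<integral>x. \<bar>tr n (f x) - g x\<bar> \<partial>M) < \<theta> / 2"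
    using continuous_dense_in_L1[OF assms(1) sets, of _ "\<theta> / 2"] \<theta> by auto
  define \<delta> where "\<delta> = min 1 (\<theta> / (2 * (measure M K + 1)))"
  have \<delta>: "\<delta> > 0" "\<delta> \<le> 1" using \<theta> by (auto simp: \<delta>_def intro!: divide_pos_pos add_nonneg_pos)
  have "\<delta> * measure M K \<le> \<theta> / (2 * (measure M K + 1)) * (measure M K + 1)"
    using \<theta> by (intro mult_mono) (auto simp: \<delta>_def)
  also have "\<dots> = \<theta> / 2"
  proof -
    have "measure M K + 1 \<noteq> 0" using measure_nonneg[of M K] by linarith
    then show ?thesis by (simp del: distrib_left_numeral)
  qed
  finally have \<delta>K: "\<delta> * measure M K \<le> \<theta> / 2" .
  \<comment> \<open>Truncation is Lipschitz with constant one and fixes \<open>tr n (f x)\<close>,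
    so truncating \<open>g\<close> as well does not increase the distance and keeps the error
    bounded.\<close>
  have "continuous_on UNIV (\<lambda>x. tr n (g x))" unfolding tr_def by (intro continuous_intros g)
  then obtain F a where F: "finite F" "\<And>x. x \<in> K \<Longrightarrow> \<bar>tr n (g x) - (\<Sum>i\<in>F. a i * v i x)\<bar> < \<delta>"
    using dense[unfolded approx_on_def] \<delta>(1) by meson
  define s where "s x = (\<Sum>i\<in>F. a i * v i x)" for x
  have [measurable]: "s \<in> borel_measurable M" unfolding s_def by measurable
  let ?u = "\<lambda>x. tr n (f x) - s x"
  have u1: "\<bar>?u x\<bar> \<le> \<bar>tr n (f x) - g x\<bar> + \<delta>" and u2: "\<bar>?u x\<bar> \<le> L" if x: "x \<in> K" for x
  proof -
    have *: "\<bar>tr n (g x) - s x\<bar> < \<delta>" using F(2)[OF x] by (simp add: s_def)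
    have "tr n (tr n (f x)) = tr n (f x)" by (auto simp: tr_def)
    then show "\<bar>?u x\<bar> \<le> \<bar>tr n (f x) - g x\<bar> + \<delta>"
      using * tr_lip[of n "tr n (f x)" "g x"] by linarith
    show "\<bar>?u x\<bar> \<le> L" using * \<delta>(2) tr_le[of n "f x"] tr_le[of n "g x"] unfolding L_def by linarith
  qed
  have up: "\<bar>?u x\<bar> powr p \<le> L powr (p - 1) * (\<bar>tr n (f x) - g x\<bar> + \<delta>)" if x: "x \<in> K" for x
  proof -
    have "\<bar>?u x\<bar> powr p = \<bar>?u x\<bar> powr (p - 1) * \<bar>?u x\<bar>"
      using powr_add[of "\<bar>?u x\<bar>" "p - 1" 1] by simp
    also have "\<dots> \<le> L powr (p - 1) * (\<bar>tr n (f x) - g x\<bar> + \<delta>)"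
      using u1[OF x] u2[OF x] p by (intro mult_mono powr_mono2) auto
    finally show ?thesis .
  qed
  have gi: "integrable M (\<lambda>x. \<bar>tr n (f x) - g x\<bar> + \<delta>)" using tr_int g by auto
  have "(\<integral>x. \<bar>?u x\<bar> powr p \<partial>M) \<le> (\<integral>x. L powr (p - 1) * (\<bar>tr n (f x) - g x\<bar> + \<delta>) \<partial>M)"
    using gi up \<delta> by (intro integral_mono') (auto simp: space)
  also have "\<dots> = L powr (p - 1) * ((\<integral>x. \<bar>tr n (f x) - g x\<bar> \<partial>M) + \<delta> * measure M K)"
    using tr_int g by (simp add: space mult.commute)
  also have "\<dots> < L powr (p - 1) * \<theta>"
    using g(3) \<delta>K L by (intro mult_strict_left_mono) auto
  also have "\<dots> = \<kappa>" using L by (simp add: \<theta>_def)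
  finally have u: "(\<integral>x. \<bar>?u x\<bar> powr p \<partial>M) < \<kappa>" .
  have int1: "integrable M (\<lambda>x. \<bar>f x - tr n (f x)\<bar> powr p)"
    using fp tr_diff p by (rule_tac Bochner_Integration.integrable_bound) (auto intro!: powr_mono2 AE_I2)
  have int2: "integrable M (\<lambda>x. \<bar>?u x\<bar> powr p)"
    using u2 p by (intro M.integrable_const_bound[of _ "L powr p"] AE_I2) (auto intro!: powr_mono2 simp: space)
  have "\<bar>f x - s x\<bar> powr p \<le> 2 powr p * (\<bar>f x - tr n (f x)\<bar> powr p + \<bar>?u x\<bar> powr p)" for x
  proof -
    have "\<bar>f x - s x\<bar> powr p \<le> (\<bar>f x - tr n (f x)\<bar> + \<bar>?u x\<bar>) powr p"
      using p by (intro powr_mono2) auto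
    also have "\<dots> \<le> 2 powr p * (\<bar>f x - tr n (f x)\<bar> powr p + \<bar>?u x\<bar> powr p)"
      using p by (intro powr_sum_le) auto
    finally show ?thesis .
  qed
  then have "(\<integral>x. \<bar>f x - s x\<bar> powr p \<partial>M) \<le> (\<integral>x. 2 powr p * (\<bar>f x - tr n (f x)\<bar> powr p + \<bar>?u x\<bar> powr p) \<partial>M)"
    using int1 int2 by (intro integral_mono') auto
  also have "\<dots> = 2 powr p * ((\<integral>x. \<bar>f x - tr n (f x)\<bar> powr p \<partial>M) + (\<integral>x. \<bar>?u x\<bar> powr p \<partial>M))"
    using int1 int2 by simp
  also have "\<dots> < 2 powr p * (\<kappa> + \<kappa>)" using n u by (intro mult_strict_left_mono) auto
  also have "\<dots> = \<epsilon> powr p" by (simp add: \<kappa>_def)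
  finally have "Lp_norm M p (\<lambda>x. f x - s x) < (\<epsilon> powr p) powr (1 / p)"
    unfolding Lp_norm_def using p by (intro powr_less_mono2) auto
  also have "\<dots> = \<epsilon>" using \<open>\<epsilon> > 0\<close> p by (simp add: powr_powr)
  finally have "Lp_norm M p (\<lambda>x. f x - (\<Sum>i\<in>F. a i * v i x)) < \<epsilon>" by (simp add: s_def)
  then show "\<exists>F c. finite F \<and> Lp_norm M p (\<lambda>x. f x - (\<Sum>i\<in>F. c i * v i x)) < \<epsilon>" using F(1) by blast
qed

section \<open>Completeness of the parabolic polynomials\<close>

theorem theorem14:
  fixes \<Omega> :: "(real^'n) set" and T p :: real and A :: "real^'n^'n"
  assumes "CARD('n) \<ge> 3"
    and "open \<Omega>" and "connected \<Omega>" and "\<Omega> \<noteq> {}" and "bounded \<Omega>"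
    and "C1_boundary \<Omega>"
    and "connected (- closure \<Omega>)"
    and "T > 0"
    and "transpose A = A"
    and "\<And>\<xi>. \<xi> \<noteq> 0 \<Longrightarrow> (\<Sum>h\<in>UNIV. \<Sum>k\<in>UNIV. A $ h $ k * \<xi> $ h * \<xi> $ k) > 0"
    and "1 \<le> p"
  shows "complete_in_Lp (parabolic_boundary_measure \<Omega> T) p (parabolic_poly A)"
proof -
  have "\<exists>c::'n \<Rightarrow> real^'n. \<forall>\<xi>.
      (\<Sum>h\<in>UNIV. \<Sum>k\<in>UNIV. A $ h $ k * \<xi> $ h * \<xi> $ k) = (\<Sum>i\<in>UNIV. (c i \<bullet> \<xi>)\<^sup>2)"
    by (intro posdef_sum_of_squares assms)
  then obtain c :: "'n \<Rightarrow> real^'n"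
    where c: "\<And>\<xi>. (\<Sum>h\<in>UNIV. \<Sum>k\<in>UNIV. A $ h $ k * \<xi> $ h * \<xi> $ k) = (\<Sum>i\<in>UNIV. (c i \<bullet> \<xi>)\<^sup>2)"
    by blast
  obtain \<beta> where frame: "elliptic_frame c \<beta>"
    by (rule elliptic_frame_exists[OF assms(10)[unfolded c]])
  interpret elliptic_frame c \<beta> by (rule frame)
  have cont: "continuous_on UNIV (parabolic_poly A \<alpha>)" for \<alpha>
  proof -
    \<comment> \<open>Every multi-index counts the entries of some list, so the identification with
      caloric extensions of monomials covers all of them.\<close>
    obtain ks where "\<forall>i. count_list ks i = \<alpha> i" using multi_index_list_exists by blast
    then have \<alpha>: "\<alpha> = count_list ks" by (simp add: fun_eq_iff)
    have "parabolic_poly A \<alpha> = (\<lambda>(x, t). heat_ext (monomial ks) x t)"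
    proof
      fix z
      show "parabolic_poly A \<alpha> z = (\<lambda>(x, t). heat_ext (monomial ks) x t) z"
        by (cases z) (simp only: \<alpha> parabolic_poly_monomial[OF frame c] prod.case)
    qed
    then show ?thesis using continuous_heat_ext[OF rpf_monomial] by simp
  qed
  have fin: "finite_measure (parabolic_boundary_measure \<Omega> T)"
    by (intro finite_measure_parabolic_boundary assms)
  have "bounded (closure \<Omega> \<times> {0..T})" using assms(5) by (intro bounded_Times) auto
  moreover have "parabolic_boundary \<Omega> T \<subseteq> closure \<Omega> \<times> {0..T}"
    using assms(8) closure_subset by (auto simp: parabolic_boundary_def frontier_def)
  ultimately have "bounded (parabolic_boundary \<Omega> T)" by (rule bounded_subset)
  then have "parabolic_poly A \<alpha> \<in> Lp_fun (parabolic_boundary_measure \<Omega> T) p" for \<alpha>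
    using assms(11) by (intro Lp_fun_continuous[OF fin _ _ cont]) auto
  moreover have "approx_on (parabolic_boundary \<Omega> T) (parabolic_poly A) F" if F: "continuous_on UNIV F" for F
  proof (rule approx_on_parabolic_boundary[OF assms(2,5,4,7) _ assms(8) F])
    show "exterior_corkscrew (closure \<Omega>) x" if "x \<in> frontier \<Omega>" for x
      using that by (rule C1_boundary_exterior_corkscrew[OF assms(6,2)])
    show "approx_on (closure \<Omega> \<times> {0..T}) (parabolic_poly A) (\<lambda>(x, t). heat_ext q x t)" if "rpf q" for q
      using that by (rule approx_on_heat_ext[OF frame c])
  qed
  ultimately show ?thesis
    using assms(11) by (intro complete_in_Lp_if_uniformly_dense[OF fin]) auto
qed

end
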